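(* Let $\frac{2Q}{Q+1}\leq p<2$, $p-1<q\leq p-1+\frac{p}{Q}$, $\lambda\in\mathbb{R}$, and let $\Omega\subset\mathbb{R}^{m+k}$ be a Carnot–Carathéodory metric ball. Let $v\in C^{1}(\Omega\setminus\mathcal{K})$ and $\tilde{w}\in L^{1}_{\mathrm{loc}}(\Omega\setminus\mathcal{K})$ be nonnegative functions, where $\mathcal{K}$ is a closed Lebesgue null subset of $\Omega$. If $$\inf_{0\neq\phi\in C_c^{\infty}(\Omega\setminus\mathcal{K})}\frac{\int_{\Omega}(\epsilon+(1-\epsilon)v(z))|\nabla_\gamma\phi|^p\,dz-\int_{\Omega}(1-\epsilon)\tilde{w}(z)|\phi|^p\,dz}{\int_{\Omega}|\phi|^p\,dz}=-\infty$$ for some $\epsilon>0$, then the problem $$\begin{cases}\frac{\partial u}{\partial t}=\nabla_\gamma\cdot\left(v(z)|\nabla_\gamma u|^{p-2}\nabla_\gamma u\right)+\tilde{w}(z)u^{p-1}+\lambda u^q&\text{in }\Omega\times(0,T),\\ u(z,0)=u_0(z)\geq0&\text{in }\Omega,\\ u(z,t)=0&\text{on }\partial\Omega\times(0,T)\end{cases}$$ has no general positive local solution off of $\mathcal{K}$.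
   Context: Baouendi–Grushin setting: $m,k\ge 1$ are integers, $\gamma\geq0$ is a real number, points are $z=(x,y)\in\mathbb{R}^{m}\times\mathbb{R}^{k}=\mathbb{R}^{m+k}$, $|\cdot|$ is the Euclidean norm and $dz$ is Lebesgue measure. Vector fields: $X_i=\partial/\partial x_i$ ($1\le i\le m$), $Y_j=|x|^{\gamma}\,\partial/\partial y_j$ ($1\le j\le k$); $\nabla_{\gamma}=(X_1,\ldots,X_m,Y_1,\ldots,Y_k)=(\nabla_x,|x|^{\gamma}\nabla_y)$; for $F=(F_1,\ldots,F_{m+k})$, $\nabla_\gamma\cdot F=\sum_{i=1}^m X_iF_i+\sum_{j=1}^k Y_jF_{m+j}$. The homogeneous dimension is $Q=m+(1+\gamma)k$. A Carnot–Carathéodory metric ball is a ball for the Carnot–Carathéodory (control) distance associated with the vector fields $X_i,Y_j$. A function $u$ is a general (also called generalized) positive local solution off of $\mathcal{K}$ of the problem if: (i) $\mathcal{K}$ is a closed Lebesgue null subset of $\Omega$; (ii) $u:[0,T)\to L^{1}(\Omega)$ is continuous for some $T>0$; (iii$'$) $u(z,t)$ is positive and locally bounded on $(\Omega\setminus\mathcal{K})\times(0,T)$; (iv$'$) $1/u(z,t)$ is locally bounded on $(\Omega\setminus\mathcal{K})\times(0,T)$; (v) $\lim_{t\to0}u(\cdot,t)=u_{0}$ in the sense of distributions; (vi) $\nabla_{\gamma}u\in L^{p}_{\mathrm{loc}}(\Omega)$ and $u$ is a solution of the PDE in the sense of distributions.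
   Formalization: The condition "for some ε > 0" is taken as "for some 0 < ε < 1": for ε > 1 the claim fails (e.g. v = 3, w̃ = 0, λ = 0, ε = 2, K empty, where a separable positive solution exists), and for ε = 1 the infimum is never −∞. *)

theory Defs
  imports "HOL-Analysis.Analysis"
begin

section \<open>Function spaces on open subsets of Euclidean space\<close>

text \<open>\<open>Ck_on n f S\<close> is meant for open \<open>S\<close>, where all derivatives are taken at interior points.\<close>

primrec Ck_on :: "nat \<Rightarrow> ('a::euclidean_space \<Rightarrow> real) \<Rightarrow> 'a set \<Rightarrow> bool" where
  "Ck_on 0 f S \<longleftrightarrow> continuous_on S f"
| "Ck_on (Suc n) f S \<longleftrightarrow> (\<forall>x\<in>S. f differentiable (at x)) \<and>
     (\<forall>h. Ck_on n (\<lambda>x. frechet_derivative f (at x) h) S)"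

text \<open>\<open>C\<^sub>c\<^sup>\<infinity>(S)\<close>; its members are extended by zero to the whole space.\<close>

definition test_functions :: "'a::euclidean_space set \<Rightarrow> ('a \<Rightarrow> real) set" where
  "test_functions S = {\<phi>. (\<forall>n. Ck_on n \<phi> UNIV) \<and>
     compact (closure {x. \<phi> x \<noteq> 0}) \<and> closure {x. \<phi> x \<noteq> 0} \<subseteq> S}"

definition Lp_loc_on ::
  "real \<Rightarrow> 'a::euclidean_space set \<Rightarrow> ('a \<Rightarrow> 'b::euclidean_space) \<Rightarrow> bool" where
  "Lp_loc_on p S f \<longleftrightarrow> (\<forall>C. compact C \<and> C \<subseteq> S \<longrightarrow>
     set_borel_measurable lebesgue C f \<and>
     set_integrable lebesgue C (\<lambda>x. norm (f x) powr p))"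

definition L1_loc_on :: "'a::euclidean_space set \<Rightarrow> ('a \<Rightarrow> 'b::euclidean_space) \<Rightarrow> bool" where
  "L1_loc_on S f \<longleftrightarrow> (\<forall>C. compact C \<and> C \<subseteq> S \<longrightarrow> set_integrable lebesgue C f)"

definition locally_bounded_on :: "'a::topological_space set \<Rightarrow> ('a \<Rightarrow> real) \<Rightarrow> bool" where
  "locally_bounded_on S f \<longleftrightarrow>
     (\<forall>x\<in>S. \<exists>U. open U \<and> x \<in> U \<and> bounded (f ` (U \<inter> S)))"

section \<open>Baouendi--Grushin vector fields\<close>

text \<open>The type \<open>real ^ 'm \<times> real ^ 'k\<close> carries the Euclidean norm and Lebesgue measure of
  \<open>\<real>\<^sup>m\<^sup>+\<^sup>k\<close>.\<close>

type_synonym ('m, 'k) point = "(real ^ 'm) \<times> (real ^ 'k)"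

text \<open>The function \<open>|x|\<^sup>\<gamma>\<close>. The case \<open>\<gamma> = 0\<close> is separate because \<open>0 powr 0 = 0\<close>, while \<open>|x|\<^sup>0\<close>
  has to be identically 1.\<close>

definition grushin_weight :: "real \<Rightarrow> ('m::finite, 'k::finite) point \<Rightarrow> real" where
  "grushin_weight \<gamma> z = (if \<gamma> = 0 then 1 else norm (fst z) powr \<gamma>)"

definition grushin_X :: "'m \<Rightarrow> (('m::finite, 'k::finite) point \<Rightarrow> real) \<Rightarrow> ('m, 'k) point \<Rightarrow> real" where
  "grushin_X i f z = frechet_derivative f (at z) (axis i 1, 0)"

definition grushin_Y ::
  "real \<Rightarrow> 'k \<Rightarrow> (('m::finite, 'k::finite) point \<Rightarrow> real) \<Rightarrow> ('m, 'k) point \<Rightarrow> real" where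
  "grushin_Y \<gamma> j f z = grushin_weight \<gamma> z * frechet_derivative f (at z) (0, axis j 1)"

definition grushin_grad ::
  "real \<Rightarrow> (('m::finite, 'k::finite) point \<Rightarrow> real) \<Rightarrow> ('m, 'k) point \<Rightarrow> ('m, 'k) point" where
  "grushin_grad \<gamma> f z = ((\<chi> i. grushin_X i f z), (\<chi> j. grushin_Y \<gamma> j f z))"

definition hom_dim :: "'m::finite itself \<Rightarrow> 'k::finite itself \<Rightarrow> real \<Rightarrow> real" where
  "hom_dim _ _ \<gamma> = real CARD('m) + (1 + \<gamma>) * real CARD('k)"

section \<open>Carnot--Caratheodory distance\<close>

text \<open>Absolutely continuous curves \<open>c\<close> on \<open>[0, \<tau>]\<close> with
  \<open>c'(s) = \<Sum>\<^sub>i a\<^sub>i(s) X\<^sub>i(c(s)) + \<Sum>\<^sub>j b\<^sub>j(s) Y\<^sub>j(c(s))\<close> for almost every \<open>s\<close>, where the measurable control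
  \<open>h = (a, b)\<close> satisfies \<open>|h| \<le> 1\<close>. Absolute continuity and the differential equation are
  expressed together by the integral equation.\<close>

definition subunit_curve ::
  "real \<Rightarrow> real \<Rightarrow> (real \<Rightarrow> ('m::finite, 'k::finite) point) \<Rightarrow> bool" where
  "subunit_curve \<gamma> \<tau> c \<longleftrightarrow> (\<exists>h :: real \<Rightarrow> ('m, 'k) point.
     h \<in> borel_measurable lebesgue \<and> (\<forall>s. norm (h s) \<le> 1) \<and>
     (let F = (\<lambda>s. (fst (h s), grushin_weight \<gamma> (c s) *\<^sub>R snd (h s))) in
       set_integrable lebesgue {0..\<tau>} F \<and>
       (\<forall>s\<in>{0..\<tau>}. c s = c 0 + set_lebesgue_integral lebesgue {0..s} F)))"

definition cc_dist ::
  "real \<Rightarrow> ('m::finite, 'k::finite) point \<Rightarrow> ('m, 'k) point \<Rightarrow> real" where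
  "cc_dist \<gamma> z z' = Inf {\<tau>. \<tau> \<ge> 0 \<and> (\<exists>c. subunit_curve \<gamma> \<tau> c \<and> c 0 = z \<and> c \<tau> = z')}"

definition cc_ball ::
  "real \<Rightarrow> ('m::finite, 'k::finite) point \<Rightarrow> real \<Rightarrow> ('m, 'k) point set" where
  "cc_ball \<gamma> z r = {z'. cc_dist \<gamma> z z' < r}"

section \<open>The parabolic problem\<close>

text \<open>The set \<open>K\<close> is closed in the subspace topology of \<open>\<Omega>\<close>.\<close>

definition closed_null_subset :: "('m::finite, 'k::finite) point set \<Rightarrow> ('m, 'k) point set \<Rightarrow> bool" where
  "closed_null_subset \<Omega> K \<longleftrightarrow> closedin (top_of_set \<Omega>) K \<and> K \<in> null_sets lebesgue"

text \<open>\<open>G = \<nabla>\<^sub>\<gamma> u\<close> in the sense of distributions on \<open>\<Omega> \<times> (0, T)\<close>. The fields \<open>X\<^sub>i\<close> and \<open>Y\<^sub>j\<close> are formally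
  skew-adjoint because \<open>|x|\<^sup>\<gamma>\<close> does not depend on \<open>y\<close>; the identity below is
  \<open>\<integral>\<integral> u \<nabla>\<^sub>\<gamma>\<psi> = - \<integral>\<integral> \<psi> G\<close>, one equation for each component.\<close>

definition weak_grushin_grad ::
  "real \<Rightarrow> ('m::finite, 'k::finite) point set \<Rightarrow> real \<Rightarrow> (('m, 'k) point \<Rightarrow> real \<Rightarrow> real) \<Rightarrow>
   (('m, 'k) point \<times> real \<Rightarrow> ('m, 'k) point) \<Rightarrow> bool" where
  "weak_grushin_grad \<gamma> \<Omega> T u G \<longleftrightarrow>
     L1_loc_on (\<Omega> \<times> {0<..<T}) (\<lambda>(z, t). u z t) \<and>
     L1_loc_on (\<Omega> \<times> {0<..<T}) G \<and>
     (\<forall>\<psi>\<in>test_functions (\<Omega> \<times> {0<..<T}).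
        set_lebesgue_integral lebesgue (\<Omega> \<times> {0<..<T})
          (\<lambda>(z, t). u z t *\<^sub>R grushin_grad \<gamma> (\<lambda>z'. \<psi> (z', t)) z)
        = - set_lebesgue_integral lebesgue (\<Omega> \<times> {0<..<T}) (\<lambda>(z, t). \<psi> (z, t) *\<^sub>R G (z, t)))"

text \<open>The equation \<open>\<partial>\<^sub>t u = \<nabla>\<^sub>\<gamma> \<cdot> (v |G|\<^sup>p\<^sup>-\<^sup>2 G) + w u\<^sup>p\<^sup>-\<^sup>1 + \<lambda> u\<^sup>q\<close> in the sense of distributions on
  \<open>D \<times> (0, T)\<close>, where \<open>G\<close> stands for \<open>\<nabla>\<^sub>\<gamma> u\<close>. For \<open>p < 2\<close> the vector \<open>|G|\<^sup>p\<^sup>-\<^sup>2 G\<close> is 0 where \<open>G = 0\<close>.\<close>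

definition pde_in_distributions ::
  "real \<Rightarrow> real \<Rightarrow> real \<Rightarrow> real \<Rightarrow> (('m::finite, 'k::finite) point \<Rightarrow> real) \<Rightarrow>
   (('m, 'k) point \<Rightarrow> real) \<Rightarrow> ('m, 'k) point set \<Rightarrow> real \<Rightarrow> (('m, 'k) point \<Rightarrow> real \<Rightarrow> real) \<Rightarrow>
   (('m, 'k) point \<times> real \<Rightarrow> ('m, 'k) point) \<Rightarrow> bool" where
  "pde_in_distributions \<gamma> p q lam v w D T u G \<longleftrightarrow>
     (let A = D \<times> {0<..<T};
          flux = (\<lambda>(z, t). (v z * norm (G (z, t)) powr (p - 2)) *\<^sub>R G (z, t));
          source = (\<lambda>(z, t). w z * u z t powr (p - 1) + lam * u z t powr q)
      in L1_loc_on A (\<lambda>(z, t). u z t) \<and> L1_loc_on A flux \<and> L1_loc_on A source \<and>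
         (\<forall>\<psi>\<in>test_functions A.
            - set_lebesgue_integral lebesgue A (\<lambda>(z, t). u z t * deriv (\<lambda>s. \<psi> (z, s)) t)
            = - set_lebesgue_integral lebesgue A
                  (\<lambda>(z, t). flux (z, t) \<bullet> grushin_grad \<gamma> (\<lambda>z'. \<psi> (z', t)) z)
              + set_lebesgue_integral lebesgue A (\<lambda>(z, t). source (z, t) * \<psi> (z, t))))"

text \<open>The boundary condition is imposed on the pointwise values of \<open>u\<close> on \<open>\<partial>\<Omega>\<close>. This is its weakest
  form: \<open>\<partial>\<Omega>\<close> is disjoint from the open set \<open>\<Omega>\<close>, where all other conditions live, so any
  solution satisfying the boundary condition in a stronger sense (traces, limits at the boundary) can be
  given the value 0 there. The equation is tested with functions supported off \<open>K\<close>, since \<open>v\<close>, \<open>w\<close>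
  and the bounds on \<open>u\<close> are controlled only there; the distributional gradient is taken on all
  of \<open>\<Omega>\<close>, and is locally \<open>p\<close>-integrable in \<open>\<Omega> \<times> (0, T)\<close>.\<close>

definition general_positive_local_solution ::
  "real \<Rightarrow> real \<Rightarrow> real \<Rightarrow> real \<Rightarrow> (('m::finite, 'k::finite) point \<Rightarrow> real) \<Rightarrow>
   (('m, 'k) point \<Rightarrow> real) \<Rightarrow> ('m, 'k) point set \<Rightarrow> ('m, 'k) point set \<Rightarrow>
   (('m, 'k) point \<Rightarrow> real) \<Rightarrow> real \<Rightarrow> (('m, 'k) point \<Rightarrow> real \<Rightarrow> real) \<Rightarrow> bool" where
  "general_positive_local_solution \<gamma> p q lam v w \<Omega> K u0 T u \<longleftrightarrow>
     closed_null_subset \<Omega> K \<and>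
     T > 0 \<and>
     (\<forall>t\<in>{0..<T}. set_integrable lebesgue \<Omega> (\<lambda>z. u z t)) \<and>
     (\<forall>t\<in>{0..<T}. ((\<lambda>s. set_lebesgue_integral lebesgue \<Omega> (\<lambda>z. \<bar>u z s - u z t\<bar>)) \<longlongrightarrow> 0)
        (at t within {0..<T})) \<and>
     (\<forall>z\<in>\<Omega> - K. \<forall>t\<in>{0<..<T}. u z t > 0) \<and>
     locally_bounded_on ((\<Omega> - K) \<times> {0<..<T}) (\<lambda>(z, t). u z t) \<and>
     locally_bounded_on ((\<Omega> - K) \<times> {0<..<T}) (\<lambda>(z, t). 1 / u z t) \<and>
     L1_loc_on \<Omega> u0 \<and>
     (\<forall>\<phi>\<in>test_functions \<Omega>.
        ((\<lambda>t. set_lebesgue_integral lebesgue \<Omega> (\<lambda>z. u z t * \<phi> z)) \<longlongrightarrow>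
          set_lebesgue_integral lebesgue \<Omega> (\<lambda>z. u0 z * \<phi> z)) (at_right 0)) \<and>
     (\<forall>z\<in>frontier \<Omega>. \<forall>t\<in>{0<..<T}. u z t = 0) \<and>
     (\<exists>G. Lp_loc_on p (\<Omega> \<times> {0<..<T}) G \<and> weak_grushin_grad \<gamma> \<Omega> T u G \<and>
        pde_in_distributions \<gamma> p q lam v w (\<Omega> - K) T u G)"

end

theory Submission
  imports Defs
begin

text \<open>
  Testing the equation with \<open>u\<^sup>1\<^sup>-\<^sup>p |\<phi>|\<^sup>p \<beta>(t)\<close>, where \<open>\<beta>\<close> is a nonnegative time cutoff with integral 1,
  and applying Young's inequality to the diffusion term (a Picone-type estimate) gives
  \<open>\<integral> w |\<phi>|\<^sup>p \<le> \<integral> v |\<nabla>\<^sub>\<gamma> \<phi>|\<^sup>p + c \<integral>\<integral> u\<^sup>2\<^sup>-\<^sup>p |\<phi>|\<^sup>p + |\<lambda>| \<integral>\<integral> u\<^sup>q\<^sup>-\<^sup>p\<^sup>+\<^sup>1 |\<phi>|\<^sup>p\<close>. Both exponents of \<open>u\<close>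
  in the last two terms lie in \<open>(0, p/Q]\<close>, and \<open>u(t)\<close> is uniformly integrable on compact time intervals. Splitting \<open>u\<close>
  at a large height \<open>N\<close> and applying the Sobolev inequality for \<open>\<nabla>\<^sub>\<gamma>\<close> to the part above \<open>N\<close> bounds
  these terms by \<open>\<delta> \<integral> |\<nabla>\<^sub>\<gamma> \<phi>|\<^sup>p + C \<integral> |\<phi>|\<^sup>p\<close> with \<open>\<delta>\<close> as small as desired and \<open>C\<close> independent of
  \<open>\<phi>\<close>, so that the infimum is finite.

  The test function is made admissible by mollifying the equation and the gradient with a symmetric
  kernel. The Sobolev inequality follows from a pseudo-Poincare inequality for averages along the vector fields and
  truncation of \<open>\<phi>\<close> at dyadic heights.
\<close>

section \<open>Smooth functions and mollifiers\<close>

text \<open>The exponents come from the weight u^(1-p). Against it the source w u^(p-1) becomes w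
  itself, the term with \<lambda> becomes u^(q-p+1), and the time derivative becomes that of
  u^(2-p)/(2-p). The hypotheses on p and q say exactly that 2-p and q-p+1 are at most p/Q. This
  power is critical: with P = Qp/(Q-p) one has 1 - p/Q = p/P, so Hoelder's inequality with u in L^1
  and \<phi> in L^P controls the integral of u^(p/Q) |\<phi>|^p. At the critical power the smallness
  comes from the L^1 mass of u above the height N, and continuity in time with values in L^1 makes
  that mass small uniformly. The number \<epsilon> in the infimum, after division by 1 - \<epsilon>,
  provides the room for the gradient term that is left over. The obstacle is regularity: the
  gradient of u exists only as a distribution and u has no given time derivative, so powers of u
  cannot be inserted as test functions directly. A chain rule for weak solutions replaces this, and
  its error terms are commutators of the degenerate fields with mollification.\<close>

abbreviation smooth :: "('a::euclidean_space \<Rightarrow> real) \<Rightarrow> bool" where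
  "smooth f \<equiv> (\<forall>n. Ck_on n f UNIV)"

text \<open>\<open>Ck_on\<close> speaks of \<open>frechet_derivative\<close>, a choice operator.
  Uniqueness of derivatives lets any explicit formula stand in for it, and the closure properties
  below are shown in this way.\<close>

lemma Ck_on_SucI:
  assumes "\<And>x. (f has_derivative f' x) (at x)" and "\<And>h. Ck_on n (\<lambda>x. f' x h) UNIV"
  shows "Ck_on (Suc n) f UNIV"
proof -
  have "frechet_derivative f (at x) = f' x" for x
    using frechet_derivative_at[OF assms(1)] by simp
  then show ?thesis
    using assms by (auto simp: differentiable_def)
qed

lemma Ck_on_SucE:
  assumes "Ck_on (Suc n) f UNIV"
  shows "(f has_derivative frechet_derivative f (at x)) (at x)"
    and "Ck_on n (\<lambda>x. frechet_derivative f (at x) h) UNIV"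
  using assms by (auto simp: frechet_derivative_works)

lemma Ck_on_Suc_imp: "Ck_on (Suc n) f UNIV \<Longrightarrow> Ck_on n f UNIV"
proof (induction n arbitrary: f)
  case 0
  then show ?case
    by (auto intro!: continuous_at_imp_continuous_on differentiable_imp_continuous_within)
next
  case (Suc n)
  show ?case
  proof (rule Ck_on_SucI)
    show "(f has_derivative frechet_derivative f (at x)) (at x)" for x
      using Suc.prems by (rule Ck_on_SucE)
    show "Ck_on n (\<lambda>x. frechet_derivative f (at x) h) UNIV" for h
      by (rule Suc.IH) (rule Ck_on_SucE(2)[OF Suc.prems])
  qed
qed

lemma Ck_on_imp_continuous: "Ck_on n f UNIV \<Longrightarrow> continuous_on UNIV f"
  by (induction n) (auto dest: Ck_on_Suc_imp simp del: Ck_on.simps(2))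

lemma Ck_on_const: "Ck_on n (\<lambda>_. c) UNIV"
proof (induction n arbitrary: c)
  case (Suc n)
  show ?case by (rule Ck_on_SucI[OF has_derivative_const]) (rule Suc)
qed simp

lemma Ck_on_linear: "bounded_linear f \<Longrightarrow> Ck_on n f UNIV"
  by (cases n)
    (auto intro!: linear_continuous_on Ck_on_SucI[where f'="\<lambda>_. f"] Ck_on_const bounded_linear_imp_has_derivative
      simp del: Ck_on.simps(2))

lemma Ck_on_add:
  "Ck_on n f UNIV \<Longrightarrow> Ck_on n g UNIV \<Longrightarrow> Ck_on n (\<lambda>x. f x + g x) UNIV"
proof (induction n arbitrary: f g)
  case 0
  then show ?case by (auto intro: continuous_intros)
next
  case (Suc n)
  show ?case
    by (rule Ck_on_SucI[OF has_derivative_add[OF Ck_on_SucE(1)[OF Suc.prems(1)] Ck_on_SucE(1)[OF Suc.prems(2)]]])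
       (rule Suc.IH[OF Ck_on_SucE(2)[OF Suc.prems(1)] Ck_on_SucE(2)[OF Suc.prems(2)]])
qed

lemma Ck_on_mult:
  "Ck_on n f UNIV \<Longrightarrow> Ck_on n g UNIV \<Longrightarrow> Ck_on n (\<lambda>x. f x * g x) UNIV"
proof (induction n arbitrary: f g)
  case 0
  then show ?case by (auto intro: continuous_intros)
next
  case (Suc n)
  show ?case
    by (rule Ck_on_SucI[OF has_derivative_mult[OF Ck_on_SucE(1)[OF Suc.prems(1)] Ck_on_SucE(1)[OF Suc.prems(2)]]])
       (intro Ck_on_add Suc.IH[OF Ck_on_Suc_imp[OF Suc.prems(1)] Ck_on_SucE(2)[OF Suc.prems(2)]]
          Suc.IH[OF Ck_on_SucE(2)[OF Suc.prems(1)] Ck_on_Suc_imp[OF Suc.prems(2)]])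
qed

lemma Ck_on_compose_affine:
  fixes L :: "'a::euclidean_space \<Rightarrow> 'b::euclidean_space"
  assumes L: "bounded_linear L"
  shows "Ck_on n f UNIV \<Longrightarrow> Ck_on n (\<lambda>x. f (a + L x)) UNIV"
proof (induction n arbitrary: f)
  case 0
  then show ?case
    by (auto intro!: continuous_on_compose2[of UNIV f] continuous_intros linear_continuous_on[OF L])
next
  case (Suc n)
  have A: "((\<lambda>x. a + L x) has_derivative L) (at x)" for x
    by (auto intro!: derivative_eq_intros bounded_linear_imp_has_derivative L)
  show ?case
    by (rule Ck_on_SucI[OF has_derivative_compose[OF A Ck_on_SucE(1)[OF Suc.prems]]])
       (rule Suc.IH[OF Ck_on_SucE(2)[OF Suc.prems]])
qed

text \<open>The induction is over all outer functions with \<open>f\<close> fixed. On the real line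
  g'(y) c = c g'(y) 1, so the derivative of the composite is a derivative of \<open>f\<close> times
  a composite with the outer function y |-> g'(y) 1, whose order is one less.\<close>

lemma Ck_on_compose_real:
  fixes g :: "real \<Rightarrow> real"
  shows "Ck_on n g UNIV \<Longrightarrow> Ck_on n f UNIV \<Longrightarrow> Ck_on n (\<lambda>x. g (f x)) UNIV"
proof (induction n arbitrary: g)
  case 0
  then show ?case
    by (auto intro!: continuous_on_compose2[of UNIV g])
next
  case (Suc n)
  have lin: "frechet_derivative g (at y) c = c * frechet_derivative g (at y) 1" for y c
    using linear_scale[OF has_derivative_linear[OF Ck_on_SucE(1)[OF Suc.prems(1)]], of y c 1] by simp
  have D: "((\<lambda>x. g (f x)) has_derivative
      (\<lambda>h. frechet_derivative f (at x) h * frechet_derivative g (at (f x)) 1)) (at x)" for x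
    using has_derivative_compose[OF Ck_on_SucE(1)[OF Suc.prems(2)] Ck_on_SucE(1)[OF Suc.prems(1)], of x]
    by (rule has_derivative_eq_rhs) (rule ext, rule lin)
  have "Ck_on n (\<lambda>x. frechet_derivative g (at (f x)) 1) UNIV"
    by (rule Suc.IH[OF Ck_on_SucE(2)[OF Suc.prems(1)] Ck_on_Suc_imp[OF Suc.prems(2)]])
  then have "Ck_on n (\<lambda>x. frechet_derivative f (at x) h * frechet_derivative g (at (f x)) 1) UNIV" for h
    by (rule Ck_on_mult[OF Ck_on_SucE(2)[OF Suc.prems(2)]])
  with D show ?case
    by (rule Ck_on_SucI)
qed

section \<open>A smooth bump function\<close>

text \<open>The derivative of each member is a linear combination of members with larger index.
  Smoothness of the classical flat function \<open>flat 0\<close> thereby becomes an induction over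
  the whole family.\<close>

definition flat :: "nat \<Rightarrow> real \<Rightarrow> real" where
  "flat n s = (if s > 0 then exp (- 1 / s) / s ^ n else 0)"

lemma flat_tendsto_0: "(flat n \<longlongrightarrow> 0) (at 0)"
proof -
  have "((\<lambda>s::real. inverse s ^ n / exp (inverse s)) \<longlongrightarrow> 0) (at_right 0)"
    by (rule filterlim_compose[OF tendsto_power_div_exp_0 filterlim_inverse_at_top_right])
  then have "(flat n \<longlongrightarrow> 0) (at_right 0)"
    by (rule Lim_transform_eventually, intro eventually_mono[OF eventually_at_right_less[of 0]])
       (simp add: flat_def exp_minus divide_inverse power_inverse mult.commute)
  moreover have "(flat n \<longlongrightarrow> 0) (at_left 0)"
    by (rule Lim_transform_eventually[OF tendsto_const]) (auto simp: eventually_at_filter flat_def)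
  ultimately show ?thesis
    by (simp add: filterlim_split_at)
qed

lemma flat_has_real_derivative:
  "(flat n has_real_derivative flat (n + 2) s - real n * flat (n + 1) s) (at s)"
proof -
  consider "s > 0" | "s < 0" | "s = 0" by linarith
  then show ?thesis
  proof cases
    case 1
    have "((\<lambda>s. exp (- 1 / s) / s ^ n) has_real_derivative flat (n + 2) s - real n * flat (n + 1) s) (at s)"
    proof -
      have "((\<lambda>s. s ^ n) has_real_derivative real n * s ^ n / s) (at s)"
        using 1 DERIV_pow[of n s] by (cases n) auto
      moreover have "((\<lambda>s. exp (- 1 / s)) has_real_derivative exp (- 1 / s) / s\<^sup>2) (at s)"
        using 1 by (auto intro!: derivative_eq_intros simp: power2_eq_square)
      ultimately have "((\<lambda>s. exp (- 1 / s) / s ^ n) has_real_derivative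
          (exp (- 1 / s) / s\<^sup>2 * s ^ n - exp (- 1 / s) * (real n * s ^ n / s)) / (s ^ n * s ^ n)) (at s)"
        using 1 by (intro DERIV_divide) auto
      moreover have "(exp (- 1 / s) / s\<^sup>2 * s ^ n - exp (- 1 / s) * (real n * s ^ n / s)) / (s ^ n * s ^ n) =
          flat (n + 2) s - real n * flat (n + 1) s"
        using 1 by (simp add: flat_def divide_simps power2_eq_square) (simp add: algebra_simps)
      ultimately show ?thesis by simp
    qed
    then show ?thesis
      by (rule has_field_derivative_transform_within_open[where S="{0<..}"]) (use 1 in \<open>auto simp: flat_def\<close>)
  next
    case 2
    have "((\<lambda>s. 0) has_real_derivative flat (n + 2) s - real n * flat (n + 1) s) (at s)"
      using 2 by (auto simp: flat_def)
    then show ?thesis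
      by (rule has_field_derivative_transform_within_open[where S="{..<0}"]) (use 2 in \<open>auto simp: flat_def\<close>)
  next
    case 3
    \<comment> \<open>At 0 the difference quotient of \<open>flat n\<close> is
      \<open>flat (n + 1)\<close>, whose limit is already known.\<close>
    have "((\<lambda>h. (flat n (0 + h) - flat n 0) / h) \<longlongrightarrow> 0) (at 0)"
      by (rule Lim_transform_eventually[OF flat_tendsto_0[of "n + 1"]])
         (auto simp: eventually_at_filter flat_def)
    then show ?thesis using 3 by (simp add: DERIV_def flat_def)
  qed
qed

lemma Ck_on_flat: "Ck_on n (flat k) UNIV"
proof (induction n arbitrary: k)
  case 0
  show ?case
    using flat_has_real_derivative by (auto intro!: continuous_at_imp_continuous_on DERIV_isCont)
next
  case (Suc n)
  have "Ck_on n (\<lambda>x. (flat (k + 2) x + (- real k) * flat (k + 1) x) * h) UNIV" for h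
    by (intro Ck_on_mult Ck_on_add Ck_on_const Suc)
  then show ?case
    using flat_has_real_derivative[of k]
    by (intro Ck_on_SucI[where f'="\<lambda>x h. (flat (k + 2) x - real k * flat (k + 1) x) * h"])
       (auto simp: has_field_derivative_def)
qed

lemma Ck_on_inner_self: "Ck_on n (\<lambda>x. x \<bullet> x) UNIV"
proof (cases n)
  case 0
  then show ?thesis by (auto intro!: continuous_intros)
next
  case (Suc m)
  have "bounded_linear (\<lambda>x::'a. x \<bullet> h + h \<bullet> x)" for h
    by (intro bounded_linear_add bounded_linear_inner_left bounded_linear_inner_right)
  then have "Ck_on m (\<lambda>x::'a. x \<bullet> h + h \<bullet> x) UNIV" for h
    by (rule Ck_on_linear)
  then show ?thesis
    unfolding Suc by (intro Ck_on_SucI) (rule has_derivative_inner[OF has_derivative_ident has_derivative_ident])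
qed

lemma continuous_compact_support_integrable:
  fixes f :: "'a::euclidean_space \<Rightarrow> 'b::{banach,second_countable_topology}"
  assumes "continuous_on UNIV f" "compact C" "\<And>x. x \<notin> C \<Longrightarrow> f x = 0"
  shows "integrable lborel f"
proof -
  have "integrable lborel (\<lambda>x. indicator C x *\<^sub>R f x)"
    using assms by (intro borel_integrable_compact) (auto intro: continuous_on_subset)
  also have "(\<lambda>x. indicator C x *\<^sub>R f x) = f"
    using assms(3) by (auto simp: indicator_def fun_eq_iff)
  finally show ?thesis .
qed

lemma continuous_compact_support_bounded:
  fixes f :: "'a::euclidean_space \<Rightarrow> 'b::real_normed_vector"
  assumes "continuous_on UNIV f" "compact C" "\<And>x. x \<notin> C \<Longrightarrow> f x = 0"
  obtains B where "B > 0" "\<And>x. norm (f x) \<le> B"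
proof -
  have "bounded (f ` C)"
    using assms by (intro compact_imp_bounded compact_continuous_image) (auto intro: continuous_on_subset)
  then obtain B where "B > 0" "\<And>y. y \<in> f ` C \<Longrightarrow> norm y \<le> B"
    unfolding bounded_pos by auto
  then have "norm (f x) \<le> B" for x
    using assms(3)[of x] by (cases "x \<in> C") auto
  with \<open>B > 0\<close> show ?thesis by (rule that)
qed

text \<open>Uniform continuity holds on the compact set \<open>C'\<close>, the support thickened by
  the unit ball. For |h| < 1 either both x and x + h lie in \<open>C'\<close>, or both values of
  \<open>f\<close> are 0.\<close>

lemma compact_support_uniformly_continuous:
  fixes f :: "'a::euclidean_space \<Rightarrow> 'b::real_normed_vector"
  assumes cont: "continuous_on UNIV f" and C: "compact C" and supp: "\<And>x. x \<notin> C \<Longrightarrow> f x = 0" and "0 < e"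
  obtains d where "d > 0" "\<And>x h. norm h < d \<Longrightarrow> norm (f (x + h) - f x) < e"
proof -
  define C' where "C' = {x + y |x y. x \<in> C \<and> y \<in> cball (0::'a) 1}"
  have "compact C'"
    unfolding C'_def by (rule compact_sums[OF C compact_cball])
  then have "uniformly_continuous_on C' f"
    using cont by (intro compact_uniformly_continuous) (auto intro: continuous_on_subset)
  then obtain d where d: "d > 0" "\<And>x x'. x \<in> C' \<Longrightarrow> x' \<in> C' \<Longrightarrow> dist x' x < d \<Longrightarrow> dist (f x') (f x) < e"
    unfolding uniformly_continuous_on_def using \<open>0 < e\<close> by metis
  show ?thesis
  proof (rule that[of "min d 1"])
    fix x h :: 'a assume h: "norm h < min d 1"
    show "norm (f (x + h) - f x) < e"
    proof (cases "x \<in> C \<or> x + h \<in> C")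
      case True
      then have "x \<in> C' \<and> x + h \<in> C'"
      proof
        assume "x \<in> C"
        moreover have "x = x + 0" "0 \<in> cball (0::'a) 1" "h \<in> cball 0 1" using h by auto
        ultimately show ?thesis unfolding C'_def by blast
      next
        assume "x + h \<in> C"
        moreover have "x = (x + h) + (- h)" "x + h = (x + h) + 0" "0 \<in> cball (0::'a) 1" "- h \<in> cball 0 1" using h by auto
        ultimately show ?thesis unfolding C'_def by blast
      qed
      then have "x \<in> C'" "x + h \<in> C'" by auto
      then show ?thesis using d(2)[of x "x + h"] h by (simp add: dist_norm)
    qed (use supp \<open>0 < e\<close> in auto)
  qed (use d in auto)
qed

text \<open>The bump is \<open>flat 0\<close> applied to \<epsilon>^2 - |x|^2: smooth as a composite
  with a polynomial, even, and positive exactly on the open ball, so that its integral is nonzero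
  and can be normalised. Evenness later makes the convolution self-adjoint.\<close>

lemma ex_mollifier:
  assumes "\<epsilon> > 0"
  obtains \<beta> :: "'a::euclidean_space \<Rightarrow> real" where "smooth \<beta>" "\<And>x. 0 \<le> \<beta> x" "\<And>x. \<beta> (- x) = \<beta> x"
    "\<And>x. norm x \<ge> \<epsilon> \<Longrightarrow> \<beta> x = 0" "integrable lborel \<beta>" "integral\<^sup>L lborel \<beta> = 1"
proof -
  define b :: "'a \<Rightarrow> real" where "b = (\<lambda>x. flat 0 (\<epsilon>\<^sup>2 + (- 1) * (x \<bullet> x)))"
  have sb: "smooth b"
    unfolding b_def
    by (intro allI Ck_on_compose_real[OF Ck_on_flat] Ck_on_add Ck_on_const Ck_on_mult Ck_on_inner_self)
  have b0: "b x \<ge> 0" for x by (simp add: b_def flat_def)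
  have bpos: "b x > 0 \<longleftrightarrow> norm x < \<epsilon>" for x
    using assms by (auto simp: b_def flat_def power2_norm_eq_inner[symmetric] power_strict_mono
        dest: power2_less_imp_less)
  have supp: "b x = 0" if "norm x \<ge> \<epsilon>" for x
    using bpos[of x] b0[of x] that by linarith
  have cb: "continuous_on UNIV b" using sb Ck_on_imp_continuous by blast
  have ib: "integrable lborel b"
    by (rule continuous_compact_support_integrable[OF cb compact_cball[of 0 \<epsilon>]]) (auto intro: supp)
  have "integral\<^sup>L lborel b \<noteq> 0"
  proof
    assume "integral\<^sup>L lborel b = 0"
    then have "AE x in lborel. b x = 0"
      using integral_nonneg_eq_0_iff_AE[OF ib] b0 by auto
    then have "AE x in lborel. x \<notin> ball (0::'a) \<epsilon>"
      by eventually_elim (use bpos in force)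
    then have "emeasure lborel (ball (0::'a) \<epsilon>) = 0"
      by (subst (asm) AE_iff_null_sets[symmetric]) auto
    then show False
      using assms content_ball_pos[of \<epsilon> "0::'a"] by (simp add: measure_def)
  qed
  moreover have "integral\<^sup>L lborel b \<ge> 0" using b0 by simp
  ultimately have I: "integral\<^sup>L lborel b > 0" by simp
  show ?thesis
  proof (rule that[of "\<lambda>x. inverse (integral\<^sup>L lborel b) * b x"])
    show "smooth (\<lambda>x. inverse (integral\<^sup>L lborel b) * b x)"
      using sb by (intro allI Ck_on_mult Ck_on_const) auto
  qed (use I b0 supp ib in \<open>auto simp: b_def\<close>)
qed

section \<open>Integration by parts and convolution\<close>

lemma distr_lborel_minus: "distr lborel borel (\<lambda>\<xi>. \<zeta> - \<xi>) = (lborel :: 'a::euclidean_space measure)"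
proof -
  have "lborel = density (distr lborel borel (\<lambda>x. \<zeta> + (-1) *\<^sub>R x)) (\<lambda>_. \<bar>-1::real\<bar> ^ DIM('a))"
    by (rule lborel_affine) simp
  then show ?thesis by (simp add: density_1)
qed

lemma integral_lborel_shift:
  fixes f :: "'a::euclidean_space \<Rightarrow> 'b::{banach,second_countable_topology}"
  assumes "f \<in> borel_measurable borel"
  shows "integral\<^sup>L lborel (\<lambda>x. f (x + a)) = integral\<^sup>L lborel f"
  using integral_distr[of "(+) a" lborel borel f] assms by (simp add: lborel_distr_plus add.commute)

lemma integral_lborel_minus:
  fixes f :: "'a::euclidean_space \<Rightarrow> 'b::{banach,second_countable_topology}"
  assumes "f \<in> borel_measurable borel"
  shows "integral\<^sup>L lborel (\<lambda>x. f (a - x)) = integral\<^sup>L lborel f"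
  using integral_distr[of "(-) a" lborel borel f] assms by (simp add: distr_lborel_minus)

lemma nn_integral_lborel_shift:
  fixes f :: "'a::euclidean_space \<Rightarrow> ennreal"
  assumes "f \<in> borel_measurable borel"
  shows "(\<integral>\<^sup>+x. f (x + a) \<partial>lborel) = (\<integral>\<^sup>+x. f x \<partial>lborel)"
  using nn_integral_distr[of "(+) a" lborel borel f] assms by (simp add: lborel_distr_plus add.commute)

lemma derivative_zero_outside:
  assumes "(f has_derivative f') (at x)" "closed C" "\<And>x. x \<notin> C \<Longrightarrow> f x = 0" "x \<notin> C"
  shows "f' h = 0"
proof -
  have "((\<lambda>_. 0) has_derivative f') (at x)"
    by (rule has_derivative_transform_within_open[OF assms(1), of "- C"]) (use assms in auto)
  then have "f' = (\<lambda>_. 0)"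
    using has_derivative_unique has_derivative_const by blast
  then show ?thesis by simp
qed

lemma has_derivative_along_line:
  fixes f :: "'a::real_normed_vector \<Rightarrow> real"
  assumes "\<And>x. (f has_derivative f' x) (at x)"
  shows "((\<lambda>s. f (x + s *\<^sub>R e)) has_real_derivative f' (x + s *\<^sub>R e) e) (at s)"
proof -
  have A: "((\<lambda>s. x + s *\<^sub>R e) has_derivative (\<lambda>c. c *\<^sub>R e)) (at s)"
    by (auto intro!: derivative_eq_intros)
  have "f' y (c *\<^sub>R e) = f' y e * c" for y c
    using linear_scale[OF has_derivative_linear[OF assms]] by (simp add: mult.commute)
  then show ?thesis
    using has_derivative_compose[OF A assms] by (simp add: has_field_derivative_def mult_commute_abs)
qed

text \<open>The difference quotients in direction \<open>e\<close> have integral 0 by translation invariance.\<close>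

lemma integral_directional_derivative:
  fixes f g :: "'a::euclidean_space \<Rightarrow> real"
  assumes der: "\<And>x. (f has_derivative f' x) (at x)"
    and cont: "continuous_on UNIV (\<lambda>x. f' x e)"
    and C: "compact C" and supp: "\<And>x. x \<notin> C \<Longrightarrow> f x = 0"
    and g: "continuous_on UNIV g" and inv: "\<And>x s. g (x + s *\<^sub>R e) = g x"
  shows "integral\<^sup>L lborel (\<lambda>x. g x * f' x e) = 0"
proof -
  have cf: "continuous_on UNIV f"
    using der by (auto intro!: continuous_at_imp_continuous_on has_derivative_continuous)
  have f'0: "f' x e = 0" if "x \<notin> C" for x
    using derivative_zero_outside[OF der compact_imp_closed[OF C] supp that] .
  \<comment> \<open>Step sizes in (0, 1], so that all difference quotients vanish outside the same
    compact set \<open>C'\<close>.\<close>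
  define h where "h n = inverse (real (Suc n))" for n
  have h: "0 < h n" "h n \<le> 1" for n by (auto simp: h_def field_simps)
  define C' where "C' = {x + y |x y. x \<in> C \<and> y \<in> cball (0::'a) (norm e)}"
  have C': "compact C'"
    unfolding C'_def by (rule compact_sums[OF C compact_cball])
  obtain M where M: "M > 0" "\<And>x. norm (f' x e) \<le> M"
    using continuous_compact_support_bounded[OF cont C f'0] by metis
  have "bounded (g ` C')"
    using C' g by (intro compact_imp_bounded compact_continuous_image) (auto intro: continuous_on_subset)
  then obtain B where B: "B > 0" "\<And>x. x \<in> C' \<Longrightarrow> \<bar>g x\<bar> \<le> B"
    unfolding bounded_pos by auto
  define q where "q n x = g x * ((f (x + h n *\<^sub>R e) - f x) / h n)" for n x
  have [measurable]: "g \<in> borel_measurable borel" "f \<in> borel_measurable borel"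
      "(\<lambda>x. f' x e) \<in> borel_measurable borel"
    using g cf cont by (auto intro: borel_measurable_continuous_onI)
  have int1: "integrable lborel (\<lambda>x. g x * f x)"
    by (rule continuous_compact_support_integrable[OF _ C]) (auto intro!: continuous_intros g cf simp: supp)
  have int2: "integrable lborel (\<lambda>x. g x * f (x + h n *\<^sub>R e))" for n
  proof (rule continuous_compact_support_integrable[OF _ C'])
    show "continuous_on UNIV (\<lambda>x. g x * f (x + h n *\<^sub>R e))"
      by (intro continuous_intros g continuous_on_compose2[OF cf]) auto
    show "g x * f (x + h n *\<^sub>R e) = 0" if "x \<notin> C'" for x
    proof -
      have "x + h n *\<^sub>R e \<notin> C"
      proof
        assume "x + h n *\<^sub>R e \<in> C"
        moreover have "x = (x + h n *\<^sub>R e) + (- h n *\<^sub>R e)" by simp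
        moreover have "- h n *\<^sub>R e \<in> cball 0 (norm e)"
          using h[of n] mult_right_mono[of "h n" 1 "norm e"] by simp
        ultimately have "x \<in> C'" unfolding C'_def by blast
        with that show False by simp
      qed
      then show ?thesis using supp by simp
    qed
  qed
  \<comment> \<open>Since \<open>g\<close> is constant along \<open>e\<close>, the integrand is a
    translate of g f. In the applications \<open>g\<close> is 1 or the weight |x|^\<gamma>, the
    latter only with \<open>e\<close> a y-direction.\<close>
  have "integral\<^sup>L lborel (\<lambda>x. g x * f (x + h n *\<^sub>R e)) = integral\<^sup>L lborel (\<lambda>x. g x * f x)" for n
    using integral_lborel_shift[of "\<lambda>x. g x * f x" "h n *\<^sub>R e"] by (simp add: inv)
  then have q0: "integral\<^sup>L lborel (q n) = 0" for n
    using int1 int2[of n] by (simp add: q_def[abs_def] right_diff_distrib diff_divide_distrib)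
  have "(\<lambda>n. integral\<^sup>L lborel (q n)) \<longlonglongrightarrow> integral\<^sup>L lborel (\<lambda>x. g x * f' x e)"
  proof (rule integral_dominated_convergence[where w="\<lambda>x. indicator C' x * (B * M)"])
    show "integrable lborel (\<lambda>x. indicator C' x * (B * M))"
      using borel_integrable_compact[OF C', of "\<lambda>_. B * M"] by simp
    show "AE x in lborel. (\<lambda>n. q n x) \<longlonglongrightarrow> g x * f' x e"
    proof (rule AE_I2)
      fix x
      have "((\<lambda>s. f (x + s *\<^sub>R e)) has_real_derivative f' x e) (at 0)"
        using has_derivative_along_line[OF der, of x e 0] by simp
      then have "((\<lambda>s. (f (x + s *\<^sub>R e) - f x) / s) \<longlongrightarrow> f' x e) (at 0)"
        by (simp add: DERIV_def)
      moreover have "filterlim h (at 0) sequentially"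
        unfolding h_def[abs_def] filterlim_at using LIMSEQ_inverse_real_of_nat by auto
      ultimately have "(\<lambda>n. (f (x + h n *\<^sub>R e) - f x) / h n) \<longlonglongrightarrow> f' x e"
        by (rule filterlim_compose)
      then show "(\<lambda>n. q n x) \<longlonglongrightarrow> g x * f' x e"
        unfolding q_def by (intro tendsto_intros)
    qed
    show "AE x in lborel. norm (q n x) \<le> indicator C' x * (B * M)" for n
    proof (rule AE_I2)
      fix x
      show "norm (q n x) \<le> indicator C' x * (B * M)"
      proof (cases "x \<in> C'")
        case True
        obtain z where "f (x + h n *\<^sub>R e) - f (x + 0 *\<^sub>R e) = (h n - 0) * f' (x + z *\<^sub>R e) e"
          using MVT2[of 0 "h n" "\<lambda>s. f (x + s *\<^sub>R e)" "\<lambda>s. f' (x + s *\<^sub>R e) e"] h[of n]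
            has_derivative_along_line[OF der] by metis
        then have Mle: "\<bar>(f (x + h n *\<^sub>R e) - f x) / h n\<bar> \<le> M"
          using M(2)[of "x + z *\<^sub>R e"] h[of n] by simp
        show ?thesis
          unfolding q_def real_norm_def abs_mult
          using True mult_mono[OF B(2)[OF True] Mle less_imp_le[OF B(1)] abs_ge_zero] by simp
      next
        case False
        have "x \<notin> C"
        proof
          assume "x \<in> C"
          moreover have "x = x + 0" by simp
          moreover have "0 \<in> cball (0::'a) (norm e)" by simp
          ultimately have "x \<in> C'" unfolding C'_def by blast
          with False show False by simp
        qed
        moreover have "x + h n *\<^sub>R e \<notin> C"
        proof
          assume "x + h n *\<^sub>R e \<in> C"
          moreover have "x = (x + h n *\<^sub>R e) + (- h n *\<^sub>R e)" by simp
          moreover have "- h n *\<^sub>R e \<in> cball 0 (norm e)"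
            using h[of n] mult_right_mono[of "h n" 1 "norm e"] by simp
          ultimately have "x \<in> C'" unfolding C'_def by blast
          with False show False by simp
        qed
        ultimately show ?thesis using False supp by (simp add: q_def)
      qed
    qed
  qed (auto simp: q_def[abs_def])
  then show ?thesis
    using LIMSEQ_unique[OF _ tendsto_const[of "0::real"]] by (simp add: q0)
qed

text \<open>The mean value theorem reduces the first-order remainder to the oscillation of the
  gradient \<open>N\<close>, which is uniformly continuous because its support is compact. The point
  is that \<open>d\<close> does not depend on the base point \<open>a\<close>; this allows
  differentiation under the convolution integral for an integrable second factor.\<close>

lemma C1_uniform_expansion:
  fixes \<kappa> :: "'a::euclidean_space \<Rightarrow> real"
  assumes der: "\<And>x. (\<kappa> has_derivative \<kappa>' x) (at x)"
    and cont: "\<And>h. continuous_on UNIV (\<lambda>x. \<kappa>' x h)"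
    and C: "compact C" and supp: "\<And>x. x \<notin> C \<Longrightarrow> \<kappa> x = 0" and e: "0 < e"
  obtains d where "d > 0"
    "\<And>a h. norm h < d \<Longrightarrow> \<bar>\<kappa> (a + h) - \<kappa> a - \<kappa>' a h\<bar> \<le> e * norm h"
proof -
  define N where "N x = (\<Sum>i\<in>Basis. \<kappa>' x i *\<^sub>R i)" for x
  have N: "\<kappa>' x h = N x \<bullet> h" for x h
  proof -
    have "\<kappa>' x h = \<kappa>' x (\<Sum>i\<in>Basis. (h \<bullet> i) *\<^sub>R i)" by (simp add: euclidean_representation)
    also have "\<dots> = (\<Sum>i\<in>Basis. (h \<bullet> i) * \<kappa>' x i)"
      using has_derivative_linear[OF der, of x] by (simp add: linear_sum linear_scale)
    also have "\<dots> = N x \<bullet> h"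
      by (simp add: N_def inner_sum_right inner_commute mult.commute)
    finally show ?thesis .
  qed
  have "continuous_on UNIV N"
    unfolding N_def by (intro continuous_intros cont)
  moreover have "N x = 0" if "x \<notin> C" for x
    using derivative_zero_outside[OF der compact_imp_closed[OF C] supp that] by (simp add: N_def)
  ultimately obtain d where d: "d > 0" "\<And>x h. norm h < d \<Longrightarrow> norm (N (x + h) - N x) < e"
    using compact_support_uniformly_continuous[OF _ C _ e, of N] by blast
  have "\<bar>\<kappa> (a + h) - \<kappa> a - \<kappa>' a h\<bar> \<le> e * norm h" if h: "norm h < d" for a h
  proof -
    obtain z where z: "0 < z" "z < 1" "\<kappa> (a + 1 *\<^sub>R h) - \<kappa> (a + 0 *\<^sub>R h) = (1 - 0) * \<kappa>' (a + z *\<^sub>R h) h"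
      using MVT2[of 0 1 "\<lambda>s. \<kappa> (a + s *\<^sub>R h)" "\<lambda>s. \<kappa>' (a + s *\<^sub>R h) h"]
        has_derivative_along_line[OF der] by (metis zero_less_one)
    have "norm (z *\<^sub>R h) < d"
      using z h mult_right_mono[of z 1 "norm h"] by simp
    then have "norm (N (a + z *\<^sub>R h) - N a) \<le> e"
      using d(2) less_imp_le by blast
    moreover have "\<kappa> (a + h) - \<kappa> a - \<kappa>' a h = (N (a + z *\<^sub>R h) - N a) \<bullet> h"
      using z by (simp add: N inner_diff_left)
    ultimately show ?thesis
      using Cauchy_Schwarz_ineq2[of "N (a + z *\<^sub>R h) - N a" h]
      by (simp add: order_trans[OF _ mult_right_mono])
  qed
  with d(1) show ?thesis by (rule that)
qed

section \<open>Convolution with a smooth kernel\<close>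

text \<open>The kernel is real while the other factor may be vector valued: one operator mollifies
  the solution, the source and the vector fields.\<close>

definition conv :: "('a::euclidean_space \<Rightarrow> real) \<Rightarrow> ('a \<Rightarrow> 'b::{banach,second_countable_topology}) \<Rightarrow> 'a \<Rightarrow> 'b" where
  "conv \<kappa> f \<zeta> = integral\<^sup>L lborel (\<lambda>\<xi>. \<kappa> (\<zeta> - \<xi>) *\<^sub>R f \<xi>)"

lemma integrable_bounded_scaleR:
  fixes f :: "'a \<Rightarrow> 'b::{banach,second_countable_topology}"
  assumes f: "integrable M f" and g [measurable]: "g \<in> borel_measurable M" and B: "\<And>x. \<bar>g x\<bar> \<le> B"
  shows "integrable M (\<lambda>x. g x *\<^sub>R f x)"
proof (rule Bochner_Integration.integrable_bound)
  show "integrable M (\<lambda>x. B * norm (f x))" using f by auto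
  show "AE x in M. norm (g x *\<^sub>R f x) \<le> norm (B * norm (f x))"
    using order_trans[OF abs_ge_zero B] B by (auto intro!: AE_I2 mult_right_mono simp: abs_mult)
qed (use f in measurable)

lemma conv_integrable:
  fixes \<kappa> :: "'a::euclidean_space \<Rightarrow> real" and f :: "'a \<Rightarrow> 'b::{banach,second_countable_topology}"
  assumes cont: "continuous_on UNIV \<kappa>" and C: "compact C" and supp: "\<And>x. x \<notin> C \<Longrightarrow> \<kappa> x = 0"
    and f: "integrable lborel f"
  shows "integrable lborel (\<lambda>\<xi>. \<kappa> (\<zeta> - \<xi>) *\<^sub>R f \<xi>)"
proof -
  obtain B where "\<And>x. norm (\<kappa> x) \<le> B"
    using continuous_compact_support_bounded[OF cont C supp] by metis
  moreover have [measurable]: "\<kappa> \<in> borel_measurable borel"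
    using cont by (rule borel_measurable_continuous_onI)
  ultimately show ?thesis
    by (intro integrable_bounded_scaleR[OF f]) auto
qed

lemma conv_has_derivative:
  fixes \<kappa> f :: "'a::euclidean_space \<Rightarrow> real"
  assumes der: "\<And>x. (\<kappa> has_derivative \<kappa>' x) (at x)"
    and cont: "\<And>h. continuous_on UNIV (\<lambda>x. \<kappa>' x h)"
    and C: "compact C" and supp: "\<And>x. x \<notin> C \<Longrightarrow> \<kappa> x = 0" and f: "integrable lborel f"
  shows "(conv \<kappa> f has_derivative (\<lambda>h. conv (\<lambda>x. \<kappa>' x h) f \<zeta>)) (at \<zeta>)"
proof -
  have c\<kappa>: "continuous_on UNIV \<kappa>"
    using der by (auto intro!: continuous_at_imp_continuous_on has_derivative_continuous)
  have \<kappa>'0: "\<kappa>' x h = 0" if "x \<notin> C" for x h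
    using derivative_zero_outside[OF der compact_imp_closed[OF C] supp that] .
  note i = conv_integrable[OF c\<kappa> C supp f]
  note i' = conv_integrable[OF cont C \<kappa>'0 f]
  have lin: "linear (\<lambda>h. conv (\<lambda>x. \<kappa>' x h) f \<zeta>)"
  proof (rule linearI)
    show "conv (\<lambda>x. \<kappa>' x (a + b)) f \<zeta> = conv (\<lambda>x. \<kappa>' x a) f \<zeta> + conv (\<lambda>x. \<kappa>' x b) f \<zeta>" for a b
      unfolding conv_def using i'[of \<zeta> a] i'[of \<zeta> b]
      by (simp add: linear_add[OF has_derivative_linear[OF der]] distrib_right)
    show "conv (\<lambda>x. \<kappa>' x (r *\<^sub>R a)) f \<zeta> = r *\<^sub>R conv (\<lambda>x. \<kappa>' x a) f \<zeta>" for r a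
      unfolding conv_def by (simp add: linear_scale[OF has_derivative_linear[OF der]] mult.assoc)
  qed
  show ?thesis
    unfolding has_derivative_at_alt
  proof (intro conjI allI impI)
    show "bounded_linear (\<lambda>h. conv (\<lambda>x. \<kappa>' x h) f \<zeta>)"
      using lin by (simp add: linear_conv_bounded_linear)
    fix e :: real assume e: "0 < e"
    define L where "L = integral\<^sup>L lborel (\<lambda>x. \<bar>f x\<bar>)"
    have L: "L \<ge> 0" by (simp add: L_def)
    \<comment> \<open>\<open>L\<close> is the L^1 norm of \<open>f\<close>. The added 1 covers the
      case L = 0.\<close>
    obtain d where d: "d > 0"
        "\<And>a h. norm h < d \<Longrightarrow> \<bar>\<kappa> (a + h) - \<kappa> a - \<kappa>' a h\<bar> \<le> e / (L + 1) * norm h"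
      using C1_uniform_expansion[OF der cont C supp, of "e / (L + 1)"] e L by auto
    have "norm (conv \<kappa> f y - conv \<kappa> f \<zeta> - conv (\<lambda>x. \<kappa>' x (y - \<zeta>)) f \<zeta>) \<le> e * norm (y - \<zeta>)"
      if y: "norm (y - \<zeta>) < d" for y
    proof -
      define r where "r \<xi> = \<kappa> (y - \<xi>) - \<kappa> (\<zeta> - \<xi>) - \<kappa>' (\<zeta> - \<xi>) (y - \<zeta>)" for \<xi>
      have *: "conv \<kappa> f y - conv \<kappa> f \<zeta> - conv (\<lambda>x. \<kappa>' x (y - \<zeta>)) f \<zeta> = integral\<^sup>L lborel (\<lambda>\<xi>. r \<xi> * f \<xi>)"
        unfolding conv_def r_def using i i' by (simp add: left_diff_distrib)
      have "norm (integral\<^sup>L lborel (\<lambda>\<xi>. r \<xi> * f \<xi>)) \<le> integral\<^sup>L lborel (\<lambda>\<xi>. e / (L + 1) * norm (y - \<zeta>) * \<bar>f \<xi>\<bar>)"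
      proof (rule Bochner_Integration.integral_norm_bound_integral)
        show "integrable lborel (\<lambda>\<xi>. r \<xi> * f \<xi>)"
          unfolding r_def using i[of y] i[of \<zeta>] i'[of \<zeta> "y - \<zeta>"] by (simp add: left_diff_distrib)
        show "norm (r \<xi> * f \<xi>) \<le> e / (L + 1) * norm (y - \<zeta>) * \<bar>f \<xi>\<bar>" for \<xi>
          using mult_right_mono[OF d(2)[OF y, of "\<zeta> - \<xi>"] abs_ge_zero[of "f \<xi>"]]
          by (simp add: r_def algebra_simps flip: abs_mult)
      qed (use f in auto)
      moreover have "integral\<^sup>L lborel (\<lambda>\<xi>. e / (L + 1) * norm (y - \<zeta>) * \<bar>f \<xi>\<bar>) = e / (L + 1) * norm (y - \<zeta>) * L"
        by (simp add: L_def)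
      moreover have "e / (L + 1) * norm (y - \<zeta>) * L \<le> e * norm (y - \<zeta>)"
        using e L by (simp add: field_simps mult_left_mono)
      ultimately show ?thesis unfolding * by linarith
    qed
    with d(1) show "\<exists>d>0. \<forall>y. norm (y - \<zeta>) < d \<longrightarrow>
        norm (conv \<kappa> f y - conv \<kappa> f \<zeta> - conv (\<lambda>x. \<kappa>' x (y - \<zeta>)) f \<zeta>) \<le> e * norm (y - \<zeta>)" by blast
  qed
qed

lemma smooth_has_derivative: "smooth \<kappa> \<Longrightarrow> (\<kappa> has_derivative frechet_derivative \<kappa> (at x)) (at x)"
  using Ck_on_SucE(1)[of 0] by blast

lemma smooth_continuous_derivative: "smooth \<kappa> \<Longrightarrow> continuous_on UNIV (\<lambda>x. frechet_derivative \<kappa> (at x) h)"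
  using Ck_on_SucE(2)[of 0 \<kappa> h] by simp

text \<open>Differentiation falls on the kernel, and a directional derivative of the kernel is again
  smooth and vanishes off the same \<open>C\<close>. Hence the induction runs over all kernels at
  once.\<close>

lemma conv_smooth:
  fixes \<kappa> f :: "'a::euclidean_space \<Rightarrow> real"
  assumes "smooth \<kappa>" and C: "compact C" and "\<And>x. x \<notin> C \<Longrightarrow> \<kappa> x = 0" and f: "integrable lborel f"
  shows "smooth (conv \<kappa> f)"
proof
  fix n
  show "Ck_on n (conv \<kappa> f) UNIV"
    using assms(1,3)
  proof (induction n arbitrary: \<kappa>)
    case 0
    then have "isCont (conv \<kappa> f) x" for x
      using has_derivative_continuous[OF conv_has_derivative[OF smooth_has_derivative[OF 0(1)]
        smooth_continuous_derivative[OF 0(1)] C 0(2) f]] by blast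
    then show ?case by (simp add: continuous_at_imp_continuous_on)
  next
    case (Suc n)
    show ?case
    proof (rule Ck_on_SucI)
      show "(conv \<kappa> f has_derivative (\<lambda>h. conv (\<lambda>x. frechet_derivative \<kappa> (at x) h) f \<zeta>)) (at \<zeta>)" for \<zeta>
        by (rule conv_has_derivative[OF smooth_has_derivative[OF Suc(2)]
          smooth_continuous_derivative[OF Suc(2)] C Suc(3) f])
      show "Ck_on n (conv (\<lambda>x. frechet_derivative \<kappa> (at x) h) f) UNIV" for h
      proof (rule Suc.IH)
        show "smooth (\<lambda>x. frechet_derivative \<kappa> (at x) h)"
          using Suc.prems(1) Ck_on_SucE(2) by blast
        show "frechet_derivative \<kappa> (at x) h = 0" if "x \<notin> C" for x
          using derivative_zero_outside[OF smooth_has_derivative[OF Suc(2)] compact_imp_closed[OF C] Suc(3) that] .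
      qed
    qed
  qed
qed

lemma conv_eq_0:
  assumes "\<And>\<xi>. f \<xi> \<noteq> 0 \<Longrightarrow> \<kappa> (\<zeta> - \<xi>) = 0"
  shows "conv \<kappa> f \<zeta> = 0"
proof -
  have "(\<lambda>\<xi>. \<kappa> (\<zeta> - \<xi>) *\<^sub>R f \<xi>) = (\<lambda>_. 0)" using assms by (intro ext) auto
  then show ?thesis unfolding conv_def by simp
qed

lemma conv_alt:
  fixes \<kappa> :: "'a::euclidean_space \<Rightarrow> real"
  assumes [measurable]: "\<kappa> \<in> borel_measurable borel" "f \<in> borel_measurable borel"
  shows "conv \<kappa> f \<zeta> = integral\<^sup>L lborel (\<lambda>\<xi>. \<kappa> \<xi> *\<^sub>R f (\<zeta> - \<xi>))"
  unfolding conv_def using integral_lborel_minus[of "\<lambda>\<xi>. \<kappa> (\<zeta> - \<xi>) *\<^sub>R f \<xi>" \<zeta>] by simp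

lemma conv_borel_measurable [measurable]:
  fixes \<kappa> :: "'a::euclidean_space \<Rightarrow> real"
  assumes [measurable]: "\<kappa> \<in> borel_measurable borel" "f \<in> borel_measurable borel"
  shows "conv \<kappa> f \<in> borel_measurable borel"
  unfolding conv_def[abs_def] by measurable

text \<open>Fubini and evenness of the kernel: convolution is self-adjoint for the pairing by
  integrals. Boundedness of the kernel makes the double integrand integrable for \<open>f\<close>
  and \<open>g\<close> merely in L^1. In the weak equation this moves the mollification from the
  test function to the solution.\<close>

lemma conv_symmetric:
  fixes f g :: "'a::euclidean_space \<Rightarrow> 'b::euclidean_space"
  assumes cont: "continuous_on UNIV \<kappa>" and C: "compact C" and supp: "\<And>x. x \<notin> C \<Longrightarrow> \<kappa> x = 0"
    and even: "\<And>x. \<kappa> (- x) = \<kappa> x"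
    and f: "integrable lborel f" and g: "integrable lborel g"
  shows "integral\<^sup>L lborel (\<lambda>x. g x \<bullet> conv \<kappa> f x) = integral\<^sup>L lborel (\<lambda>x. conv \<kappa> g x \<bullet> f x)"
proof -
  obtain B where B: "B > 0" "\<And>x. norm (\<kappa> x) \<le> B"
    using continuous_compact_support_bounded[OF cont C supp] by metis
  have [measurable]: "\<kappa> \<in> borel_measurable borel"
    using cont by (rule borel_measurable_continuous_onI)
  have [measurable]: "f \<in> borel_measurable borel" "g \<in> borel_measurable borel"
    using f g by auto
  let ?k = "\<lambda>x y. \<kappa> (x - y) * (g x \<bullet> f y)"
  have int: "integrable (lborel \<Otimes>\<^sub>M lborel) (\<lambda>(x, y). ?k x y)"
  proof (rule integrableI_bounded)
    show "(\<lambda>(x, y). ?k x y) \<in> borel_measurable (lborel \<Otimes>\<^sub>M lborel)"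
      by measurable
    have "(\<integral>\<^sup>+z. ennreal (norm ((\<lambda>(x, y). ?k x y) z)) \<partial>(lborel \<Otimes>\<^sub>M lborel)) \<le>
        (\<integral>\<^sup>+z. (\<lambda>(x, y). ennreal (B * norm (g x)) * ennreal (norm (f y))) z \<partial>(lborel \<Otimes>\<^sub>M lborel))"
    proof (rule nn_integral_mono, clarify)
      fix x y
      have "\<bar>?k x y\<bar> \<le> B * (norm (g x) * norm (f y))"
        unfolding abs_mult using B Cauchy_Schwarz_ineq2[of "g x" "f y"] by (intro mult_mono) auto
      then show "ennreal (norm (?k x y)) \<le> ennreal (B * norm (g x)) * ennreal (norm (f y))"
        using B by (simp add: ennreal_mult[symmetric] mult.assoc)
    qed
    also have "\<dots> = (\<integral>\<^sup>+x. (\<integral>\<^sup>+y. ennreal (B * norm (g x)) * ennreal (norm (f y)) \<partial>lborel) \<partial>lborel)"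
      by (subst lborel.nn_integral_fst[symmetric]) auto
    also have "\<dots> = (\<integral>\<^sup>+x. ennreal (B * norm (g x)) \<partial>lborel) * (\<integral>\<^sup>+y. ennreal (norm (f y)) \<partial>lborel)"
      by (simp add: nn_integral_cmult nn_integral_multc)
    also have "\<dots> < \<infinity>"
    proof -
      have "integrable lborel (\<lambda>x. B * norm (g x))" "integrable lborel (\<lambda>x. norm (f x))"
        using f g by auto
      then have "(\<integral>\<^sup>+x. ennreal (B * norm (g x)) \<partial>lborel) < \<infinity>" "(\<integral>\<^sup>+y. ennreal (norm (f y)) \<partial>lborel) < \<infinity>"
        using B by (simp_all add: nn_integral_eq_integral)
      then show ?thesis by (simp add: ennreal_mult_less_top)
    qed
    finally show "(\<integral>\<^sup>+z. ennreal (norm ((\<lambda>(x, y). ?k x y) z)) \<partial>(lborel \<Otimes>\<^sub>M lborel)) < \<infinity>" .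
  qed
  have ix: "integrable lborel (\<lambda>y. \<kappa> (x - y) *\<^sub>R f y)" "integrable lborel (\<lambda>y. \<kappa> (x - y) *\<^sub>R g y)" for x
    using conv_integrable[OF cont C supp] f g by blast+
  have "integral\<^sup>L lborel (\<lambda>x. g x \<bullet> conv \<kappa> f x) = (\<integral>x. (\<integral>y. ?k x y \<partial>lborel) \<partial>lborel)"
    unfolding conv_def using ix by (simp flip: integral_inner_right)
  also have "\<dots> = (\<integral>y. (\<integral>x. ?k x y \<partial>lborel) \<partial>lborel)"
    by (rule lborel_pair.Fubini_integral[OF int, symmetric])
  also have "\<dots> = integral\<^sup>L lborel (\<lambda>y. conv \<kappa> g y \<bullet> f y)"
  proof (rule Bochner_Integration.integral_cong[OF refl])
    fix y
    have "\<kappa> (x - y) = \<kappa> (y - x)" for x using even[of "x - y"] by simp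
    then show "(\<integral>x. ?k x y \<partial>lborel) = conv \<kappa> g y \<bullet> f y"
      unfolding conv_def using ix(2)[of y] by (simp flip: integral_inner_left)
  qed
  finally show ?thesis .
qed

text \<open>The product \<kappa>(\<zeta> - \<xi>) \<psi>(\<xi>) has compact support in \<xi>, so its
  derivative along \<open>e\<close> integrates to 0 against \<open>g\<close>. The inner minus sign
  lets the derivative change factors without a change of sign.\<close>

lemma conv_by_parts:
  fixes \<kappa> \<psi> g :: "'a::euclidean_space \<Rightarrow> real"
  assumes der: "\<And>x. (\<kappa> has_derivative \<kappa>' x) (at x)" and cont: "continuous_on UNIV (\<lambda>x. \<kappa>' x e)"
    and der\<psi>: "\<And>x. (\<psi> has_derivative \<psi>' x) (at x)" and cont\<psi>: "continuous_on UNIV (\<lambda>x. \<psi>' x e)"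
    and C: "compact C" and supp: "\<And>x. x \<notin> C \<Longrightarrow> \<psi> x = 0"
    and g: "continuous_on UNIV g" and inv: "\<And>x s. g (x + s *\<^sub>R e) = g x"
  shows "conv (\<lambda>x. \<kappa>' x e) (\<lambda>\<xi>. g \<xi> * \<psi> \<xi>) \<zeta> = conv \<kappa> (\<lambda>\<xi>. g \<xi> * \<psi>' \<xi> e) \<zeta>"
proof -
  have c: "continuous_on UNIV \<kappa>" "continuous_on UNIV \<psi>"
    using der der\<psi> by (auto intro!: continuous_at_imp_continuous_on has_derivative_continuous)
  have \<psi>'0: "\<psi>' x e = 0" if "x \<notin> C" for x
    using derivative_zero_outside[OF der\<psi> compact_imp_closed[OF C] supp that] .
  have D: "((\<lambda>\<xi>. \<kappa> (\<zeta> - \<xi>) * \<psi> \<xi>) has_derivative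
      (\<lambda>h. \<kappa> (\<zeta> - x) * \<psi>' x h + \<kappa>' (\<zeta> - x) (- h) * \<psi> x)) (at x)" for x
  proof -
    have "((\<lambda>\<xi>. \<zeta> - \<xi>) has_derivative (\<lambda>h. - h)) (at x)"
      by (auto intro!: derivative_eq_intros)
    from has_derivative_mult[OF has_derivative_compose[OF this der] der\<psi>] show ?thesis .
  qed
  have neg: "\<kappa>' x (- e) = - \<kappa>' x e" for x
    using linear_neg[OF has_derivative_linear[OF der]] .
  have "integral\<^sup>L lborel (\<lambda>x. g x * (\<kappa> (\<zeta> - x) * \<psi>' x e + \<kappa>' (\<zeta> - x) (- e) * \<psi> x)) = 0"
    by (rule integral_directional_derivative[OF D _ C _ g inv])
      (auto intro!: continuous_intros continuous_on_compose2[OF c(1)] continuous_on_compose2[OF cont] c cont\<psi> simp: neg supp)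
  moreover have "integrable lborel (\<lambda>x. g x * (\<kappa> (\<zeta> - x) * \<psi>' x e))"
    by (rule continuous_compact_support_integrable[OF _ C])
      (auto intro!: continuous_intros continuous_on_compose2[OF c(1)] c cont\<psi> g simp: \<psi>'0)
  moreover have "integrable lborel (\<lambda>x. g x * (\<kappa>' (\<zeta> - x) e * \<psi> x))"
    by (rule continuous_compact_support_integrable[OF _ C])
      (auto intro!: continuous_intros continuous_on_compose2[OF cont] c g simp: supp)
  ultimately show ?thesis
    unfolding conv_def by (simp add: neg right_diff_distrib mult_ac)
qed

section \<open>Convergence of mollifications\<close>

lemma ennreal_ex_pos_real_less:
  assumes "(0::ennreal) < a"
  obtains r :: real where "0 < r" "ennreal r < a"
proof -
  obtain b where b: "0 < b" "b < a" using dense[OF assms] by blast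
  then obtain r where "0 \<le> r" "b = ennreal r"
    by (cases b) auto
  with b show ?thesis by (intro that[of r]) auto
qed

lemma ennreal_tendsto_zeroI:
  fixes f :: "'a \<Rightarrow> ennreal"
  assumes "\<And>e. 0 < e \<Longrightarrow> \<forall>\<^sub>F x in F. f x \<le> ennreal e"
  shows "(f \<longlongrightarrow> 0) F"
proof (rule order_tendstoI)
  fix a :: ennreal assume "0 < a"
  then obtain r where "0 < r" "ennreal r < a" by (rule ennreal_ex_pos_real_less)
  with assms[of r] show "\<forall>\<^sub>F x in F. f x < a"
    by (auto elim!: eventually_mono)
qed simp

text \<open>Convexity: the graph of a^p lies above its tangent at c. The form with a free second
  variable serves both Jensen's inequality and the pointwise energy estimate.\<close>

lemma Young_tangent:
  fixes a c p :: real
  assumes p: "1 \<le> p" and a: "0 \<le> a" and c: "0 \<le> c"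
  shows "p * a * c powr (p - 1) \<le> a powr p + (p - 1) * c powr p"
proof (cases "p = 1")
  case True
  then show ?thesis using a by (cases "c = 0") auto
next
  case False
  then have p1: "p > 1" using p by simp
  define q where "q = p / (p - 1)"
  have q: "q > 1" "1 / p + 1 / q = 1" "(p - 1) * q = p"
    using p1 by (auto simp: q_def field_simps)
  have "a * c powr (p - 1) \<le> a powr p / p + (c powr (p - 1)) powr q / q"
    by (rule Youngs_inequality[OF p1 q(1,2) a]) simp
  also have "(c powr (p - 1)) powr q = c powr p"
    using q by (simp add: powr_powr)
  finally have "p * (a * c powr (p - 1)) \<le> p * (a powr p / p + c powr p / q)"
    using p1 by (intro mult_left_mono) auto
  also have "\<dots> = a powr p + (p - 1) * c powr p"
    using p1 by (simp add: q_def field_simps)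
  finally show ?thesis by (simp add: mult.assoc)
qed

lemma powr_add_le:
  fixes a b p :: real
  assumes "0 \<le> a" "0 \<le> b" "0 \<le> p"
  shows "(a + b) powr p \<le> 2 powr p * (a powr p + b powr p)"
proof -
  have "(a + b) powr p \<le> (2 * max a b) powr p"
    using assms by (intro powr_mono2) auto
  also have "\<dots> = 2 powr p * max a b powr p"
    using assms by (simp add: powr_mult)
  also have "max a b powr p \<le> a powr p + b powr p"
    by (simp add: max_def)
  finally show ?thesis by simp
qed

lemma norm_add_powr_le:
  fixes a b :: "'a::real_normed_vector"
  assumes "0 \<le> p"
  shows "norm (a + b) powr p \<le> 2 powr p * (norm a powr p + norm b powr p)"
  using powr_mono2[OF assms norm_ge_zero norm_triangle_ineq[of a b]] powr_add_le[OF norm_ge_zero norm_ge_zero assms, of a b]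
  by linarith

text \<open>The tangent inequality at c = |integral of k f| is integrated against the probability
  density \<open>k\<close>. If k |f|^p is not integrable, the right side is infinite; if k f is not
  integrable, its Bochner integral is 0 by default, and so is the left side.\<close>

lemma weighted_Jensen_powr:
  fixes f :: "'a \<Rightarrow> 'b::euclidean_space"
  assumes p: "1 \<le> p" and k: "\<And>x. 0 \<le> k x" "integrable M k" "integral\<^sup>L M k = 1"
    and [measurable]: "f \<in> borel_measurable M"
  shows "ennreal (norm (integral\<^sup>L M (\<lambda>x. k x *\<^sub>R f x)) powr p) \<le> (\<integral>\<^sup>+x. ennreal (k x * norm (f x) powr p) \<partial>M)"
proof -
  have [measurable]: "k \<in> borel_measurable M" using k by auto
  define c where "c = norm (integral\<^sup>L M (\<lambda>x. k x *\<^sub>R f x))"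
  show ?thesis
  proof (cases "integrable M (\<lambda>x. k x *\<^sub>R f x) \<and> integrable M (\<lambda>x. k x * norm (f x) powr p)")
    case True
    then have i: "integrable M (\<lambda>x. k x * norm (f x))" "integrable M (\<lambda>x. k x * norm (f x) powr p)"
      using integrable_norm[of M "\<lambda>x. k x *\<^sub>R f x"] k by auto
    have "c \<le> integral\<^sup>L M (\<lambda>x. k x * norm (f x))"
      using integral_norm_bound[of M "\<lambda>x. k x *\<^sub>R f x"] k by (simp add: c_def)
    then have "p * c powr (p - 1) * c \<le> p * c powr (p - 1) * integral\<^sup>L M (\<lambda>x. k x * norm (f x))"
      using p by (intro mult_left_mono) auto
    moreover have "c powr (p - 1) * c = c powr p"
      by (cases "c = 0") (auto simp: c_def powr_mult_base mult.commute)
    ultimately have "p * c powr p \<le> p * c powr (p - 1) * integral\<^sup>L M (\<lambda>x. k x * norm (f x))"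
      by (simp only: mult.assoc)
    then have "c powr p \<le> p * c powr (p - 1) * integral\<^sup>L M (\<lambda>x. k x * norm (f x)) - (p - 1) * c powr p"
      by (simp add: algebra_simps)
    also have "\<dots> = integral\<^sup>L M (\<lambda>x. p * c powr (p - 1) * (k x * norm (f x)) - (p - 1) * c powr p * k x)"
      using i k by simp
    also have "\<dots> \<le> integral\<^sup>L M (\<lambda>x. k x * norm (f x) powr p)"
    proof (rule integral_mono)
      show "integrable M (\<lambda>x. p * c powr (p - 1) * (k x * norm (f x)) - (p - 1) * c powr p * k x)"
        using i k by auto
      show "p * c powr (p - 1) * (k x * norm (f x)) - (p - 1) * c powr p * k x \<le> k x * norm (f x) powr p" for x
        using mult_left_mono[OF Young_tangent[OF p norm_ge_zero norm_ge_zero] k(1)[of x],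
            of "f x" "integral\<^sup>L M (\<lambda>x. k x *\<^sub>R f x)"]
        by (simp add: c_def algebra_simps)
    qed (use i in auto)
    finally show ?thesis
      using i k by (subst nn_integral_eq_integral) (auto simp: c_def intro!: ennreal_leI)
  next
    case False
    show ?thesis
    proof (cases "integrable M (\<lambda>x. k x *\<^sub>R f x)")
      case True
      with False have "\<not> integrable M (\<lambda>x. k x * norm (f x) powr p)" by simp
      then have "(\<integral>\<^sup>+x. ennreal (norm (k x * norm (f x) powr p)) \<partial>M) = \<infinity>"
        by (simp add: integrable_iff_bounded not_less top_unique)
      then show ?thesis using k by simp
    qed (simp add: not_integrable_integral_eq)
  qed
qed

section \<open>Convergence in L^p, measured by the modular\<close>

text \<open>The p-th power of the L^p norm, with values in \<open>ennreal\<close> so that Tonelli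
  applies without integrability conditions. Convergence of it to 0 is convergence in L^p; the
  triangle inequality is replaced by one with the factor 2^p.\<close>

definition modular :: "real \<Rightarrow> ('a::euclidean_space \<Rightarrow> 'b::euclidean_space) \<Rightarrow> ennreal" where
  "modular p f = (\<integral>\<^sup>+x. ennreal (norm (f x) powr p) \<partial>lborel)"

lemma modular_add_le:
  fixes f g :: "'a::euclidean_space \<Rightarrow> 'b::euclidean_space"
  assumes p: "0 \<le> p" and [measurable]: "f \<in> borel_measurable borel" "g \<in> borel_measurable borel"
  shows "modular p (\<lambda>x. f x + g x) \<le> ennreal (2 powr p) * (modular p f + modular p g)"
proof -
  have "modular p (\<lambda>x. f x + g x) \<le>
      (\<integral>\<^sup>+x. ennreal (2 powr p) * (ennreal (norm (f x) powr p) + ennreal (norm (g x) powr p)) \<partial>lborel)"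
    unfolding modular_def
    by (intro nn_integral_mono)
      (auto simp: norm_add_powr_le p simp flip: ennreal_plus ennreal_mult intro!: ennreal_leI)
  also have "\<dots> = ennreal (2 powr p) * (modular p f + modular p g)"
    unfolding modular_def by (subst nn_integral_cmult) (auto simp: nn_integral_add)
  finally show ?thesis .
qed

lemma modular_shift:
  assumes [measurable]: "f \<in> borel_measurable borel"
  shows "modular p (\<lambda>x. f (x - h)) = modular p f"
  unfolding modular_def
  using nn_integral_lborel_shift[of "\<lambda>x. ennreal (norm (f x) powr p)" "- h"] by simp

lemma modular_commute: "modular p (\<lambda>x. f x - g x) = modular p (\<lambda>x. g x - f x)"
  unfolding modular_def by (simp add: norm_minus_commute)

text \<open>On the compact set \<open>K\<close> one has |f| \<le> 1 + |f|^p, and \<open>f\<close>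
  vanishes elsewhere.\<close>

lemma modular_integrable:
  fixes f :: "'a::euclidean_space \<Rightarrow> 'b::euclidean_space"
  assumes p: "1 \<le> p" and [measurable]: "f \<in> borel_measurable borel" and fin: "modular p f < \<infinity>"
    and K: "compact K" and supp: "\<And>x. x \<notin> K \<Longrightarrow> f x = 0"
  shows "integrable lborel f"
proof (rule integrableI_bounded)
  have "(\<integral>\<^sup>+x. ennreal (norm (f x)) \<partial>lborel) \<le> (\<integral>\<^sup>+x. indicator K x + ennreal (norm (f x) powr p) \<partial>lborel)"
  proof (rule nn_integral_mono)
    fix x
    have "norm (f x) \<le> 1 + norm (f x) powr p"
    proof (cases "norm (f x) \<le> 1")
      case False
      then show ?thesis using powr_mono[OF p, of "norm (f x)"] by simp
    qed (simp add: add_increasing2)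
    then show "ennreal (norm (f x)) \<le> indicator K x + ennreal (norm (f x) powr p)"
      using supp[of x] by (cases "x \<in> K") (auto simp flip: ennreal_1 ennreal_plus intro!: ennreal_leI)
  qed
  also have "\<dots> = emeasure lborel K + modular p f"
    using borel_compact[OF K] unfolding modular_def by (subst nn_integral_add) auto
  also have "\<dots> < \<infinity>"
    using fin emeasure_lborel_cbox_finite emeasure_compact_finite[OF K] by (simp add: less_top)
  finally show "(\<integral>\<^sup>+x. ennreal (norm (f x)) \<partial>lborel) < \<infinity>" .
qed simp

lemma compact_thickening:
  fixes K :: "'a::euclidean_space set"
  assumes "compact K"
  obtains K' where "compact K'" "K \<subseteq> K'" "\<And>x y. y \<in> K \<Longrightarrow> dist x y \<le> 1 \<Longrightarrow> x \<in> K'"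
proof
  show "compact {x + y |x y. x \<in> K \<and> y \<in> cball 0 1}"
    by (rule compact_sums[OF assms compact_cball])
  show *: "x \<in> {x + y |x y. x \<in> K \<and> y \<in> cball 0 1}" if "y \<in> K" "dist x y \<le> 1" for x y
  proof -
    have "x = y + (x - y)" "x - y \<in> cball 0 1" using that by (auto simp: dist_norm norm_minus_commute)
    with that show ?thesis by blast
  qed
  show "K \<subseteq> {x + y |x y. x \<in> K \<and> y \<in> cball 0 1}"
    using * by fastforce
qed

lemma modular_tendsto_dominated:
  fixes f :: "nat \<Rightarrow> 'a::euclidean_space \<Rightarrow> 'b::euclidean_space"
  assumes p: "0 < p" and [measurable]: "\<And>n. f n \<in> borel_measurable borel" "g \<in> borel_measurable borel"
    "w \<in> borel_measurable borel"
    and bound: "\<And>n. AE x in lborel. norm (f n x - g x) powr p \<le> w x"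
    and w: "(\<integral>\<^sup>+x. ennreal (w x) \<partial>lborel) < \<infinity>"
    and lim: "AE x in lborel. (\<lambda>n. f n x) \<longlonglongrightarrow> g x"
  shows "(\<lambda>n. modular p (\<lambda>x. f n x - g x)) \<longlonglongrightarrow> 0"
proof -
  have "(\<lambda>n. \<integral>\<^sup>+x. ennreal (norm (f n x - g x) powr p) \<partial>lborel) \<longlonglongrightarrow> (\<integral>\<^sup>+x. 0 \<partial>(lborel :: 'a measure))"
  proof (rule nn_integral_dominated_convergence[where w="\<lambda>x. ennreal (w x)"])
    show "AE x in lborel. ennreal (norm (f n x - g x) powr p) \<le> ennreal (w x)" for n
      using bound[of n] by eventually_elim (rule ennreal_leI)
    show "AE x in lborel. (\<lambda>n. ennreal (norm (f n x - g x) powr p)) \<longlonglongrightarrow> 0"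
      using lim
    proof eventually_elim
      case (elim x)
      have "(\<lambda>n. norm (f n x - g x)) \<longlonglongrightarrow> 0"
        using elim by (simp add: LIM_zero_iff tendsto_norm_zero)
      then have "(\<lambda>n. norm (f n x - g x) powr p) \<longlonglongrightarrow> 0"
        using p by (intro tendsto_zero_powrI[of _ _ _ p]) auto
      then show ?case
        by (metis ennreal_0 tendsto_ennrealI)
    qed
  qed (use w in auto)
  then show ?thesis by (simp add: modular_def)
qed

text \<open>Density in L^p of continuous functions with compact support. The function is truncated
  in size first; the truncation is an almost everywhere limit of continuous functions, and these are
  clamped to a ball of values and cut off in space so that dominated convergence applies.\<close>

lemma approx_by_continuous:
  fixes f :: "'a::euclidean_space \<Rightarrow> 'b::euclidean_space"
  assumes p: "1 \<le> p" and f [measurable]: "f \<in> borel_measurable borel" and fin: "modular p f < \<infinity>"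
    and K: "compact K" and supp: "\<And>x. x \<notin> K \<Longrightarrow> f x = 0" and e: "(0::ennreal) < e"
  obtains g K' where "continuous_on UNIV g" "compact K'" "\<And>x. x \<notin> K' \<Longrightarrow> g x = 0"
    "modular p (\<lambda>x. g x - f x) < e"
proof -
  obtain e' :: ennreal where e': "0 < e'" "ennreal (2 powr p) * (e' + e') \<le> e"
  proof -
    obtain r where r: "r > 0" "ennreal r < e" using ennreal_ex_pos_real_less[OF e] by blast
    have "ennreal (2 powr p) * (ennreal (r / (2 * 2 powr p)) + ennreal (r / (2 * 2 powr p))) = ennreal r"
      using r by (simp flip: ennreal_plus ennreal_mult)
    with r that[of "ennreal (r / (2 * 2 powr p))"] show thesis by simp
  qed
  define b where "b n x = (if norm (f x) \<le> real n then f x else 0)" for n x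
  have [measurable]: "b n \<in> borel_measurable borel" for n
    unfolding b_def[abs_def] by measurable
  have "(\<lambda>n. modular p (\<lambda>x. b n x - f x)) \<longlonglongrightarrow> 0"
  proof (rule modular_tendsto_dominated[where w="\<lambda>x. norm (f x) powr p"])
    show "AE x in lborel. (\<lambda>n. b n x) \<longlonglongrightarrow> f x"
    proof (rule AE_I2)
      fix x
      obtain N where "norm (f x) \<le> real N" using real_arch_simple by blast
      then have "\<forall>\<^sub>F n in sequentially. b n x = f x"
        unfolding eventually_sequentially b_def by (intro exI[of _ N]) auto
      then show "(\<lambda>n. b n x) \<longlonglongrightarrow> f x" by (rule tendsto_eventually)
    qed
  qed (use p fin in \<open>auto simp: b_def modular_def\<close>)
  then have "\<forall>\<^sub>F n in sequentially. modular p (\<lambda>x. b n x - f x) < e'"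
    using e'(1) by (rule order_tendstoD(2))
  then have "\<exists>n. modular p (\<lambda>x. b n x - f x) < e'"
    by (rule eventually_happens'[OF sequentially_bot])
  then obtain n where n: "modular p (\<lambda>x. b n x - f x) < e'" ..
  define N where "N = real n + 1"
  have N: "N > 0" "\<And>x. norm (b n x) \<le> N" by (auto simp: N_def b_def)
  \<comment> \<open>The characterisation \<open>measurable_on\<close> supplies continuous functions
    that converge off a negligible set.\<close>
  have "b n \<in> borel_measurable lebesgue"
    using measurable_completion[of "b n" lborel borel] by simp
  then have "b n measurable_on UNIV"
    by (rule lebesgue_measurable_imp_measurable_on) simp
  then obtain Z g where Z: "negligible Z" and g: "\<And>m. continuous_on UNIV (g m)"
      "\<And>x. x \<notin> Z \<Longrightarrow> (\<lambda>m. g m x) \<longlonglongrightarrow> b n x"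
    unfolding measurable_on_def by auto
  have Z0: "AE x in lborel. x \<notin> Z"
    using Z AE_completion_iff[of "\<lambda>x. x \<notin> Z" lborel] by (simp add: negligible_iff_null_sets AE_not_in)
  \<comment> \<open>The point 0 is added because the distance to \<open>K1\<close> is attained only
    for a nonempty set.\<close>
  define K1 where "K1 = insert 0 K"
  have K1: "compact K1" "K1 \<noteq> {}" "K \<subseteq> K1" using K by (auto simp: K1_def)
  obtain K' where K': "compact K'" "K1 \<subseteq> K'" "\<And>x y. y \<in> K1 \<Longrightarrow> dist x y \<le> 1 \<Longrightarrow> x \<in> K'"
    using compact_thickening[OF K1(1)] by metis
  define \<eta> where "\<eta> x = max 0 (1 - infdist x K1)" for x
  have \<eta>: "continuous_on UNIV \<eta>" "\<And>x. 0 \<le> \<eta> x" "\<And>x. \<eta> x \<le> 1" "\<And>x. x \<in> K \<Longrightarrow> \<eta> x = 1"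
    using K1 by (auto simp: \<eta>_def infdist_nonneg intro!: continuous_intros)
  have \<eta>0: "\<eta> x = 0" if "x \<notin> K'" for x
  proof -
    obtain y where "y \<in> K1" "infdist x K1 = dist x y"
      using infdist_attains_inf[OF compact_imp_closed[OF K1(1)] K1(2)] by blast
    moreover from this have "dist x y > 1" using K'(3)[of y x] that by force
    ultimately show ?thesis by (simp add: \<eta>_def)
  qed
  \<comment> \<open>The radial retraction onto the closed ball of radius N. It fixes the values of
    \<open>b n\<close>, so the clamped functions still converge to \<open>b n\<close>.\<close>
  define cl :: "'b \<Rightarrow> 'b" where "cl y = (N / max N (norm y)) *\<^sub>R y" for y
  have ccl: "continuous_on UNIV cl"
    unfolding cl_def using N by (intro continuous_intros) (auto simp: max_def)
  have cl: "norm (cl y) \<le> N" for y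
    using N by (auto simp: cl_def max_def abs_mult field_simps)
  have cl_id: "cl y = y" if "norm y \<le> N" for y
    using N that by (simp add: cl_def max_def)
  define h where "h m x = \<eta> x *\<^sub>R cl (g m x)" for m x
  have ch: "continuous_on UNIV (h m)" for m
    unfolding h_def by (intro continuous_intros \<eta> continuous_on_compose2[OF ccl] g) auto
  have [measurable]: "h m \<in> borel_measurable borel" for m
    using ch by (rule borel_measurable_continuous_onI)
  have h0: "h m x = 0" if "x \<notin> K'" for m x
    using \<eta>0[OF that] by (simp add: h_def)
  have "(\<lambda>m. modular p (\<lambda>x. h m x - b n x)) \<longlonglongrightarrow> 0"
  proof (rule modular_tendsto_dominated[where w="\<lambda>x. (2 * N) powr p * indicator K' x"])
    show "AE x in lborel. norm (h m x - b n x) powr p \<le> (2 * N) powr p * indicator K' x" for m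
    proof (rule AE_I2)
      fix x
      show "norm (h m x - b n x) powr p \<le> (2 * N) powr p * indicator K' x"
      proof (cases "x \<in> K'")
        case True
        have "norm (h m x) \<le> N"
          using \<eta>(2,3)[of x] cl[of "g m x"] mult_mono[of "\<eta> x" 1 "norm (cl (g m x))" N] by (simp add: h_def)
        then have "norm (h m x - b n x) \<le> 2 * N"
          using norm_triangle_ineq4[of "h m x" "b n x"] N(2)[of x] by linarith
        then show ?thesis using True p by (auto intro!: powr_mono2)
      next
        case False
        then have "x \<notin> K" using K' K1 by auto
        then show ?thesis using False h0 supp by (simp add: b_def)
      qed
    qed
    show "(\<integral>\<^sup>+x. ennreal ((2 * N) powr p * indicator K' x) \<partial>lborel) < \<infinity>"
      using borel_compact[OF K'(1)] emeasure_compact_finite[OF K'(1)]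
      by (simp add: ennreal_mult' ennreal_indicator nn_integral_cmult_indicator ennreal_mult_less_top)
    show "AE x in lborel. (\<lambda>m. h m x) \<longlonglongrightarrow> b n x"
      using Z0
    proof eventually_elim
      case (elim x)
      have "(\<lambda>m. cl (g m x)) \<longlonglongrightarrow> cl (b n x)"
        by (rule continuous_on_tendsto_compose[OF ccl g(2)[OF elim]]) auto
      then have "(\<lambda>m. h m x) \<longlonglongrightarrow> \<eta> x *\<^sub>R cl (b n x)"
        unfolding h_def by (intro tendsto_intros)
      moreover have "\<eta> x *\<^sub>R cl (b n x) = b n x"
      proof (cases "x \<in> K")
        case True
        then show ?thesis by (simp add: \<eta>(4) cl_id[OF N(2)])
      next
        case False
        then have "b n x = 0" by (simp add: b_def supp)
        moreover have "cl 0 = 0" by (simp add: cl_def)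
        ultimately show ?thesis by simp
      qed
      ultimately show ?case by simp
    qed
    have [measurable]: "K' \<in> sets borel" using K'(1) by (rule borel_compact)
    show "(\<lambda>x. (2 * N) powr p * indicator K' x) \<in> borel_measurable borel" by measurable
    show "0 < p" using p by simp
    show "h m \<in> borel_measurable borel" "b n \<in> borel_measurable borel" for m by measurable
  qed
  then have "\<forall>\<^sub>F m in sequentially. modular p (\<lambda>x. h m x - b n x) < e'"
    using e'(1) by (rule order_tendstoD(2))
  then have "\<exists>m. modular p (\<lambda>x. h m x - b n x) < e'"
    by (rule eventually_happens'[OF sequentially_bot])
  then obtain m where m: "modular p (\<lambda>x. h m x - b n x) < e'" ..
  have "modular p (\<lambda>x. h m x - f x) = modular p (\<lambda>x. (h m x - b n x) + (b n x - f x))" by simp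
  also have "\<dots> \<le> ennreal (2 powr p) * (modular p (\<lambda>x. h m x - b n x) + modular p (\<lambda>x. b n x - f x))"
    using p by (intro modular_add_le) auto
  also have "\<dots> < ennreal (2 powr p) * (e' + e')"
    using m n by (intro ennreal_mult_strict_left_mono add_strict_mono) auto
  also have "\<dots> \<le> e" by (rule e')
  finally have *: "modular p (\<lambda>x. h m x - f x) < e" .
  show ?thesis by (rule that[OF ch K'(1) _ *]) (rule h0)
qed

lemma continuous_translation:
  fixes g :: "'a::euclidean_space \<Rightarrow> 'b::euclidean_space"
  assumes p: "0 < p" and g: "continuous_on UNIV g" and K: "compact K" and supp: "\<And>x. x \<notin> K \<Longrightarrow> g x = 0"
    and e: "0 < e"
  obtains d where "0 < d" "\<And>h. norm h < d \<Longrightarrow> modular p (\<lambda>x. g (x - h) - g x) \<le> ennreal e"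
proof -
  obtain K' where K': "compact K'" "K \<subseteq> K'" "\<And>x y. y \<in> K \<Longrightarrow> dist x y \<le> 1 \<Longrightarrow> x \<in> K'"
    using compact_thickening[OF K] by metis
  define \<mu> where "\<mu> = measure lborel K'"
  have \<mu>: "emeasure lborel K' = ennreal \<mu>" "\<mu> \<ge> 0"
    using emeasure_compact_finite[OF K'(1)] by (auto simp: \<mu>_def emeasure_eq_ennreal_measure less_top)
  define \<delta> where "\<delta> = (e / (\<mu> + 1)) powr (1 / p)"
  have \<delta>: "\<delta> > 0" "\<delta> powr p = e / (\<mu> + 1)"
    using e \<mu> p by (auto simp: \<delta>_def powr_powr)
  obtain d where d: "d > 0" "\<And>x h. norm h < d \<Longrightarrow> norm (g (x + h) - g x) < \<delta>"
    using compact_support_uniformly_continuous[OF g K supp \<delta>(1)] by metis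
  show ?thesis
  proof
    show "0 < min d 1" using d by simp
    fix h :: 'a assume h: "norm h < min d 1"
    have "modular p (\<lambda>x. g (x - h) - g x) \<le> (\<integral>\<^sup>+x. ennreal (\<delta> powr p) * indicator K' x \<partial>lborel)"
      unfolding modular_def
    proof (rule nn_integral_mono)
      fix x
      show "ennreal (norm (g (x - h) - g x) powr p) \<le> ennreal (\<delta> powr p) * indicator K' x"
      proof (cases "x \<in> K'")
        case True
        have "norm (g (x - h) - g x) \<le> \<delta>"
          using d(2)[of "- h" x] h by simp
        then show ?thesis using True p by (auto intro!: ennreal_leI powr_mono2)
      next
        case False
        then have "x \<notin> K" "x - h \<notin> K"
          using K'(2) K'(3)[of "x - h" x] h by (auto simp: dist_norm)
        then show ?thesis using supp by simp
      qed
    qed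
    also have "\<dots> = ennreal (\<delta> powr p * \<mu>)"
      using K'(1) \<mu> borel_compact[OF K'(1)]
      by (simp add: nn_integral_cmult_indicator ennreal_mult)
    also have "\<dots> \<le> ennreal e"
      using e \<mu>(2) unfolding \<delta>(2) by (intro ennreal_leI) (simp add: field_simps)
    finally show "modular p (\<lambda>x. g (x - h) - g x) \<le> ennreal e" .
  qed
qed

lemma modular_translation:
  fixes f :: "'a::euclidean_space \<Rightarrow> 'b::euclidean_space"
  assumes p: "1 \<le> p" and f [measurable]: "f \<in> borel_measurable borel" and fin: "modular p f < \<infinity>"
    and K: "compact K" and supp: "\<And>x. x \<notin> K \<Longrightarrow> f x = 0" and e: "0 < e"
  obtains d where "0 < d" "\<And>h. norm h < d \<Longrightarrow> modular p (\<lambda>x. f (x - h) - f x) \<le> ennreal e"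
proof -
  define A where "A = 2 powr p"
  have A: "A > 0" by (simp add: A_def)
  \<comment> \<open>\<open>f(x - h) - f(x)\<close> is split into three differences through the
    continuous function \<open>g\<close>. Two applications of the inequality with factor A = 2^p
    produce the constant A (1 + 2 A).\<close>
  define D where "D = A * (1 + A * 2)"
  have D: "D > 0" using A by (simp add: D_def add_pos_pos)
  define e' where "e' = e / D"
  have "A * (e' + A * (e' + e')) = D * e'" by (simp add: D_def algebra_simps)
  then have e': "e' > 0" "A * (e' + A * (e' + e')) = e"
    using e D by (auto simp: e'_def)
  obtain g K' where g: "continuous_on UNIV g" "compact K'" "\<And>x. x \<notin> K' \<Longrightarrow> g x = 0"
      "modular p (\<lambda>x. g x - f x) < ennreal e'"
    using approx_by_continuous[OF p f fin K supp, of "ennreal e'"] e' by auto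
  have [measurable]: "g \<in> borel_measurable borel"
    using g(1) by (rule borel_measurable_continuous_onI)
  obtain d where d: "0 < d" "\<And>h. norm h < d \<Longrightarrow> modular p (\<lambda>x. g (x - h) - g x) \<le> ennreal e'"
    using continuous_translation[OF _ g(1-3) e'(1), of p] p by auto
  show ?thesis
  proof
    show "0 < d" by (rule d)
    fix h :: 'a assume h: "norm h < d"
    have "modular p (\<lambda>x. f (x - h) - f x) =
        modular p (\<lambda>x. (f (x - h) - g (x - h)) + ((g (x - h) - g x) + (g x - f x)))" by simp
    also have "\<dots> \<le> ennreal A * (modular p (\<lambda>x. f (x - h) - g (x - h)) +
        modular p (\<lambda>x. (g (x - h) - g x) + (g x - f x)))"
      using p unfolding A_def by (intro modular_add_le) auto
    also have "\<dots> \<le> ennreal A * (modular p (\<lambda>x. f (x - h) - g (x - h)) +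
        ennreal A * (modular p (\<lambda>x. g (x - h) - g x) + modular p (\<lambda>x. g x - f x)))"
      using p unfolding A_def by (intro mult_left_mono add_left_mono modular_add_le) auto
    also have "\<dots> \<le> ennreal A * (ennreal e' + ennreal A * (ennreal e' + ennreal e'))"
    proof (intro mult_left_mono add_mono)
      have "modular p (\<lambda>x. f (x - h) - g (x - h)) = modular p (\<lambda>x. f x - g x)"
        using modular_shift[of "\<lambda>x. f x - g x" p h] by simp
      then show "modular p (\<lambda>x. f (x - h) - g (x - h)) \<le> ennreal e'"
        using g(4) modular_commute[of p f g] by simp
    qed (use d(2)[OF h] g(4) in auto)
    also have "\<dots> = ennreal e"
      using e' A by (simp flip: ennreal_plus ennreal_mult)
    finally show "modular p (\<lambda>x. f (x - h) - f x) \<le> ennreal e" .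
  qed
qed

definition mollifier :: "('a::euclidean_space \<Rightarrow> real) \<Rightarrow> real \<Rightarrow> bool" where
  "mollifier \<kappa> d \<longleftrightarrow> smooth \<kappa> \<and> (\<forall>x. 0 \<le> \<kappa> x) \<and> (\<forall>x. \<kappa> (- x) = \<kappa> x) \<and>
     (\<forall>x. d \<le> norm x \<longrightarrow> \<kappa> x = 0) \<and> integral\<^sup>L lborel \<kappa> = 1"

lemma mollifierD:
  assumes "mollifier \<kappa> d"
  shows "smooth \<kappa>" "\<And>x. 0 \<le> \<kappa> x" "\<And>x. \<kappa> (- x) = \<kappa> x" "\<And>x. d \<le> norm x \<Longrightarrow> \<kappa> x = 0"
    "\<And>x. x \<notin> cball 0 d \<Longrightarrow> \<kappa> x = 0"
    "integral\<^sup>L lborel \<kappa> = 1" "integrable lborel \<kappa>" "continuous_on UNIV \<kappa>" "\<kappa> \<in> borel_measurable borel"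
proof -
  show c: "continuous_on UNIV \<kappa>"
    using assms Ck_on_imp_continuous unfolding mollifier_def by blast
  show "\<kappa> \<in> borel_measurable borel"
    using c by (rule borel_measurable_continuous_onI)
  show "integrable lborel \<kappa>"
    using assms by (intro continuous_compact_support_integrable[OF c compact_cball[of 0 d]]) (auto simp: mollifier_def)
qed (use assms in \<open>auto simp: mollifier_def\<close>)

text \<open>A mollification is an average of translates with respect to the probability density
  \<kappa>. Jensen's inequality and Tonelli bound its distance to \<open>f\<close> by the largest
  distance of a translate by less than \<open>d\<close>.\<close>

lemma conv_modular_le:
  fixes f :: "'a::euclidean_space \<Rightarrow> 'b::euclidean_space"
  assumes p: "1 \<le> p" and \<kappa>: "mollifier \<kappa> d" and f [measurable]: "f \<in> borel_measurable borel"
    and int: "integrable lborel f"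
    and e: "\<And>h. norm h < d \<Longrightarrow> modular p (\<lambda>x. f (x - h) - f x) \<le> e"
  shows "modular p (\<lambda>x. conv \<kappa> f x - f x) \<le> e"
proof -
  note k = mollifierD[OF \<kappa>]
  note [measurable] = k(9)
  have "conv \<kappa> f x - f x = integral\<^sup>L lborel (\<lambda>\<xi>. \<kappa> \<xi> *\<^sub>R (f (x - \<xi>) - f x))" for x
  proof -
    have "integrable lborel (\<lambda>\<xi>. \<kappa> (x - \<xi>) *\<^sub>R f \<xi>)"
      by (rule conv_integrable[OF k(8) compact_cball k(5) int])
    then have "integrable (distr lborel borel (\<lambda>\<xi>. x - \<xi>)) (\<lambda>\<xi>. \<kappa> (x - \<xi>) *\<^sub>R f \<xi>)"
      by (simp add: distr_lborel_minus)
    then have "integrable lborel (\<lambda>\<xi>. \<kappa> \<xi> *\<^sub>R f (x - \<xi>))"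
      by (subst (asm) integrable_distr_eq) auto
    then show ?thesis
      using k(6,7) by (simp add: conv_alt scaleR_diff_right integral_scaleR_left)
  qed
  then have "modular p (\<lambda>x. conv \<kappa> f x - f x) \<le>
      (\<integral>\<^sup>+x. (\<integral>\<^sup>+\<xi>. ennreal (\<kappa> \<xi> * norm (f (x - \<xi>) - f x) powr p) \<partial>lborel) \<partial>lborel)"
    unfolding modular_def
    by (auto intro!: nn_integral_mono weighted_Jensen_powr[OF p k(2,7,6)])
  also have "\<dots> = (\<integral>\<^sup>+\<xi>. (\<integral>\<^sup>+x. ennreal (\<kappa> \<xi> * norm (f (x - \<xi>) - f x) powr p) \<partial>lborel) \<partial>lborel)"
    by (rule lborel_pair.Fubini'[symmetric]) measurable
  also have "\<dots> = (\<integral>\<^sup>+\<xi>. ennreal (\<kappa> \<xi>) * modular p (\<lambda>x. f (x - \<xi>) - f x) \<partial>lborel)"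
    unfolding modular_def using k(2) by (simp add: ennreal_mult' nn_integral_cmult)
  also have "\<dots> \<le> (\<integral>\<^sup>+\<xi>. ennreal (\<kappa> \<xi>) * e \<partial>lborel)"
  proof (rule nn_integral_mono)
    fix \<xi>
    show "ennreal (\<kappa> \<xi>) * modular p (\<lambda>x. f (x - \<xi>) - f x) \<le> ennreal (\<kappa> \<xi>) * e"
      using e[of \<xi>] k(4)[of \<xi>] by (cases "norm \<xi> < d") (auto intro!: mult_left_mono)
  qed
  also have "\<dots> = e"
    using k(2,6,7) by (simp add: nn_integral_multc nn_integral_eq_integral)
  finally show ?thesis .
qed

lemma conv_modular_tendsto:
  fixes f :: "'a::euclidean_space \<Rightarrow> 'b::euclidean_space"
  assumes p: "1 \<le> p" and f [measurable]: "f \<in> borel_measurable borel" and fin: "modular p f < \<infinity>"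
    and K: "compact K" and supp: "\<And>x. x \<notin> K \<Longrightarrow> f x = 0"
    and \<kappa>: "\<And>n. mollifier (\<kappa> n) (d n)" and d: "d \<longlonglongrightarrow> 0"
  shows "(\<lambda>n. modular p (\<lambda>x. conv (\<kappa> n) f x - f x)) \<longlonglongrightarrow> 0"
proof -
  note int = modular_integrable[OF p f fin K supp]
  have "\<forall>\<^sub>F n in sequentially. modular p (\<lambda>x. conv (\<kappa> n) f x - f x) \<le> ennreal e" if "0 < e" for e
  proof -
    obtain \<delta> where \<delta>: "0 < \<delta>" "\<And>h. norm h < \<delta> \<Longrightarrow> modular p (\<lambda>x. f (x - h) - f x) \<le> ennreal e"
      using modular_translation[OF p f fin K supp \<open>0 < e\<close>] by metis
    have "\<forall>\<^sub>F n in sequentially. d n < \<delta>"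
      using d \<delta>(1) by (rule order_tendstoD(2))
    then show ?thesis
    proof eventually_elim
      case (elim n)
      show ?case
        by (rule conv_modular_le[OF p \<kappa> f int]) (use \<delta>(2) elim in auto)
    qed
  qed
  then show ?thesis
    by (rule ennreal_tendsto_zeroI)
qed

text \<open>A Lebesgue measurable function is an almost everywhere limit of continuous ones, and the
  \<open>lim\<close> of these is Borel everywhere. The solution concept speaks of Lebesgue
  measurability, while Fubini and convolution are carried out for products of
  \<open>lborel\<close>.\<close>

lemma lebesgue_measurable_borel_version:
  fixes f :: "'a::euclidean_space \<Rightarrow> 'b::euclidean_space"
  assumes "f \<in> borel_measurable lebesgue"
  obtains g where "g \<in> borel_measurable borel" "AE x in lborel. g x = f x"
proof -
  have "f measurable_on UNIV"
    by (rule lebesgue_measurable_imp_measurable_on[OF assms]) simp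
  then obtain Z g where Z: "negligible Z" and g: "\<And>m. continuous_on UNIV (g m)"
      "\<And>x. x \<notin> Z \<Longrightarrow> (\<lambda>m. g m x) \<longlonglongrightarrow> f x"
    unfolding measurable_on_def by auto
  have [measurable]: "g m \<in> borel_measurable borel" for m
    using g(1) by (rule borel_measurable_continuous_onI)
  have "AE x in lborel. x \<notin> Z"
    using Z AE_completion_iff[of "\<lambda>x. x \<notin> Z" lborel] by (simp add: negligible_iff_null_sets AE_not_in)
  then have "AE x in lborel. lim (\<lambda>m. g m x) = f x"
    by eventually_elim (use g(2) in \<open>simp add: limI\<close>)
  moreover have "(\<lambda>x. lim (\<lambda>m. g m x)) \<in> borel_measurable borel"
    by measurable
  ultimately show ?thesis using that by blast
qed

section \<open>Hoelder's inequality and horizontal gradients\<close>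

text \<open>After division by the two integrals A and B, the weighted inequality between geometric
  and arithmetic means is integrated. If A or B is 0, one of the functions vanishes almost
  everywhere. The shape with exponents \<alpha> and 1 - \<alpha> fits the later use with \<alpha> =
  p/Q.\<close>

lemma Holder_powr:
  fixes f g :: "'a \<Rightarrow> real"
  assumes \<alpha>: "0 < \<alpha>" "\<alpha> < 1" and f: "integrable M f" "\<And>x. 0 \<le> f x" and g: "integrable M g" "\<And>x. 0 \<le> g x"
  shows "integrable M (\<lambda>x. f x powr \<alpha> * g x powr (1 - \<alpha>))"
    and "integral\<^sup>L M (\<lambda>x. f x powr \<alpha> * g x powr (1 - \<alpha>)) \<le> integral\<^sup>L M f powr \<alpha> * integral\<^sup>L M g powr (1 - \<alpha>)"
proof -
  have [measurable]: "f \<in> borel_measurable M" "g \<in> borel_measurable M" using f g by auto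
  have AG: "a powr \<alpha> * b powr (1 - \<alpha>) \<le> \<alpha> * a + (1 - \<alpha>) * b" if "0 \<le> a" "0 \<le> b" for a b :: real
  proof (cases "a = 0 \<or> b = 0")
    case False
    then show ?thesis using that \<alpha> by (intro Youngs_inequality_0) auto
  qed (use that \<alpha> in auto)
  show int: "integrable M (\<lambda>x. f x powr \<alpha> * g x powr (1 - \<alpha>))"
  proof (rule Bochner_Integration.integrable_bound)
    show "integrable M (\<lambda>x. \<alpha> * f x + (1 - \<alpha>) * g x)" using f g by auto
    show "AE x in M. norm (f x powr \<alpha> * g x powr (1 - \<alpha>)) \<le> norm (\<alpha> * f x + (1 - \<alpha>) * g x)"
      using AG[OF f(2) g(2)] by (intro AE_I2) (metis abs_ge_self abs_of_nonneg mult_nonneg_nonneg order_trans powr_ge_zero real_norm_def)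
  qed simp
  define A where "A = integral\<^sup>L M f"
  define B where "B = integral\<^sup>L M g"
  have AB: "A \<ge> 0" "B \<ge> 0" using f g by (auto simp: A_def B_def)
  show "integral\<^sup>L M (\<lambda>x. f x powr \<alpha> * g x powr (1 - \<alpha>)) \<le> integral\<^sup>L M f powr \<alpha> * integral\<^sup>L M g powr (1 - \<alpha>)"
  proof (cases "A = 0 \<or> B = 0")
    case True
    then have "(AE x in M. f x = 0) \<or> (AE x in M. g x = 0)"
      using integral_nonneg_eq_0_iff_AE[OF f(1)] integral_nonneg_eq_0_iff_AE[OF g(1)] f g by (auto simp: A_def B_def)
    then have "AE x in M. f x powr \<alpha> * g x powr (1 - \<alpha>) = 0"
      by (elim disjE) (auto elim!: eventually_mono)
    then have "integral\<^sup>L M (\<lambda>x. f x powr \<alpha> * g x powr (1 - \<alpha>)) = 0"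
      by (rule integral_eq_zero_AE)
    then show ?thesis by simp
  next
    case False
    then have pos: "A > 0" "B > 0" using AB by auto
    have "integral\<^sup>L M (\<lambda>x. f x powr \<alpha> * g x powr (1 - \<alpha>)) \<le>
        integral\<^sup>L M (\<lambda>x. A powr \<alpha> * B powr (1 - \<alpha>) * (\<alpha> / A * f x + (1 - \<alpha>) / B * g x))"
    proof (rule integral_mono[OF int])
      show "integrable M (\<lambda>x. A powr \<alpha> * B powr (1 - \<alpha>) * (\<alpha> / A * f x + (1 - \<alpha>) / B * g x))"
        using f g by auto
      fix x
      have "f x powr \<alpha> * g x powr (1 - \<alpha>) = A powr \<alpha> * B powr (1 - \<alpha>) * ((f x / A) powr \<alpha> * (g x / B) powr (1 - \<alpha>))"
        using pos f(2)[of x] g(2)[of x] by (simp add: powr_divide)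
      also have "\<dots> \<le> A powr \<alpha> * B powr (1 - \<alpha>) * (\<alpha> * (f x / A) + (1 - \<alpha>) * (g x / B))"
        using pos f(2)[of x] g(2)[of x] by (intro mult_left_mono AG) auto
      finally show "f x powr \<alpha> * g x powr (1 - \<alpha>) \<le> A powr \<alpha> * B powr (1 - \<alpha>) * (\<alpha> / A * f x + (1 - \<alpha>) / B * g x)"
        by simp
    qed
    also have "\<dots> = A powr \<alpha> * B powr (1 - \<alpha>) * (\<alpha> / A * A + (1 - \<alpha>) / B * B)"
      using f g by (simp add: A_def B_def)
    also have "\<dots> = A powr \<alpha> * B powr (1 - \<alpha>)" using pos by simp
    finally show ?thesis by (simp add: A_def B_def)
  qed
qed

lemma modular_eq_integral:
  fixes f :: "'a::euclidean_space \<Rightarrow> 'b::euclidean_space"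
  assumes [measurable]: "f \<in> borel_measurable borel" and fin: "modular p f < \<infinity>"
  shows "integrable lborel (\<lambda>x. norm (f x) powr p)"
    and "enn2real (modular p f) = integral\<^sup>L lborel (\<lambda>x. norm (f x) powr p)"
proof -
  show i: "integrable lborel (\<lambda>x. norm (f x) powr p)"
    using fin by (intro integrableI_bounded) (auto simp: modular_def)
  show "enn2real (modular p f) = integral\<^sup>L lborel (\<lambda>x. norm (f x) powr p)"
    unfolding modular_def by (subst nn_integral_eq_integral[OF i]) auto
qed

lemma Holder_modular:
  fixes f g :: "'a::euclidean_space \<Rightarrow> 'b::euclidean_space"
  assumes p: "1 < p" and q: "q = p / (p - 1)"
    and f [measurable]: "f \<in> borel_measurable borel" "modular q f < \<infinity>"
    and g [measurable]: "g \<in> borel_measurable borel" "modular p g < \<infinity>"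
  shows "integrable lborel (\<lambda>x. f x \<bullet> g x)"
    and "\<bar>integral\<^sup>L lborel (\<lambda>x. f x \<bullet> g x)\<bar> \<le> enn2real (modular q f) powr (1 / q) * enn2real (modular p g) powr (1 / p)"
proof -
  have q1: "q > 1" "1 - 1 / q = 1 / p" using p by (auto simp: q field_simps)
  have eq: "(norm (f x) powr q) powr (1 / q) * (norm (g x) powr p) powr (1 - 1 / q) = norm (f x) * norm (g x)" for x
    using p q1 by (simp add: powr_powr)
  note H = Holder_powr[of "1 / q" lborel "\<lambda>x. norm (f x) powr q" "\<lambda>x. norm (g x) powr p",
    OF _ _ modular_eq_integral(1)[OF f] _ modular_eq_integral(1)[OF g], unfolded eq]
  have i: "integrable lborel (\<lambda>x. norm (f x) * norm (g x))"
    using H(1) q1 by auto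
  show i': "integrable lborel (\<lambda>x. f x \<bullet> g x)"
    by (rule Bochner_Integration.integrable_bound[OF i]) (auto simp: Cauchy_Schwarz_ineq2)
  have "\<bar>integral\<^sup>L lborel (\<lambda>x. f x \<bullet> g x)\<bar> \<le> integral\<^sup>L lborel (\<lambda>x. norm (f x) * norm (g x))"
    using i i' Cauchy_Schwarz_ineq2 by (intro integral_abs_bound_integral) auto
  also have "\<dots> \<le> enn2real (modular q f) powr (1 / q) * enn2real (modular p g) powr (1 / p)"
    using H(2) q1 modular_eq_integral(2)[OF f] modular_eq_integral(2)[OF g] by simp
  finally show "\<bar>integral\<^sup>L lborel (\<lambda>x. f x \<bullet> g x)\<bar> \<le> enn2real (modular q f) powr (1 / q) * enn2real (modular p g) powr (1 / p)" .
qed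

lemma modular_finite_add:
  fixes f g :: "'a::euclidean_space \<Rightarrow> 'b::euclidean_space"
  assumes "0 \<le> p" and "f \<in> borel_measurable borel" "g \<in> borel_measurable borel"
    and "modular p f < \<infinity>" "modular p g < \<infinity>"
  shows "modular p (\<lambda>x. f x + g x) < \<infinity>"
  using modular_add_le[OF assms(1-3)] assms(4,5)
  by (auto simp: ennreal_mult_less_top intro: le_less_trans)

lemma tendsto_0_powr_const:
  fixes f :: "'a \<Rightarrow> real"
  assumes "(f \<longlongrightarrow> 0) F" "\<And>x. 0 \<le> f x" "0 < a"
  shows "((\<lambda>x. f x powr a) \<longlongrightarrow> 0) F"
  using tendsto_zero_powrI[OF assms(1) tendsto_const _ assms(3)] assms(2) by simp

text \<open>Bilinearity writes the error as three pairings, each containing a factor that tends to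
  0. The modulars of the differences are finite only from some index on, since finiteness comes from
  their convergence to 0.\<close>

lemma modular_pairing_tendsto:
  fixes a b :: "'a::euclidean_space \<Rightarrow> 'b::euclidean_space"
  assumes p: "1 < p" and q: "q = p / (p - 1)"
    and [measurable]: "\<And>n. A n \<in> borel_measurable borel" "\<And>n. B n \<in> borel_measurable borel"
      "a \<in> borel_measurable borel" "b \<in> borel_measurable borel"
    and fin: "modular q a < \<infinity>" "modular p b < \<infinity>"
    and lim: "(\<lambda>n. modular q (\<lambda>x. A n x - a x)) \<longlonglongrightarrow> 0" "(\<lambda>n. modular p (\<lambda>x. B n x - b x)) \<longlonglongrightarrow> 0"
  shows "(\<lambda>n. integral\<^sup>L lborel (\<lambda>x. A n x \<bullet> B n x)) \<longlonglongrightarrow> integral\<^sup>L lborel (\<lambda>x. a x \<bullet> b x)"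
proof -
  have q1: "q > 1" using p by (auto simp: q field_simps)
  define x where "x n = enn2real (modular q (\<lambda>x. A n x - a x)) powr (1 / q)" for n
  define y where "y n = enn2real (modular p (\<lambda>x. B n x - b x)) powr (1 / p)" for n
  define X where "X = enn2real (modular q a) powr (1 / q)"
  define Y where "Y = enn2real (modular p b) powr (1 / p)"
  have "(\<lambda>n. enn2real (modular q (\<lambda>x. A n x - a x))) \<longlonglongrightarrow> 0" "(\<lambda>n. enn2real (modular p (\<lambda>x. B n x - b x))) \<longlonglongrightarrow> 0"
    using tendsto_enn2real[OF lim(1)[folded ennreal_0]] tendsto_enn2real[OF lim(2)[folded ennreal_0]] by simp_all
  then have "x \<longlonglongrightarrow> 0" "y \<longlonglongrightarrow> 0"
    unfolding x_def[abs_def] y_def[abs_def] using p q1 by (auto intro!: tendsto_0_powr_const)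
  then have "(\<lambda>n. x n * y n + x n * Y + X * y n) \<longlonglongrightarrow> 0 * 0 + 0 * Y + X * 0"
    by (intro tendsto_intros)
  then have lim0: "(\<lambda>n. x n * y n + x n * Y + X * y n) \<longlonglongrightarrow> 0" by simp
  have "\<forall>\<^sub>F n in sequentially. modular q (\<lambda>x. A n x - a x) < \<infinity>" "\<forall>\<^sub>F n in sequentially. modular p (\<lambda>x. B n x - b x) < \<infinity>"
    using order_tendstoD(2)[OF lim(1), of \<infinity>] order_tendstoD(2)[OF lim(2), of \<infinity>] by auto
  then have "\<forall>\<^sub>F n in sequentially. norm (integral\<^sup>L lborel (\<lambda>x. A n x \<bullet> B n x) - integral\<^sup>L lborel (\<lambda>x. a x \<bullet> b x))
      \<le> x n * y n + x n * Y + X * y n"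
  proof eventually_elim
    case (elim n)
    note H1 = Holder_modular[OF p q _ elim(1) _ elim(2)]
    note H2 = Holder_modular[OF p q _ elim(1) _ fin(2)]
    note H3 = Holder_modular[OF p q _ fin(1) _ elim(2)]
    note H4 = Holder_modular[OF p q _ fin(1) _ fin(2)]
    have "integral\<^sup>L lborel (\<lambda>x. A n x \<bullet> B n x) = integral\<^sup>L lborel (\<lambda>x.
        (A n x - a x) \<bullet> (B n x - b x) + (A n x - a x) \<bullet> b x + a x \<bullet> (B n x - b x) + a x \<bullet> b x)"
      by (simp add: inner_diff_left inner_diff_right)
    also have "\<dots> = integral\<^sup>L lborel (\<lambda>x. (A n x - a x) \<bullet> (B n x - b x)) + integral\<^sup>L lborel (\<lambda>x. (A n x - a x) \<bullet> b x)
        + integral\<^sup>L lborel (\<lambda>x. a x \<bullet> (B n x - b x)) + integral\<^sup>L lborel (\<lambda>x. a x \<bullet> b x)"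
      using H1(1) H2(1) H3(1) H4(1) by simp
    finally show ?case
      using H1(2) H2(2) H3(2) unfolding x_def y_def X_def Y_def by simp
  qed
  then have "(\<lambda>n. integral\<^sup>L lborel (\<lambda>x. A n x \<bullet> B n x) - integral\<^sup>L lborel (\<lambda>x. a x \<bullet> b x)) \<longlonglongrightarrow> 0"
    by (rule Lim_null_comparison[OF _ lim0])
  then show ?thesis by (rule LIM_zero_cancel)
qed

lemma lborel_integral_product:
  fixes f :: "'a::euclidean_space \<Rightarrow> real" and g :: "'b::euclidean_space \<Rightarrow> real"
  assumes f: "integrable lborel f" and g: "integrable lborel g"
  shows "integrable lborel (\<lambda>z. f (fst z) * g (snd z))"
    and "integral\<^sup>L lborel (\<lambda>z. f (fst z) * g (snd z)) = integral\<^sup>L lborel f * integral\<^sup>L lborel g"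
proof -
  have [measurable]: "f \<in> borel_measurable borel" "g \<in> borel_measurable borel" using f g by auto
  have int: "integrable (lborel \<Otimes>\<^sub>M lborel) (\<lambda>z. f (fst z) * g (snd z))"
  proof (rule integrableI_bounded)
    have "(\<integral>\<^sup>+z. ennreal (norm (f (fst z) * g (snd z))) \<partial>(lborel \<Otimes>\<^sub>M lborel)) =
        (\<integral>\<^sup>+x. (\<integral>\<^sup>+y. ennreal (norm (f x)) * ennreal (norm (g y)) \<partial>lborel) \<partial>lborel)"
      by (subst lborel.nn_integral_fst[symmetric]) (auto simp: abs_mult ennreal_mult)
    also have "\<dots> = (\<integral>\<^sup>+x. ennreal (norm (f x)) \<partial>lborel) * (\<integral>\<^sup>+y. ennreal (norm (g y)) \<partial>lborel)"
      by (simp add: nn_integral_cmult nn_integral_multc)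
    also have "\<dots> < \<infinity>"
      using f g by (simp add: integrable_iff_bounded ennreal_mult_less_top)
    finally show "(\<integral>\<^sup>+z. ennreal (norm (f (fst z) * g (snd z))) \<partial>(lborel \<Otimes>\<^sub>M lborel)) < \<infinity>" .
  qed measurable
  then show "integrable lborel (\<lambda>z. f (fst z) * g (snd z))" by (simp add: lborel_prod)
  have "integral\<^sup>L (lborel \<Otimes>\<^sub>M lborel) (\<lambda>z. f (fst z) * g (snd z)) = (\<integral>x. (\<integral>y. f x * g y \<partial>lborel) \<partial>lborel)"
    using lborel_pair.integral_fst'[OF int] by simp
  also have "\<dots> = integral\<^sup>L lborel f * integral\<^sup>L lborel g"
    by simp
  finally show "integral\<^sup>L lborel (\<lambda>z. f (fst z) * g (snd z)) = integral\<^sup>L lborel f * integral\<^sup>L lborel g"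
    by (simp add: lborel_prod)
qed

section \<open>The degenerate weight and the horizontal gradient\<close>

lemma continuous_grushin_weight:
  assumes "0 \<le> \<gamma>"
  shows "continuous_on S (grushin_weight \<gamma>)"
proof (cases "\<gamma> = 0")
  case False
  then have "continuous_on S (\<lambda>z. norm (fst z) powr \<gamma>)"
    using assms by (intro continuous_on_powr' continuous_intros) auto
  with False show ?thesis by (simp add: grushin_weight_def[abs_def])
qed (simp add: grushin_weight_def[abs_def])

text \<open>\<open>ggrad \<gamma> \<zeta> L\<close> is the horizontal gradient at the space-time point \<open>\<zeta>\<close> of a function with Frechet
  derivative \<open>L\<close> at \<open>\<zeta>\<close>.\<close>

definition ggrad :: "real \<Rightarrow> ('m::finite, 'k::finite) point \<times> real \<Rightarrow> (('m, 'k) point \<times> real \<Rightarrow> real) \<Rightarrow> ('m, 'k) point" where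
  "ggrad \<gamma> \<zeta> L = ((\<chi> i. L ((axis i 1, 0), 0)), (\<chi> j. grushin_weight \<gamma> (fst \<zeta>) * L ((0, axis j 1), 0)))"

lemma ggrad_add: "ggrad \<gamma> \<zeta> (\<lambda>e. L e + L' e) = ggrad \<gamma> \<zeta> L + ggrad \<gamma> \<zeta> L'"
  by (simp add: ggrad_def vec_eq_iff distrib_left)

lemma ggrad_cmult: "ggrad \<gamma> \<zeta> (\<lambda>e. c * L e) = c *\<^sub>R ggrad \<gamma> \<zeta> L"
  by (simp add: ggrad_def vec_eq_iff)

lemma ggrad_minus: "ggrad \<gamma> \<zeta> (\<lambda>e. - L e) = - ggrad \<gamma> \<zeta> L"
  by (simp add: ggrad_def vec_eq_iff)

lemma ggrad_zero [simp]: "ggrad \<gamma> \<zeta> (\<lambda>e. 0) = 0"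
  by (simp add: ggrad_def zero_prod_def vec_eq_iff)

lemma continuous_on_ggrad:
  assumes "0 \<le> \<gamma>" and "continuous_on S a" and "\<And>e. continuous_on S (\<lambda>\<zeta>. L \<zeta> e)"
  shows "continuous_on S (\<lambda>\<zeta>. ggrad \<gamma> (a \<zeta>) (L \<zeta>))"
proof -
  have "continuous_on S (\<lambda>\<zeta>. grushin_weight \<gamma> (fst (a \<zeta>)))"
    by (rule continuous_on_compose2[OF continuous_grushin_weight[OF assms(1), of UNIV] continuous_on_fst[OF assms(2)]]) simp
  then show ?thesis
    unfolding ggrad_def
    by (intro continuous_on_Pair continuous_on_vec_lambda continuous_on_mult assms(3))
qed

lemma grushin_grad_slice:
  assumes "(\<psi> has_derivative L) (at (z, t))"
  shows "grushin_grad \<gamma> (\<lambda>z'. \<psi> (z', t)) z = ggrad \<gamma> (z, t) L"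
proof -
  have "((\<lambda>z'. (z', t)) has_derivative (\<lambda>h. (h, 0))) (at z)"
    by (auto intro!: derivative_eq_intros)
  from has_derivative_compose[OF this assms]
  have "frechet_derivative (\<lambda>z'. \<psi> (z', t)) (at z) = (\<lambda>h. L (h, 0))"
    by (rule frechet_derivative_at[symmetric])
  then show ?thesis
    by (simp add: grushin_grad_def grushin_X_def grushin_Y_def ggrad_def)
qed

lemma deriv_slice:
  fixes \<psi> :: "'a::euclidean_space \<times> real \<Rightarrow> real"
  assumes "(\<psi> has_derivative L) (at (z, t))"
  shows "deriv (\<lambda>s. \<psi> (z, s)) t = L (0, 1)"
proof -
  have "((\<lambda>s. (z, s)) has_derivative (\<lambda>h. (0, h))) (at t)"
    by (auto intro!: derivative_eq_intros)
  from has_derivative_compose[OF this assms]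
  have D: "((\<lambda>s. \<psi> (z, s)) has_derivative (\<lambda>h. L (0, h))) (at t)" .
  have "(\<lambda>h. L (0, h)) = (*) (L (0, 1))"
  proof
    show "L (0, h) = L (0, 1) * h" for h
      using linear_scale[OF has_derivative_linear[OF assms], of h "(0, 1)"] by simp
  qed
  with D show ?thesis
    by (intro DERIV_imp_deriv) (simp only: has_field_derivative_def)
qed

text \<open>The fields \<open>Y\<^sub>j\<close> do not commute with mollification when \<open>\<gamma> > 0\<close>. The commutator is made small by
  mollifying in \<open>x\<close> on a scale much smaller than in \<open>(y, t)\<close>, because only \<open>y\<close>-derivatives of the kernel
  enter it; this works for all \<open>\<gamma>\<close>, although \<open>|x|\<^sup>\<gamma>\<close> is not Lipschitz for \<open>\<gamma> < 1\<close>.\<close>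

lemma ex_grushin_mollifier:
  fixes \<gamma> d R :: real
  assumes \<gamma>: "0 \<le> \<gamma>" and d: "0 < d"
  obtains \<kappa> :: "('m::finite, 'k::finite) point \<times> real \<Rightarrow> real" where "mollifier \<kappa> d"
    "\<And>\<zeta> j. norm \<zeta> \<le> R \<Longrightarrow> integral\<^sup>L lborel (\<lambda>\<xi>. \<bar>grushin_weight \<gamma> (fst \<zeta>) - grushin_weight \<gamma> (fst (\<zeta> - \<xi>))\<bar> *
        \<bar>frechet_derivative \<kappa> (at \<xi>) ((0, axis j 1), 0)\<bar>) \<le> d"
proof -
  have d3: "d / 3 > 0" using d by simp
  obtain \<beta>2 :: "real ^ 'k \<Rightarrow> real" where \<beta>2: "smooth \<beta>2" "\<And>x. 0 \<le> \<beta>2 x" "\<And>x. \<beta>2 (- x) = \<beta>2 x"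
    "\<And>x. norm x \<ge> d / 3 \<Longrightarrow> \<beta>2 x = 0" "integrable lborel \<beta>2" "integral\<^sup>L lborel \<beta>2 = 1"
    using ex_mollifier[OF d3] by metis
  obtain \<beta>3 :: "real \<Rightarrow> real" where \<beta>3: "smooth \<beta>3" "\<And>x. 0 \<le> \<beta>3 x" "\<And>x. \<beta>3 (- x) = \<beta>3 x"
    "\<And>x. norm x \<ge> d / 3 \<Longrightarrow> \<beta>3 x = 0" "integrable lborel \<beta>3" "integral\<^sup>L lborel \<beta>3 = 1"
    using ex_mollifier[OF d3] by metis
  define D where "D j y = \<bar>frechet_derivative \<beta>2 (at y) (axis j 1)\<bar>" for j :: 'k and y
  have D0: "D j y = 0" if "y \<notin> cball 0 (d / 3)" for j y
    using derivative_zero_outside[OF smooth_has_derivative[OF \<beta>2(1)] closed_cball _ that] \<beta>2(4) by (simp add: D_def)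
  have cD: "continuous_on UNIV (D j)" for j
    unfolding D_def by (intro continuous_intros smooth_continuous_derivative \<beta>2)
  have D: "integrable lborel (D j)" for j
    by (rule continuous_compact_support_integrable[OF cD compact_cball D0])
  \<comment> \<open>\<open>M\<close> bounds the L^1 norms of all first y-derivatives of the
    y-factor. It is fixed first, and the scale in x may then depend on it.\<close>
  define M where "M = (\<Sum>j\<in>UNIV. integral\<^sup>L lborel (D j))"
  have M: "M \<ge> 0" "integral\<^sup>L lborel (D j) \<le> M" for j
    unfolding M_def by (auto intro!: sum_nonneg member_le_sum simp: D_def)
  define \<omega> :: "real ^ 'm \<Rightarrow> real" where "\<omega> x = grushin_weight \<gamma> (x, 0 :: real ^ 'k)" for x
  have \<omega>: "grushin_weight \<gamma> z = \<omega> (fst z)" for z :: "('m, 'k) point"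
    by (simp add: \<omega>_def grushin_weight_def)
  have c\<omega>: "continuous_on S \<omega>" for S
    unfolding \<omega>_def by (intro continuous_on_compose2[OF continuous_grushin_weight[OF \<gamma>, of UNIV]] continuous_intros) auto
  have "uniformly_continuous_on (cball 0 (R + d)) \<omega>"
    by (intro compact_uniformly_continuous c\<omega> compact_cball)
  moreover have "d / (M + 1) > 0" using d M by simp
  ultimately obtain \<delta> where \<delta>: "\<delta> > 0" "\<And>x x'. x \<in> cball 0 (R + d) \<Longrightarrow> x' \<in> cball 0 (R + d) \<Longrightarrow>
      dist x' x < \<delta> \<Longrightarrow> dist (\<omega> x') (\<omega> x) < d / (M + 1)"
    unfolding uniformly_continuous_on_def by metis
  \<comment> \<open>With this support in x, on the support of the kernel the weight changes by less
    than d / (M + 1), which compensates the size of the y-derivatives. The bound d / 3 for each of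
    the three factors keeps the whole support within radius d.\<close>
  have e1: "min \<delta> (d / 3) > 0" using \<delta> d by simp
  obtain \<beta>1 :: "real ^ 'm \<Rightarrow> real" where \<beta>1: "smooth \<beta>1" "\<And>x. 0 \<le> \<beta>1 x" "\<And>x. \<beta>1 (- x) = \<beta>1 x"
    "\<And>x. norm x \<ge> min \<delta> (d / 3) \<Longrightarrow> \<beta>1 x = 0" "integrable lborel \<beta>1" "integral\<^sup>L lborel \<beta>1 = 1"
    using ex_mollifier[OF e1] by metis
  define \<kappa> :: "('m, 'k) point \<times> real \<Rightarrow> real"
    where "\<kappa> \<xi> = (\<beta>1 (fst (fst \<xi>)) * \<beta>2 (snd (fst \<xi>))) * \<beta>3 (snd \<xi>)" for \<xi>
  have bl: "bounded_linear (\<lambda>\<xi>::('m, 'k) point \<times> real. fst (fst \<xi>))" "bounded_linear (\<lambda>\<xi>::('m, 'k) point \<times> real. snd (fst \<xi>))"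
    by (auto intro: bounded_linear_compose bounded_linear_fst bounded_linear_snd)
  have sm: "smooth \<kappa>"
    unfolding \<kappa>_def
    using Ck_on_compose_affine[OF bl(1), of _ \<beta>1 0] Ck_on_compose_affine[OF bl(2), of _ \<beta>2 0]
      Ck_on_compose_affine[OF bounded_linear_snd, of _ \<beta>3 0] \<beta>1(1) \<beta>2(1) \<beta>3(1)
    by (intro allI Ck_on_mult) auto
  have supp: "\<kappa> \<xi> = 0" if "d \<le> norm \<xi>" for \<xi>
  proof (rule ccontr)
    assume "\<kappa> \<xi> \<noteq> 0"
    then have "norm (fst (fst \<xi>)) < d / 3" "norm (snd (fst \<xi>)) < d / 3" "norm (snd \<xi>) < d / 3"
      using \<beta>1(4)[of "fst (fst \<xi>)"] \<beta>2(4)[of "snd (fst \<xi>)"] \<beta>3(4)[of "snd \<xi>"] by (auto simp: \<kappa>_def not_le[symmetric] min_le_iff_disj)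
    moreover have "norm \<xi> \<le> norm (fst (fst \<xi>)) + norm (snd (fst \<xi>)) + norm (snd \<xi>)"
      using norm_Pair_le[of "fst \<xi>" "snd \<xi>"] norm_Pair_le[of "fst (fst \<xi>)" "snd (fst \<xi>)"] by simp
    ultimately show False using that by linarith
  qed
  have ck: "continuous_on UNIV \<kappa>" using sm Ck_on_imp_continuous by blast
  have "integral\<^sup>L lborel \<kappa> = 1"
    unfolding \<kappa>_def
    using lborel_integral_product(2)[OF lborel_integral_product(1)[OF \<beta>1(5) \<beta>2(5)] \<beta>3(5)]
      lborel_integral_product(2)[OF \<beta>1(5) \<beta>2(5)] \<beta>1(6) \<beta>2(6) \<beta>3(6) by simp
  then have mol: "mollifier \<kappa> d"
    using sm supp \<beta>1(2,3) \<beta>2(2,3) \<beta>3(2,3) by (auto simp: mollifier_def \<kappa>_def)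
  have D\<kappa>: "\<bar>frechet_derivative \<kappa> (at \<xi>) ((0, axis j 1), 0)\<bar> = (\<beta>1 (fst (fst \<xi>)) * D j (snd (fst \<xi>))) * \<beta>3 (snd \<xi>)" for \<xi> j
  proof -
    have "(\<kappa> has_derivative
       (\<lambda>h. (\<beta>1 (fst (fst \<xi>)) * \<beta>2 (snd (fst \<xi>))) * frechet_derivative \<beta>3 (at (snd \<xi>)) (snd h) +
         (\<beta>1 (fst (fst \<xi>)) * frechet_derivative \<beta>2 (at (snd (fst \<xi>))) (snd (fst h)) +
           frechet_derivative \<beta>1 (at (fst (fst \<xi>))) (fst (fst h)) * \<beta>2 (snd (fst \<xi>))) * \<beta>3 (snd \<xi>))) (at \<xi>)"
      unfolding \<kappa>_def[abs_def]
      by (intro has_derivative_mult has_derivative_compose[OF bounded_linear_imp_has_derivative[OF bl(1)] smooth_has_derivative[OF \<beta>1(1)]]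
         has_derivative_compose[OF bounded_linear_imp_has_derivative[OF bl(2)] smooth_has_derivative[OF \<beta>2(1)]]
         has_derivative_compose[OF bounded_linear_imp_has_derivative[OF bounded_linear_snd] smooth_has_derivative[OF \<beta>3(1)]])
    from frechet_derivative_at[OF this, symmetric] show ?thesis
      using \<beta>1(2) \<beta>3(2) linear_0[OF has_derivative_linear[OF smooth_has_derivative[OF \<beta>1(1)]]]
         linear_0[OF has_derivative_linear[OF smooth_has_derivative[OF \<beta>3(1)]]]
      by (simp add: D_def abs_mult)
  qed
  show ?thesis
  proof (rule that[OF mol])
    fix \<zeta> :: "('m, 'k) point \<times> real" and j :: 'k assume \<zeta>: "norm \<zeta> \<le> R"
    note iP = lborel_integral_product[OF lborel_integral_product(1)[OF \<beta>1(5) D[of j]] \<beta>3(5)]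
    have "integral\<^sup>L lborel (\<lambda>\<xi>. \<bar>grushin_weight \<gamma> (fst \<zeta>) - grushin_weight \<gamma> (fst (\<zeta> - \<xi>))\<bar> *
        \<bar>frechet_derivative \<kappa> (at \<xi>) ((0, axis j 1), 0)\<bar>) \<le>
      integral\<^sup>L lborel (\<lambda>\<xi>. d / (M + 1) * ((\<beta>1 (fst (fst \<xi>)) * D j (snd (fst \<xi>))) * \<beta>3 (snd \<xi>)))"
    proof (rule integral_mono')
      show "integrable lborel (\<lambda>\<xi>::('m, 'k) point \<times> real. d / (M + 1) * ((\<beta>1 (fst (fst \<xi>)) * D j (snd (fst \<xi>))) * \<beta>3 (snd \<xi>)))"
        using iP(1) by simp
      show "0 \<le> d / (M + 1) * ((\<beta>1 (fst (fst \<xi>)) * D j (snd (fst \<xi>))) * \<beta>3 (snd \<xi>))" for \<xi>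
        using d M(1) \<beta>1(2) \<beta>3(2) by (simp add: D_def)
      fix \<xi> :: "('m, 'k) point \<times> real"
      show "\<bar>grushin_weight \<gamma> (fst \<zeta>) - grushin_weight \<gamma> (fst (\<zeta> - \<xi>))\<bar> *
        \<bar>frechet_derivative \<kappa> (at \<xi>) ((0, axis j 1), 0)\<bar> \<le> d / (M + 1) * ((\<beta>1 (fst (fst \<xi>)) * D j (snd (fst \<xi>))) * \<beta>3 (snd \<xi>))"
        unfolding D\<kappa>
      proof (cases "\<beta>1 (fst (fst \<xi>)) = 0")
        case False
        then have s: "norm (fst (fst \<xi>)) < \<delta>" "norm (fst (fst \<xi>)) < d / 3"
          using \<beta>1(4)[of "fst (fst \<xi>)"] by (auto simp: not_le[symmetric] min_le_iff_disj)
        have "norm (fst (fst \<zeta>)) \<le> R"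
          using \<zeta> norm_fst_le[of "fst \<zeta>" "snd \<zeta>"] norm_fst_le[of "fst (fst \<zeta>)" "snd (fst \<zeta>)"] by simp
        moreover have "norm (fst (fst \<zeta>) - fst (fst \<xi>)) \<le> norm (fst (fst \<zeta>)) + norm (fst (fst \<xi>))"
          by (rule norm_triangle_ineq4)
        ultimately have "dist (\<omega> (fst (fst \<zeta>))) (\<omega> (fst (fst (\<zeta> - \<xi>)))) < d / (M + 1)"
          using s d norm_minus_commute[of "fst (fst \<zeta>)" "fst (fst \<xi>)"] by (intro \<delta>(2)) (auto simp: dist_norm)
        then show "\<bar>grushin_weight \<gamma> (fst \<zeta>) - grushin_weight \<gamma> (fst (\<zeta> - \<xi>))\<bar> *
          ((\<beta>1 (fst (fst \<xi>)) * D j (snd (fst \<xi>))) * \<beta>3 (snd \<xi>)) \<le> d / (M + 1) * ((\<beta>1 (fst (fst \<xi>)) * D j (snd (fst \<xi>))) * \<beta>3 (snd \<xi>))"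
          using \<beta>1(2) \<beta>3(2) by (intro mult_right_mono) (auto simp: \<omega> dist_real_def D_def)
      qed simp
    qed
    also have "\<dots> = d / (M + 1) * integral\<^sup>L lborel (D j)"
      using iP(2) lborel_integral_product(2)[OF \<beta>1(5) D[of j]] \<beta>1(6) \<beta>3(6) by simp
    also have "\<dots> \<le> d / (M + 1) * (M + 1)"
      using M(2)[of j] M(1) d by (intro mult_left_mono) auto
    also have "\<dots> = d" using M by simp
    finally show "integral\<^sup>L lborel (\<lambda>\<xi>. \<bar>grushin_weight \<gamma> (fst \<zeta>) - grushin_weight \<gamma> (fst (\<zeta> - \<xi>))\<bar> *
        \<bar>frechet_derivative \<kappa> (at \<xi>) ((0, axis j 1), 0)\<bar>) \<le> d" .
  qed
qed

section \<open>Commutators and local weak solutions\<close>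

abbreviation fd :: "('a::real_normed_vector \<Rightarrow> real) \<Rightarrow> 'a \<Rightarrow> 'a \<Rightarrow> real" where
  "fd f x \<equiv> frechet_derivative f (at x)"

lemma integral_ggrad:
  fixes L :: "'x \<Rightarrow> ('m::finite, 'k::finite) point \<times> real \<Rightarrow> real"
  assumes "\<And>e. integrable M (\<lambda>\<xi>. L \<xi> e)"
  shows "integrable M (\<lambda>\<xi>. ggrad \<gamma> \<zeta> (L \<xi>))"
    and "integral\<^sup>L M (\<lambda>\<xi>. ggrad \<gamma> \<zeta> (L \<xi>)) = ggrad \<gamma> \<zeta> (\<lambda>e. integral\<^sup>L M (\<lambda>\<xi>. L \<xi> e))"
proof -
  have rep: "ggrad \<gamma> \<zeta> l = (\<Sum>i\<in>UNIV. l ((axis i 1, 0), 0) *\<^sub>R (axis i 1, 0)) +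
      (\<Sum>j\<in>UNIV. (grushin_weight \<gamma> (fst \<zeta>) * l ((0, axis j 1), 0)) *\<^sub>R (0, axis j 1))" for l :: "('m, 'k) point \<times> real \<Rightarrow> real"
    by (simp add: ggrad_def prod_eq_iff vec_eq_iff fst_sum snd_sum axis_def if_distrib sum.delta cong: if_cong)
  show "integrable M (\<lambda>\<xi>. ggrad \<gamma> \<zeta> (L \<xi>))"
    unfolding rep by (intro Bochner_Integration.integrable_add Bochner_Integration.integrable_sum
        integrable_scaleR_left integrable_mult_right assms)
  then have i: "integrable M (\<lambda>\<xi>. ggrad \<gamma> \<zeta> (L \<xi>))" .
  have bl: "bounded_linear (\<lambda>v::('m, 'k) point. fst v $ i)" "bounded_linear (\<lambda>v::('m, 'k) point. snd v $ j)" for i j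
    by (intro bounded_linear_compose[OF bounded_linear_vec_nth] bounded_linear_fst bounded_linear_snd)+
  show "integral\<^sup>L M (\<lambda>\<xi>. ggrad \<gamma> \<zeta> (L \<xi>)) = ggrad \<gamma> \<zeta> (\<lambda>e. integral\<^sup>L M (\<lambda>\<xi>. L \<xi> e))"
    using integral_bounded_linear[OF bl(1) i] integral_bounded_linear[OF bl(2) i]
    by (intro prod_eqI) (simp_all add: vec_eq_iff ggrad_def)
qed

text \<open>The commutator of the horizontal gradient with convolution by \<open>\<kappa>\<close>; its first \<open>m\<close> components
  vanish.\<close>

definition gcomm :: "real \<Rightarrow> (('m::finite, 'k::finite) point \<times> real \<Rightarrow> real) \<Rightarrow>
    (('m, 'k) point \<times> real \<Rightarrow> real) \<Rightarrow> ('m, 'k) point \<times> real \<Rightarrow> ('m, 'k) point" where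
  "gcomm \<gamma> \<kappa> f \<zeta> = integral\<^sup>L lborel (\<lambda>\<xi>. f \<xi> *\<^sub>R (ggrad \<gamma> \<zeta> (fd \<kappa> (\<zeta> - \<xi>)) - ggrad \<gamma> \<xi> (fd \<kappa> (\<zeta> - \<xi>))))"

context
  fixes \<gamma> d :: real and \<kappa> :: "('m::finite, 'k::finite) point \<times> real \<Rightarrow> real"
  assumes \<gamma>: "0 \<le> \<gamma>" and \<kappa>: "mollifier \<kappa> d"
begin

lemma fd_mollifier_zero: "\<xi> \<notin> cball 0 d \<Longrightarrow> fd \<kappa> \<xi> e = 0"
  by (rule derivative_zero_outside[OF smooth_has_derivative[OF mollifierD(1)[OF \<kappa>]] closed_cball mollifierD(5)[OF \<kappa>]])

lemma fd_mollifier_continuous: "continuous_on UNIV (\<lambda>\<xi>. fd \<kappa> \<xi> e)"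
  by (rule smooth_continuous_derivative[OF mollifierD(1)[OF \<kappa>]])

lemma continuous_ggrad_fd:
  "continuous_on UNIV (\<lambda>(\<zeta>, \<xi>). ggrad \<gamma> \<zeta> (fd \<kappa> (\<zeta> - \<xi>)))"
  "continuous_on UNIV (\<lambda>(\<zeta>, \<xi>). ggrad \<gamma> \<xi> (fd \<kappa> (\<zeta> - \<xi>)))"
  unfolding case_prod_beta
  by (intro continuous_on_ggrad \<gamma> continuous_intros continuous_on_compose2[OF fd_mollifier_continuous]; simp)+

lemma gcomm_measurable:
  assumes [measurable]: "f \<in> borel_measurable borel"
  shows "gcomm \<gamma> \<kappa> f \<in> borel_measurable borel"
proof -
  have [measurable]: "(\<lambda>(\<zeta>, \<xi>). ggrad \<gamma> \<zeta> (fd \<kappa> (\<zeta> - \<xi>))) \<in> borel_measurable (borel \<Otimes>\<^sub>M borel)"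
    "(\<lambda>(\<zeta>, \<xi>). ggrad \<gamma> \<xi> (fd \<kappa> (\<zeta> - \<xi>))) \<in> borel_measurable (borel \<Otimes>\<^sub>M borel)"
    using continuous_ggrad_fd[THEN borel_measurable_continuous_onI] by (simp_all add: borel_prod)
  show ?thesis
    unfolding gcomm_def[abs_def] by measurable
qed

lemma fd_conv:
  assumes "integrable lborel f"
  shows "fd (conv \<kappa> f) \<zeta> = (\<lambda>e. conv (\<lambda>x. fd \<kappa> x e) f \<zeta>)"
  by (rule frechet_derivative_at[symmetric], rule conv_has_derivative[OF smooth_has_derivative[OF mollifierD(1)[OF \<kappa>]]
      fd_mollifier_continuous compact_cball mollifierD(5)[OF \<kappa>] assms])

lemma ggrad_conv:
  assumes f: "integrable lborel f"
  shows "integrable lborel (\<lambda>\<xi>. f \<xi> *\<^sub>R ggrad \<gamma> \<zeta> (fd \<kappa> (\<zeta> - \<xi>)))"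
    and "ggrad \<gamma> \<zeta> (fd (conv \<kappa> f) \<zeta>) = integral\<^sup>L lborel (\<lambda>\<xi>. f \<xi> *\<^sub>R ggrad \<gamma> \<zeta> (fd \<kappa> (\<zeta> - \<xi>)))"
proof -
  have i: "integrable lborel (\<lambda>\<xi>. f \<xi> * fd \<kappa> (\<zeta> - \<xi>) e)" for e
  proof -
    have "integrable lborel (\<lambda>\<xi>. fd \<kappa> (\<zeta> - \<xi>) e *\<^sub>R f \<xi>)"
      by (rule conv_integrable[OF fd_mollifier_continuous compact_cball _ f]) (rule fd_mollifier_zero)
    then show ?thesis by (simp add: mult.commute)
  qed
  show "integrable lborel (\<lambda>\<xi>. f \<xi> *\<^sub>R ggrad \<gamma> \<zeta> (fd \<kappa> (\<zeta> - \<xi>)))"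
    using integral_ggrad(1)[OF i] by (simp add: ggrad_cmult)
  show "ggrad \<gamma> \<zeta> (fd (conv \<kappa> f) \<zeta>) = integral\<^sup>L lborel (\<lambda>\<xi>. f \<xi> *\<^sub>R ggrad \<gamma> \<zeta> (fd \<kappa> (\<zeta> - \<xi>)))"
    using integral_ggrad(2)[of lborel "\<lambda>\<xi> e. f \<xi> * fd \<kappa> (\<zeta> - \<xi>) e" \<gamma> \<zeta>, OF i]
    unfolding fd_conv[OF f] ggrad_cmult conv_def by (simp add: mult.commute)
qed

text \<open>Here the weight is taken at the integration variable \<xi>, unlike in
  \<open>ggrad_conv\<close>, where it is frozen at \<zeta>. The difference of the two integrals is
  \<open>gcomm\<close>. The moving weight stays bounded because the kernel confines \<xi> to a ball
  around \<zeta>.\<close>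

lemma ggrad_conv_moving_integrable:
  assumes f: "integrable lborel f" and K: "compact K" and supp: "\<And>\<xi>. \<xi> \<notin> K \<Longrightarrow> f \<xi> = 0"
  shows "integrable lborel (\<lambda>\<xi>. f \<xi> *\<^sub>R ggrad \<gamma> \<xi> (fd \<kappa> (\<zeta> - \<xi>)))"
proof -
  define g where "g \<xi> = ggrad \<gamma> \<xi> (fd \<kappa> (\<zeta> - \<xi>))" for \<xi>
  have cg: "continuous_on UNIV g"
    unfolding g_def
    by (intro continuous_on_ggrad \<gamma> continuous_intros continuous_on_compose2[OF fd_mollifier_continuous]) simp
  have g0: "g \<xi> = 0" if "\<xi> \<notin> (\<lambda>x. \<zeta> - x) ` cball 0 d" for \<xi>
  proof -
    have "\<zeta> - \<xi> \<notin> cball 0 d"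
    proof
      assume "\<zeta> - \<xi> \<in> cball 0 d"
      moreover have "\<xi> = \<zeta> - (\<zeta> - \<xi>)" by simp
      ultimately have "\<xi> \<in> (\<lambda>x. \<zeta> - x) ` cball 0 d" by blast
      with that show False by simp
    qed
    then have "fd \<kappa> (\<zeta> - \<xi>) = (\<lambda>_. 0)"
      using fd_mollifier_zero by blast
    then show ?thesis by (simp add: g_def)
  qed
  have "compact ((\<lambda>x. \<zeta> - x) ` cball 0 d)"
    by (intro compact_continuous_image continuous_intros compact_cball)
  then obtain B where B: "B > 0" "\<And>x. norm (g x) \<le> B"
    using continuous_compact_support_bounded[OF cg _ g0] by blast
  have [measurable]: "g \<in> borel_measurable borel"
    using cg by (rule borel_measurable_continuous_onI)
  have "integrable lborel (\<lambda>\<xi>. f \<xi> *\<^sub>R g \<xi>)"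
  proof (rule Bochner_Integration.integrable_bound)
    show "integrable lborel (\<lambda>x. B * f x)" using f by auto
    show "AE x in lborel. norm (f x *\<^sub>R g x) \<le> norm (B * f x)"
      using B by (auto simp: abs_mult mult.commute[of _ "\<bar>f _\<bar>"] intro!: mult_left_mono)
  qed (use f in measurable)
  then show ?thesis by (simp add: g_def)
qed

text \<open>Only the last components survive, and in each the difference of weights multiplies a
  y-derivative of the kernel, so the hypothesis \<open>e\<close> applies after the substitution
  \<xi> -> \<zeta> - \<xi>. The estimate uses the sup norm of \<open>f\<close> and none of its
  derivatives. The factor \<open>CARD('k)\<close> comes from bounding the Euclidean norm by the sum
  of the components.\<close>

lemma gcomm_bound:
  assumes f [measurable]: "f \<in> borel_measurable borel" and B: "\<And>\<xi>. \<bar>f \<xi>\<bar> \<le> B"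
    and K: "compact K" and supp: "\<And>\<xi>. \<xi> \<notin> K \<Longrightarrow> f \<xi> = 0"
    and e: "\<And>j. integral\<^sup>L lborel (\<lambda>\<xi>. \<bar>grushin_weight \<gamma> (fst \<zeta>) - grushin_weight \<gamma> (fst (\<zeta> - \<xi>))\<bar> *
        \<bar>fd \<kappa> \<xi> ((0, axis j 1), 0)\<bar>) \<le> e"
  shows "norm (gcomm \<gamma> \<kappa> f \<zeta>) \<le> real CARD('k) * (B * e)"
proof -
  have B0: "0 \<le> B" using order_trans[OF abs_ge_zero B] .
  have int: "integrable lborel f"
  proof (rule Bochner_Integration.integrable_bound)
    show "integrable lborel (\<lambda>x. indicator K x *\<^sub>R B)"
      by (rule borel_integrable_compact[OF K]) simp
    show "AE x in lborel. norm (f x) \<le> norm (indicator K x *\<^sub>R B)"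
      using B supp B0 by (auto simp: indicator_def)
  qed simp
  let ?w = "\<lambda>\<xi>. grushin_weight \<gamma> (fst \<zeta>) - grushin_weight \<gamma> (fst \<xi>)"
  let ?g = "\<lambda>\<xi>. f \<xi> *\<^sub>R (ggrad \<gamma> \<zeta> (fd \<kappa> (\<zeta> - \<xi>)) - ggrad \<gamma> \<xi> (fd \<kappa> (\<zeta> - \<xi>)))"
  have i: "integrable lborel ?g"
    using ggrad_conv(1)[OF int] ggrad_conv_moving_integrable[OF int K supp] by (simp add: scaleR_diff_right)
  have fst0: "fst (?g \<xi>) = 0" for \<xi> by (simp add: ggrad_def vec_eq_iff)
  have snd: "snd (?g \<xi>) $ j = f \<xi> * (?w \<xi> * fd \<kappa> (\<zeta> - \<xi>) ((0, axis j 1), 0))" for \<xi> j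
    by (simp add: ggrad_def left_diff_distrib)
  have bl: "bounded_linear (\<lambda>v::('m, 'k) point. snd v $ j)" for j
    by (intro bounded_linear_compose[OF bounded_linear_vec_nth bounded_linear_snd])
  have comp: "\<bar>snd (gcomm \<gamma> \<kappa> f \<zeta>) $ j\<bar> \<le> B * e" for j
  proof -
    define h where "h \<xi> = \<bar>grushin_weight \<gamma> (fst \<zeta>) - grushin_weight \<gamma> (fst (\<zeta> - \<xi>))\<bar> *
        \<bar>fd \<kappa> \<xi> ((0, axis j 1), 0)\<bar>" for \<xi>
    have ch: "continuous_on UNIV h"
      unfolding h_def by (intro continuous_intros fd_mollifier_continuous
         continuous_on_compose2[OF continuous_grushin_weight[OF \<gamma>, of UNIV]]) auto
    have [measurable]: "h \<in> borel_measurable borel" using ch by (rule borel_measurable_continuous_onI)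
    have ih: "integrable lborel h"
      by (rule continuous_compact_support_integrable[OF ch compact_cball[of 0 d]])
        (simp add: h_def fd_mollifier_zero del: mem_cball)
    have ih': "integrable lborel (\<lambda>\<xi>. h (\<zeta> - \<xi>))"
      using ih integrable_distr_eq[of "\<lambda>\<xi>. \<zeta> - \<xi>" lborel borel h] by (simp add: distr_lborel_minus)
    have eq: "snd (gcomm \<gamma> \<kappa> f \<zeta>) $ j = integral\<^sup>L lborel (\<lambda>\<xi>. f \<xi> * (?w \<xi> * fd \<kappa> (\<zeta> - \<xi>) ((0, axis j 1), 0)))"
      using integral_bounded_linear[OF bl[of j] i] unfolding snd gcomm_def by simp
    have "integrable lborel (\<lambda>\<xi>. f \<xi> * (?w \<xi> * fd \<kappa> (\<zeta> - \<xi>) ((0, axis j 1), 0)))"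
      using integrable_bounded_linear[OF bl[of j] i] unfolding snd .
    then have "\<bar>integral\<^sup>L lborel (\<lambda>\<xi>. f \<xi> * (?w \<xi> * fd \<kappa> (\<zeta> - \<xi>) ((0, axis j 1), 0)))\<bar> \<le> integral\<^sup>L lborel (\<lambda>\<xi>. B * h (\<zeta> - \<xi>))"
      using ih' B by (intro integral_abs_bound_integral) (auto simp: h_def abs_mult intro!: mult_right_mono)
    also have "\<dots> = B * integral\<^sup>L lborel h"
      using integral_lborel_minus[of h \<zeta>] by simp
    also have "\<dots> \<le> B * e"
      using e[of j] B0 by (intro mult_left_mono) (auto simp: h_def[abs_def])
    finally show ?thesis unfolding eq .
  qed
  have "fst (gcomm \<gamma> \<kappa> f \<zeta>) = 0"
    using integral_bounded_linear[OF bounded_linear_fst i] unfolding fst0 gcomm_def by simp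
  then have "norm (gcomm \<gamma> \<kappa> f \<zeta>) = norm (snd (gcomm \<gamma> \<kappa> f \<zeta>))"
    by (simp add: norm_prod_def)
  also have "\<dots> \<le> (\<Sum>j\<in>UNIV. \<bar>snd (gcomm \<gamma> \<kappa> f \<zeta>) $ j\<bar>)"
    by (rule norm_le_l1_cart)
  also have "\<dots> \<le> real CARD('k) * (B * e)"
    using sum_bounded_above[of UNIV "\<lambda>j. \<bar>snd (gcomm \<gamma> \<kappa> f \<zeta>) $ j\<bar>" "B * e"] comp by simp
  finally show ?thesis .
qed

text \<open>The weight depends on x only, so it passes through the integration by parts in y. The
  integral with the moving weight is therefore the convolution of the horizontal gradient, and the
  commutator is what remains.\<close>

lemma ggrad_conv_C1:
  fixes \<psi> :: "('m, 'k) point \<times> real \<Rightarrow> real"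
  assumes der: "\<And>x. (\<psi> has_derivative \<psi>' x) (at x)" and cont: "\<And>e. continuous_on UNIV (\<lambda>x. \<psi>' x e)"
    and K: "compact K" and supp: "\<And>x. x \<notin> K \<Longrightarrow> \<psi> x = 0"
  shows "ggrad \<gamma> \<zeta> (fd (conv \<kappa> \<psi>) \<zeta>) = conv \<kappa> (\<lambda>\<xi>. ggrad \<gamma> \<xi> (\<psi>' \<xi>)) \<zeta> + gcomm \<gamma> \<kappa> \<psi> \<zeta>"
    and "fd (conv \<kappa> \<psi>) \<zeta> e = conv \<kappa> (\<lambda>\<xi>. \<psi>' \<xi> e) \<zeta>"
proof -
  have c\<psi>: "continuous_on UNIV \<psi>"
    using der by (auto intro!: continuous_at_imp_continuous_on has_derivative_continuous)
  have i\<psi>: "integrable lborel \<psi>"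
    by (rule continuous_compact_support_integrable[OF c\<psi> K supp])
  have parts: "conv (\<lambda>x. fd \<kappa> x e) (\<lambda>\<xi>. g \<xi> * \<psi> \<xi>) \<zeta> = conv \<kappa> (\<lambda>\<xi>. g \<xi> * \<psi>' \<xi> e) \<zeta>"
    if "continuous_on UNIV g" "\<And>x s. g (x + s *\<^sub>R e) = g x" for g e \<zeta>
    by (rule conv_by_parts[OF smooth_has_derivative[OF mollifierD(1)[OF \<kappa>]] fd_mollifier_continuous der cont K])
      (use supp that in auto)
  show "fd (conv \<kappa> \<psi>) \<zeta> e = conv \<kappa> (\<lambda>\<xi>. \<psi>' \<xi> e) \<zeta>"
    using parts[of "\<lambda>_. 1" e \<zeta>] by (simp add: fd_conv[OF i\<psi>])
  have \<psi>'0: "\<psi>' x e = 0" if "x \<notin> K" for x e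
    using derivative_zero_outside[OF der compact_imp_closed[OF K] supp that] .
  note i1 = ggrad_conv_moving_integrable[OF i\<psi> K supp]
  have i2: "integrable lborel (\<lambda>\<xi>. \<kappa> (\<zeta> - \<xi>) *\<^sub>R ggrad \<gamma> \<xi> (\<psi>' \<xi>))"
  proof (rule conv_integrable[OF mollifierD(8)[OF \<kappa>] compact_cball mollifierD(5)[OF \<kappa>]])
    show "integrable lborel (\<lambda>\<xi>. ggrad \<gamma> \<xi> (\<psi>' \<xi>))"
    proof (rule continuous_compact_support_integrable[OF _ K])
      show "continuous_on UNIV (\<lambda>\<xi>. ggrad \<gamma> \<xi> (\<psi>' \<xi>))"
        by (intro continuous_on_ggrad \<gamma> cont continuous_intros)
      show "ggrad \<gamma> \<xi> (\<psi>' \<xi>) = 0" if "\<xi> \<notin> K" for \<xi>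
      proof -
        have "\<psi>' \<xi> = (\<lambda>_. 0)" using \<psi>'0[OF that] by blast
        then show ?thesis by simp
      qed
    qed
  qed
  have "conv \<kappa> (\<lambda>\<xi>. ggrad \<gamma> \<xi> (\<psi>' \<xi>)) \<zeta> = integral\<^sup>L lborel (\<lambda>\<xi>. \<psi> \<xi> *\<^sub>R ggrad \<gamma> \<xi> (fd \<kappa> (\<zeta> - \<xi>)))"
  proof (rule prod_eqI)
    have bl: "bounded_linear (\<lambda>v::('m, 'k) point. fst v $ i)" for i
      by (intro bounded_linear_compose[OF bounded_linear_vec_nth bounded_linear_fst])
    have "fst (conv \<kappa> (\<lambda>\<xi>. ggrad \<gamma> \<xi> (\<psi>' \<xi>)) \<zeta>) $ i = fst (integral\<^sup>L lborel (\<lambda>\<xi>. \<psi> \<xi> *\<^sub>R ggrad \<gamma> \<xi> (fd \<kappa> (\<zeta> - \<xi>)))) $ i" for i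
      using integral_bounded_linear[OF bl[of i] i2] integral_bounded_linear[OF bl[of i] i1[of \<zeta>]]
        parts[of "\<lambda>_. 1" "((axis i 1, 0), 0)" \<zeta>]
      unfolding conv_def by (simp add: ggrad_def mult.commute)
    then show "fst (conv \<kappa> (\<lambda>\<xi>. ggrad \<gamma> \<xi> (\<psi>' \<xi>)) \<zeta>) = fst (integral\<^sup>L lborel (\<lambda>\<xi>. \<psi> \<xi> *\<^sub>R ggrad \<gamma> \<xi> (fd \<kappa> (\<zeta> - \<xi>))))"
      by (simp add: vec_eq_iff)
    have bl: "bounded_linear (\<lambda>v::('m, 'k) point. snd v $ i)" for i
      by (intro bounded_linear_compose[OF bounded_linear_vec_nth bounded_linear_snd])
    have "snd (conv \<kappa> (\<lambda>\<xi>. ggrad \<gamma> \<xi> (\<psi>' \<xi>)) \<zeta>) $ j = snd (integral\<^sup>L lborel (\<lambda>\<xi>. \<psi> \<xi> *\<^sub>R ggrad \<gamma> \<xi> (fd \<kappa> (\<zeta> - \<xi>)))) $ j" for j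
    proof -
      have "continuous_on UNIV (\<lambda>\<xi>::('m, 'k) point \<times> real. grushin_weight \<gamma> (fst \<xi>))"
        by (intro continuous_on_compose2[OF continuous_grushin_weight[OF \<gamma>, of UNIV]] continuous_intros) auto
      from parts[OF this, of "((0, axis j 1), 0)" \<zeta>]
      show ?thesis
        using integral_bounded_linear[OF bl[of j] i2] integral_bounded_linear[OF bl[of j] i1[of \<zeta>]]
        unfolding conv_def by (simp add: ggrad_def mult_ac grushin_weight_def)
    qed
    then show "snd (conv \<kappa> (\<lambda>\<xi>. ggrad \<gamma> \<xi> (\<psi>' \<xi>)) \<zeta>) = snd (integral\<^sup>L lborel (\<lambda>\<xi>. \<psi> \<xi> *\<^sub>R ggrad \<gamma> \<xi> (fd \<kappa> (\<zeta> - \<xi>))))"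
      by (simp add: vec_eq_iff)
  qed
  then show "ggrad \<gamma> \<zeta> (fd (conv \<kappa> \<psi>) \<zeta>) = conv \<kappa> (\<lambda>\<xi>. ggrad \<gamma> \<xi> (\<psi>' \<xi>)) \<zeta> + gcomm \<gamma> \<kappa> \<psi> \<zeta>"
    using ggrad_conv[OF i\<psi>] i1 by (simp add: gcomm_def scaleR_diff_right)
qed

end

section \<open>Cutoffs, bounds and supports for mollified functions\<close>

text \<open>\<open>A\<close> is differentiable only on the positive axis and \<open>U\<close> is
  known to be positive only on \<open>K\<close>. The open sets {U > 0} and the complement of
  \<open>K\<close> cover the space: on the first the chain rule holds, on the second the product is
  0.\<close>

lemma C1_cutoff_times_compose:
  fixes \<Phi> U :: "'a::euclidean_space \<Rightarrow> real" and A :: "real \<Rightarrow> real"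
  assumes K: "compact K" and \<Phi>: "\<And>x. (\<Phi> has_derivative \<Phi>' x) (at x)" "\<And>e. continuous_on UNIV (\<lambda>x. \<Phi>' x e)"
      "\<And>x. x \<notin> K \<Longrightarrow> \<Phi> x = 0"
    and U: "\<And>x. (U has_derivative U' x) (at x)" "\<And>e. continuous_on UNIV (\<lambda>x. U' x e)"
      "\<And>x. x \<in> K \<Longrightarrow> 0 < U x"
    and A: "\<And>s. 0 < s \<Longrightarrow> (A has_real_derivative A' s) (at s)" "continuous_on {0<..} A'"
  defines "D \<equiv> \<lambda>x e. \<Phi>' x e * A (U x) + \<Phi> x * (A' (U x) * U' x e)"
  shows "\<And>x. ((\<lambda>x. \<Phi> x * A (U x)) has_derivative D x) (at x)"
    and "\<And>e. continuous_on UNIV (\<lambda>x. D x e)"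
    and "\<And>x. x \<notin> K \<Longrightarrow> \<Phi> x * A (U x) = 0"
proof -
  have cU: "continuous_on UNIV U" and c\<Phi>: "continuous_on UNIV \<Phi>"
    using U(1) \<Phi>(1) by (auto intro!: continuous_at_imp_continuous_on has_derivative_continuous)
  have \<Phi>'0: "\<Phi>' x e = 0" if "x \<notin> K" for x e
    using derivative_zero_outside[OF \<Phi>(1) compact_imp_closed[OF K] \<Phi>(3) that] .
  have opK: "open (- K)" using compact_imp_closed[OF K] by auto
  show "((\<lambda>x. \<Phi> x * A (U x)) has_derivative D x) (at x)" for x
  proof (cases "x \<in> K")
    case True
    have "(A has_derivative (*) (A' (U x))) (at (U x))"
      using A(1)[OF U(3)[OF True]] by (simp add: has_field_derivative_def)
    from has_derivative_mult[OF \<Phi>(1) has_derivative_compose[OF U(1) this]]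
    show ?thesis
      by (rule has_derivative_eq_rhs) (simp add: D_def fun_eq_iff)
  next
    case False
    have "D x = (\<lambda>_. 0)" using \<Phi>'0[OF False] \<Phi>(3)[OF False] by (simp add: D_def fun_eq_iff)
    moreover have "((\<lambda>x. \<Phi> x * A (U x)) has_derivative (\<lambda>_. 0)) (at x)"
      by (rule has_derivative_transform_within_open[OF has_derivative_const opK, of x 0]) (use False \<Phi>(3) in auto)
    ultimately show ?thesis by simp
  qed
  show "continuous_on UNIV (\<lambda>x. D x e)" for e
  proof -
    define W where "W = {x. 0 < U x}"
    have "open W"
      unfolding W_def using cU by (intro open_Collect_less) (auto intro: continuous_intros)
    moreover have "continuous_on W (\<lambda>x. D x e)"
    proof -
      have "continuous_on {0<..} A"
        using A(1) by (auto intro!: continuous_at_imp_continuous_on DERIV_isCont)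
      then have "continuous_on W (\<lambda>x. A (U x))"
        by (rule continuous_on_compose2[OF _ continuous_on_subset[OF cU]]) (auto simp: W_def)
      moreover have "continuous_on W (\<lambda>x. A' (U x))"
        by (rule continuous_on_compose2[OF A(2) continuous_on_subset[OF cU]]) (auto simp: W_def)
      ultimately show ?thesis
        unfolding D_def
        by (intro continuous_on_add continuous_on_mult continuous_on_subset[OF \<Phi>(2)] continuous_on_subset[OF U(2)]
            continuous_on_subset[OF c\<Phi>]) auto
    qed
    moreover have "continuous_on (- K) (\<lambda>x. D x e)"
    proof -
      have "D x e = 0" if "x \<in> - K" for x
        using \<Phi>'0[of x] \<Phi>(3)[of x] that by (simp add: D_def)
      then show ?thesis by (subst continuous_on_cong[OF refl, of _ _ "\<lambda>_. 0"]) auto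
    qed
    ultimately have "continuous_on (W \<union> - K) (\<lambda>x. D x e)"
      using opK by (intro continuous_on_open_Un)
    moreover have "W \<union> - K = UNIV" using U(3) by (auto simp: W_def)
    ultimately show ?thesis by simp
  qed
qed (use \<Phi>(3) in simp)


text \<open>The bound on \<open>X\<close> is asked only where \<open>F\<close> is nonzero, since the
  commutators to which this is applied are controlled only on the compact set carrying
  \<open>F\<close>.\<close>

lemma bounded_integrable_inner:
  fixes F X :: "'a::euclidean_space \<Rightarrow> 'b::euclidean_space"
  assumes F: "integrable lborel F" and [measurable]: "X \<in> borel_measurable borel"
    and B: "\<And>x. F x \<noteq> 0 \<Longrightarrow> norm (X x) \<le> B"
  shows "integrable lborel (\<lambda>x. F x \<bullet> X x)"
    and "\<bar>integral\<^sup>L lborel (\<lambda>x. F x \<bullet> X x)\<bar> \<le> B * integral\<^sup>L lborel (\<lambda>x. norm (F x))"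
proof -
  have le: "\<bar>F x \<bullet> X x\<bar> \<le> B * norm (F x)" for x
  proof (cases "F x = 0")
    case False
    have "\<bar>F x \<bullet> X x\<bar> \<le> norm (F x) * norm (X x)" by (rule Cauchy_Schwarz_ineq2)
    also have "\<dots> \<le> norm (F x) * B" using B[OF False] by (intro mult_left_mono) auto
    finally show ?thesis by (simp add: mult.commute)
  qed simp
  show i: "integrable lborel (\<lambda>x. F x \<bullet> X x)"
    by (rule Bochner_Integration.integrable_bound[of _ "\<lambda>x. B * norm (F x)"])
      (use F le in \<open>auto intro: order_trans[OF _ abs_ge_self]\<close>)
  have "\<bar>integral\<^sup>L lborel (\<lambda>x. F x \<bullet> X x)\<bar> \<le> integral\<^sup>L lborel (\<lambda>x. B * norm (F x))"
    using i F le by (intro integral_abs_bound_integral) auto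
  then show "\<bar>integral\<^sup>L lborel (\<lambda>x. F x \<bullet> X x)\<bar> \<le> B * integral\<^sup>L lborel (\<lambda>x. norm (F x))" by simp
qed

lemma conv_norm_le:
  fixes f :: "'a::euclidean_space \<Rightarrow> 'b::euclidean_space"
  assumes \<kappa>: "mollifier \<kappa> d" and f: "integrable lborel f" and B: "\<And>x. norm (f x) \<le> B"
  shows "norm (conv \<kappa> f x) \<le> B"
proof -
  note [measurable] = mollifierD(9)[OF \<kappa>]
  have i: "integrable lborel (\<lambda>\<xi>. \<kappa> (x - \<xi>) *\<^sub>R f \<xi>)"
    by (rule conv_integrable[OF mollifierD(8)[OF \<kappa>] compact_cball _ f]) (rule mollifierD(5)[OF \<kappa>])
  have j: "integrable lborel (\<lambda>\<xi>. \<kappa> (x - \<xi>))"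
    using mollifierD(7)[OF \<kappa>] integrable_distr_eq[of "\<lambda>\<xi>. x - \<xi>" lborel borel \<kappa>] by (simp add: distr_lborel_minus)
  have "norm (conv \<kappa> f x) \<le> integral\<^sup>L lborel (\<lambda>\<xi>. \<kappa> (x - \<xi>) * B)"
    unfolding conv_def
    by (rule Bochner_Integration.integral_norm_bound_integral[OF i]) (use j B mollifierD(2)[OF \<kappa>] in \<open>auto intro!: mult_left_mono\<close>)
  also have "\<dots> = B"
    using integral_lborel_minus[of \<kappa> x] mollifierD(6)[OF \<kappa>] by simp
  finally show ?thesis .
qed

lemma conv_real_bounds:
  fixes f :: "'a::euclidean_space \<Rightarrow> real"
  assumes \<kappa>: "mollifier \<kappa> d" and f: "integrable lborel f" and b: "\<And>\<xi>. dist x \<xi> < d \<Longrightarrow> a \<le> f \<xi> \<and> f \<xi> \<le> b"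
  shows "a \<le> conv \<kappa> f x" "conv \<kappa> f x \<le> b"
proof -
  note [measurable] = mollifierD(9)[OF \<kappa>]
  have i: "integrable lborel (\<lambda>\<xi>. \<kappa> (x - \<xi>) *\<^sub>R f \<xi>)"
    by (rule conv_integrable[OF mollifierD(8)[OF \<kappa>] compact_cball _ f]) (rule mollifierD(5)[OF \<kappa>])
  have j: "integrable lborel (\<lambda>\<xi>. \<kappa> (x - \<xi>))"
    using mollifierD(7)[OF \<kappa>] integrable_distr_eq[of "\<lambda>\<xi>. x - \<xi>" lborel borel \<kappa>] by (simp add: distr_lborel_minus)
  have c: "integral\<^sup>L lborel (\<lambda>\<xi>. \<kappa> (x - \<xi>) * C) = C" for C
    using integral_lborel_minus[of \<kappa> x] mollifierD(6)[OF \<kappa>] by simp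
  have *: "\<kappa> (x - \<xi>) * a \<le> \<kappa> (x - \<xi>) * f \<xi>" "\<kappa> (x - \<xi>) * f \<xi> \<le> \<kappa> (x - \<xi>) * b" for \<xi>
    using mollifierD(2,4)[OF \<kappa>, of "x - \<xi>"] b[of \<xi>]
    by (cases "norm (x - \<xi>) < d"; auto simp: dist_norm intro!: mult_left_mono)+
  have "integral\<^sup>L lborel (\<lambda>\<xi>. \<kappa> (x - \<xi>) * a) \<le> conv \<kappa> f x"
    unfolding conv_def real_scaleR_def by (rule integral_mono) (use i j * in auto)
  then show "a \<le> conv \<kappa> f x" by (simp only: c)
  have "conv \<kappa> f x \<le> integral\<^sup>L lborel (\<lambda>\<xi>. \<kappa> (x - \<xi>) * b)"
    unfolding conv_def real_scaleR_def by (rule integral_mono) (use i j * in auto)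
  then show "conv \<kappa> f x \<le> b" by (simp only: c)
qed

lemma conv_mollifier_support:
  assumes \<kappa>: "mollifier \<kappa> d" and supp: "\<And>x. x \<notin> K \<Longrightarrow> f x = 0" and x: "\<And>\<xi>. dist x \<xi> < d \<Longrightarrow> \<xi> \<notin> K"
  shows "conv \<kappa> f x = 0"
proof (rule conv_eq_0)
  fix \<xi> assume "f \<xi> \<noteq> 0"
  then have "\<not> dist x \<xi> < d" using supp x by blast
  then show "\<kappa> (x - \<xi>) = 0" using mollifierD(4)[OF \<kappa>] by (simp add: dist_norm)
qed

section \<open>Mollifying a local weak solution\<close>

text \<open>A solution after localisation: Borel data vanishing off a compact space-time set
  \<open>K1\<close>, on which \<open>u\<close> lies between positive constants. \<open>F\<close> and
  \<open>S\<close> stand for flux and source. The margin \<open>d0\<close> between \<open>K0\<close>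
  and \<open>K1\<close> ensures that kernels of radius at most \<open>d0\<close> carry a cutoff
  supported in \<open>K0\<close> to an admissible test function.\<close>

locale local_weak_solution =
  fixes \<gamma> p c0 c1 d0 :: real and u S :: "('m::finite, 'k::finite) point \<times> real \<Rightarrow> real"
    and G F :: "('m, 'k) point \<times> real \<Rightarrow> ('m, 'k) point" and K0 K1 :: "(('m, 'k) point \<times> real) set"
  assumes \<gamma>: "0 \<le> \<gamma>" and p: "1 < p" and c0: "0 < c0" and d0: "0 < d0"
    and K0: "compact K0" and K1: "compact K1"
    and thick: "\<And>\<zeta> \<xi>. \<zeta> \<in> K0 \<Longrightarrow> dist \<zeta> \<xi> < d0 \<Longrightarrow> \<xi> \<in> K1"
    and meas [measurable]: "u \<in> borel_measurable borel" "G \<in> borel_measurable borel"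
      "F \<in> borel_measurable borel" "S \<in> borel_measurable borel"
    and supp: "\<And>\<zeta>. \<zeta> \<notin> K1 \<Longrightarrow> u \<zeta> = 0" "\<And>\<zeta>. \<zeta> \<notin> K1 \<Longrightarrow> G \<zeta> = 0"
      "\<And>\<zeta>. \<zeta> \<notin> K1 \<Longrightarrow> F \<zeta> = 0" "\<And>\<zeta>. \<zeta> \<notin> K1 \<Longrightarrow> S \<zeta> = 0"
    and u_bounds: "\<And>\<zeta>. \<zeta> \<in> K1 \<Longrightarrow> c0 \<le> u \<zeta>" "\<And>\<zeta>. \<zeta> \<in> K1 \<Longrightarrow> u \<zeta> \<le> c1"
    and fin: "modular p G < \<infinity>" "modular (p / (p - 1)) F < \<infinity>" and int_S: "integrable lborel S"
    and weak_grad: "\<And>\<psi>. smooth \<psi> \<Longrightarrow> (\<And>\<zeta>. \<zeta> \<notin> K1 \<Longrightarrow> \<psi> \<zeta> = 0) \<Longrightarrow>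
      integral\<^sup>L lborel (\<lambda>\<zeta>. u \<zeta> *\<^sub>R ggrad \<gamma> \<zeta> (fd \<psi> \<zeta>)) = - integral\<^sup>L lborel (\<lambda>\<zeta>. \<psi> \<zeta> *\<^sub>R G \<zeta>)"
    and weak_pde: "\<And>\<psi>. smooth \<psi> \<Longrightarrow> (\<And>\<zeta>. \<zeta> \<notin> K1 \<Longrightarrow> \<psi> \<zeta> = 0) \<Longrightarrow>
      - integral\<^sup>L lborel (\<lambda>\<zeta>. u \<zeta> * fd \<psi> \<zeta> (0, 1)) =
      - integral\<^sup>L lborel (\<lambda>\<zeta>. F \<zeta> \<bullet> ggrad \<gamma> \<zeta> (fd \<psi> \<zeta>)) + integral\<^sup>L lborel (\<lambda>\<zeta>. S \<zeta> * \<psi> \<zeta>)"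
begin

lemma K0_subset: "K0 \<subseteq> K1"
  using thick d0 by (metis dist_self subsetI)

lemma abs_u_le: "\<bar>u \<zeta>\<bar> \<le> max 0 c1"
  using u_bounds[of \<zeta>] supp(1)[of \<zeta>] c0 by (cases "\<zeta> \<in> K1") auto

lemma int_u: "integrable lborel u"
proof (rule Bochner_Integration.integrable_bound)
  show "integrable lborel (\<lambda>x. indicator K1 x *\<^sub>R max 0 c1)"
    by (rule borel_integrable_compact[OF K1]) simp
  show "AE x in lborel. norm (u x) \<le> norm (indicator K1 x *\<^sub>R max 0 c1)"
    using abs_u_le supp(1) by (auto simp: indicator_def)
qed simp

lemma int_F: "integrable lborel F"
  by (rule modular_integrable[OF _ _ fin(2) K1]) (use p supp in \<open>auto simp: field_simps\<close>)

lemma conv_u_bounds: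
  assumes "mollifier \<kappa> d" "d \<le> d0" "\<zeta> \<in> K0"
  shows "c0 \<le> conv \<kappa> u \<zeta>" "conv \<kappa> u \<zeta> \<le> c1"
proof -
  have "c0 \<le> u \<xi> \<and> u \<xi> \<le> c1" if "dist \<zeta> \<xi> < d" for \<xi>
    using u_bounds[of \<xi>] thick[OF assms(3), of \<xi>] that assms(2) by auto
  from conv_real_bounds[OF assms(1) int_u this]
  show "c0 \<le> conv \<kappa> u \<zeta>" "conv \<kappa> u \<zeta> \<le> c1" by auto
qed

text \<open>The reflected kernel \<xi> |-> \<kappa>(\<zeta> - \<xi>) is itself a test function,
  since \<zeta> lies in \<open>K0\<close> and the radius is at most \<open>d0\<close>. The sign from
  the reflection cancels the sign in the definition of the weak gradient.\<close>

lemma ggrad_conv_u: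
  assumes \<kappa>: "mollifier \<kappa> d" and d: "d \<le> d0" and \<zeta>: "\<zeta> \<in> K0"
  shows "ggrad \<gamma> \<zeta> (fd (conv \<kappa> u) \<zeta>) = conv \<kappa> G \<zeta> + gcomm \<gamma> \<kappa> u \<zeta>"
proof -
  have bl: "bounded_linear (\<lambda>x::('m, 'k) point \<times> real. - x)" by (intro bounded_linear_minus bounded_linear_ident)
  have sm: "smooth (\<lambda>\<xi>. \<kappa> (\<zeta> - \<xi>))"
    using Ck_on_compose_affine[OF bl, of _ \<kappa> \<zeta>] mollifierD(1)[OF \<kappa>] by simp
  have z: "\<kappa> (\<zeta> - \<xi>) = 0" if "\<xi> \<notin> K1" for \<xi>
  proof (rule mollifierD(4)[OF \<kappa>])
    show "d \<le> norm (\<zeta> - \<xi>)"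
      using thick[OF \<zeta>, of \<xi>] that d by (auto simp: dist_norm not_less[symmetric])
  qed
  have "fd (\<lambda>\<xi>. \<kappa> (\<zeta> - \<xi>)) \<xi> = (\<lambda>e. - fd \<kappa> (\<zeta> - \<xi>) e)" for \<xi>
  proof -
    have "((\<lambda>\<xi>. \<zeta> - \<xi>) has_derivative (\<lambda>h. - h)) (at \<xi>)"
      by (auto intro!: derivative_eq_intros)
    from has_derivative_compose[OF this smooth_has_derivative[OF mollifierD(1)[OF \<kappa>]]]
    have "fd (\<lambda>\<xi>. \<kappa> (\<zeta> - \<xi>)) \<xi> = (\<lambda>e. fd \<kappa> (\<zeta> - \<xi>) (- e))"
      by (rule frechet_derivative_at[symmetric])
    then show ?thesis
      using linear_neg[OF has_derivative_linear[OF smooth_has_derivative[OF mollifierD(1)[OF \<kappa>]]]] by simp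
  qed
  then have "integral\<^sup>L lborel (\<lambda>\<xi>. u \<xi> *\<^sub>R ggrad \<gamma> \<xi> (fd \<kappa> (\<zeta> - \<xi>))) = conv \<kappa> G \<zeta>"
    using weak_grad[OF sm z] by (simp add: ggrad_minus conv_def)
  then show ?thesis
    using ggrad_conv[OF \<gamma> \<kappa> int_u] ggrad_conv_moving_integrable[OF \<gamma> \<kappa> int_u K1 supp(1)]
    by (simp add: gcomm_def scaleR_diff_right)
qed

text \<open>The equation is tested with the mollification of \<Phi> h(U), where U = conv \<kappa> u.
  Self-adjointness then puts U beside the time derivative of \<Phi> h(U), so the time term becomes
  an exact derivative of H(U). The diffusion term acquires two commutators, one from mollifying the
  test function and one from the gradient of U.\<close>

lemma mollified_identity:
  assumes \<kappa>: "mollifier \<kappa> d" and d: "d \<le> d0"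
    and e: "\<And>\<zeta> j. \<zeta> \<in> K1 \<Longrightarrow> integral\<^sup>L lborel (\<lambda>\<xi>. \<bar>grushin_weight \<gamma> (fst \<zeta>) - grushin_weight \<gamma> (fst (\<zeta> - \<xi>))\<bar> *
        \<bar>fd \<kappa> \<xi> ((0, axis j 1), 0)\<bar>) \<le> \<epsilon>"
    and \<Phi>: "\<And>x. (\<Phi> has_derivative \<Phi>' x) (at x)" "\<And>e. continuous_on UNIV (\<lambda>x. \<Phi>' x e)" "\<And>x. x \<notin> K0 \<Longrightarrow> \<Phi> x = 0"
    and h: "\<And>s. 0 < s \<Longrightarrow> (h has_real_derivative h' s) (at s)" "continuous_on {0<..} h'"
    and H: "\<And>s. 0 < s \<Longrightarrow> (H has_real_derivative h s) (at s)"
  defines "U \<equiv> conv \<kappa> u"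
  defines "b \<equiv> \<lambda>\<zeta>. h (U \<zeta>) *\<^sub>R ggrad \<gamma> \<zeta> (\<Phi>' \<zeta>) + (\<Phi> \<zeta> * h' (U \<zeta>)) *\<^sub>R (conv \<kappa> G \<zeta> + gcomm \<gamma> \<kappa> u \<zeta>)"
  shows "- integral\<^sup>L lborel (\<lambda>\<zeta>. \<Phi>' \<zeta> (0, 1) * H (U \<zeta>)) =
      - integral\<^sup>L lborel (\<lambda>\<zeta>. conv \<kappa> F \<zeta> \<bullet> b \<zeta>) - integral\<^sup>L lborel (\<lambda>\<zeta>. F \<zeta> \<bullet> gcomm \<gamma> \<kappa> (\<lambda>\<zeta>. \<Phi> \<zeta> * h (U \<zeta>)) \<zeta>)
      + integral\<^sup>L lborel (\<lambda>\<zeta>. conv \<kappa> S \<zeta> * (\<Phi> \<zeta> * h (U \<zeta>)))"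
proof -
  note [measurable] = mollifierD(9)[OF \<kappa>]
  have smU: "smooth U"
    unfolding U_def by (rule conv_smooth[OF mollifierD(1)[OF \<kappa>] compact_cball mollifierD(5)[OF \<kappa>] int_u])
  have U: "(U has_derivative fd U x) (at x)" "continuous_on UNIV (\<lambda>x. fd U x e)" for x e
    using smooth_has_derivative[OF smU] smooth_continuous_derivative[OF smU] by auto
  have Upos: "0 < U x" if "x \<in> K0" for x
    using conv_u_bounds(1)[OF \<kappa> d that] c0 by (simp add: U_def)
  have ch: "continuous_on {0<..} h"
    using h(1) by (auto intro!: continuous_at_imp_continuous_on DERIV_isCont)
  define \<psi> where "\<psi> \<zeta> = \<Phi> \<zeta> * h (U \<zeta>)" for \<zeta>
  define \<psi>' where "\<psi>' \<zeta> e = \<Phi>' \<zeta> e * h (U \<zeta>) + \<Phi> \<zeta> * (h' (U \<zeta>) * fd U \<zeta> e)" for \<zeta> e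
  have \<psi>: "(\<psi> has_derivative \<psi>' x) (at x)" "continuous_on UNIV (\<lambda>x. \<psi>' x e)" for x e
    unfolding \<psi>_def[abs_def] \<psi>'_def[abs_def]
    by (rule C1_cutoff_times_compose[OF K0 \<Phi>(1,2) _ U _ _ h(2)]; use \<Phi>(3) Upos h(1) in blast)+
  have \<eta>: "((\<lambda>x. \<Phi> x * H (U x)) has_derivative (\<lambda>e. \<Phi>' x e * H (U x) + \<Phi> x * (h (U x) * fd U x e))) (at x)"
    "continuous_on UNIV (\<lambda>x. \<Phi>' x e * H (U x) + \<Phi> x * (h (U x) * fd U x e))" for x e
    by (rule C1_cutoff_times_compose[OF K0 \<Phi>(1,2) _ U _ _ ch]; use \<Phi>(3) Upos H in blast)+
  have c\<psi>: "continuous_on UNIV \<psi>"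
    using \<psi>(1) by (auto intro!: continuous_at_imp_continuous_on has_derivative_continuous)
  have \<psi>0: "\<psi> x = 0" if "x \<notin> K0" for x using that \<Phi>(3) by (simp add: \<psi>_def)
  have \<Phi>'0: "\<Phi>' x e = 0" if "x \<notin> K0" for x e
    using derivative_zero_outside[OF \<Phi>(1) compact_imp_closed[OF K0] \<Phi>(3) that] .
  have \<psi>'0: "\<psi>' x e = 0" if "x \<notin> K0" for x e
    using \<Phi>'0[OF that] \<Phi>(3)[OF that] by (simp add: \<psi>'_def)
  have i\<psi>: "integrable lborel \<psi>"
    by (rule continuous_compact_support_integrable[OF c\<psi> K0 \<psi>0])
  have i\<psi>': "integrable lborel (\<lambda>x. \<psi>' x e)" for e
    by (rule continuous_compact_support_integrable[OF \<psi>(2) K0 \<psi>'0])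
  have [measurable]: "\<psi> \<in> borel_measurable borel"
    using c\<psi> by (rule borel_measurable_continuous_onI)
  have sm: "smooth (conv \<kappa> \<psi>)"
    by (rule conv_smooth[OF mollifierD(1)[OF \<kappa>] compact_cball _ i\<psi>]) (rule mollifierD(5)[OF \<kappa>])
  have z: "conv \<kappa> \<psi> \<zeta> = 0" if "\<zeta> \<notin> K1" for \<zeta>
  proof (rule conv_mollifier_support[OF \<kappa> \<psi>0])
    show "\<xi> \<notin> K0" if "dist \<zeta> \<xi> < d" for \<xi>
      using thick[of \<xi> \<zeta>] \<open>\<zeta> \<notin> K1\<close> that d by (auto simp: dist_commute)
  qed
  have sym: "integral\<^sup>L lborel (\<lambda>x. g x \<bullet> conv \<kappa> f x) = integral\<^sup>L lborel (\<lambda>x. conv \<kappa> g x \<bullet> f x)"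
    if "integrable lborel f" "integrable lborel g" for f g :: "('m, 'k) point \<times> real \<Rightarrow> 'c::euclidean_space"
    by (rule conv_symmetric[OF mollifierD(8)[OF \<kappa>] compact_cball _ mollifierD(3)[OF \<kappa>] that]) (rule mollifierD(5)[OF \<kappa>])
  have fd\<psi>: "fd (conv \<kappa> \<psi>) \<zeta> e = conv \<kappa> (\<lambda>\<xi>. \<psi>' \<xi> e) \<zeta>" for \<zeta> e
    by (rule ggrad_conv_C1(2)[OF \<gamma> \<kappa> \<psi>(1,2) K0]) (rule \<psi>0)
  have grad\<psi>: "ggrad \<gamma> \<zeta> (fd (conv \<kappa> \<psi>) \<zeta>) = conv \<kappa> (\<lambda>\<xi>. ggrad \<gamma> \<xi> (\<psi>' \<xi>)) \<zeta> + gcomm \<gamma> \<kappa> \<psi> \<zeta>" for \<zeta>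
    by (rule ggrad_conv_C1(1)[OF \<gamma> \<kappa> \<psi>(1,2) K0]) (rule \<psi>0)
  have P1: "- integral\<^sup>L lborel (\<lambda>\<zeta>. u \<zeta> * fd (conv \<kappa> \<psi>) \<zeta> (0, 1)) = - integral\<^sup>L lborel (\<lambda>\<zeta>. \<Phi>' \<zeta> (0, 1) * H (U \<zeta>))"
  proof -
    have "integral\<^sup>L lborel (\<lambda>\<zeta>. u \<zeta> * fd (conv \<kappa> \<psi>) \<zeta> (0, 1)) = integral\<^sup>L lborel (\<lambda>\<zeta>. U \<zeta> * \<psi>' \<zeta> (0, 1))"
      using sym[OF i\<psi>' int_u, of "(0, 1)"] unfolding fd\<psi> U_def
      by simp
    \<comment> \<open>Integration by parts in time, available because U is smooth even though
      \<open>u\<close> is not.\<close>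
    also have "\<dots> = - integral\<^sup>L lborel (\<lambda>\<zeta>. fd U \<zeta> (0, 1) * \<psi> \<zeta>)"
    proof -
      have cU: "continuous_on UNIV U" using smU Ck_on_imp_continuous by blast
      have D: "((\<lambda>x. U x * \<psi> x) has_derivative (\<lambda>e. U x * \<psi>' x e + fd U x e * \<psi> x)) (at x)" for x
        by (rule has_derivative_mult[OF U(1) \<psi>(1)])
      have "integral\<^sup>L lborel (\<lambda>x. 1 * (U x * \<psi>' x (0, 1) + fd U x (0, 1) * \<psi> x)) = 0"
        by (rule integral_directional_derivative[OF D _ K0]) (auto intro!: continuous_intros cU \<psi>(2) U(2) c\<psi> simp: \<psi>0)
      moreover have "integrable lborel (\<lambda>x. U x * \<psi>' x (0, 1))" "integrable lborel (\<lambda>x. fd U x (0, 1) * \<psi> x)"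
        by (rule continuous_compact_support_integrable[OF _ K0];
          auto intro!: continuous_intros cU \<psi>(2) U(2) c\<psi> simp: \<psi>0 \<psi>'0)+
      ultimately show ?thesis by simp
    qed
    \<comment> \<open>h(U) times the time derivative of U is the time derivative of H(U), so the
      derivative can be moved onto \<Phi>.\<close>
    also have "\<dots> = integral\<^sup>L lborel (\<lambda>\<zeta>. \<Phi>' \<zeta> (0, 1) * H (U \<zeta>))"
    proof -
      have "integral\<^sup>L lborel (\<lambda>x. 1 * (\<Phi>' x (0, 1) * H (U x) + \<Phi> x * (h (U x) * fd U x (0, 1)))) = 0"
        by (rule integral_directional_derivative[OF \<eta>(1) \<eta>(2) K0]) (auto simp: \<Phi>(3))
      moreover have i1: "integrable lborel (\<lambda>x. fd U x (0, 1) * \<psi> x)"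
        by (rule continuous_compact_support_integrable[OF _ K0]) (auto intro!: continuous_intros U(2) c\<psi> simp: \<psi>0)
      moreover have "integrable lborel (\<lambda>x. \<Phi>' x (0, 1) * H (U x))"
      proof -
        have "integrable lborel (\<lambda>x. \<Phi>' x (0, 1) * H (U x) + \<Phi> x * (h (U x) * fd U x (0, 1)))"
          by (rule continuous_compact_support_integrable[OF \<eta>(2) K0]) (auto simp: \<Phi>(3) \<Phi>'0)
        from Bochner_Integration.integrable_diff[OF this i1] show ?thesis by (simp add: \<psi>_def mult_ac)
      qed
      ultimately show ?thesis by (simp add: \<psi>_def mult_ac)
    qed
    finally show ?thesis by simp
  qed
  have cg: "continuous_on UNIV (\<lambda>\<xi>. ggrad \<gamma> \<xi> (\<psi>' \<xi>))"
    by (intro continuous_on_ggrad \<gamma> \<psi>(2) continuous_intros)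
  have g0: "ggrad \<gamma> \<xi> (\<psi>' \<xi>) = 0" if "\<xi> \<notin> K0" for \<xi>
  proof -
    have "\<psi>' \<xi> = (\<lambda>_. 0)" using \<psi>'0[OF that] by blast
    then show ?thesis by simp
  qed
  have ig: "integrable lborel (\<lambda>\<xi>. ggrad \<gamma> \<xi> (\<psi>' \<xi>))"
    by (rule continuous_compact_support_integrable[OF cg K0 g0])
  \<comment> \<open>The formula for the horizontal gradient of U is available on \<open>K0\<close>
    only; off \<open>K0\<close> both sides vanish together with \<Phi>.\<close>
  have b_eq: "ggrad \<gamma> \<zeta> (\<psi>' \<zeta>) = b \<zeta>" for \<zeta>
  proof (cases "\<zeta> \<in> K0")
    case True
    have "\<psi>' \<zeta> = (\<lambda>e. h (U \<zeta>) * \<Phi>' \<zeta> e + (\<Phi> \<zeta> * h' (U \<zeta>)) * fd U \<zeta> e)"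
      by (simp add: \<psi>'_def fun_eq_iff)
    then show ?thesis
      using ggrad_conv_u[OF \<kappa> d True] by (simp add: ggrad_add ggrad_cmult b_def U_def)
  next
    case False
    have "\<Phi>' \<zeta> = (\<lambda>_. 0)" using \<Phi>'0[OF False] by blast
    then show ?thesis using g0[OF False] \<Phi>(3)[OF False] by (simp add: b_def)
  qed
  obtain B1 where B1: "norm (\<psi> x) \<le> B1" for x
    using continuous_compact_support_bounded[OF c\<psi> K0 \<psi>0] by metis
  obtain B2 where B2: "norm (ggrad \<gamma> \<xi> (\<psi>' \<xi>)) \<le> B2" for \<xi>
    using continuous_compact_support_bounded[OF cg K0 g0] by metis
  have [measurable]: "(\<lambda>\<xi>. ggrad \<gamma> \<xi> (\<psi>' \<xi>)) \<in> borel_measurable borel"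
    using cg by (rule borel_measurable_continuous_onI)
  have [measurable]: "gcomm \<gamma> \<kappa> \<psi> \<in> borel_measurable borel"
    by (rule gcomm_measurable[OF \<gamma> \<kappa>]) simp
  have i1: "integrable lborel (\<lambda>\<zeta>. F \<zeta> \<bullet> conv \<kappa> (\<lambda>\<xi>. ggrad \<gamma> \<xi> (\<psi>' \<xi>)) \<zeta>)"
    by (rule bounded_integrable_inner(1)[OF int_F]) (use conv_norm_le[OF \<kappa> ig B2] in auto)
  have i2: "integrable lborel (\<lambda>\<zeta>. F \<zeta> \<bullet> gcomm \<gamma> \<kappa> \<psi> \<zeta>)"
  proof (rule bounded_integrable_inner(1)[OF int_F])
    fix \<zeta> assume "F \<zeta> \<noteq> 0"
    then have "\<zeta> \<in> K1" using supp(3) by blast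
    then show "norm (gcomm \<gamma> \<kappa> \<psi> \<zeta>) \<le> real CARD('k) * (B1 * \<epsilon>)"
      using B1 by (intro gcomm_bound[OF \<gamma> \<kappa> _ _ K0 \<psi>0 e]) auto
  qed simp
  have P2: "integral\<^sup>L lborel (\<lambda>\<zeta>. F \<zeta> \<bullet> ggrad \<gamma> \<zeta> (fd (conv \<kappa> \<psi>) \<zeta>)) =
      integral\<^sup>L lborel (\<lambda>\<zeta>. conv \<kappa> F \<zeta> \<bullet> b \<zeta>) + integral\<^sup>L lborel (\<lambda>\<zeta>. F \<zeta> \<bullet> gcomm \<gamma> \<kappa> \<psi> \<zeta>)"
    unfolding grad\<psi> inner_add_right
    using i1 i2 sym[OF ig int_F] by (simp add: b_eq)
  have P3: "integral\<^sup>L lborel (\<lambda>\<zeta>. S \<zeta> * conv \<kappa> \<psi> \<zeta>) = integral\<^sup>L lborel (\<lambda>\<zeta>. conv \<kappa> S \<zeta> * \<psi> \<zeta>)"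
    using sym[OF i\<psi> int_S] by simp
  show ?thesis
    using weak_pde[OF sm z] unfolding P1 P2 P3 by (simp add: \<psi>_def[abs_def])
qed

end

section \<open>Removing the mollification: the weak chain rule\<close>

lemma modular_le_cmult:
  fixes f :: "'a::euclidean_space \<Rightarrow> 'b::euclidean_space" and g :: "'a \<Rightarrow> 'c::euclidean_space"
  assumes p: "0 \<le> p" and c: "0 \<le> c" and [measurable]: "g \<in> borel_measurable borel"
    and le: "\<And>x. norm (f x) \<le> c * norm (g x)"
  shows "modular p f \<le> ennreal (c powr p) * modular p g"
proof -
  have "modular p f \<le> (\<integral>\<^sup>+x. ennreal (c powr p) * ennreal (norm (g x) powr p) \<partial>lborel)"
    unfolding modular_def
  proof (rule nn_integral_mono)
    fix x
    have "norm (f x) powr p \<le> (c * norm (g x)) powr p"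
      using le[of x] p by (intro powr_mono2) auto
    then show "ennreal (norm (f x) powr p) \<le> ennreal (c powr p) * ennreal (norm (g x) powr p)"
      using c by (simp add: powr_mult ennreal_mult[symmetric] ennreal_leI)
  qed
  then show ?thesis by (simp add: modular_def nn_integral_cmult)
qed

lemma modular_bounded_finite:
  fixes f :: "'a::euclidean_space \<Rightarrow> 'b::euclidean_space"
  assumes p: "0 \<le> p" and K: "compact K" and B: "\<And>x. norm (f x) \<le> B" and supp: "\<And>x. x \<notin> K \<Longrightarrow> f x = 0"
  shows "modular p f < \<infinity>"
proof -
  have "modular p f \<le> (\<integral>\<^sup>+x. ennreal (B powr p) * indicator K x \<partial>lborel)"
    unfolding modular_def
    using B supp p by (intro nn_integral_mono) (auto simp: indicator_def intro!: ennreal_leI powr_mono2)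
  also have "\<dots> < \<infinity>"
    using borel_compact[OF K] emeasure_compact_finite[OF K]
    by (simp add: nn_integral_cmult_indicator ennreal_mult_less_top)
  finally show ?thesis .
qed

lemma modular_1: "modular 1 f = (\<integral>\<^sup>+x. ennreal (norm (f x)) \<partial>lborel)"
  by (simp add: modular_def)

lemma integrable_modular_1:
  fixes f :: "'a::euclidean_space \<Rightarrow> 'b::euclidean_space"
  shows "integrable lborel f \<Longrightarrow> modular 1 f < \<infinity>"
  by (simp add: modular_1 integrable_iff_bounded)

lemma integrable_conv:
  fixes f :: "'a::euclidean_space \<Rightarrow> real"
  assumes \<kappa>: "mollifier \<kappa> d" and f: "integrable lborel f" and K: "compact K" and supp: "\<And>x. x \<notin> K \<Longrightarrow> f x = 0"
  shows "integrable lborel (conv \<kappa> f)"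
proof -
  have "smooth (conv \<kappa> f)"
    by (rule conv_smooth[OF mollifierD(1)[OF \<kappa>] compact_cball _ f]) (rule mollifierD(5)[OF \<kappa>])
  then have c: "continuous_on UNIV (conv \<kappa> f)" using Ck_on_imp_continuous by blast
  have K': "compact {x + y |x y. x \<in> K \<and> y \<in> cball 0 d}"
    by (rule compact_sums[OF K compact_cball])
  show ?thesis
  proof (rule continuous_compact_support_integrable[OF c K'])
    fix x assume x: "x \<notin> {x + y |x y. x \<in> K \<and> y \<in> cball 0 d}"
    show "conv \<kappa> f x = 0"
    proof (rule conv_mollifier_support[OF \<kappa> supp])
      fix \<xi> assume "dist x \<xi> < d"
      then have "x = \<xi> + (x - \<xi>)" "x - \<xi> \<in> cball 0 d" by (auto simp: dist_norm norm_minus_commute)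
      with x show "\<xi> \<notin> K" by blast
    qed
  qed
qed

lemma bounded_on_positive_interval:
  fixes f :: "real \<Rightarrow> real"
  assumes f: "continuous_on {0<..} f" and a: "0 < a"
  obtains B where "0 \<le> B" "\<And>s. a \<le> s \<Longrightarrow> s \<le> b \<Longrightarrow> \<bar>f s\<bar> \<le> B"
proof -
  have "bounded (f ` {a..b})"
    using a by (intro compact_imp_bounded compact_continuous_image continuous_on_subset[OF f]) auto
  then obtain B where "B > 0" "\<forall>x\<in>f ` {a..b}. norm x \<le> B"
    unfolding bounded_pos by blast
  then show ?thesis by (intro that[of B]) auto
qed

context local_weak_solution
begin

text \<open>The outcome of formally testing the equation with \<Phi> h(u). In the mollified identity
  the time term converges by domination, the source by L^1 convergence against a bounded factor, the
  flux term by pairing L^(p/(p-1)) with L^p, and both commutators disappear in the limit.\<close>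

lemma weak_chain_rule:
  assumes \<Phi>: "\<And>x. (\<Phi> has_derivative \<Phi>' x) (at x)" "\<And>e. continuous_on UNIV (\<lambda>x. \<Phi>' x e)" "\<And>x. x \<notin> K0 \<Longrightarrow> \<Phi> x = 0"
    and h: "\<And>s. 0 < s \<Longrightarrow> (h has_real_derivative h' s) (at s)" "continuous_on {0<..} h'"
    and H: "\<And>s. 0 < s \<Longrightarrow> (H has_real_derivative h s) (at s)"
    and hm [measurable]: "h \<in> borel_measurable borel" "h' \<in> borel_measurable borel" "H \<in> borel_measurable borel"
  shows "- integral\<^sup>L lborel (\<lambda>\<zeta>. \<Phi>' \<zeta> (0, 1) * H (u \<zeta>)) =
      - integral\<^sup>L lborel (\<lambda>\<zeta>. F \<zeta> \<bullet> (h (u \<zeta>) *\<^sub>R ggrad \<gamma> \<zeta> (\<Phi>' \<zeta>) + (\<Phi> \<zeta> * h' (u \<zeta>)) *\<^sub>R G \<zeta>))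
      + integral\<^sup>L lborel (\<lambda>\<zeta>. S \<zeta> * (\<Phi> \<zeta> * h (u \<zeta>)))"
proof -
  have ch: "continuous_on {0<..} h" "continuous_on {0<..} H"
    using h(1) H by (auto intro!: continuous_at_imp_continuous_on DERIV_isCont)
  obtain Bh where Bh: "0 \<le> Bh" "\<And>s. c0 \<le> s \<Longrightarrow> s \<le> c1 \<Longrightarrow> \<bar>h s\<bar> \<le> Bh"
    using bounded_on_positive_interval[OF ch(1) c0] by metis
  obtain Bh' where Bh': "0 \<le> Bh'" "\<And>s. c0 \<le> s \<Longrightarrow> s \<le> c1 \<Longrightarrow> \<bar>h' s\<bar> \<le> Bh'"
    using bounded_on_positive_interval[OF h(2) c0] by metis
  obtain BH where BH: "0 \<le> BH" "\<And>s. c0 \<le> s \<Longrightarrow> s \<le> c1 \<Longrightarrow> \<bar>H s\<bar> \<le> BH"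
    using bounded_on_positive_interval[OF ch(2) c0] by metis
  have c\<Phi>: "continuous_on UNIV \<Phi>"
    using \<Phi>(1) by (auto intro!: continuous_at_imp_continuous_on has_derivative_continuous)
  have \<Phi>'0: "\<Phi>' x e = 0" if "x \<notin> K0" for x e
    using derivative_zero_outside[OF \<Phi>(1) compact_imp_closed[OF K0] \<Phi>(3) that] .
  have g\<Phi>0: "ggrad \<gamma> x (\<Phi>' x) = 0" if "x \<notin> K0" for x
  proof -
    have "\<Phi>' x = (\<lambda>_. 0)" using \<Phi>'0[OF that] by blast
    then show ?thesis by simp
  qed
  have cg\<Phi>: "continuous_on UNIV (\<lambda>x. ggrad \<gamma> x (\<Phi>' x))"
    by (intro continuous_on_ggrad \<gamma> \<Phi>(2) continuous_intros)
  obtain B\<Phi> where B\<Phi>: "0 < B\<Phi>" "\<And>x. norm (\<Phi> x) \<le> B\<Phi>"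
    using continuous_compact_support_bounded[OF c\<Phi> K0 \<Phi>(3)] by metis
  obtain Bg where Bg: "0 < Bg" "\<And>x. norm (ggrad \<gamma> x (\<Phi>' x)) \<le> Bg"
    using continuous_compact_support_bounded[OF cg\<Phi> K0 g\<Phi>0] by metis
  have [measurable]: "\<Phi> \<in> borel_measurable borel" "(\<lambda>x. ggrad \<gamma> x (\<Phi>' x)) \<in> borel_measurable borel"
      "(\<lambda>x. \<Phi>' x e) \<in> borel_measurable borel" for e
    by (rule borel_measurable_continuous_onI, rule c\<Phi> cg\<Phi> \<Phi>(2))+
  have [measurable]: "K0 \<in> sets borel" using K0 by (rule borel_compact)
  \<comment> \<open>One number bounds both the radius of the n-th kernel and its commutator
    integrals; the minimum keeps the radius within the margin \<open>d0\<close>.\<close>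
  define \<delta> where "\<delta> n = min d0 (inverse (real (Suc n)))" for n
  have \<delta>: "0 < \<delta> n" "\<delta> n \<le> d0" for n using d0 by (auto simp: \<delta>_def)
  have "(\<lambda>n. min d0 (inverse (real (Suc n)))) \<longlonglongrightarrow> min d0 0"
    by (intro tendsto_min tendsto_const LIMSEQ_inverse_real_of_nat)
  then have \<delta>0: "\<delta> \<longlonglongrightarrow> 0" using d0 by (simp add: \<delta>_def[abs_def])
  obtain R where R: "\<And>x. x \<in> K1 \<Longrightarrow> norm x \<le> R"
    using compact_imp_bounded[OF K1] unfolding bounded_iff by blast
  have "\<forall>n. \<exists>\<kappa>. mollifier \<kappa> (\<delta> n) \<and> (\<forall>\<zeta> j. \<zeta> \<in> K1 \<longrightarrow>
      integral\<^sup>L lborel (\<lambda>\<xi>. \<bar>grushin_weight \<gamma> (fst \<zeta>) - grushin_weight \<gamma> (fst (\<zeta> - \<xi>))\<bar> *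
        \<bar>fd \<kappa> \<xi> ((0, axis j 1), 0)\<bar>) \<le> \<delta> n)"
  proof
    fix n
    obtain \<kappa> :: "('m, 'k) point \<times> real \<Rightarrow> real" where "mollifier \<kappa> (\<delta> n)"
      "\<And>\<zeta> j. norm \<zeta> \<le> R \<Longrightarrow> integral\<^sup>L lborel (\<lambda>\<xi>. \<bar>grushin_weight \<gamma> (fst \<zeta>) - grushin_weight \<gamma> (fst (\<zeta> - \<xi>))\<bar> *
        \<bar>fd \<kappa> \<xi> ((0, axis j 1), 0)\<bar>) \<le> \<delta> n"
      using ex_grushin_mollifier[OF \<gamma> \<delta>(1)] by blast
    with R show "\<exists>\<kappa>. mollifier \<kappa> (\<delta> n) \<and> (\<forall>\<zeta> j. \<zeta> \<in> K1 \<longrightarrow>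
      integral\<^sup>L lborel (\<lambda>\<xi>. \<bar>grushin_weight \<gamma> (fst \<zeta>) - grushin_weight \<gamma> (fst (\<zeta> - \<xi>))\<bar> *
        \<bar>fd \<kappa> \<xi> ((0, axis j 1), 0)\<bar>) \<le> \<delta> n)" by blast
  qed
  from choice[OF this] obtain \<kappa> where \<kappa>: "\<And>n. mollifier (\<kappa> n) (\<delta> n)"
    and \<kappa>c: "\<And>n \<zeta> j. \<zeta> \<in> K1 \<Longrightarrow>
      integral\<^sup>L lborel (\<lambda>\<xi>. \<bar>grushin_weight \<gamma> (fst \<zeta>) - grushin_weight \<gamma> (fst (\<zeta> - \<xi>))\<bar> *
        \<bar>fd (\<kappa> n) \<xi> ((0, axis j 1), 0)\<bar>) \<le> \<delta> n" by blast
  note [measurable] = mollifierD(9)[OF \<kappa>]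
  have "(\<lambda>n. modular 1 (\<lambda>x. conv (\<kappa> n) u x - u x)) \<longlonglongrightarrow> 0"
    by (rule conv_modular_tendsto[OF _ _ integrable_modular_1[OF int_u] K1 supp(1) \<kappa> \<delta>0]) auto
  moreover have iu: "integrable lborel (\<lambda>x. conv (\<kappa> n) u x - u x)" for n
    by (intro Bochner_Integration.integrable_diff int_u integrable_conv[OF \<kappa> int_u K1 supp(1)])
  ultimately have "(\<lambda>n. integral\<^sup>L lborel (\<lambda>x. norm (conv (\<kappa> n) u x - u x))) \<longlonglongrightarrow> 0"
    using tendsto_enn2real[of "\<lambda>n. modular 1 (\<lambda>x. conv (\<kappa> n) u x - u x)" 0 sequentially]
      modular_eq_integral(2)[OF _ integrable_modular_1[OF iu]] by simp
  \<comment> \<open>The nonlinear functions h, h' and H of the mollified solution need pointwise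
    convergence, which L^1 convergence gives along a subsequence.\<close>
  from tendsto_L1_AE_subseq[OF iu this] obtain r where r: "strict_mono r"
    and rlim: "AE x in lborel. (\<lambda>n. conv (\<kappa> (r n)) u x - u x) \<longlonglongrightarrow> 0" by blast
  define k where "k n = \<kappa> (r n)" for n
  define e where "e n = \<delta> (r n)" for n
  have k: "mollifier (k n) (e n)" for n using \<kappa> by (simp add: k_def e_def)
  have e: "0 < e n" "e n \<le> d0" for n using \<delta> by (simp_all add: e_def)
  have e0: "e \<longlonglongrightarrow> 0" using LIMSEQ_subseq_LIMSEQ[OF \<delta>0 r] by (simp add: e_def[abs_def] o_def)
  have kc: "integral\<^sup>L lborel (\<lambda>\<xi>. \<bar>grushin_weight \<gamma> (fst \<zeta>) - grushin_weight \<gamma> (fst (\<zeta> - \<xi>))\<bar> *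
        \<bar>fd (k n) \<xi> ((0, axis j 1), 0)\<bar>) \<le> e n" if "\<zeta> \<in> K1" for n \<zeta> j
    using \<kappa>c[OF that] by (simp add: k_def e_def)
  note [measurable] = mollifierD(9)[OF k]
  define U where "U n = conv (k n) u" for n
  have [measurable]: "U n \<in> borel_measurable borel" for n by (simp add: U_def)
  have Ulim: "AE x in lborel. (\<lambda>n. U n x) \<longlonglongrightarrow> u x"
    using rlim by eventually_elim (auto simp: U_def k_def intro: LIM_zero_cancel)
  have Ub: "c0 \<le> U n x" "U n x \<le> c1" if "x \<in> K0" for n x
    using conv_u_bounds[OF k e(2) that] by (auto simp: U_def)
  have ub: "c0 \<le> u x" "u x \<le> c1" if "x \<in> K0" for x
    using u_bounds[of x] K0_subset that by auto
  have comp: "(\<lambda>n. A (U n x)) \<longlonglongrightarrow> A (u x)"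
    if "(\<lambda>n. U n x) \<longlonglongrightarrow> u x" "x \<in> K0" "continuous_on {0<..} A" for A :: "real \<Rightarrow> real" and x
    using that ub[OF that(2)] c0
    by (intro isCont_tendsto_compose[OF _ that(1)]) (auto simp: continuous_on_eq_continuous_at)
  define Cg where "Cg = real CARD('k) * (max 0 c1 * d0)"
  have gc: "norm (gcomm \<gamma> (k n) u \<zeta>) \<le> real CARD('k) * (max 0 c1 * e n)" if "\<zeta> \<in> K1" for n \<zeta>
    by (rule gcomm_bound[OF \<gamma> k _ abs_u_le K1 supp(1)]) (use kc[OF that] in auto)
  have gc': "norm (gcomm \<gamma> (k n) u \<zeta>) \<le> Cg" if "\<zeta> \<in> K1" for n \<zeta>
    unfolding Cg_def by (rule order_trans[OF gc[OF that]]) (intro mult_left_mono e(2); simp)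
  have Cg: "0 \<le> Cg" using d0 by (simp add: Cg_def)
  have [measurable]: "gcomm \<gamma> (k n) u \<in> borel_measurable borel" for n
    by (rule gcomm_measurable[OF \<gamma> k]) simp
  define B where "B n \<zeta> = h (U n \<zeta>) *\<^sub>R ggrad \<gamma> \<zeta> (\<Phi>' \<zeta>) + (\<Phi> \<zeta> * h' (U n \<zeta>)) *\<^sub>R (conv (k n) G \<zeta> + gcomm \<gamma> (k n) u \<zeta>)" for n \<zeta>
  \<comment> \<open>An intermediate field with the coefficients of \<open>B n\<close> but the
    unmollified \<open>G\<close>. Since \<open>G\<close> is fixed, \<open>B1 n\<close> tends to
    \<open>b\<close> by domination, while \<open>B n - B1 n\<close> is a bounded multiple of conv (k
    n) G - G.\<close>
  define B1 where "B1 n \<zeta> = h (U n \<zeta>) *\<^sub>R ggrad \<gamma> \<zeta> (\<Phi>' \<zeta>) + (\<Phi> \<zeta> * h' (U n \<zeta>)) *\<^sub>R (G \<zeta> + gcomm \<gamma> (k n) u \<zeta>)" for n \<zeta>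
  define b where "b \<zeta> = h (u \<zeta>) *\<^sub>R ggrad \<gamma> \<zeta> (\<Phi>' \<zeta>) + (\<Phi> \<zeta> * h' (u \<zeta>)) *\<^sub>R G \<zeta>" for \<zeta>
  have [measurable]: "B n \<in> borel_measurable borel" "B1 n \<in> borel_measurable borel" "b \<in> borel_measurable borel" for n
    unfolding B_def[abs_def] B1_def[abs_def] b_def[abs_def] by measurable
  have id: "- integral\<^sup>L lborel (\<lambda>\<zeta>. \<Phi>' \<zeta> (0, 1) * H (U n \<zeta>)) =
      - integral\<^sup>L lborel (\<lambda>\<zeta>. conv (k n) F \<zeta> \<bullet> B n \<zeta>) - integral\<^sup>L lborel (\<lambda>\<zeta>. F \<zeta> \<bullet> gcomm \<gamma> (k n) (\<lambda>\<zeta>. \<Phi> \<zeta> * h (U n \<zeta>)) \<zeta>)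
      + integral\<^sup>L lborel (\<lambda>\<zeta>. conv (k n) S \<zeta> * (\<Phi> \<zeta> * h (U n \<zeta>)))" for n
    unfolding U_def B_def
    by (rule mollified_identity[OF k e(2) kc \<Phi>(1,2)]) (use \<Phi>(3) h H in auto)
  have T1: "(\<lambda>n. integral\<^sup>L lborel (\<lambda>\<zeta>. \<Phi>' \<zeta> (0, 1) * H (U n \<zeta>))) \<longlonglongrightarrow> integral\<^sup>L lborel (\<lambda>\<zeta>. \<Phi>' \<zeta> (0, 1) * H (u \<zeta>))"
  proof (rule integral_dominated_convergence[where w="\<lambda>\<zeta>. \<bar>\<Phi>' \<zeta> (0, 1)\<bar> * BH"])
    show "integrable lborel (\<lambda>\<zeta>. \<bar>\<Phi>' \<zeta> (0, 1)\<bar> * BH)"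
      using continuous_compact_support_integrable[OF \<Phi>(2) K0 \<Phi>'0] by auto
    show "AE x in lborel. (\<lambda>n. \<Phi>' x (0, 1) * H (U n x)) \<longlonglongrightarrow> \<Phi>' x (0, 1) * H (u x)"
      using Ulim
    proof eventually_elim
      case (elim x)
      show ?case
      proof (cases "x \<in> K0")
        case True
        show ?thesis by (intro tendsto_intros comp[OF elim True] ch)
      qed (simp add: \<Phi>'0)
    qed
    show "AE x in lborel. norm (\<Phi>' x (0, 1) * H (U n x)) \<le> \<bar>\<Phi>' x (0, 1)\<bar> * BH" for n
    proof (rule AE_I2)
      fix x
      show "norm (\<Phi>' x (0, 1) * H (U n x)) \<le> \<bar>\<Phi>' x (0, 1)\<bar> * BH"
        using BH(2)[of "U n x"] Ub[of x n] \<Phi>'0[of x] by (cases "x \<in> K0") (auto simp: abs_mult intro!: mult_left_mono)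
    qed
  qed auto
  define B\<psi> where "B\<psi> = B\<Phi> * Bh"
  have \<psi>b: "\<bar>\<Phi> x * h (U n x)\<bar> \<le> B\<psi>" for n x
    using B\<Phi>(1) B\<Phi>(2)[of x] Bh(1) Bh(2)[of "U n x"] Ub[of x n] \<Phi>(3)[of x]
    by (cases "x \<in> K0") (auto simp: B\<psi>_def abs_mult intro!: mult_mono)
  \<comment> \<open>The functions \<Phi> h(U n) are bounded uniformly in n, and the commutator bound
    involves nothing else about them; so this term is of the order of \<open>e n\<close>.\<close>
  have T3: "(\<lambda>n. integral\<^sup>L lborel (\<lambda>\<zeta>. F \<zeta> \<bullet> gcomm \<gamma> (k n) (\<lambda>\<zeta>. \<Phi> \<zeta> * h (U n \<zeta>)) \<zeta>)) \<longlonglongrightarrow> 0"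
  proof (rule Lim_null_comparison)
    show "\<forall>\<^sub>F n in sequentially. norm (integral\<^sup>L lborel (\<lambda>\<zeta>. F \<zeta> \<bullet> gcomm \<gamma> (k n) (\<lambda>\<zeta>. \<Phi> \<zeta> * h (U n \<zeta>)) \<zeta>)) \<le>
        real CARD('k) * (B\<psi> * e n) * integral\<^sup>L lborel (\<lambda>x. norm (F x))"
    proof (rule always_eventually, rule)
      fix n
      show "norm (integral\<^sup>L lborel (\<lambda>\<zeta>. F \<zeta> \<bullet> gcomm \<gamma> (k n) (\<lambda>\<zeta>. \<Phi> \<zeta> * h (U n \<zeta>)) \<zeta>)) \<le>
        real CARD('k) * (B\<psi> * e n) * integral\<^sup>L lborel (\<lambda>x. norm (F x))"
        unfolding real_norm_def
      proof (rule bounded_integrable_inner(2)[OF int_F])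
        show "gcomm \<gamma> (k n) (\<lambda>\<zeta>. \<Phi> \<zeta> * h (U n \<zeta>)) \<in> borel_measurable borel"
          by (rule gcomm_measurable[OF \<gamma> k]) simp
        fix \<zeta> assume "F \<zeta> \<noteq> 0"
        then have "\<zeta> \<in> K1" using supp(3) by blast
        then show "norm (gcomm \<gamma> (k n) (\<lambda>\<zeta>. \<Phi> \<zeta> * h (U n \<zeta>)) \<zeta>) \<le> real CARD('k) * (B\<psi> * e n)"
          by (intro gcomm_bound[OF \<gamma> k _ \<psi>b K0] kc) (auto simp: \<Phi>(3))
      qed
    qed
    have "(\<lambda>n. real CARD('k) * (B\<psi> * e n) * integral\<^sup>L lborel (\<lambda>x. norm (F x))) \<longlonglongrightarrow>
        real CARD('k) * (B\<psi> * 0) * integral\<^sup>L lborel (\<lambda>x. norm (F x))"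
      by (intro tendsto_intros e0)
    then show "(\<lambda>n. real CARD('k) * (B\<psi> * e n) * integral\<^sup>L lborel (\<lambda>x. norm (F x))) \<longlonglongrightarrow> 0" by simp
  qed
  have T4: "(\<lambda>n. integral\<^sup>L lborel (\<lambda>\<zeta>. conv (k n) S \<zeta> * (\<Phi> \<zeta> * h (U n \<zeta>)))) \<longlonglongrightarrow> integral\<^sup>L lborel (\<lambda>\<zeta>. S \<zeta> * (\<Phi> \<zeta> * h (u \<zeta>)))"
  proof -
    have iS: "integrable lborel (\<lambda>x. conv (k n) S x - S x)" for n
      by (intro Bochner_Integration.integrable_diff int_S integrable_conv[OF k int_S K1 supp(4)])
    have "(\<lambda>n. modular 1 (\<lambda>x. conv (k n) S x - S x)) \<longlonglongrightarrow> 0"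
      by (rule conv_modular_tendsto[OF _ _ integrable_modular_1[OF int_S] K1 supp(4) k e0]) auto
    then have S0: "(\<lambda>n. integral\<^sup>L lborel (\<lambda>x. norm (conv (k n) S x - S x))) \<longlonglongrightarrow> 0"
      using tendsto_enn2real[of "\<lambda>n. modular 1 (\<lambda>x. conv (k n) S x - S x)" 0 sequentially]
        modular_eq_integral(2)[OF _ integrable_modular_1[OF iS]] by simp
    have bi: "integrable lborel (\<lambda>\<zeta>. (conv (k n) S \<zeta> - S \<zeta>) * (\<Phi> \<zeta> * h (U n \<zeta>)))"
      "\<bar>integral\<^sup>L lborel (\<lambda>\<zeta>. (conv (k n) S \<zeta> - S \<zeta>) * (\<Phi> \<zeta> * h (U n \<zeta>)))\<bar> \<le>
        B\<psi> * integral\<^sup>L lborel (\<lambda>x. norm (conv (k n) S x - S x))" for n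
      using bounded_integrable_inner[OF iS[of n], of "\<lambda>\<zeta>. \<Phi> \<zeta> * h (U n \<zeta>)" B\<psi>] \<psi>b by simp_all
    have "(\<lambda>n. integral\<^sup>L lborel (\<lambda>\<zeta>. (conv (k n) S \<zeta> - S \<zeta>) * (\<Phi> \<zeta> * h (U n \<zeta>)))) \<longlonglongrightarrow> 0"
    proof (rule Lim_null_comparison)
      show "\<forall>\<^sub>F n in sequentially. norm (integral\<^sup>L lborel (\<lambda>\<zeta>. (conv (k n) S \<zeta> - S \<zeta>) * (\<Phi> \<zeta> * h (U n \<zeta>)))) \<le>
          B\<psi> * integral\<^sup>L lborel (\<lambda>x. norm (conv (k n) S x - S x))"
        using bi(2) by (intro always_eventually allI) simp
      show "(\<lambda>n. B\<psi> * integral\<^sup>L lborel (\<lambda>x. norm (conv (k n) S x - S x))) \<longlonglongrightarrow> 0"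
        using tendsto_mult_left[OF S0, of B\<psi>] by simp
    qed
    moreover have "(\<lambda>n. integral\<^sup>L lborel (\<lambda>\<zeta>. S \<zeta> * (\<Phi> \<zeta> * h (U n \<zeta>)))) \<longlonglongrightarrow> integral\<^sup>L lborel (\<lambda>\<zeta>. S \<zeta> * (\<Phi> \<zeta> * h (u \<zeta>)))"
    proof (rule integral_dominated_convergence[where w="\<lambda>x. \<bar>S x\<bar> * B\<psi>"])
      show "AE x in lborel. (\<lambda>n. S x * (\<Phi> x * h (U n x))) \<longlonglongrightarrow> S x * (\<Phi> x * h (u x))"
        using Ulim
      proof eventually_elim
        case (elim x)
        show ?case
        proof (cases "x \<in> K0")
          case True
          show ?thesis by (intro tendsto_intros comp[OF elim True] ch)
        qed (simp add: \<Phi>(3))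
      qed
      show "AE x in lborel. norm (S x * (\<Phi> x * h (U n x))) \<le> \<bar>S x\<bar> * B\<psi>" for n
        unfolding real_norm_def abs_mult[of "S _"] using \<psi>b by (intro AE_I2 mult_left_mono) auto
    qed (use int_S in auto)
    ultimately have "(\<lambda>n. integral\<^sup>L lborel (\<lambda>\<zeta>. (conv (k n) S \<zeta> - S \<zeta>) * (\<Phi> \<zeta> * h (U n \<zeta>))) +
        integral\<^sup>L lborel (\<lambda>\<zeta>. S \<zeta> * (\<Phi> \<zeta> * h (U n \<zeta>)))) \<longlonglongrightarrow> 0 + integral\<^sup>L lborel (\<lambda>\<zeta>. S \<zeta> * (\<Phi> \<zeta> * h (u \<zeta>)))"
      by (rule tendsto_add)
    moreover have "integral\<^sup>L lborel (\<lambda>\<zeta>. (conv (k n) S \<zeta> - S \<zeta>) * (\<Phi> \<zeta> * h (U n \<zeta>))) +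
        integral\<^sup>L lborel (\<lambda>\<zeta>. S \<zeta> * (\<Phi> \<zeta> * h (U n \<zeta>))) = integral\<^sup>L lborel (\<lambda>\<zeta>. conv (k n) S \<zeta> * (\<Phi> \<zeta> * h (U n \<zeta>)))" for n
    proof -
      have "integrable lborel (\<lambda>\<zeta>. (conv (k n) S \<zeta> - S \<zeta>) * (\<Phi> \<zeta> * h (U n \<zeta>)))"
        by (rule bi(1))
      moreover have "integrable lborel (\<lambda>\<zeta>. S \<zeta> * (\<Phi> \<zeta> * h (U n \<zeta>)))"
        using bounded_integrable_inner(1)[OF int_S, of "\<lambda>\<zeta>. \<Phi> \<zeta> * h (U n \<zeta>)" B\<psi>] \<psi>b by simp
      ultimately show ?thesis
        by (subst Bochner_Integration.integral_add[symmetric]) (auto simp: left_diff_distrib)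
    qed
    ultimately show ?thesis by simp
  qed
  define q where "q = p / (p - 1)"
  have q: "1 \<le> q" using p by (simp add: q_def field_simps)
  have T2: "(\<lambda>n. integral\<^sup>L lborel (\<lambda>\<zeta>. conv (k n) F \<zeta> \<bullet> B n \<zeta>)) \<longlonglongrightarrow> integral\<^sup>L lborel (\<lambda>\<zeta>. F \<zeta> \<bullet> b \<zeta>)"
  proof (rule modular_pairing_tendsto[OF p q_def])
    show "(\<lambda>n. modular q (\<lambda>x. conv (k n) F x - F x)) \<longlonglongrightarrow> 0"
      by (rule conv_modular_tendsto[OF q _ _ K1 supp(3) k e0]) (use fin in \<open>auto simp: q_def\<close>)
    have Gterm: "norm ((\<Phi> x * h' (s x)) *\<^sub>R y) \<le> B\<Phi> * Bh' * norm y"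
      if "x \<in> K0 \<Longrightarrow> c0 \<le> s x \<and> s x \<le> c1" for x y and s :: "('m, 'k) point \<times> real \<Rightarrow> real"
    proof -
      have "\<bar>\<Phi> x * h' (s x)\<bar> \<le> B\<Phi> * Bh'"
        using that B\<Phi>(1) B\<Phi>(2)[of x] Bh'(1) Bh'(2)[of "s x"] \<Phi>(3)[of x]
        by (cases "x \<in> K0") (auto simp: abs_mult intro!: mult_mono)
      then show ?thesis by (simp add: mult_right_mono)
    qed
    have gterm: "norm (h (s x) *\<^sub>R ggrad \<gamma> x (\<Phi>' x)) \<le> Bh * Bg * indicator K0 x"
      if "x \<in> K0 \<Longrightarrow> c0 \<le> s x \<and> s x \<le> c1" for x and s :: "('m, 'k) point \<times> real \<Rightarrow> real"
      using that Bg(1) Bg(2)[of x] Bh(1) Bh(2)[of "s x"] g\<Phi>0[of x]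
      by (cases "x \<in> K0") (auto intro!: mult_mono)
    have p0: "0 \<le> p" "0 < p" "1 \<le> p" using p by auto
    show "modular p b < \<infinity>"
      unfolding b_def
    proof (rule modular_finite_add[OF p0(1)])
      have "norm (h (u x) *\<^sub>R ggrad \<gamma> x (\<Phi>' x)) \<le> Bh * Bg" for x
      proof (rule order_trans[OF gterm[of x u]])
        show "c0 \<le> u x \<and> u x \<le> c1" if "x \<in> K0" using ub[OF that] by simp
        show "Bh * Bg * indicator K0 x \<le> Bh * Bg" using Bh(1) Bg(1) by (simp add: indicator_def)
      qed
      then show "modular p (\<lambda>x. h (u x) *\<^sub>R ggrad \<gamma> x (\<Phi>' x)) < \<infinity>"
        by (rule modular_bounded_finite[OF p0(1) K0]) (simp add: g\<Phi>0)
      have "modular p (\<lambda>x. (\<Phi> x * h' (u x)) *\<^sub>R G x) \<le> ennreal ((B\<Phi> * Bh') powr p) * modular p G"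
        using B\<Phi>(1) Bh'(1) ub by (intro modular_le_cmult p0 Gterm) simp_all
      also have "\<dots> < \<infinity>" using fin(1) by (simp add: ennreal_mult_less_top)
      finally show "modular p (\<lambda>x. (\<Phi> x * h' (u x)) *\<^sub>R G x) < \<infinity>" .
    qed auto
    have L1: "(\<lambda>n. modular p (\<lambda>x. B1 n x - b x)) \<longlonglongrightarrow> 0"
    proof (rule modular_tendsto_dominated[OF p0(2)])
      \<comment> \<open>Collects the bounds of the summands of \<open>B1 n x - b x\<close>: those
        not involving |G x| and those proportional to it.\<close>
      define c where "c = 2 * (Bh * Bg) + B\<Phi> * Bh' * Cg + 2 * (B\<Phi> * Bh')"
      have c: "0 \<le> c" "2 * (Bh * Bg) + B\<Phi> * Bh' * Cg \<le> c" "2 * (B\<Phi> * Bh') \<le> c"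
        using Bh Bg B\<Phi> Bh' Cg by (auto simp: c_def)
      define w where "w x = 2 powr p * ((c * indicator K0 x) powr p + (c * norm (G x)) powr p)" for x
      show "AE x in lborel. norm (B1 n x - b x) powr p \<le> w x" for n
      proof (rule AE_I2)
        fix x
        have "norm (B1 n x - b x) \<le> c * indicator K0 x + c * norm (G x)"
        proof (cases "x \<in> K0")
          case True
          have "norm (B1 n x - b x) \<le> norm (h (U n x) *\<^sub>R ggrad \<gamma> x (\<Phi>' x)) + norm ((\<Phi> x * h' (U n x)) *\<^sub>R (G x + gcomm \<gamma> (k n) u x))
              + (norm (h (u x) *\<^sub>R ggrad \<gamma> x (\<Phi>' x)) + norm ((\<Phi> x * h' (u x)) *\<^sub>R G x))"
            unfolding B1_def b_def by (intro order_trans[OF norm_triangle_ineq4] add_mono norm_triangle_ineq)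
          also have "\<dots> \<le> Bh * Bg * indicator K0 x + B\<Phi> * Bh' * (norm (G x) + Cg) + (Bh * Bg * indicator K0 x + B\<Phi> * Bh' * norm (G x))"
          proof (intro add_mono gterm)
            have "norm (G x + gcomm \<gamma> (k n) u x) \<le> norm (G x) + Cg"
              using norm_triangle_ineq[of "G x" "gcomm \<gamma> (k n) u x"] gc'[OF subsetD[OF K0_subset True], of n] by linarith
            then have "B\<Phi> * Bh' * norm (G x + gcomm \<gamma> (k n) u x) \<le> B\<Phi> * Bh' * (norm (G x) + Cg)"
              using B\<Phi> Bh' by (intro mult_left_mono) auto
            moreover have "norm ((\<Phi> x * h' (U n x)) *\<^sub>R (G x + gcomm \<gamma> (k n) u x)) \<le> B\<Phi> * Bh' * norm (G x + gcomm \<gamma> (k n) u x)"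
              by (rule Gterm) (use Ub in auto)
            ultimately show "norm ((\<Phi> x * h' (U n x)) *\<^sub>R (G x + gcomm \<gamma> (k n) u x)) \<le> B\<Phi> * Bh' * (norm (G x) + Cg)" by linarith
            show "norm ((\<Phi> x * h' (u x)) *\<^sub>R G x) \<le> B\<Phi> * Bh' * norm (G x)" by (rule Gterm) (use ub in auto)
          qed (use Ub ub in auto)
          also have "\<dots> = (2 * (Bh * Bg) + B\<Phi> * Bh' * Cg) + 2 * (B\<Phi> * Bh') * norm (G x)"
            using True by (simp add: algebra_simps)
          also have "\<dots> \<le> c + c * norm (G x)"
            using c by (intro add_mono mult_right_mono) auto
          finally show ?thesis using True by simp
        next
          case False
          then show ?thesis using g\<Phi>0[OF False] \<Phi>(3)[OF False] c by (simp add: B1_def b_def)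
        qed
        then have "norm (B1 n x - b x) powr p \<le> (c * indicator K0 x + c * norm (G x)) powr p"
          using p0 by (intro powr_mono2) auto
        also have "\<dots> \<le> w x"
          unfolding w_def using c p0 by (intro powr_add_le) auto
        finally show "norm (B1 n x - b x) powr p \<le> w x" .
      qed
      have "modular p (\<lambda>x. c *\<^sub>R (indicator K0 x :: real)) < \<infinity>"
        by (rule modular_bounded_finite[OF p0(1) K0, of _ c]) (use c in \<open>auto simp: indicator_def\<close>)
      moreover have "modular p (\<lambda>x. c *\<^sub>R G x) < \<infinity>"
        using modular_le_cmult[OF p0(1) c(1), of G "\<lambda>x. c *\<^sub>R G x"] c fin(1)
        by (auto simp: ennreal_mult_less_top intro: le_less_trans)
      ultimately have "ennreal (2 powr p) * (modular p (\<lambda>x. c *\<^sub>R (indicator K0 x :: real)) + modular p (\<lambda>x. c *\<^sub>R G x)) < \<infinity>"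
        by (simp add: ennreal_mult_less_top)
      also have "ennreal (2 powr p) * (modular p (\<lambda>x. c *\<^sub>R (indicator K0 x :: real)) + modular p (\<lambda>x. c *\<^sub>R G x)) = (\<integral>\<^sup>+x. ennreal (w x) \<partial>lborel)"
        unfolding modular_def w_def using c
        by (subst nn_integral_add[symmetric], simp, simp, subst nn_integral_cmult[symmetric], simp)
          (simp add: abs_mult ennreal_mult)
      finally show "(\<integral>\<^sup>+x. ennreal (w x) \<partial>lborel) < \<infinity>" .
      show "w \<in> borel_measurable borel" unfolding w_def[abs_def] by measurable
      show "AE x in lborel. (\<lambda>n. B1 n x) \<longlonglongrightarrow> b x"
        using Ulim
      proof eventually_elim
        case (elim x)
        show ?case
        proof (cases "x \<in> K0")
          case True
          have "(\<lambda>n. gcomm \<gamma> (k n) u x) \<longlonglongrightarrow> 0"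
          proof (rule Lim_null_comparison)
            show "\<forall>\<^sub>F n in sequentially. norm (gcomm \<gamma> (k n) u x) \<le> real CARD('k) * (max 0 c1 * e n)"
              using subsetD[OF K0_subset True] by (intro always_eventually allI gc)
            have "(\<lambda>n. real CARD('k) * (max 0 c1 * e n)) \<longlonglongrightarrow> real CARD('k) * (max 0 c1 * 0)"
              by (intro tendsto_intros e0)
            then show "(\<lambda>n. real CARD('k) * (max 0 c1 * e n)) \<longlonglongrightarrow> 0" by simp
          qed
          then have "(\<lambda>n. B1 n x) \<longlonglongrightarrow> h (u x) *\<^sub>R ggrad \<gamma> x (\<Phi>' x) + (\<Phi> x * h' (u x)) *\<^sub>R (G x + 0)"
            unfolding B1_def by (intro tendsto_intros comp[OF elim True] ch h(2))
          then show ?thesis by (simp add: b_def)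
        qed (simp add: B1_def b_def g\<Phi>0 \<Phi>(3))
      qed
    qed auto
    define c where "c = B\<Phi> * Bh'"
    have c: "0 \<le> c" using B\<Phi> Bh' by (simp add: c_def)
    have G0: "(\<lambda>n. modular p (\<lambda>x. conv (k n) G x - G x)) \<longlonglongrightarrow> 0"
      by (rule conv_modular_tendsto[OF p0(3) _ fin(1) K1 supp(2) k e0]) auto
    have le: "modular p (\<lambda>x. B n x - b x) \<le> ennreal (2 powr p) *
        (modular p (\<lambda>x. B1 n x - b x) + ennreal (c powr p) * modular p (\<lambda>x. conv (k n) G x - G x))" for n
    proof -
      have "modular p (\<lambda>x. B n x - b x) = modular p (\<lambda>x. (B1 n x - b x) + (\<Phi> x * h' (U n x)) *\<^sub>R (conv (k n) G x - G x))"
        by (simp add: B_def B1_def algebra_simps)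
      also have "\<dots> \<le> ennreal (2 powr p) * (modular p (\<lambda>x. B1 n x - b x) + modular p (\<lambda>x. (\<Phi> x * h' (U n x)) *\<^sub>R (conv (k n) G x - G x)))"
        by (intro modular_add_le p0) auto
      also have "\<dots> \<le> ennreal (2 powr p) *
        (modular p (\<lambda>x. B1 n x - b x) + ennreal (c powr p) * modular p (\<lambda>x. conv (k n) G x - G x))"
        unfolding c_def using c[unfolded c_def] Ub by (intro mult_left_mono add_left_mono modular_le_cmult p0 Gterm) simp_all
      finally show ?thesis .
    qed
    have "(\<lambda>n. ennreal (2 powr p) * (modular p (\<lambda>x. B1 n x - b x) + ennreal (c powr p) * modular p (\<lambda>x. conv (k n) G x - G x)))
        \<longlonglongrightarrow> ennreal (2 powr p) * (0 + ennreal (c powr p) * 0)"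
      by (intro ennreal_tendsto_cmult tendsto_add L1 G0) auto
    then have "(\<lambda>n. ennreal (2 powr p) * (modular p (\<lambda>x. B1 n x - b x) + ennreal (c powr p) * modular p (\<lambda>x. conv (k n) G x - G x))) \<longlonglongrightarrow> 0"
      by simp
    from tendsto_sandwich[OF _ _ tendsto_const this] le
    show "(\<lambda>n. modular p (\<lambda>x. B n x - b x)) \<longlonglongrightarrow> 0" by simp
  qed (use fin in \<open>auto simp: q_def\<close>)
  have "(\<lambda>n. - integral\<^sup>L lborel (\<lambda>\<zeta>. \<Phi>' \<zeta> (0, 1) * H (U n \<zeta>))) \<longlonglongrightarrow>
      - integral\<^sup>L lborel (\<lambda>\<zeta>. F \<zeta> \<bullet> b \<zeta>) - 0 + integral\<^sup>L lborel (\<lambda>\<zeta>. S \<zeta> * (\<Phi> \<zeta> * h (u \<zeta>)))"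
    unfolding id by (intro tendsto_intros T2 T3 T4)
  from LIMSEQ_unique[OF tendsto_minus[OF T1] this] show ?thesis
    by (simp add: b_def[abs_def])
qed

end

section \<open>A Sobolev inequality for the Grushin gradient\<close>

text \<open>Continuously differentiable functions with compact support. The class is used instead of
  smooth functions because it is stable under the truncations below, which are only once
  continuously differentiable.\<close>

definition C1c :: "('a::euclidean_space \<Rightarrow> real) \<Rightarrow> bool" where
  "C1c f \<longleftrightarrow> (\<forall>x. f differentiable (at x)) \<and> (\<forall>e. continuous_on UNIV (\<lambda>x. fd f x e)) \<and>
     (\<exists>K. compact K \<and> (\<forall>x. x \<notin> K \<longrightarrow> f x = 0))"

lemma C1cD:
  assumes "C1c f"
  shows "(f has_derivative fd f x) (at x)" "continuous_on UNIV (\<lambda>x. fd f x e)" "continuous_on UNIV f"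
    "f \<in> borel_measurable borel"
proof -
  show *: "(f has_derivative fd f x) (at x)" for x
    using assms by (simp add: C1c_def frechet_derivative_works[symmetric])
  show "continuous_on UNIV (\<lambda>x. fd f x e)" using assms by (simp add: C1c_def)
  show "continuous_on UNIV f"
    using * by (auto intro!: continuous_at_imp_continuous_on has_derivative_continuous)
  then show "f \<in> borel_measurable borel" by (rule borel_measurable_continuous_onI)
qed

lemma fd_representation:
  fixes f :: "'a::euclidean_space \<Rightarrow> real"
  assumes "C1c f"
  shows "fd f x e = (\<Sum>i\<in>Basis. (e \<bullet> i) * fd f x i)"
proof -
  have "fd f x e = fd f x (\<Sum>i\<in>Basis. (e \<bullet> i) *\<^sub>R i)" by (simp add: euclidean_representation)
  also have "\<dots> = (\<Sum>i\<in>Basis. (e \<bullet> i) * fd f x i)"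
    using has_derivative_linear[OF C1cD(1)[OF assms], of x] by (simp add: linear_sum linear_scale)
  finally show ?thesis .
qed

lemma fd_continuous_pair:
  fixes f :: "'a::euclidean_space \<Rightarrow> real"
  assumes f: "C1c f" and "continuous_on S a" "continuous_on S b"
  shows "continuous_on S (\<lambda>z. fd f (a z) (b z))"
  by (subst fd_representation[OF f])
    (intro continuous_intros assms continuous_on_compose2[OF C1cD(2)[OF f] assms(2)]; simp)

text \<open>\<open>b\<close> is constant along its own lines, so z |-> z + \<theta> b(z) is the flow
  of \<open>b\<close>, and the increment of \<open>g\<close> is the integral over \<theta> in [0, 1]
  of its derivative along \<open>b\<close> at the flow point. Jensen's inequality in \<theta>,
  Tonelli and invariance of the measure under each flow map finish the estimate.\<close>

lemma flow_displacement:
  fixes g :: "'a::euclidean_space \<Rightarrow> real" and b :: "'a \<Rightarrow> 'a"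
  assumes p: "1 \<le> p" and g: "C1c g" and b: "continuous_on UNIV b"
    and pres: "\<And>\<theta> k. k \<in> borel_measurable borel \<Longrightarrow> (\<integral>\<^sup>+z. k (z + \<theta> *\<^sub>R b z) \<partial>lborel) = (\<integral>\<^sup>+z. k z \<partial>lborel)"
    and inv: "\<And>z \<theta>. b (z + \<theta> *\<^sub>R b z) = b z"
  shows "modular p (\<lambda>z. g (z + b z) - g z) \<le> modular p (\<lambda>z. fd g z (b z))"
proof -
  have [measurable]: "b \<in> borel_measurable borel" using b by (rule borel_measurable_continuous_onI)
  have [measurable]: "(\<lambda>z. fd g z (b z)) \<in> borel_measurable borel"
    by (intro borel_measurable_continuous_onI fd_continuous_pair[OF g] b continuous_intros)
  have c2: "continuous_on UNIV (\<lambda>(z, \<theta>). fd g (z + \<theta> *\<^sub>R b z) (b z))"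
    unfolding case_prod_beta
    by (intro fd_continuous_pair[OF g] continuous_intros continuous_on_compose2[OF b]) auto
  have [measurable]: "(\<lambda>(z, \<theta>). fd g (z + \<theta> *\<^sub>R b z) (b z)) \<in> borel_measurable (lborel \<Otimes>\<^sub>M lborel)"
    using borel_measurable_continuous_onI[OF c2] by (simp add: lborel_prod)
  have J: "ennreal (norm (g (z + b z) - g z) powr p) \<le>
      (\<integral>\<^sup>+\<theta>. ennreal (indicator {0..1} \<theta> * norm (fd g (z + \<theta> *\<^sub>R b z) (b z)) powr p) \<partial>lborel)" for z
  proof -
    have c1: "continuous_on UNIV (\<lambda>\<theta>. fd g (z + \<theta> *\<^sub>R b z) (b z))"
      by (intro fd_continuous_pair[OF g] continuous_intros)
    have "(\<integral>\<theta>. indicator {0..1} \<theta> *\<^sub>R fd g (z + \<theta> *\<^sub>R b z) (b z) \<partial>lborel) = g (z + 1 *\<^sub>R b z) - g (z + 0 *\<^sub>R b z)"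
    proof (rule integral_FTC_Icc)
      show "((\<lambda>\<theta>. g (z + \<theta> *\<^sub>R b z)) has_vector_derivative fd g (z + x *\<^sub>R b z) (b z)) (at x within {0..1})" for x :: real
        using has_derivative_along_line[OF C1cD(1)[OF g], of z "b z" x]
        by (simp add: has_real_derivative_iff_has_vector_derivative has_vector_derivative_at_within)
      show "continuous_on {0..1} (\<lambda>\<theta>. fd g (z + \<theta> *\<^sub>R b z) (b z))"
        using c1 by (rule continuous_on_subset) simp
    qed simp
    then show ?thesis
      using weighted_Jensen_powr[OF p, of "indicator {0..1::real}" lborel "\<lambda>\<theta>. fd g (z + \<theta> *\<^sub>R b z) (b z)"]
        borel_measurable_continuous_onI[OF c1] by simp
  qed
  have "modular p (\<lambda>z. g (z + b z) - g z) \<le>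
      (\<integral>\<^sup>+z. (\<integral>\<^sup>+\<theta>. ennreal (indicator {0..1} \<theta> * norm (fd g (z + \<theta> *\<^sub>R b z) (b z)) powr p) \<partial>lborel) \<partial>lborel)"
    unfolding modular_def by (intro nn_integral_mono J)
  also have "\<dots> = (\<integral>\<^sup>+\<theta>. (\<integral>\<^sup>+z. ennreal (indicator {0..1} \<theta> * norm (fd g (z + \<theta> *\<^sub>R b z) (b z)) powr p) \<partial>lborel) \<partial>lborel)"
    by (rule lborel_pair.Fubini'[symmetric]) measurable
  also have "\<dots> = (\<integral>\<^sup>+\<theta>. indicator {0..1::real} \<theta> * modular p (\<lambda>z. fd g z (b z)) \<partial>lborel)"
  proof (rule nn_integral_cong)
    fix \<theta> :: real
    have "(\<integral>\<^sup>+z. ennreal (norm (fd g (z + \<theta> *\<^sub>R b z) (b z)) powr p) \<partial>lborel) = modular p (\<lambda>z. fd g z (b z))"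
      using pres[of "\<lambda>z. ennreal (norm (fd g z (b z)) powr p)" \<theta>] by (simp add: inv modular_def)
    then show "(\<integral>\<^sup>+z. ennreal (indicator {0..1} \<theta> * norm (fd g (z + \<theta> *\<^sub>R b z) (b z)) powr p) \<partial>lborel) =
        indicator {0..1::real} \<theta> * modular p (\<lambda>z. fd g z (b z))"
      by (simp add: indicator_def)
  qed
  also have "\<dots> = modular p (\<lambda>z. fd g z (b z))"
    by (simp add: nn_integral_multc)
  finally show ?thesis .
qed

lemma grushin_grad_fst:
  fixes g :: "('m::finite, 'k::finite) point \<Rightarrow> real"
  assumes "C1c g"
  shows "fd g z (s, 0) = s \<bullet> fst (grushin_grad \<gamma> g z)"
proof -
  have "(s, 0) = (\<Sum>i\<in>UNIV. (s $ i) *\<^sub>R (axis i 1, 0 :: real ^ 'k))"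
    by (simp add: prod_eq_iff fst_sum snd_sum vec_eq_iff axis_def if_distrib sum.delta cong: if_cong)
  then have "fd g z (s, 0) = (\<Sum>i\<in>UNIV. s $ i * fd g z (axis i 1, 0))"
    using has_derivative_linear[OF C1cD(1)[OF assms], of z] by (simp only: linear_sum linear_scale real_scaleR_def)
  then show ?thesis
    by (simp add: grushin_grad_def grushin_X_def inner_vec_def)
qed

lemma grushin_grad_snd:
  fixes g :: "('m::finite, 'k::finite) point \<Rightarrow> real"
  assumes "C1c g"
  shows "fd g z (0, grushin_weight \<gamma> z *\<^sub>R \<tau>) = \<tau> \<bullet> snd (grushin_grad \<gamma> g z)"
proof -
  have "(0, grushin_weight \<gamma> z *\<^sub>R \<tau>) = (\<Sum>j\<in>UNIV. (grushin_weight \<gamma> z * \<tau> $ j) *\<^sub>R (0 :: real ^ 'm, axis j 1))"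
    by (simp add: prod_eq_iff fst_sum snd_sum vec_eq_iff axis_def if_distrib sum.delta cong: if_cong)
  then have "fd g z (0, grushin_weight \<gamma> z *\<^sub>R \<tau>) = (\<Sum>j\<in>UNIV. (grushin_weight \<gamma> z * \<tau> $ j) * fd g z (0, axis j 1))"
    using has_derivative_linear[OF C1cD(1)[OF assms], of z] by (simp only: linear_sum linear_scale real_scaleR_def)
  then show ?thesis
    by (simp add: grushin_grad_def grushin_Y_def inner_vec_def mult_ac)
qed

lemma continuous_grushin_grad:
  fixes g :: "('m::finite, 'k::finite) point \<Rightarrow> real"
  assumes \<gamma>: "0 \<le> \<gamma>" and g: "\<And>e. continuous_on UNIV (\<lambda>x. fd g x e)"
  shows "continuous_on UNIV (grushin_grad \<gamma> g)"
  unfolding grushin_grad_def[abs_def] grushin_X_def grushin_Y_def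
  by (intro continuous_on_Pair continuous_on_vec_lambda continuous_on_mult g continuous_grushin_weight \<gamma>)

text \<open>The point reached from \<open>z\<close> by moving by \<open>s\<close> in \<open>x\<close> and then along the fields \<open>Y\<^sub>j\<close> for the times \<open>\<tau>\<^sub>j\<close>.\<close>

definition gshift :: "real \<Rightarrow> ('m::finite, 'k::finite) point \<Rightarrow> ('m, 'k) point \<Rightarrow> ('m, 'k) point" where
  "gshift \<gamma> \<sigma> z = (fst z + fst \<sigma>, snd z + grushin_weight \<gamma> (fst z + fst \<sigma>, 0 :: real ^ 'k) *\<^sub>R snd \<sigma>)"

lemma continuous_gshift:
  assumes "0 \<le> \<gamma>" "continuous_on S a" "continuous_on S b"
  shows "continuous_on S (\<lambda>w. gshift \<gamma> (a w) (b w))"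
  unfolding gshift_def
  by (intro continuous_intros assms continuous_on_compose2[OF continuous_grushin_weight[OF assms(1), of UNIV]]) auto

text \<open>The shift is a translation in x followed by the flow of a combination of the fields Y_j.
  Each of the two flows preserves the measure and costs N^p times the modular of the gradient;
  adding the two increments costs the factor 2^p.\<close>

lemma gshift_displacement:
  fixes g :: "('m::finite, 'k::finite) point \<Rightarrow> real"
  assumes \<gamma>: "0 \<le> \<gamma>" and p: "1 \<le> p" and g: "C1c g"
    and N: "norm (fst \<sigma>) \<le> N" "norm (snd \<sigma>) \<le> N"
  shows "modular p (\<lambda>z. g (gshift \<gamma> \<sigma> z) - g z) \<le> ennreal (2 powr p * (2 * N powr p)) * modular p (grushin_grad \<gamma> g)"
proof -
  note [measurable] = C1cD(4)[OF g]
  have N0: "0 \<le> N" using N(1) norm_ge_zero order_trans by blast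
  have p0: "0 \<le> p" using p by simp
  have [measurable]: "grushin_grad \<gamma> g \<in> borel_measurable borel"
    by (intro borel_measurable_continuous_onI continuous_grushin_grad \<gamma> C1cD(2)[OF g])
  have [measurable]: "grushin_weight \<gamma> \<in> borel_measurable borel"
    by (intro borel_measurable_continuous_onI continuous_grushin_weight \<gamma>)
  define a :: "('m, 'k) point" where "a = (fst \<sigma>, 0)"
  define b :: "('m, 'k) point \<Rightarrow> ('m, 'k) point" where "b z = (0, grushin_weight \<gamma> z *\<^sub>R snd \<sigma>)" for z
  have cb: "continuous_on UNIV b"
    unfolding b_def[abs_def] by (intro continuous_intros continuous_grushin_weight \<gamma>)
  have [measurable]: "b \<in> borel_measurable borel" using cb by (rule borel_measurable_continuous_onI)
  have gs: "gshift \<gamma> \<sigma> z = (z + a) + b (z + a)" for z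
    by (simp add: gshift_def a_def b_def prod_eq_iff grushin_weight_def)
  have M1: "modular p (\<lambda>z. g (z + a) - g z) \<le> ennreal (N powr p) * modular p (grushin_grad \<gamma> g)"
  proof -
    have "modular p (\<lambda>z. g (z + a) - g z) \<le> modular p (\<lambda>z. fd g z a)"
    proof (rule flow_displacement[OF p g, of "\<lambda>_. a"])
      show "(\<integral>\<^sup>+z. k (z + \<theta> *\<^sub>R a) \<partial>lborel) = (\<integral>\<^sup>+z. k z \<partial>lborel)"
        if "k \<in> borel_measurable borel" for k :: "('m, 'k) point \<Rightarrow> ennreal" and \<theta>
        by (rule nn_integral_lborel_shift[OF that])
    qed simp_all
    also have "\<dots> \<le> ennreal (N powr p) * modular p (\<lambda>z. norm (grushin_grad \<gamma> g z))"
    proof (rule modular_le_cmult[OF p0 N0])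
      fix z
      have "norm (fd g z a) \<le> norm (fst \<sigma>) * norm (fst (grushin_grad \<gamma> g z))"
        unfolding a_def grushin_grad_fst[OF g, of z "fst \<sigma>" \<gamma>] real_norm_def by (rule Cauchy_Schwarz_ineq2)
      also have "\<dots> \<le> N * norm (grushin_grad \<gamma> g z)"
        using N N0 norm_fst_le[of "fst (grushin_grad \<gamma> g z)" "snd (grushin_grad \<gamma> g z)"] by (intro mult_mono) auto
      finally show "norm (fd g z a) \<le> N * norm (norm (grushin_grad \<gamma> g z))" by simp
    qed simp
    finally show ?thesis by (simp add: modular_def)
  qed
  have M2: "modular p (\<lambda>z. g (z + b z) - g z) \<le> ennreal (N powr p) * modular p (grushin_grad \<gamma> g)"
  proof -
    \<comment> \<open>For fixed x this flow is a translation in y, hence measure preserving by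
      Tonelli.\<close>
    have "modular p (\<lambda>z. g (z + b z) - g z) \<le> modular p (\<lambda>z. fd g z (b z))"
    proof (rule flow_displacement[OF p g cb])
      show "b (z + \<theta> *\<^sub>R b z) = b z" for z \<theta>
        by (simp add: b_def grushin_weight_def)
      fix k :: "('m, 'k) point \<Rightarrow> ennreal" and \<theta> :: real
      assume [measurable]: "k \<in> borel_measurable borel"
      have "(\<integral>\<^sup>+z. k (z + \<theta> *\<^sub>R b z) \<partial>lborel) = (\<integral>\<^sup>+z. k (z + \<theta> *\<^sub>R b z) \<partial>(lborel \<Otimes>\<^sub>M lborel))"
        by (simp add: lborel_prod)
      also have "\<dots> = (\<integral>\<^sup>+x. (\<integral>\<^sup>+y. k ((x, y) + \<theta> *\<^sub>R b (x, y)) \<partial>lborel) \<partial>lborel)"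
        by (subst lborel.nn_integral_fst[symmetric]) (auto simp: lborel_prod)
      also have "\<dots> = (\<integral>\<^sup>+x. (\<integral>\<^sup>+y. k (x, y) \<partial>lborel) \<partial>lborel)"
      proof (rule nn_integral_cong)
        fix x
        have "(x, y) + \<theta> *\<^sub>R b (x, y) = (x, y + (\<theta> * grushin_weight \<gamma> (x, 0 :: real ^ 'k)) *\<^sub>R snd \<sigma>)" for y
          by (simp add: b_def grushin_weight_def)
        then show "(\<integral>\<^sup>+y. k ((x, y) + \<theta> *\<^sub>R b (x, y)) \<partial>lborel) = (\<integral>\<^sup>+y. k (x, y) \<partial>lborel)"
          using nn_integral_lborel_shift[of "\<lambda>y. k (x, y)" "(\<theta> * grushin_weight \<gamma> (x, 0 :: real ^ 'k)) *\<^sub>R snd \<sigma>"] by simp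
      qed
      also have "\<dots> = (\<integral>\<^sup>+z. k z \<partial>(lborel \<Otimes>\<^sub>M lborel))"
        by (subst lborel.nn_integral_fst[symmetric]) (auto simp: lborel_prod)
      finally show "(\<integral>\<^sup>+z. k (z + \<theta> *\<^sub>R b z) \<partial>lborel) = (\<integral>\<^sup>+z. k z \<partial>lborel)"
        by (simp add: lborel_prod)
    qed
    also have "\<dots> \<le> ennreal (N powr p) * modular p (\<lambda>z. norm (grushin_grad \<gamma> g z))"
    proof (rule modular_le_cmult[OF p0 N0])
      fix z
      have "norm (fd g z (b z)) \<le> norm (snd \<sigma>) * norm (snd (grushin_grad \<gamma> g z))"
        unfolding b_def grushin_grad_snd[OF g] real_norm_def by (rule Cauchy_Schwarz_ineq2)
      also have "\<dots> \<le> N * norm (grushin_grad \<gamma> g z)"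
        using N N0 norm_snd_le[of "snd (grushin_grad \<gamma> g z)" "fst (grushin_grad \<gamma> g z)"] by (intro mult_mono) auto
      finally show "norm (fd g z (b z)) \<le> N * norm (norm (grushin_grad \<gamma> g z))" by simp
    qed simp
    finally show ?thesis by (simp add: modular_def)
  qed
  have "modular p (\<lambda>z. g (gshift \<gamma> \<sigma> z) - g z) =
      modular p (\<lambda>z. (g ((z + a) + b (z + a)) - g (z + a)) + (g (z + a) - g z))"
    by (simp add: gs)
  also have "\<dots> \<le> ennreal (2 powr p) * (modular p (\<lambda>z. g ((z + a) + b (z + a)) - g (z + a)) + modular p (\<lambda>z. g (z + a) - g z))"
    by (intro modular_add_le p0) measurable
  also have "modular p (\<lambda>z. g ((z + a) + b (z + a)) - g (z + a)) = modular p (\<lambda>z. g (z + b z) - g z)"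
    using modular_shift[of "\<lambda>z. g (z + b z) - g z" p "- a"] by simp
  also have "ennreal (2 powr p) * (modular p (\<lambda>z. g (z + b z) - g z) + modular p (\<lambda>z. g (z + a) - g z)) \<le>
      ennreal (2 powr p) * (ennreal (N powr p) * modular p (grushin_grad \<gamma> g) + ennreal (N powr p) * modular p (grushin_grad \<gamma> g))"
    by (intro mult_left_mono add_mono M1 M2) auto
  also have "\<dots> = ennreal (2 powr p * (2 * N powr p)) * modular p (grushin_grad \<gamma> g)"
    by (simp add: ennreal_mult distrib_right[symmetric] mult.assoc flip: ennreal_plus mult_2)
  finally show ?thesis .
qed

lemma nn_integral_affine:
  fixes f :: "'a::euclidean_space \<Rightarrow> ennreal"
  assumes [measurable]: "f \<in> borel_measurable borel" and c: "c \<noteq> 0"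
  shows "(\<integral>\<^sup>+x. f x \<partial>lborel) = ennreal (\<bar>c\<bar> ^ DIM('a)) * (\<integral>\<^sup>+x. f (t + c *\<^sub>R x) \<partial>lborel)"
proof -
  have "(\<integral>\<^sup>+x. f x \<partial>lborel) = (\<integral>\<^sup>+x. f x \<partial>(density (distr lborel borel (\<lambda>x. t + c *\<^sub>R x)) (\<lambda>_. \<bar>c\<bar> ^ DIM('a))))"
    using lborel_affine[OF c, of t] by simp
  also have "\<dots> = (\<integral>\<^sup>+x. ennreal (\<bar>c\<bar> ^ DIM('a)) * f (t + c *\<^sub>R x) \<partial>lborel)"
    by (subst nn_integral_density) (auto simp: nn_integral_distr)
  also have "\<dots> = ennreal (\<bar>c\<bar> ^ DIM('a)) * (\<integral>\<^sup>+x. f (t + c *\<^sub>R x) \<partial>lborel)"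
    by (rule nn_integral_cmult) measurable
  finally show ?thesis .
qed

text \<open>Away from \<open>x = 0\<close> the change of variables \<open>\<sigma> \<mapsto> gshift \<gamma> \<sigma> z\<close> has a Jacobian bounded from below.\<close>

lemma gshift_average:
  fixes g :: "('m::finite, 'k::finite) point \<Rightarrow> ennreal" and B :: "(real ^ 'm) set"
  assumes \<gamma>: "0 \<le> \<gamma>" and r: "0 < r" and [measurable]: "g \<in> borel_measurable borel" "B \<in> sets borel"
    and B: "\<And>s. s \<in> B \<Longrightarrow> r \<le> norm (fst z + s)"
  shows "(\<integral>\<^sup>+\<sigma>. indicator (B \<times> UNIV) \<sigma> * g (gshift \<gamma> \<sigma> z) \<partial>lborel) \<le>
      ennreal (r powr (- \<gamma> * CARD('k))) * (\<integral>\<^sup>+z. g z \<partial>lborel)"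
proof -
  have [measurable]: "(\<lambda>\<sigma>. gshift \<gamma> \<sigma> z) \<in> borel_measurable borel"
    by (intro borel_measurable_continuous_onI continuous_gshift[OF \<gamma>] continuous_intros)
  have [measurable]: "B \<times> (UNIV :: (real ^ 'k) set) \<in> sets borel" using borel_Times[of B UNIV] by simp
  have inner: "(\<integral>\<^sup>+\<tau>. g (gshift \<gamma> (s, \<tau>) z) \<partial>lborel) \<le> ennreal (r powr (- \<gamma> * CARD('k))) * (\<integral>\<^sup>+y. g (fst z + s, y) \<partial>lborel)"
    if "s \<in> B" for s
  proof -
    define c where "c = grushin_weight \<gamma> (fst z + s, 0 :: real ^ 'k)"
    have c: "r powr \<gamma> \<le> c" "0 < c"
    proof -
      show "r powr \<gamma> \<le> c"
        using B[OF that] r \<gamma> by (auto simp: c_def grushin_weight_def intro: powr_mono2)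
      moreover have "0 < r powr \<gamma>" using r by simp
      ultimately show "0 < c" by linarith
    qed
    have "(\<integral>\<^sup>+\<tau>. g (gshift \<gamma> (s, \<tau>) z) \<partial>lborel) = (\<integral>\<^sup>+\<tau>. g (fst z + s, snd z + c *\<^sub>R \<tau>) \<partial>lborel)"
      by (simp add: gshift_def c_def)
    also have "\<dots> = ennreal (inverse (c ^ CARD('k))) * (\<integral>\<^sup>+y. g (fst z + s, y) \<partial>lborel)"
      using nn_integral_affine[of "\<lambda>y. g (fst z + s, y)" c "snd z"] c
      by (simp add: mult.assoc[symmetric] ennreal_mult[symmetric])
    also have "\<dots> \<le> ennreal (r powr (- \<gamma> * CARD('k))) * (\<integral>\<^sup>+y. g (fst z + s, y) \<partial>lborel)"
    proof (intro mult_right_mono ennreal_leI)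
      have "(r powr \<gamma>) ^ CARD('k) \<le> c ^ CARD('k)"
        using c by (intro power_mono) auto
      moreover have "(r powr \<gamma>) ^ CARD('k) = r powr (\<gamma> * CARD('k))"
        using r by (simp add: powr_powr flip: powr_realpow)
      ultimately have "inverse (c ^ CARD('k)) \<le> inverse (r powr (\<gamma> * CARD('k)))"
        using r by (intro le_imp_inverse_le) auto
      then show "inverse (c ^ CARD('k)) \<le> r powr (- \<gamma> * CARD('k))"
        by (simp add: powr_minus)
    qed simp
    finally show ?thesis .
  qed
  have "(\<integral>\<^sup>+\<sigma>. indicator (B \<times> UNIV) \<sigma> * g (gshift \<gamma> \<sigma> z) \<partial>lborel) =
      (\<integral>\<^sup>+\<sigma>. indicator (B \<times> UNIV) \<sigma> * g (gshift \<gamma> \<sigma> z) \<partial>(lborel \<Otimes>\<^sub>M lborel))"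
    by (simp add: lborel_prod)
  also have "\<dots> = (\<integral>\<^sup>+s. (\<integral>\<^sup>+\<tau>. indicator (B \<times> UNIV) (s, \<tau>) * g (gshift \<gamma> (s, \<tau>) z) \<partial>lborel) \<partial>lborel)"
    by (subst lborel.nn_integral_fst[symmetric]) (auto simp: lborel_prod)
  also have "\<dots> \<le> (\<integral>\<^sup>+s. ennreal (r powr (- \<gamma> * CARD('k))) * (\<integral>\<^sup>+y. g (s + fst z, y) \<partial>lborel) \<partial>lborel)"
  proof (rule nn_integral_mono)
    fix s
    show "(\<integral>\<^sup>+\<tau>. indicator (B \<times> UNIV) (s, \<tau>) * g (gshift \<gamma> (s, \<tau>) z) \<partial>lborel) \<le>
        ennreal (r powr (- \<gamma> * CARD('k))) * (\<integral>\<^sup>+y. g (s + fst z, y) \<partial>lborel)"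
      using inner[of s] by (cases "s \<in> B") (auto simp: add.commute)
  qed
  also have "\<dots> = ennreal (r powr (- \<gamma> * CARD('k))) * (\<integral>\<^sup>+s. (\<integral>\<^sup>+y. g (s + fst z, y) \<partial>lborel) \<partial>lborel)"
    by (rule nn_integral_cmult) measurable
  also have "(\<integral>\<^sup>+s. (\<integral>\<^sup>+y. g (s + fst z, y) \<partial>lborel) \<partial>lborel) = (\<integral>\<^sup>+s. (\<integral>\<^sup>+y. g (s, y) \<partial>lborel) \<partial>lborel)"
    by (rule nn_integral_lborel_shift[of "\<lambda>s. \<integral>\<^sup>+y. g (s, y) \<partial>lborel"]) measurable
  also have "\<dots> = (\<integral>\<^sup>+z. g z \<partial>(lborel \<Otimes>\<^sub>M lborel))"
    by (subst lborel.nn_integral_fst[symmetric]) (auto simp: lborel_prod)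
  finally show ?thesis by (simp add: lborel_prod)
qed


lemma emeasure_cube:
  assumes "0 \<le> r"
  shows "emeasure lborel (cbox (\<chi> i. a) (\<chi> i. a + r) :: (real ^ 'n::finite) set) = ennreal (r ^ CARD('n))"
proof -
  have "cbox (\<chi> i. a) (\<chi> i. a + r) \<noteq> ({} :: (real ^ 'n) set)"
    using assms by (auto simp: interval_ne_empty_cart)
  then have "measure lborel (cbox (\<chi> i. a) (\<chi> i. a + r) :: (real ^ 'n) set) = r ^ CARD('n)"
    by (simp add: content_cbox_cart)
  then show ?thesis
    using emeasure_eq_ennreal_measure[of lborel "cbox (\<chi> i. a) (\<chi> i. a + r) :: (real ^ 'n) set"]
      emeasure_lborel_cbox_finite[of "\<chi> i. a :: real ^ 'n" "\<chi> i. a + r"] by (simp add: less_top)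
qed

text \<open>On the half space \<open>\<plusminus>x\<^sub>i \<ge> 0\<close> averaging over shifts with \<open>\<plusminus>s \<in> [r, 2r]\<^sup>m\<close> stays away from the degenerate
  set \<open>x = 0\<close>, and \<open>g\<close> differs from its average by at most \<open>r\<close> times the gradient in \<open>L\<^sup>p\<close>.\<close>

lemma half_space_level_estimate:
  fixes g :: "('m::finite, 'k::finite) point \<Rightarrow> real" and sg :: real
  assumes \<gamma>: "0 \<le> \<gamma>" and p: "1 \<le> p" and g: "C1c g" and g0: "\<And>z. 0 \<le> g z" "\<And>z. g z \<le> l"
    and l: "0 < l" and r: "0 < r" and sg: "\<bar>sg\<bar> = 1"
    and Q: "Q = real CARD('m) + (1 + \<gamma>) * real CARD('k)"
    and a: "emeasure lborel {z. 0 < g z} \<le> ennreal a" and ar: "4 * a \<le> r powr Q" "0 \<le> a"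
  shows "emeasure lborel {z. g z = l \<and> 0 \<le> sg * fst z $ i} \<le>
      ennreal (4 * 2 powr p * (4 * r * (CARD('m) + CARD('k)) / l) powr p) * modular p (grushin_grad \<gamma> g)"
proof -
  note [measurable] = C1cD(4)[OF g]
  define n where "n = CARD('m) + CARD('k)"
  define vol where "vol = r ^ n"
  have vol: "0 < vol" using r by (simp add: vol_def)
  define B1 where "B1 = {s :: real ^ 'm. sg *\<^sub>R s \<in> cbox (\<chi> i. r) (\<chi> i. r + r)}"
  define B2 where "B2 = (cbox (\<chi> i. 0) (\<chi> i. 0 + r) :: (real ^ 'k) set)"
  define X where "X = {z. g z = l \<and> 0 \<le> sg * fst z $ i}"
  have sg2: "sg * sg = 1" using sg by (auto simp: abs_if split: if_splits)
  have cl: "closed X"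
    unfolding X_def by (intro closed_Collect_conj closed_Collect_eq closed_Collect_le continuous_intros C1cD(3)[OF g])
  then have [measurable]: "X \<in> sets borel" by (rule borel_closed)
  have [measurable]: "B1 \<in> sets borel"
  proof -
    have "closed ((\<lambda>s::real ^ 'm. sg *\<^sub>R s) -` cbox (\<chi> i. r) (\<chi> i. r + r))"
      by (rule closed_vimage[OF closed_cbox]) (intro continuous_intros)
    then show ?thesis by (simp add: B1_def vimage_def borel_closed)
  qed
  have [measurable]: "B2 \<in> sets borel" by (simp add: B2_def)
  have eB1: "emeasure lborel B1 = ennreal (r ^ CARD('m))"
  proof -
    have "emeasure lborel B1 = (\<integral>\<^sup>+s. indicator (cbox (\<chi> i. r) (\<chi> i. r + r) :: (real ^ 'm) set) (0 + sg *\<^sub>R s) \<partial>lborel)"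
    proof -
      have "emeasure lborel B1 = (\<integral>\<^sup>+s. indicator B1 s \<partial>lborel)" by simp
      also have "\<dots> = (\<integral>\<^sup>+s. indicator (cbox (\<chi> i. r) (\<chi> i. r + r) :: (real ^ 'm) set) (0 + sg *\<^sub>R s) \<partial>lborel)"
        by (intro nn_integral_cong) (simp add: B1_def indicator_def)
      finally show ?thesis .
    qed
    also have "\<dots> = (\<integral>\<^sup>+s. indicator (cbox (\<chi> i. r) (\<chi> i. r + r) :: (real ^ 'm) set) s \<partial>lborel)"
      using nn_integral_affine[of "indicator (cbox (\<chi> i. r) (\<chi> i. r + r) :: (real ^ 'm) set)" sg 0] sg by auto
    also have "\<dots> = ennreal (r ^ CARD('m))"
      using emeasure_cube[of r r, where 'n='m] r by simp
    finally show ?thesis .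
  qed
  have eB: "emeasure lborel (B1 \<times> B2) = ennreal vol"
  proof -
    have "emeasure lborel (B1 \<times> B2) = emeasure lborel B1 * emeasure lborel B2"
      using lborel.emeasure_pair_measure_Times[of B1 lborel B2] by (simp add: lborel_prod)
    then show ?thesis
      using eB1 emeasure_cube[of r 0, where 'n='k] r by (simp add: B2_def vol_def n_def power_add ennreal_mult)
  qed
  have [measurable]: "B1 \<times> B2 \<in> sets borel"
    using borel_Times[of B1 B2] by simp
  \<comment> \<open>In the i-th coordinate x and the shift have the same sign, so they cannot
    cancel, and the shift alone has absolute value at least r there.\<close>
  have far: "r \<le> norm (fst z + s)" if "z \<in> X" "s \<in> B1" for z s
  proof -
    have "r \<le> sg * s $ i" using that(2) by (auto simp: B1_def mem_box_cart)
    moreover have "0 \<le> sg * fst z $ i" using that(1) by (simp add: X_def)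
    ultimately have "r \<le> sg * (fst z + s) $ i" by (simp add: distrib_left)
    also have "\<dots> \<le> \<bar>sg * (fst z + s) $ i\<bar>" by simp
    also have "\<dots> = \<bar>(fst z + s) $ i\<bar>" using sg by (simp add: abs_mult)
    also have "\<dots> \<le> norm (fst z + s)" by (rule component_le_norm_cart)
    finally show ?thesis .
  qed
  define N where "N = 2 * r * real n"
  have N: "norm (fst \<sigma>) \<le> N" "norm (snd \<sigma>) \<le> N" if "\<sigma> \<in> B1 \<times> B2" for \<sigma>
  proof -
    have "\<bar>fst \<sigma> $ i\<bar> \<le> 2 * r" for i
    proof -
      have "r \<le> sg * fst \<sigma> $ i \<and> sg * fst \<sigma> $ i \<le> 2 * r" using that by (auto simp: B1_def mem_box_cart)
      then have "\<bar>sg * fst \<sigma> $ i\<bar> \<le> 2 * r" using r by linarith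
      then show ?thesis using sg by (simp add: abs_mult)
    qed
    then have "norm (fst \<sigma>) \<le> real CARD('m) * (2 * r)"
      using norm_le_l1_cart[of "fst \<sigma>"] sum_bounded_above[of UNIV "\<lambda>i. \<bar>fst \<sigma> $ i\<bar>" "2 * r"] by simp
    also have "\<dots> \<le> N" using r by (simp add: N_def n_def)
    finally show "norm (fst \<sigma>) \<le> N" .
    have "\<bar>snd \<sigma> $ j\<bar> \<le> 2 * r" for j
    proof -
      have "0 \<le> snd \<sigma> $ j \<and> snd \<sigma> $ j \<le> r" using that by (auto simp: B2_def mem_box_cart)
      then show ?thesis using r by linarith
    qed
    then have "norm (snd \<sigma>) \<le> real CARD('k) * (2 * r)"
      using norm_le_l1_cart[of "snd \<sigma>"] sum_bounded_above[of UNIV "\<lambda>i. \<bar>snd \<sigma> $ i\<bar>" "2 * r"] by simp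
    also have "\<dots> \<le> N" using r by (simp add: N_def n_def)
    finally show "norm (snd \<sigma>) \<le> N" .
  qed
  have [measurable]: "(\<lambda>(\<sigma>, z). gshift \<gamma> \<sigma> z) \<in> borel_measurable (lborel \<Otimes>\<^sub>M lborel)"
    "(\<lambda>(z, \<sigma>). gshift \<gamma> \<sigma> z) \<in> borel_measurable (lborel \<Otimes>\<^sub>M lborel)"
    unfolding case_prod_beta lborel_prod
    by (simp, intro borel_measurable_continuous_onI continuous_gshift[OF \<gamma>] continuous_intros)+
  have [measurable]: "(\<lambda>\<sigma>. gshift \<gamma> \<sigma> z) \<in> borel_measurable borel" for z :: "('m, 'k) point"
    by (intro borel_measurable_continuous_onI continuous_gshift[OF \<gamma>] continuous_intros)
  define D where "D z \<sigma> = ennreal (\<bar>g (gshift \<gamma> \<sigma> z) - g z\<bar> powr p)" for z \<sigma>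
  have mD [measurable]: "(\<lambda>(z, \<sigma>). D z \<sigma>) \<in> borel_measurable (lborel \<Otimes>\<^sub>M lborel)"
    unfolding D_def by measurable
  have mDz [measurable]: "D z \<in> borel_measurable borel" for z
    unfolding D_def by measurable
  \<comment> \<open>Chosen so that c l/2 = (l/2)^p: the values of \<open>g\<close> that are at least
    l/2 are then accounted for linearly.\<close>
  define c where "c = (l / 2) powr (p - 1)"
  have c: "0 < c" "c * (l / 2) = (l / 2) powr p"
    using l by (auto simp: c_def powr_mult_base[symmetric] mult.commute powr_diff)
  \<comment> \<open>At a point of the level set each shift either lowers \<open>g\<close> by at
    least l/2 or lands where \<open>g\<close> is at least l/2. The second alternative uses at most
    half of the box, because {g > 0} has small measure compared with r^Q; the first is therefore
    responsible for the other half.\<close>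
  have lower: "ennreal ((l / 2) powr p * vol / 2) \<le> (\<integral>\<^sup>+\<sigma>. indicator (B1 \<times> B2) \<sigma> * D z \<sigma> \<partial>lborel)" if z: "z \<in> X" for z
  proof -
    have gz: "g z = l" using z by (simp add: X_def)
    have pw: "(l / 2) powr p \<le> \<bar>g (gshift \<gamma> \<sigma> z) - g z\<bar> powr p + c * g (gshift \<gamma> \<sigma> z)" for \<sigma>
    proof (cases "l / 2 \<le> g (gshift \<gamma> \<sigma> z)")
      case True
      then have "(l / 2) powr p \<le> c * g (gshift \<gamma> \<sigma> z)"
        using c mult_left_mono[OF True, of c] by simp
      then show ?thesis by (simp add: add_increasing)
    next
      case False
      then have "(l / 2) powr p \<le> \<bar>g (gshift \<gamma> \<sigma> z) - g z\<bar> powr p"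
        using l p by (intro powr_mono2) (auto simp: gz)
      then show ?thesis using c(1) g0(1)[of "gshift \<gamma> \<sigma> z"] by (simp add: add_increasing2)
    qed
    have "ennreal ((l / 2) powr p * vol) = (\<integral>\<^sup>+\<sigma>. ennreal ((l / 2) powr p) * indicator (B1 \<times> B2) \<sigma> \<partial>lborel)"
      using eB vol by (simp add: nn_integral_cmult_indicator ennreal_mult)
    also have "\<dots> \<le> (\<integral>\<^sup>+\<sigma>. indicator (B1 \<times> B2) \<sigma> * D z \<sigma> + ennreal c * (indicator (B1 \<times> UNIV) \<sigma> * ennreal (g (gshift \<gamma> \<sigma> z))) \<partial>lborel)"
    proof (rule nn_integral_mono)
      fix \<sigma>
      show "ennreal ((l / 2) powr p) * indicator (B1 \<times> B2) \<sigma> \<le>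
        indicator (B1 \<times> B2) \<sigma> * D z \<sigma> + ennreal c * (indicator (B1 \<times> UNIV) \<sigma> * ennreal (g (gshift \<gamma> \<sigma> z)))"
        using pw[of \<sigma>] c(1) g0(1)
        by (cases "\<sigma> \<in> B1 \<times> B2") (auto simp: D_def indicator_def mem_Times_iff ennreal_leI simp flip: ennreal_plus ennreal_mult)
    qed
    also have "\<dots> = (\<integral>\<^sup>+\<sigma>. indicator (B1 \<times> B2) \<sigma> * D z \<sigma> \<partial>lborel) +
        ennreal c * (\<integral>\<^sup>+\<sigma>. indicator (B1 \<times> UNIV) \<sigma> * ennreal (g (gshift \<gamma> \<sigma> z)) \<partial>lborel)"
    proof -
      have [measurable]: "B1 \<times> (UNIV :: (real ^ 'k) set) \<in> sets borel" using borel_Times[of B1 UNIV] by simp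
      show ?thesis by (subst nn_integral_add, simp, simp, subst nn_integral_cmult, simp, simp)
    qed
    also have "ennreal c * (\<integral>\<^sup>+\<sigma>. indicator (B1 \<times> UNIV) \<sigma> * ennreal (g (gshift \<gamma> \<sigma> z)) \<partial>lborel) \<le>
        ennreal c * (ennreal (r powr (- \<gamma> * CARD('k))) * (\<integral>\<^sup>+z. ennreal (g z) \<partial>lborel))"
      using far[OF z] by (intro mult_left_mono gshift_average[OF \<gamma> r, of "\<lambda>z. ennreal (g z)"]) auto
    also have "(\<integral>\<^sup>+z. ennreal (g z) \<partial>lborel) \<le> ennreal l * ennreal a"
    proof -
      have "(\<integral>\<^sup>+z. ennreal (g z) \<partial>lborel) \<le> (\<integral>\<^sup>+z. ennreal l * indicator {z. 0 < g z} z \<partial>lborel)"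
        using g0 by (intro nn_integral_mono) (auto simp: indicator_def ennreal_leI not_less ennreal_neg)
      also have "\<dots> = ennreal l * emeasure lborel {z. 0 < g z}"
        by (rule nn_integral_cmult_indicator) (auto intro!: borel_open open_Collect_less continuous_intros C1cD(3)[OF g])
      also have "\<dots> \<le> ennreal l * ennreal a" by (intro mult_left_mono a) simp
      finally show ?thesis .
    qed
    \<comment> \<open>The Jacobian factor r^(-\<gamma> k) turns r^Q into r^(m+k), the volume of the
      box. This is where the homogeneous dimension comes from, and 4 a \<le> r^Q leaves exactly one
      half.\<close>
    also have "ennreal c * (ennreal (r powr (- \<gamma> * CARD('k))) * (ennreal l * ennreal a)) \<le> ennreal ((l / 2) powr p * vol / 2)"
    proof -
      have "r powr (- \<gamma> * CARD('k)) * (4 * a) \<le> r powr (- \<gamma> * CARD('k)) * r powr Q"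
        using ar by (intro mult_left_mono) auto
      also have "\<dots> = r powr real n" by (simp add: Q n_def algebra_simps flip: powr_add)
      also have "\<dots> = vol" using r by (simp add: vol_def powr_realpow)
      finally have "c * (l / 2) * (r powr (- \<gamma> * CARD('k)) * (4 * a)) / 2 \<le> c * (l / 2) * vol / 2"
        using c l by (intro divide_right_mono mult_left_mono) auto
      then have "c * (r powr (- \<gamma> * CARD('k)) * (l * a)) \<le> (l / 2) powr p * vol / 2"
        unfolding c(2)[symmetric] by (simp add: mult_ac)
      then show ?thesis
        using c l ar by (simp add: ennreal_leI flip: ennreal_mult)
    qed
    finally have le: "ennreal ((l / 2) powr p * vol) \<le> (\<integral>\<^sup>+\<sigma>. indicator (B1 \<times> B2) \<sigma> * D z \<sigma> \<partial>lborel) + ennreal ((l / 2) powr p * vol / 2)"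
      by (simp add: mult_left_mono add_left_mono)
    show ?thesis
    proof (rule ccontr)
      assume "\<not> ennreal ((l / 2) powr p * vol / 2) \<le> (\<integral>\<^sup>+\<sigma>. indicator (B1 \<times> B2) \<sigma> * D z \<sigma> \<partial>lborel)"
      then have "(\<integral>\<^sup>+\<sigma>. indicator (B1 \<times> B2) \<sigma> * D z \<sigma> \<partial>lborel) + ennreal ((l / 2) powr p * vol / 2) <
          ennreal ((l / 2) powr p * vol / 2) + ennreal ((l / 2) powr p * vol / 2)"
        using ennreal_add_left_cancel_less[of "ennreal ((l / 2) powr p * vol / 2)"
          "\<integral>\<^sup>+\<sigma>. indicator (B1 \<times> B2) \<sigma> * D z \<sigma> \<partial>lborel" "ennreal ((l / 2) powr p * vol / 2)"]
        by (simp add: not_le add.commute)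
      also have "\<dots> = ennreal ((l / 2) powr p * vol)"
        using vol by (simp flip: ennreal_plus)
      finally show False using le by simp
    qed
  qed
  \<comment> \<open>The lower bound is integrated over the level set and the order of integration
    exchanged, so that for each fixed shift the displacement estimate applies.\<close>
  have "ennreal ((l / 2) powr p * vol / 2) * emeasure lborel X = (\<integral>\<^sup>+z. ennreal ((l / 2) powr p * vol / 2) * indicator X z \<partial>lborel)"
    by (simp add: nn_integral_cmult_indicator)
  also have "\<dots> \<le> (\<integral>\<^sup>+z. (\<integral>\<^sup>+\<sigma>. indicator (B1 \<times> B2) \<sigma> * D z \<sigma> \<partial>lborel) \<partial>lborel)"
    using lower by (intro nn_integral_mono) (auto simp: indicator_def)
  also have "\<dots> = (\<integral>\<^sup>+\<sigma>. (\<integral>\<^sup>+z. indicator (B1 \<times> B2) \<sigma> * D z \<sigma> \<partial>lborel) \<partial>lborel)"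
    by (rule lborel_pair.Fubini'[symmetric]) measurable
  also have "\<dots> \<le> (\<integral>\<^sup>+\<sigma>. (ennreal (2 powr p * (2 * N powr p)) * modular p (grushin_grad \<gamma> g)) * indicator (B1 \<times> B2) \<sigma> \<partial>lborel)"
  proof (rule nn_integral_mono)
    fix \<sigma> :: "('m, 'k) point"
    show "(\<integral>\<^sup>+z. indicator (B1 \<times> B2) \<sigma> * D z \<sigma> \<partial>lborel) \<le>
        (ennreal (2 powr p * (2 * N powr p)) * modular p (grushin_grad \<gamma> g)) * indicator (B1 \<times> B2) \<sigma>"
    proof (cases "\<sigma> \<in> B1 \<times> B2")
      case True
      have "(\<integral>\<^sup>+z. D z \<sigma> \<partial>lborel) = modular p (\<lambda>z. g (gshift \<gamma> \<sigma> z) - g z)"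
        by (simp add: modular_def D_def)
      then show ?thesis
        using gshift_displacement[OF \<gamma> p g N[OF True]] True by (simp add: indicator_def)
    qed (simp add: indicator_def)
  qed
  also have "\<dots> = ennreal (2 powr p * (2 * N powr p)) * modular p (grushin_grad \<gamma> g) * ennreal vol"
    using eB by (simp add: nn_integral_cmult_indicator)
  finally have fin: "ennreal ((l / 2) powr p * vol / 2) * emeasure lborel X \<le>
      ennreal (2 powr p * (2 * N powr p)) * modular p (grushin_grad \<gamma> g) * ennreal vol" .
  have inv: "2 / ((l / 2) powr p * vol) * ((l / 2) powr p * vol / 2) = 1" using l vol by simp
  have "emeasure lborel X = ennreal (2 / ((l / 2) powr p * vol)) * (ennreal ((l / 2) powr p * vol / 2) * emeasure lborel X)"
    using l vol by (simp add: mult.assoc[symmetric] inv flip: ennreal_mult)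
  also have "\<dots> \<le> ennreal (2 / ((l / 2) powr p * vol)) * (ennreal (2 powr p * (2 * N powr p)) * modular p (grushin_grad \<gamma> g) * ennreal vol)"
    by (intro mult_left_mono fin) simp
  also have "\<dots> = ennreal (2 / ((l / 2) powr p * vol) * (2 powr p * (2 * N powr p)) * vol) * modular p (grushin_grad \<gamma> g)"
  proof -
    have gen: "ennreal x * (ennreal y * M * ennreal v) = ennreal (x * y * v) * M"
      if "0 \<le> x" "0 \<le> y" "0 \<le> v" for x y v :: real and M
      using that by (simp add: ennreal_mult mult_ac)
    show ?thesis by (rule gen) (use l vol in auto)
  qed
  also have "2 / ((l / 2) powr p * vol) * (2 powr p * (2 * N powr p)) * vol = 4 * 2 powr p * ((2 * N / l) powr p)"
    using l vol r powr_mult[of 2 2 p] by (simp add: powr_divide powr_mult N_def field_simps)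
  finally show ?thesis
    unfolding X_def N_def n_def by (simp add: mult.assoc)
qed

section \<open>Truncation at a given height\<close>

lemma pos_part_powr_deriv:
  fixes p s :: real
  assumes p: "1 < p"
  shows "((\<lambda>s. max 0 s powr p) has_real_derivative p * max 0 s powr (p - 1)) (at s)"
proof -
  consider "s > 0" | "s < 0" | "s = 0" by linarith
  then show ?thesis
  proof cases
    case 1
    have "((\<lambda>s. s powr p) has_real_derivative p * s powr (p - 1)) (at s)"
      using 1 by (rule has_real_derivative_powr)
    then have "((\<lambda>s. max 0 s powr p) has_real_derivative p * s powr (p - 1)) (at s)"
      by (rule has_field_derivative_transform_within_open[where S="{0<..}"]) (use 1 in auto)
    then show ?thesis using 1 by simp
  next
    case 2
    have "((\<lambda>s. 0) has_real_derivative 0) (at s)" by simp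
    then have "((\<lambda>s. max 0 s powr p) has_real_derivative 0) (at s)"
      by (rule has_field_derivative_transform_within_open[where S="{..<0}"]) (use 2 in auto)
    then show ?thesis using 2 by simp
  next
    case 3
    have "((\<lambda>h. max 0 h powr p / h) \<longlongrightarrow> 0) (at 0)"
    proof (rule Lim_null_comparison)
      show "\<forall>\<^sub>F h in at 0. norm (max 0 h powr p / h) \<le> \<bar>h\<bar> powr (p - 1)"
      proof (rule always_eventually, rule)
        show "norm (max 0 h powr p / h) \<le> \<bar>h\<bar> powr (p - 1)" for h :: real
        proof (cases "0 < h")
          case False
          then have "max 0 h = 0" by simp
          then show ?thesis by simp
        qed (simp add: powr_diff)
      qed
      show "((\<lambda>h::real. \<bar>h\<bar> powr (p - 1)) \<longlongrightarrow> 0) (at 0)"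
        by (rule tendsto_0_powr_const) (use p in \<open>auto intro!: tendsto_rabs_zero\<close>)
    qed
    then show ?thesis using 3 by (simp add: DERIV_def)
  qed
qed

text \<open>\<open>R\<close> is a second difference of the squared positive part: it rises from 0 to
  1/2 on [0, 1], and its derivative is a hat of height 1. The substitution \<open>\<tau>\<close>
  maps 1 \<le> |s| \<le> 2 onto [0, 1] and avoids the corner of |s| at 0. On that range the slope is
  at most 2 times 4/3, hence the bound 3.\<close>

lemma smooth_step_exists:
  obtains T T' :: "real \<Rightarrow> real" where "\<And>s. (T has_real_derivative T' s) (at s)" "continuous_on UNIV T'"
    "\<And>s. 0 \<le> T s" "\<And>s. T s \<le> 1" "\<And>s. \<bar>s\<bar> \<le> 1 \<Longrightarrow> T s = 0" "\<And>s. 2 \<le> \<bar>s\<bar> \<Longrightarrow> T s = 1"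
    "\<And>s. \<bar>T' s\<bar> \<le> 3" "\<And>s. \<not> (1 < \<bar>s\<bar> \<and> \<bar>s\<bar> \<le> 2) \<Longrightarrow> T' s = 0"
proof -
  define P :: "real \<Rightarrow> real" where "P t = max 0 t powr 2" for t
  define R where "R t = P t - 2 * P (t - 1/2) + P (t - 1)" for t
  define H :: "real \<Rightarrow> real" where "H t = 2 * max 0 t - 4 * max 0 (t - 1/2) + 2 * max 0 (t - 1)" for t
  define \<tau> :: "real \<Rightarrow> real" where "\<tau> s = (s\<^sup>2 - 1) / 3" for s
  have dP: "(P has_real_derivative 2 * max 0 t) (at t)" for t
    using pos_part_powr_deriv[of 2 t] unfolding P_def[abs_def] by simp
  have dR: "(R has_real_derivative H t) (at t)" for t
  proof -
    have "((\<lambda>t. P (t - c)) has_real_derivative 2 * max 0 (t - c) * 1) (at t)" for c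
      by (rule DERIV_chain2[OF dP]) (auto intro!: derivative_eq_intros)
    from this[of "1/2"] this[of 1] dP[of t] show ?thesis
      unfolding R_def[abs_def] H_def by (auto intro!: derivative_eq_intros)
  qed
  have P: "P t = (if 0 \<le> t then t\<^sup>2 else 0)" for t
    by (auto simp: P_def max_def powr_numeral)
  have RH: "0 \<le> R t \<and> R t \<le> 1/2 \<and> 0 \<le> H t \<and> H t \<le> 1 \<and> (t \<le> 0 \<longrightarrow> R t = 0 \<and> H t = 0) \<and> (1 \<le> t \<longrightarrow> R t = 1/2 \<and> H t = 0)" for t
  proof -
    consider "t \<le> 0" | "0 < t" "t \<le> 1/2" | "1/2 < t" "t < 1" | "1 \<le> t" by linarith
    then show ?thesis
    proof cases
      case 1
      then show ?thesis by (auto simp: R_def H_def P)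
    next
      case 2
      then have "R t = t\<^sup>2" "H t = 2 * t" by (auto simp: R_def H_def P)
      moreover have "t\<^sup>2 \<le> (1/2)\<^sup>2" using 2 by (intro power_mono) auto
      ultimately show ?thesis using 2 by (auto simp: power2_eq_square)
    next
      case 3
      then have "R t = 1/2 - (1 - t)\<^sup>2" "H t = 2 - 2 * t" by (auto simp: R_def H_def P power2_eq_square algebra_simps)
      moreover have "(1 - t)\<^sup>2 \<le> (1/2)\<^sup>2" using 3 by (intro power_mono) auto
      ultimately show ?thesis using 3 by (auto simp: power2_eq_square)
    next
      case 4
      then show ?thesis by (auto simp: R_def H_def P power2_eq_square algebra_simps)
    qed
  qed
  have t1: "\<bar>s\<bar> \<le> 1 \<longleftrightarrow> \<tau> s \<le> 0" for s using abs_square_le_1[of s] by (simp add: \<tau>_def)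
  have t2: "2 \<le> \<bar>s\<bar> \<longleftrightarrow> 1 \<le> \<tau> s" for s
    using abs_le_square_iff[of 2 s] by (auto simp: \<tau>_def)
  have d\<tau>: "(\<tau> has_real_derivative 2 * s / 3) (at s)" for s
    unfolding \<tau>_def by (auto intro!: derivative_eq_intros)
  show ?thesis
  proof (rule that[of "\<lambda>s. 2 * R (\<tau> s)" "\<lambda>s. 2 * (H (\<tau> s) * (2 * s / 3))"])
    show "((\<lambda>s. 2 * R (\<tau> s)) has_real_derivative 2 * (H (\<tau> s) * (2 * s / 3))) (at s)" for s
      by (rule DERIV_cmult[OF DERIV_chain2[OF dR d\<tau>]])
    show "continuous_on UNIV (\<lambda>s. 2 * (H (\<tau> s) * (2 * s / 3)))"
      unfolding H_def \<tau>_def by (intro continuous_intros) auto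
    show "\<bar>2 * (H (\<tau> s) * (2 * s / 3))\<bar> \<le> 3" for s
    proof (cases "\<bar>s\<bar> \<le> 2")
      case True
      have "\<bar>H (\<tau> s)\<bar> * \<bar>2 * s / 3\<bar> \<le> 1 * (4 / 3)"
        using RH[of "\<tau> s"] True by (intro mult_mono) auto
      then show ?thesis by (simp add: abs_mult mult_ac)
    next
      case False
      then have "H (\<tau> s) = 0" using RH[of "\<tau> s"] t2[of s] by auto
      then show ?thesis by simp
    qed
    show "2 * (H (\<tau> s) * (2 * s / 3)) = 0" if "\<not> (1 < \<bar>s\<bar> \<and> \<bar>s\<bar> \<le> 2)" for s
    proof -
      have "\<tau> s \<le> 0 \<or> 1 \<le> \<tau> s" using that t1[of s] t2[of s] by linarith
      then show ?thesis using RH[of "\<tau> s"] by auto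
    qed
    show "0 \<le> 2 * R (\<tau> s)" "2 * R (\<tau> s) \<le> 1" for s using RH[of "\<tau> s"] by auto
    show "2 * R (\<tau> s) = 0" if "\<bar>s\<bar> \<le> 1" for s using that RH[of "\<tau> s"] t1[of s] by auto
    show "2 * R (\<tau> s) = 1" if "2 \<le> \<bar>s\<bar>" for s using that RH[of "\<tau> s"] t2[of s] by auto
  qed
qed

lemma C1c_compose:
  fixes A A' :: "real \<Rightarrow> real"
  assumes f: "C1c f" and A: "\<And>s. (A has_real_derivative A' s) (at s)" "continuous_on UNIV A'" "A 0 = 0"
  shows "C1c (\<lambda>x. A (f x))" and "fd (\<lambda>x. A (f x)) x e = A' (f x) * fd f x e"
proof -
  have D: "((\<lambda>x. A (f x)) has_derivative (\<lambda>e. A' (f x) * fd f x e)) (at x)" for x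
    using has_derivative_compose[OF C1cD(1)[OF f] A(1)[unfolded has_field_derivative_def]] .
  then show fd: "fd (\<lambda>x. A (f x)) x e = A' (f x) * fd f x e" for x e
    using frechet_derivative_at[OF D] by metis
  obtain K where "compact K" "\<And>x. x \<notin> K \<Longrightarrow> f x = 0" using f by (auto simp: C1c_def)
  then have "\<exists>K. compact K \<and> (\<forall>x. x \<notin> K \<longrightarrow> A (f x) = 0)" using A(3) by auto
  moreover have "continuous_on UNIV (\<lambda>x. A' (f x) * fd f x e)" for e
    by (intro continuous_on_mult C1cD(2)[OF f] continuous_on_compose2[OF A(2) C1cD(3)[OF f]]) auto
  ultimately show "C1c (\<lambda>x. A (f x))"
    using D unfolding C1c_def fd by (auto simp: differentiable_def)
qed

lemma grushin_grad_compose: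
  fixes f :: "('m::finite, 'k::finite) point \<Rightarrow> real"
  assumes f: "C1c f" and A: "\<And>s. (A has_real_derivative A' s) (at s)" "continuous_on UNIV A'" "A 0 = 0"
  shows "grushin_grad \<gamma> (\<lambda>x. A (f x)) z = A' (f z) *\<^sub>R grushin_grad \<gamma> f z"
  by (simp add: grushin_grad_def grushin_X_def grushin_Y_def C1c_compose(2)[OF assms] vec_eq_iff mult_ac)

text \<open>The outer 2 counts two half spaces, the next factors are the constant of the half space
  estimate without r and l, and 4^(p/Q) comes from the choice r = (4 a)^(1/Q).\<close>

definition weak_const :: "nat \<Rightarrow> real \<Rightarrow> real \<Rightarrow> real" where
  "weak_const n p Q = 2 * (4 * 2 powr p * (4 * real n) powr p * 4 powr (p / Q))"

text \<open>A weak-type Sobolev inequality at a single height. The two half spaces given by the sign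
  of one coordinate of x cover everything, and the radius r is adapted to the measure of {g > 0}.
  For a = 0 no positive r results, but then the level set is null as a subset of {g > 0}.\<close>

lemma level_estimate:
  fixes g :: "('m::finite, 'k::finite) point \<Rightarrow> real"
  assumes \<gamma>: "0 \<le> \<gamma>" and p: "1 \<le> p" and g: "C1c g" and g0: "\<And>z. 0 \<le> g z" "\<And>z. g z \<le> l" and l: "0 < l"
    and Q: "Q = real CARD('m) + (1 + \<gamma>) * real CARD('k)"
    and a: "emeasure lborel {z. 0 < g z} \<le> ennreal a" "0 \<le> a"
  shows "emeasure lborel {z. g z = l} \<le>
      ennreal (weak_const (CARD('m) + CARD('k)) p Q * a powr (p / Q) / l powr p) * modular p (grushin_grad \<gamma> g)"
proof -
  have Q0: "0 < Q" using \<gamma> by (simp add: Q add_pos_nonneg)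
  have op: "open {z. 0 < g z}"
    by (intro open_Collect_less continuous_intros C1cD(3)[OF g])
  show ?thesis
  proof (cases "a = 0")
    case True
    have "emeasure lborel {z. g z = l} \<le> emeasure lborel {z. 0 < g z}"
      using l op by (intro emeasure_mono) auto
    then show ?thesis using a True by simp
  next
    case False
    then have a0: "0 < a" using a by simp
    define r where "r = (4 * a) powr (1 / Q)"
    have r: "0 < r" "r powr Q = 4 * a"
      using a0 Q0 by (auto simp: r_def powr_powr)
    define n where "n = CARD('m) + CARD('k)"
    define c where "c = 4 * 2 powr p * (4 * r * real n / l) powr p"
    \<comment> \<open>Any coordinate of x serves, so the index is left
      \<open>undefined\<close>.\<close>
    have half: "emeasure lborel {z. g z = l \<and> 0 \<le> sg * fst z $ undefined} \<le> ennreal c * modular p (grushin_grad \<gamma> g)"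
      if "\<bar>sg\<bar> = 1" for sg :: real
      using half_space_level_estimate[OF \<gamma> p g g0 l r(1) that Q a(1) _ a(2), of undefined] r by (simp add: c_def n_def)
    have cl: "closed {z. g z = l \<and> 0 \<le> sg * fst z $ undefined}" for sg :: real
      by (intro closed_Collect_conj closed_Collect_eq closed_Collect_le continuous_intros C1cD(3)[OF g])
    have "emeasure lborel {z. g z = l} \<le>
        emeasure lborel ({z. g z = l \<and> 0 \<le> 1 * fst z $ undefined} \<union> {z. g z = l \<and> 0 \<le> (-1) * fst z $ undefined})"
    proof (rule emeasure_mono)
      show "{z. g z = l \<and> 0 \<le> 1 * fst z $ undefined} \<union> {z. g z = l \<and> 0 \<le> (-1) * fst z $ undefined} \<in> sets lborel"
        using borel_closed[OF closed_Un[OF cl[of 1] cl[of "-1"]]] by (simp only: sets_lborel)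
    qed auto
    also have "\<dots> \<le> emeasure lborel {z. g z = l \<and> 0 \<le> 1 * fst z $ undefined} + emeasure lborel {z. g z = l \<and> 0 \<le> (-1) * fst z $ undefined}"
      using borel_closed[OF cl[of 1]] borel_closed[OF cl[of "-1"]]
      by (intro emeasure_subadditive) (simp_all only: sets_lborel)
    also have "\<dots> \<le> ennreal c * modular p (grushin_grad \<gamma> g) + ennreal c * modular p (grushin_grad \<gamma> g)"
      by (intro add_mono half) auto
    also have "\<dots> = ennreal (2 * c) * modular p (grushin_grad \<gamma> g)"
      by (simp add: c_def mult.assoc flip: distrib_right ennreal_plus)
    also have "2 * c = weak_const n p Q * a powr (p / Q) / l powr p"
    proof -
      have "r powr p = 4 powr (p / Q) * a powr (p / Q)"
        using a0 by (simp add: r_def powr_powr powr_mult)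
      then show ?thesis
        using l r by (simp add: c_def weak_const_def powr_mult powr_divide)
    qed
    finally show ?thesis by (simp add: n_def)
  qed
qed

lemma C1c_level_sets:
  assumes f: "C1c f" and s: "0 < s"
  shows "{z. s \<le> \<bar>f z\<bar>} \<in> sets borel" "emeasure lborel {z. s \<le> \<bar>f z\<bar>} < \<infinity>"
    "emeasure lborel {z. s \<le> \<bar>f z\<bar>} = ennreal (measure lborel {z. s \<le> \<bar>f z\<bar>})"
proof -
  show m: "{z. s \<le> \<bar>f z\<bar>} \<in> sets borel"
    by (intro borel_closed closed_Collect_le continuous_intros C1cD(3)[OF f])
  obtain K where K: "compact K" "\<And>x. x \<notin> K \<Longrightarrow> f x = 0" using f by (auto simp: C1c_def)
  have "emeasure lborel {z. s \<le> \<bar>f z\<bar>} \<le> emeasure lborel K"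
    using K s borel_compact[OF K(1)] by (intro emeasure_mono) force+
  then show "emeasure lborel {z. s \<le> \<bar>f z\<bar>} < \<infinity>"
    using emeasure_compact_finite[OF K(1)] by simp
  then show "emeasure lborel {z. s \<le> \<bar>f z\<bar>} = ennreal (measure lborel {z. s \<le> \<bar>f z\<bar>})"
    by (intro emeasure_eq_ennreal_measure) auto
qed

lemma grad_powr_integrable:
  fixes \<phi> :: "('m::finite, 'k::finite) point \<Rightarrow> real"
  assumes \<gamma>: "0 \<le> \<gamma>" and p: "0 < p" and \<phi>: "C1c \<phi>"
  shows "continuous_on UNIV (\<lambda>z. norm (grushin_grad \<gamma> \<phi> z) powr p)"
    and "integrable lborel (\<lambda>z. norm (grushin_grad \<gamma> \<phi> z) powr p)"
proof -
  show c: "continuous_on UNIV (\<lambda>z. norm (grushin_grad \<gamma> \<phi> z) powr p)"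
    using p by (intro continuous_on_powr' continuous_intros continuous_grushin_grad \<gamma> C1cD(2)[OF \<phi>]) auto
  obtain K where K: "compact K" "\<And>x. x \<notin> K \<Longrightarrow> \<phi> x = 0" using \<phi> by (auto simp: C1c_def)
  have "fd \<phi> x e = 0" if "x \<notin> K" for x e
    using derivative_zero_outside[OF C1cD(1)[OF \<phi>] compact_imp_closed[OF K(1)] K(2) that] .
  then have "grushin_grad \<gamma> \<phi> x = 0" if "x \<notin> K" for x
    using that by (simp add: grushin_grad_def grushin_X_def grushin_Y_def prod_eq_iff vec_eq_iff)
  then show "integrable lborel (\<lambda>z. norm (grushin_grad \<gamma> \<phi> z) powr p)"
    by (intro continuous_compact_support_integrable[OF c K(1)]) simp
qed

text \<open>The single-height estimate is applied to l T(\<phi>/l), which equals l where |\<phi>|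
  \<ge> 2 l and vanishes where |\<phi>| \<le> l. Its gradient is at most 3 times that of \<phi> and
  lives on one dyadic layer; the localisation to the layer is what later allows summation.\<close>

lemma truncated_level_estimate:
  fixes \<phi> :: "('m::finite, 'k::finite) point \<Rightarrow> real"
  assumes \<gamma>: "0 \<le> \<gamma>" and p: "1 \<le> p" and \<phi>: "C1c \<phi>" and l: "0 < l"
    and Q: "Q = real CARD('m) + (1 + \<gamma>) * real CARD('k)"
  defines "a \<equiv> \<lambda>s. measure lborel {z. s \<le> \<bar>\<phi> z\<bar>}"
  shows "a (2 * l) \<le> weak_const (CARD('m) + CARD('k)) p Q * 3 powr p * a l powr (p / Q) / l powr p *
      integral\<^sup>L lborel (\<lambda>z. indicator {z. l < \<bar>\<phi> z\<bar> \<and> \<bar>\<phi> z\<bar> \<le> 2 * l} z * norm (grushin_grad \<gamma> \<phi> z) powr p)"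
proof -
  obtain T T' :: "real \<Rightarrow> real" where T: "\<And>s. (T has_real_derivative T' s) (at s)" "continuous_on UNIV T'"
    "\<And>s. 0 \<le> T s" "\<And>s. T s \<le> 1" "\<And>s. \<bar>s\<bar> \<le> 1 \<Longrightarrow> T s = 0" "\<And>s. 2 \<le> \<bar>s\<bar> \<Longrightarrow> T s = 1"
    "\<And>s. \<bar>T' s\<bar> \<le> 3" "\<And>s. \<not> (1 < \<bar>s\<bar> \<and> \<bar>s\<bar> \<le> 2) \<Longrightarrow> T' s = 0"
    using smooth_step_exists by metis
  note [measurable] = C1cD(4)[OF \<phi>]
  have [measurable]: "grushin_grad \<gamma> \<phi> \<in> borel_measurable borel"
    by (intro borel_measurable_continuous_onI continuous_grushin_grad \<gamma> C1cD(2)[OF \<phi>])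
  define A where "A s = l * T (s / l)" for s
  have A: "(A has_real_derivative T' (s / l)) (at s)" for s
  proof -
    have "((\<lambda>s. T (s / l)) has_real_derivative T' (s / l) * (1 / l)) (at s)"
      by (rule DERIV_chain2[OF T(1)]) (use l in \<open>auto intro!: derivative_eq_intros\<close>)
    from DERIV_cmult[OF this, of l] show ?thesis using l by (simp add: A_def[abs_def])
  qed
  have A': "continuous_on UNIV (\<lambda>s. T' (s / l))"
    by (rule continuous_on_compose2[OF T(2)]) (use l in \<open>auto intro!: continuous_intros\<close>)
  have A0: "A 0 = 0" using T(5)[of 0] by (simp add: A_def)
  define g where "g z = A (\<phi> z)" for z
  have g: "C1c g" unfolding g_def[abs_def] by (rule C1c_compose(1)[OF \<phi> A A' A0])
  have gg: "grushin_grad \<gamma> g z = T' (\<phi> z / l) *\<^sub>R grushin_grad \<gamma> \<phi> z" for z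
    unfolding g_def[abs_def] by (rule grushin_grad_compose[OF \<phi> A A' A0])
  have q: "\<bar>s / l\<bar> \<le> c \<longleftrightarrow> \<bar>s\<bar> \<le> c * l" "c \<le> \<bar>s / l\<bar> \<longleftrightarrow> c * l \<le> \<bar>s\<bar>" "c < \<bar>s / l\<bar> \<longleftrightarrow> c * l < \<bar>s\<bar>" for s c
    using l by (simp_all add: abs_divide divide_le_eq le_divide_eq less_divide_eq)
  have sub1: "{z. 0 < g z} \<subseteq> {z. l \<le> \<bar>\<phi> z\<bar>}"
  proof
    fix z assume "z \<in> {z. 0 < g z}"
    then have "T (\<phi> z / l) \<noteq> 0" by (auto simp: g_def A_def)
    then have "\<not> \<bar>\<phi> z / l\<bar> \<le> 1" using T(5)[of "\<phi> z / l"] by blast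
    then show "z \<in> {z. l \<le> \<bar>\<phi> z\<bar>}" unfolding q by simp
  qed
  have sub2: "{z. 2 * l \<le> \<bar>\<phi> z\<bar>} \<subseteq> {z. g z = l}"
  proof
    fix z assume "z \<in> {z. 2 * l \<le> \<bar>\<phi> z\<bar>}"
    then have "2 \<le> \<bar>\<phi> z / l\<bar>" unfolding q by simp
    then have "T (\<phi> z / l) = 1" by (rule T(6))
    then show "z \<in> {z. g z = l}" by (simp add: g_def A_def)
  qed
  define E where "E = integral\<^sup>L lborel (\<lambda>z. indicator {z. l < \<bar>\<phi> z\<bar> \<and> \<bar>\<phi> z\<bar> \<le> 2 * l} z * norm (grushin_grad \<gamma> \<phi> z) powr p)"
  have iE: "integrable lborel (\<lambda>z. indicator {z. l < \<bar>\<phi> z\<bar> \<and> \<bar>\<phi> z\<bar> \<le> 2 * l} z * norm (grushin_grad \<gamma> \<phi> z) powr p)"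
    by (rule Bochner_Integration.integrable_bound[OF grad_powr_integrable(2)[OF \<gamma> _ \<phi>, of p]])
      (use p in \<open>auto simp: indicator_def\<close>)
  have mod: "modular p (grushin_grad \<gamma> g) \<le> ennreal (3 powr p * E)"
  proof -
    have "modular p (grushin_grad \<gamma> g) \<le>
        (\<integral>\<^sup>+z. ennreal (3 powr p * (indicator {z. l < \<bar>\<phi> z\<bar> \<and> \<bar>\<phi> z\<bar> \<le> 2 * l} z * norm (grushin_grad \<gamma> \<phi> z) powr p)) \<partial>lborel)"
      unfolding modular_def
    proof (intro nn_integral_mono ennreal_leI)
      fix z
      show "norm (grushin_grad \<gamma> g z) powr p \<le> 3 powr p * (indicator {z. l < \<bar>\<phi> z\<bar> \<and> \<bar>\<phi> z\<bar> \<le> 2 * l} z * norm (grushin_grad \<gamma> \<phi> z) powr p)"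
      proof (cases "l < \<bar>\<phi> z\<bar> \<and> \<bar>\<phi> z\<bar> \<le> 2 * l")
        case True
        have "norm (grushin_grad \<gamma> g z) powr p \<le> (3 * norm (grushin_grad \<gamma> \<phi> z)) powr p"
          unfolding gg using T(7) p by (intro powr_mono2) (auto intro!: mult_right_mono)
        then show ?thesis using True by (simp add: powr_mult)
      next
        case False
        then have "\<not> (1 < \<bar>\<phi> z / l\<bar> \<and> \<bar>\<phi> z / l\<bar> \<le> 2)"
          unfolding q by simp
        then have "T' (\<phi> z / l) = 0" by (rule T(8))
        then show ?thesis by (simp add: gg)
      qed
    qed
    also have "\<dots> = ennreal (3 powr p * E)"
      unfolding E_def using iE by (subst nn_integral_eq_integral) auto
    finally show ?thesis .
  qed
  have gb: "0 \<le> g z" "g z \<le> l" for z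
    using T(3,4)[of "\<phi> z / l"] l by (auto simp: g_def A_def)
  define W where "W = weak_const (CARD('m) + CARD('k)) p Q"
  have W: "0 \<le> W" by (simp add: W_def weak_const_def)
  have E0: "0 \<le> E" by (simp add: E_def)
  have a0: "emeasure lborel {z. 0 < g z} \<le> ennreal (a l)"
    using emeasure_mono[OF sub1, of lborel] C1c_level_sets[OF \<phi> l] by (simp add: a_def)
  have "ennreal (a (2 * l)) = emeasure lborel {z. 2 * l \<le> \<bar>\<phi> z\<bar>}"
    using C1c_level_sets(3)[OF \<phi>, of "2 * l"] l by (simp add: a_def)
  also have "\<dots> \<le> emeasure lborel {z. g z = l}"
  proof (rule emeasure_mono[OF sub2])
    have "closed {z. g z = l}" by (intro closed_Collect_eq continuous_intros C1cD(3)[OF g])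
    then show "{z. g z = l} \<in> sets lborel" by (simp add: borel_closed)
  qed
  also have "\<dots> \<le> ennreal (W * a l powr (p / Q) / l powr p) * modular p (grushin_grad \<gamma> g)"
    unfolding W_def by (rule level_estimate[OF \<gamma> p g gb l Q a0]) (simp add: a_def)
  also have "\<dots> \<le> ennreal (W * a l powr (p / Q) / l powr p) * ennreal (3 powr p * E)"
    by (intro mult_left_mono mod) simp
  also have "\<dots> = ennreal (W * 3 powr p * a l powr (p / Q) / l powr p * E)"
    using W E0 l by (simp add: mult_ac flip: ennreal_mult)
  finally show ?thesis
    using W E0 by (simp add: W_def E_def)
qed

section \<open>From level sets to the Sobolev inequality\<close>

text \<open>Maz'ya's truncation argument. With l n halving at each step and b n = (l n)^P |{|\<phi>|
  \<ge> l n}|, the layer estimate reads b n \<le> C b(n+1)^\<alpha> E(n+1). As the layers are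
  disjoint, summation gives S \<le> C S^\<alpha> E for the sum S of the b n, and S controls the P-th
  power integral up to the factor 2^P.\<close>

lemma grushin_Sobolev:
  fixes \<phi> :: "('m::finite, 'k::finite) point \<Rightarrow> real"
  assumes \<gamma>: "0 \<le> \<gamma>" and p: "1 \<le> p" and Q: "Q = real CARD('m) + (1 + \<gamma>) * real CARD('k)" and pQ: "p < Q"
    and \<phi>: "C1c \<phi>"
  defines "P \<equiv> Q * p / (Q - p)"
  defines "C \<equiv> 2 powr P * (weak_const (CARD('m) + CARD('k)) p Q * 3 powr p)"
  shows "integrable lborel (\<lambda>z. \<bar>\<phi> z\<bar> powr P)"
    and "integral\<^sup>L lborel (\<lambda>z. \<bar>\<phi> z\<bar> powr P) powr (1 - p / Q) \<le>
      2 powr p * C * integral\<^sup>L lborel (\<lambda>z. norm (grushin_grad \<gamma> \<phi> z) powr p)"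
proof -
  note [measurable] = C1cD(4)[OF \<phi>]
  define \<alpha> where "\<alpha> = p / Q"
  have Q0: "0 < Q" using p pQ by linarith
  have \<alpha>: "0 < \<alpha>" "\<alpha> < 1" using p pQ Q0 by (auto simp: \<alpha>_def)
  have P: "0 < P" "P * (1 - \<alpha>) = p" "P - p = P * \<alpha>"
    using p pQ Q0 by (auto simp: P_def \<alpha>_def field_simps)
  have C: "0 \<le> C" by (simp add: C_def weak_const_def)
  obtain K where K: "compact K" "\<And>x. x \<notin> K \<Longrightarrow> \<phi> x = 0" using \<phi> by (auto simp: C1c_def)
  show iP: "integrable lborel (\<lambda>z. \<bar>\<phi> z\<bar> powr P)"
  proof (rule continuous_compact_support_integrable[OF _ K(1)])
    show "continuous_on UNIV (\<lambda>z. \<bar>\<phi> z\<bar> powr P)"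
      using P by (intro continuous_on_powr' continuous_intros C1cD(3)[OF \<phi>]) auto
  qed (simp add: K(2))
  obtain L0 where L0: "0 < L0" "\<And>z. norm (\<phi> z) \<le> L0"
    using continuous_compact_support_bounded[OF C1cD(3)[OF \<phi>] K] by metis
  define L where "L = 2 * L0"
  have L: "0 < L" "\<And>z. \<bar>\<phi> z\<bar> < L"
  proof -
    show "0 < L" using L0(1) by (simp add: L_def)
    show "\<bar>\<phi> z\<bar> < L" for z using L0(1) L0(2)[of z] by (simp add: L_def)
  qed
  define l where "l n = L / 2 ^ n" for n
  have l: "0 < l n" "l n = 2 * l (Suc n)" for n using L by (auto simp: l_def)
  define a where "a n = measure lborel {z. l n \<le> \<bar>\<phi> z\<bar>}" for n
  define b where "b n = l n powr P * a n" for n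
  define E where "E n = integral\<^sup>L lborel (\<lambda>z. indicator {z. l n < \<bar>\<phi> z\<bar> \<and> \<bar>\<phi> z\<bar> \<le> 2 * l n} z * norm (grushin_grad \<gamma> \<phi> z) powr p)" for n
  define Et where "Et = integral\<^sup>L lborel (\<lambda>z. norm (grushin_grad \<gamma> \<phi> z) powr p)"
  have ig: "integrable lborel (\<lambda>z. norm (grushin_grad \<gamma> \<phi> z) powr p)"
    by (rule grad_powr_integrable(2)[OF \<gamma> _ \<phi>]) (use p in auto)
  have [measurable]: "grushin_grad \<gamma> \<phi> \<in> borel_measurable borel"
    by (intro borel_measurable_continuous_onI continuous_grushin_grad \<gamma> C1cD(2)[OF \<phi>])
  have nonneg: "0 \<le> a n" "0 \<le> b n" "0 \<le> E n" for n
    by (auto simp: a_def b_def E_def)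
  have iE: "integrable lborel (\<lambda>z. indicator {z. l n < \<bar>\<phi> z\<bar> \<and> \<bar>\<phi> z\<bar> \<le> 2 * l n} z * norm (grushin_grad \<gamma> \<phi> z) powr p)" for n
    by (rule Bochner_Integration.integrable_bound[OF ig]) (auto simp: indicator_def)
  have step: "b n \<le> C * b (Suc n) powr \<alpha> * E (Suc n)" for n
  proof -
    define m where "m = Suc n"
    have lm: "0 < l m" "l n = 2 * l m" using l(1)[of m] l(2)[of n] by (simp_all add: m_def)
    have "a n \<le> weak_const (CARD('m) + CARD('k)) p Q * 3 powr p * a m powr \<alpha> / l m powr p * E m"
      using truncated_level_estimate[OF \<gamma> p \<phi> lm(1) Q] unfolding a_def E_def \<alpha>_def lm(2) .
    then have "l n powr P * a n \<le> l n powr P * (weak_const (CARD('m) + CARD('k)) p Q * 3 powr p * a m powr \<alpha> / l m powr p * E m)"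
      by (intro mult_left_mono) auto
    also have "\<dots> = C * (l m powr P / l m powr p * a m powr \<alpha>) * E m"
      using lm by (simp add: C_def powr_mult mult_ac)
    \<comment> \<open>The exponents match because P - p = P \<alpha>, which singles out P.\<close>
    also have "l m powr P / l m powr p * a m powr \<alpha> = b m powr \<alpha>"
      using lm nonneg(1)[of m] by (simp add: b_def powr_mult powr_powr P(3)[symmetric] powr_diff)
    finally show ?thesis by (simp add: b_def m_def)
  qed
  have sE: "(\<Sum>n<N. E n) \<le> Et" for N
  proof -
    have "(\<Sum>n<N. E n) = integral\<^sup>L lborel (\<lambda>z. \<Sum>n<N. indicator {z. l n < \<bar>\<phi> z\<bar> \<and> \<bar>\<phi> z\<bar> \<le> 2 * l n} z * norm (grushin_grad \<gamma> \<phi> z) powr p)"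
      unfolding E_def by (rule Bochner_Integration.integral_sum[symmetric]) (rule iE)
    also have "\<dots> \<le> Et"
      unfolding Et_def
    proof (rule integral_mono[OF _ ig])
      show "integrable lborel (\<lambda>z. \<Sum>n<N. indicator {z. l n < \<bar>\<phi> z\<bar> \<and> \<bar>\<phi> z\<bar> \<le> 2 * l n} z * norm (grushin_grad \<gamma> \<phi> z) powr p)"
        by (intro Bochner_Integration.integrable_sum iE)
      fix z
      \<comment> \<open>For n < n' one has 2 l n' \<le> l n, so the layers are disjoint and at most
        one summand is nonzero at each point.\<close>
      define X where "X = {n. n < N \<and> l n < \<bar>\<phi> z\<bar> \<and> \<bar>\<phi> z\<bar> \<le> 2 * l n}"
      have anti: "2 * l n' \<le> l n" if "n < n'" for n n'
      proof -
        have "(2::real) ^ Suc n \<le> 2 ^ n'" using that by (intro power_increasing) auto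
        then have "L / 2 ^ n' \<le> L / 2 ^ Suc n" using L(1) by (intro divide_left_mono) auto
        then show ?thesis by (simp add: l_def)
      qed
      have "n = n'" if "n \<in> X" "n' \<in> X" for n n'
        using that anti[of n n'] anti[of n' n] by (cases n n' rule: linorder_cases) (auto simp: X_def)
      moreover have "finite X" unfolding X_def by simp
      ultimately have "card X \<le> 1" using card_le_Suc0_iff_eq[of X] by auto
      have "(\<Sum>n<N. indicator {z. l n < \<bar>\<phi> z\<bar> \<and> \<bar>\<phi> z\<bar> \<le> 2 * l n} z * norm (grushin_grad \<gamma> \<phi> z) powr p) =
          (\<Sum>n\<in>X. norm (grushin_grad \<gamma> \<phi> z) powr p)"
        by (rule sum.mono_neutral_cong_right) (auto simp: X_def indicator_def)
      also have "\<dots> \<le> norm (grushin_grad \<gamma> \<phi> z) powr p"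
        using \<open>card X \<le> 1\<close> mult_right_mono[of "real (card X)" 1 "norm (grushin_grad \<gamma> \<phi> z) powr p"] by simp
      finally show "(\<Sum>n<N. indicator {z. l n < \<bar>\<phi> z\<bar> \<and> \<bar>\<phi> z\<bar> \<le> 2 * l n} z * norm (grushin_grad \<gamma> \<phi> z) powr p) \<le>
          norm (grushin_grad \<gamma> \<phi> z) powr p" .
    qed
    finally show ?thesis .
  qed
  define \<mu> where "\<mu> = measure lborel K"
  have a_le: "a n \<le> \<mu>" for n
  proof -
    have "{z. l n \<le> \<bar>\<phi> z\<bar>} \<subseteq> K" using K(2) l(1)[of n] by force
    then show ?thesis
      unfolding a_def \<mu>_def using emeasure_compact_finite[OF K(1)] borel_compact[OF K(1)] C1c_level_sets(1)[OF \<phi> l(1)]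
      by (intro measure_mono_fmeasurable) (auto simp: fmeasurable_def)
  qed
  \<comment> \<open>The measures are bounded by that of the support and (l n)^P decays
    geometrically. Finiteness of the sum S is what permits dividing by S^\<alpha> below.\<close>
  have sb: "summable b"
  proof (rule summable_comparison_test')
    show "summable (\<lambda>n. L powr P * \<mu> * (2 powr (- P)) ^ n)"
      using P by (intro summable_mult summable_geometric) (simp add: powr_less_one)
    show "norm (b n) \<le> L powr P * \<mu> * (2 powr (- P)) ^ n" for n
    proof -
      have "l n powr P = L powr P * (2 powr (- P)) ^ n"
      proof -
        have "(2 ^ n :: real) powr P = (2 powr real n) powr P" by (simp add: powr_realpow)
        also have "\<dots> = (2 powr P) powr real n" by (simp add: powr_powr mult.commute)
        also have "\<dots> = (2 powr P) ^ n" by (simp add: powr_realpow)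
        finally have "(2 ^ n :: real) powr P = (2 powr P) ^ n" .
        then show ?thesis using L(1) by (simp add: l_def powr_divide powr_minus power_inverse divide_simps)
      qed
      then show ?thesis
        using nonneg(1)[of n] mult_left_mono[OF a_le[of n], of "L powr P * (2 powr (- P)) ^ n"] by (simp add: b_def mult_ac)
    qed
  qed
  define S where "S = suminf b"
  have bS: "b n \<le> S" for n
    unfolding S_def using sum_le_suminf[OF sb, of "{n}"] nonneg(2) by simp
  have S0: "0 \<le> S" using bS[of 0] nonneg(2)[of 0] by linarith
  have "S \<le> C * S powr \<alpha> * Et"
    unfolding S_def
  proof (rule suminf_le_const[OF sb])
    fix N
    have "sum b {..<N} \<le> (\<Sum>n<N. C * S powr \<alpha> * E (Suc n))"
    proof (rule sum_mono)
      fix n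
      have "b (Suc n) powr \<alpha> \<le> S powr \<alpha>" using bS nonneg(2) \<alpha> by (intro powr_mono2) auto
      then show "b n \<le> C * S powr \<alpha> * E (Suc n)"
        using step[of n] C nonneg(3)[of "Suc n"] by (meson mult_left_mono mult_right_mono order_trans)
    qed
    also have "\<dots> = C * S powr \<alpha> * (\<Sum>n<N. E (Suc n))" by (simp add: sum_distrib_left)
    also have "\<dots> \<le> C * S powr \<alpha> * Et"
    proof (intro mult_left_mono)
      have "(\<Sum>n<N. E (Suc n)) \<le> (\<Sum>n<Suc N. E n)"
        unfolding sum.lessThan_Suc_shift using nonneg(3)[of 0] by simp
      then show "(\<Sum>n<N. E (Suc n)) \<le> Et" using sE[of "Suc N"] by linarith
    qed (use C in simp)
    finally show "sum b {..<N} \<le> C * suminf b powr \<alpha> * Et" by (simp add: S_def)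
  qed
  have Et0: "0 \<le> Et" by (simp add: Et_def)
  have SE: "S powr (1 - \<alpha>) \<le> C * Et"
  proof (cases "S = 0")
    case False
    then have "0 < S" using S0 by simp
    have "S powr (1 - \<alpha>) = S / S powr \<alpha>" using \<open>0 < S\<close> by (simp add: powr_diff)
    also have "\<dots> \<le> C * S powr \<alpha> * Et / S powr \<alpha>" using \<open>S \<le> C * S powr \<alpha> * Et\<close> by (intro divide_right_mono) auto
    also have "\<dots> = C * Et" using \<open>0 < S\<close> by simp
    finally show ?thesis .
  qed (use C Et0 in simp)
  have "ennreal (integral\<^sup>L lborel (\<lambda>z. \<bar>\<phi> z\<bar> powr P)) = (\<integral>\<^sup>+z. ennreal (\<bar>\<phi> z\<bar> powr P) \<partial>lborel)"
    using iP by (intro nn_integral_eq_integral[symmetric]) auto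
  also have "\<dots> \<le> (\<integral>\<^sup>+z. (\<Sum>n. ennreal ((2 * l n) powr P) * indicator {z. l n \<le> \<bar>\<phi> z\<bar>} z) \<partial>lborel)"
  proof (rule nn_integral_mono)
    fix z
    show "ennreal (\<bar>\<phi> z\<bar> powr P) \<le> (\<Sum>n. ennreal ((2 * l n) powr P) * indicator {z. l n \<le> \<bar>\<phi> z\<bar>} z)"
    proof (cases "\<phi> z = 0")
      case False
      obtain n0 where "(1/2) ^ n0 < \<bar>\<phi> z\<bar> / L"
        using real_arch_pow_inv[of "\<bar>\<phi> z\<bar> / L" "1/2"] False L by auto
      then have ex: "l n0 \<le> \<bar>\<phi> z\<bar>" using L(1) by (simp add: l_def field_simps)
      \<comment> \<open>The first height reached from above: by minimality |\<phi> z| lies below the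
        preceding height 2 l n, and for n = 0 the bound \<open>L\<close> takes its place.\<close>
      define n where "n = (LEAST n. l n \<le> \<bar>\<phi> z\<bar>)"
      have n: "l n \<le> \<bar>\<phi> z\<bar>" unfolding n_def using ex by (rule LeastI)
      have "\<bar>\<phi> z\<bar> \<le> 2 * l n"
      proof (cases n)
        case 0
        then show ?thesis using n L(2)[of z] by (simp add: l_def)
      next
        case (Suc k)
        then have "\<not> l k \<le> \<bar>\<phi> z\<bar>" using not_less_Least[of k "\<lambda>n. l n \<le> \<bar>\<phi> z\<bar>"] by (simp add: n_def)
        then show ?thesis using l(2)[of k] Suc by simp
      qed
      then have "\<bar>\<phi> z\<bar> powr P \<le> (2 * l n) powr P" using P by (intro powr_mono2) auto
      then have "ennreal (\<bar>\<phi> z\<bar> powr P) \<le> (\<Sum>n\<in>{n}. ennreal ((2 * l n) powr P) * indicator {z. l n \<le> \<bar>\<phi> z\<bar>} z)"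
        using n by (simp add: ennreal_leI)
      also have "\<dots> \<le> (\<Sum>n. ennreal ((2 * l n) powr P) * indicator {z. l n \<le> \<bar>\<phi> z\<bar>} z)"
        by (rule sum_le_suminf) auto
      finally show ?thesis .
    qed simp
  qed
  also have "\<dots> = (\<Sum>n. \<integral>\<^sup>+z. ennreal ((2 * l n) powr P) * indicator {z. l n \<le> \<bar>\<phi> z\<bar>} z \<partial>lborel)"
    by (rule nn_integral_suminf) (use C1c_level_sets(1)[OF \<phi> l(1)] in simp)
  also have "\<dots> = (\<Sum>n. ennreal (2 powr P * b n))"
  proof (rule suminf_cong)
    fix n
    show "(\<integral>\<^sup>+z. ennreal ((2 * l n) powr P) * indicator {z. l n \<le> \<bar>\<phi> z\<bar>} z \<partial>lborel) = ennreal (2 powr P * b n)"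
      using C1c_level_sets(1,3)[OF \<phi> l(1)[of n]] l(1)[of n]
      by (simp add: nn_integral_cmult_indicator b_def a_def powr_mult mult.assoc flip: ennreal_mult)
  qed
  also have "\<dots> = ennreal (2 powr P * S)"
    unfolding S_def using sb nonneg(2) by (subst suminf_ennreal2) (auto simp: suminf_mult intro!: summable_mult)
  finally have "integral\<^sup>L lborel (\<lambda>z. \<bar>\<phi> z\<bar> powr P) \<le> 2 powr P * S"
    using S0 by simp
  then have "integral\<^sup>L lborel (\<lambda>z. \<bar>\<phi> z\<bar> powr P) powr (1 - \<alpha>) \<le> (2 powr P * S) powr (1 - \<alpha>)"
    using \<alpha> by (intro powr_mono2) auto
  also have "\<dots> = 2 powr p * S powr (1 - \<alpha>)"
    using S0 P(2) by (simp add: powr_mult powr_powr)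
  also have "\<dots> \<le> 2 powr p * (C * Et)"
    using SE by (intro mult_left_mono) auto
  finally show "integral\<^sup>L lborel (\<lambda>z. \<bar>\<phi> z\<bar> powr P) powr (1 - p / Q) \<le>
      2 powr p * C * integral\<^sup>L lborel (\<lambda>z. norm (grushin_grad \<gamma> \<phi> z) powr p)"
    by (simp add: \<alpha>_def Et_def mult.assoc)
qed

text \<open>Hoelder's inequality between \<open>h\<close> in L^1 and |\<phi>|^P in L^1 with weights
  p/Q and 1 - p/Q; since P (1 - p/Q) = p, the power of \<phi> is p. The constant is independent of
  \<open>h\<close> and \<phi>, so small mass of \<open>h\<close> gives a small factor in front of
  the gradient.\<close>

lemma grushin_weighted_Sobolev:
  fixes \<gamma> p Q :: real
  assumes \<gamma>: "0 \<le> \<gamma>" and p: "1 \<le> p" and Q: "Q = real CARD('m::finite) + (1 + \<gamma>) * real CARD('k::finite)" and pQ: "p < Q"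
  obtains C where "0 \<le> C" "\<And>(\<phi> :: ('m, 'k) point \<Rightarrow> real) h. C1c \<phi> \<Longrightarrow> integrable lebesgue h \<Longrightarrow> (\<And>z. 0 \<le> h z) \<Longrightarrow>
    integrable lebesgue (\<lambda>z. h z powr (p / Q) * \<bar>\<phi> z\<bar> powr p) \<and>
    integral\<^sup>L lebesgue (\<lambda>z. h z powr (p / Q) * \<bar>\<phi> z\<bar> powr p) \<le>
      C * integral\<^sup>L lebesgue h powr (p / Q) * integral\<^sup>L lborel (\<lambda>z. norm (grushin_grad \<gamma> \<phi> z) powr p)"
proof -
  define P where "P = Q * p / (Q - p)"
  define C where "C = 2 powr P * (weak_const (CARD('m) + CARD('k)) p Q * 3 powr p)"
  define \<alpha> where "\<alpha> = p / Q"
  have Q0: "0 < Q" using p pQ by linarith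
  have \<alpha>: "0 < \<alpha>" "\<alpha> < 1" using p pQ Q0 by (auto simp: \<alpha>_def)
  have P: "P * (1 - \<alpha>) = p"
    using p pQ Q0 by (auto simp: P_def \<alpha>_def field_simps)
  show ?thesis
  proof (rule that[of "2 powr p * C"])
    show "0 \<le> 2 powr p * C" by (simp add: C_def weak_const_def)
    fix \<phi> h :: "('m, 'k) point \<Rightarrow> real"
    assume \<phi>: "C1c \<phi>" and h: "integrable lebesgue h" "\<And>z. 0 \<le> h z"
    note S = grushin_Sobolev[OF \<gamma> p Q pQ \<phi>, folded P_def C_def \<alpha>_def]
    have i: "integrable lebesgue (\<lambda>z. \<bar>\<phi> z\<bar> powr P)"
      and eq: "integral\<^sup>L lebesgue (\<lambda>z. \<bar>\<phi> z\<bar> powr P) = integral\<^sup>L lborel (\<lambda>z. \<bar>\<phi> z\<bar> powr P)"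
      using S(1) by (auto simp: integrable_completion integral_completion)
    have pw: "(\<bar>\<phi> z\<bar> powr P) powr (1 - \<alpha>) = \<bar>\<phi> z\<bar> powr p" for z
      by (simp add: powr_powr P)
    note H = Holder_powr[OF \<alpha> h i, unfolded pw]
    have "integral\<^sup>L lebesgue (\<lambda>z. h z powr \<alpha> * \<bar>\<phi> z\<bar> powr p) \<le>
        integral\<^sup>L lebesgue h powr \<alpha> * integral\<^sup>L lborel (\<lambda>z. \<bar>\<phi> z\<bar> powr P) powr (1 - \<alpha>)"
      using H(2) by (simp add: eq)
    also have "\<dots> \<le> integral\<^sup>L lebesgue h powr \<alpha> * (2 powr p * C * integral\<^sup>L lborel (\<lambda>z. norm (grushin_grad \<gamma> \<phi> z) powr p))"
      using S(2) by (intro mult_left_mono) (auto simp: C_def)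
    finally show "integrable lebesgue (\<lambda>z. h z powr (p / Q) * \<bar>\<phi> z\<bar> powr p) \<and>
      integral\<^sup>L lebesgue (\<lambda>z. h z powr (p / Q) * \<bar>\<phi> z\<bar> powr p) \<le>
      2 powr p * C * integral\<^sup>L lebesgue h powr (p / Q) * integral\<^sup>L lborel (\<lambda>z. norm (grushin_grad \<gamma> \<phi> z) powr p)"
      using H(1) by (simp add: \<alpha>_def mult_ac)
  qed
qed

section \<open>Integrability lemmas and truncations\<close>

text \<open>By compactness finitely many times t approximate all others in L^1, and each single
  function has a small tail above some height \<open>n t\<close>. One \<open>N\<close> at least
  twice all these heights then serves for the whole interval.\<close>

lemma uniform_integrability:
  fixes f :: "real \<Rightarrow> 'a \<Rightarrow> real"
  assumes int: "\<And>t. t \<in> {a..b} \<Longrightarrow> integrable M (f t)"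
    and cont: "\<And>t. t \<in> {a..b} \<Longrightarrow> ((\<lambda>s. integral\<^sup>L M (\<lambda>z. \<bar>f s z - f t z\<bar>)) \<longlongrightarrow> 0) (at t within {a..b})"
    and e: "0 < e"
  obtains N where "1 \<le> N"
    "\<And>t. t \<in> {a..b} \<Longrightarrow> integral\<^sup>L M (\<lambda>z. \<bar>f t z\<bar> * indicator {x. N < x} \<bar>f t z\<bar>) \<le> e"
proof -
  have tail: "\<exists>n::nat. integral\<^sup>L M (\<lambda>z. \<bar>f t z\<bar> * indicator {x. real n < x} \<bar>f t z\<bar>) < e / 4"
    if t: "t \<in> {a..b}" for t
  proof -
    note [measurable] = borel_measurable_integrable[OF int[OF t]]
    have "(\<lambda>n. integral\<^sup>L M (\<lambda>z. \<bar>f t z\<bar> * indicator {x. real n < x} \<bar>f t z\<bar>)) \<longlonglongrightarrow> integral\<^sup>L M (\<lambda>z. 0)"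
    proof (rule integral_dominated_convergence[where w="\<lambda>z. \<bar>f t z\<bar>"])
      show "AE z in M. (\<lambda>n. \<bar>f t z\<bar> * indicator {x. real n < x} \<bar>f t z\<bar>) \<longlonglongrightarrow> 0"
      proof (rule AE_I2)
        fix z
        obtain n0 where "\<bar>f t z\<bar> \<le> real n0" using real_arch_simple by blast
        then have "\<forall>\<^sub>F n in sequentially. \<bar>f t z\<bar> * indicator {x. real n < x} \<bar>f t z\<bar> = 0"
          unfolding eventually_sequentially by (intro exI[of _ n0]) (auto simp: indicator_def)
        then show "(\<lambda>n. \<bar>f t z\<bar> * indicator {x. real n < x} \<bar>f t z\<bar>) \<longlonglongrightarrow> 0"
          by (rule tendsto_eventually)
      qed
    qed (use int[OF t] in \<open>auto simp: indicator_def\<close>)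
    then have "\<forall>\<^sub>F n in sequentially. integral\<^sup>L M (\<lambda>z. \<bar>f t z\<bar> * indicator {x. real n < x} \<bar>f t z\<bar>) < e / 4"
      using e by (intro order_tendstoD(2)) auto
    then show ?thesis by (rule eventually_happens'[OF sequentially_bot])
  qed
  then obtain n :: "real \<Rightarrow> nat" where n: "\<And>t. t \<in> {a..b} \<Longrightarrow>
      integral\<^sup>L M (\<lambda>z. \<bar>f t z\<bar> * indicator {x. real (n t) < x} \<bar>f t z\<bar>) < e / 4" by metis
  have "\<exists>d>0. \<forall>s\<in>{a..b}. dist s t < d \<longrightarrow> integral\<^sup>L M (\<lambda>z. \<bar>f s z - f t z\<bar>) < e / 4" if t: "t \<in> {a..b}" for t
  proof -
    have "\<forall>\<^sub>F s in at t within {a..b}. integral\<^sup>L M (\<lambda>z. \<bar>f s z - f t z\<bar>) < e / 4"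
      using cont[OF t] e by (intro order_tendstoD(2)) auto
    then obtain d where d: "d > 0" "\<And>s. s \<in> {a..b} \<Longrightarrow> s \<noteq> t \<Longrightarrow> dist s t < d \<Longrightarrow> integral\<^sup>L M (\<lambda>z. \<bar>f s z - f t z\<bar>) < e / 4"
      unfolding eventually_at by blast
    have "integral\<^sup>L M (\<lambda>z. \<bar>f t z - f t z\<bar>) < e / 4" using e by simp
    with d show ?thesis by metis
  qed
  then obtain d where d: "\<And>t. t \<in> {a..b} \<Longrightarrow> 0 < d t"
    "\<And>t s. t \<in> {a..b} \<Longrightarrow> s \<in> {a..b} \<Longrightarrow> dist s t < d t \<Longrightarrow> integral\<^sup>L M (\<lambda>z. \<bar>f s z - f t z\<bar>) < e / 4"
    by metis
  have "{a..b} \<subseteq> (\<Union>t\<in>{a..b}. ball t (d t))" using d(1) by force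
  from compactE_image[OF compact_Icc open_ball this]
  obtain C where C: "C \<subseteq> {a..b}" "finite C" "{a..b} \<subseteq> (\<Union>t\<in>C. ball t (d t))"
    by blast
  define N where "N = 1 + 2 * real (\<Sum>t\<in>C. n t)"
  show ?thesis
  proof
    show "1 \<le> N" by (simp add: N_def sum_nonneg)
    fix s assume s: "s \<in> {a..b}"
    then obtain t where t: "t \<in> C" "dist s t < d t" using C(3) by (auto simp: dist_commute)
    then have tab: "t \<in> {a..b}" using C(1) by auto
    have "n t \<le> (\<Sum>t\<in>C. n t)" using C(2) t(1) by (intro member_le_sum) auto
    then have "real (n t) \<le> real (\<Sum>t\<in>C. n t)" by (simp only: of_nat_le_iff)
    then have "2 * real (n t) \<le> N" unfolding N_def by linarith
    note [measurable] = borel_measurable_integrable[OF int[OF s]] borel_measurable_integrable[OF int[OF tab]]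
    \<comment> \<open>Suppose |f s z| > N. If |f t z| exceeds \<open>n t\<close>, the triangle
      inequality suffices. Otherwise |f t z| is at most half of |f s z|, so the difference carries
      at least the other half; this explains the two factors 2.\<close>
    have pw: "\<bar>f s z\<bar> * indicator {x. N < x} \<bar>f s z\<bar> \<le>
        2 * \<bar>f s z - f t z\<bar> + 2 * (\<bar>f t z\<bar> * indicator {x. real (n t) < x} \<bar>f t z\<bar>)" for z
    proof -
      have tri: "\<bar>f s z\<bar> \<le> \<bar>f s z - f t z\<bar> + \<bar>f t z\<bar>" by linarith
      show ?thesis
        using \<open>2 * real (n t) \<le> N\<close> tri unfolding indicator_def mem_Collect_eq
        by (cases "N < \<bar>f s z\<bar>"; cases "real (n t) < \<bar>f t z\<bar>"; simp; linarith)
    qed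
    have i1: "integrable M (\<lambda>z. \<bar>f s z - f t z\<bar>)" using int[OF s] int[OF tab] by auto
    have i2: "integrable M (\<lambda>z. \<bar>f t z\<bar> * indicator {x. real (n t) < x} \<bar>f t z\<bar>)"
      by (rule Bochner_Integration.integrable_bound[OF integrable_abs[OF int[OF tab]]]) (auto simp: indicator_def)
    have "integral\<^sup>L M (\<lambda>z. \<bar>f s z\<bar> * indicator {x. N < x} \<bar>f s z\<bar>) \<le>
        integral\<^sup>L M (\<lambda>z. 2 * \<bar>f s z - f t z\<bar> + 2 * (\<bar>f t z\<bar> * indicator {x. real (n t) < x} \<bar>f t z\<bar>))"
      using i1 i2 pw by (intro integral_mono') (auto simp: indicator_def)
    also have "\<dots> = 2 * integral\<^sup>L M (\<lambda>z. \<bar>f s z - f t z\<bar>) +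
        2 * integral\<^sup>L M (\<lambda>z. \<bar>f t z\<bar> * indicator {x. real (n t) < x} \<bar>f t z\<bar>)"
      using i1 i2 by simp
    also have "\<dots> \<le> e" using d(2)[OF tab s t(2)] n[OF tab] by simp
    finally show "integral\<^sup>L M (\<lambda>z. \<bar>f s z\<bar> * indicator {x. N < x} \<bar>f s z\<bar>) \<le> e" .
  qed
qed

lemma AE_lborel_sections:
  fixes P :: "'a::euclidean_space \<times> 'b::euclidean_space \<Rightarrow> bool"
  assumes "AE x in lborel. P x"
  shows "AE t in lborel. AE z in lborel. P (z, t)"
proof -
  obtain N where N: "{x. \<not> P x} \<subseteq> N" "N \<in> sets borel" "emeasure lborel N = 0"
    using AE_E[OF assms] by (auto simp: Collect_neg_eq)
  have "sets (lborel \<Otimes>\<^sub>M lborel) = sets (borel :: ('a \<times> 'b) measure)"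
    by (metis lborel_prod sets_lborel)
  with N(2) have [measurable]: "N \<in> sets (lborel \<Otimes>\<^sub>M lborel)" by blast
  have "(\<integral>\<^sup>+t. (\<integral>\<^sup>+z. indicator N (z, t) \<partial>lborel) \<partial>lborel) = (\<integral>\<^sup>+x. indicator N x \<partial>(lborel \<Otimes>\<^sub>M lborel))"
    by (rule lborel_pair.nn_integral_snd) measurable
  also have "\<dots> = 0" using N by (simp add: lborel_prod)
  finally have "AE t in lborel. (\<integral>\<^sup>+z. indicator N (z, t) \<partial>lborel) = 0"
    by (subst (asm) nn_integral_0_iff_AE) auto
  then show ?thesis
  proof eventually_elim
    case (elim t)
    have "AE z in lborel. indicator N (z, t) = (0::ennreal)"
      using elim by (subst (asm) nn_integral_0_iff_AE) auto
    then show ?case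
      by eventually_elim (use N(1) in \<open>auto simp: indicator_def split: if_splits\<close>)
  qed
qed

lemma AE_lborel_fst:
  fixes P :: "'a::euclidean_space \<Rightarrow> bool"
  assumes "AE x in lborel. P x"
  shows "AE x in (lborel :: ('a \<times> 'b::euclidean_space) measure). P (fst x)"
proof -
  obtain N where N: "{x. \<not> P x} \<subseteq> N" "N \<in> sets borel" "emeasure lborel N = 0"
    using AE_E[OF assms] by (auto simp: Collect_neg_eq)
  have "emeasure (lborel \<Otimes>\<^sub>M lborel) (N \<times> (UNIV :: 'b set)) = emeasure lborel N * emeasure lborel (UNIV :: 'b set)"
    using N by (intro lborel.emeasure_pair_measure_Times) auto
  then have "emeasure lborel (N \<times> (UNIV :: 'b set)) = 0"
    using N by (simp add: lborel_prod)
  moreover have "N \<times> (UNIV :: 'b set) \<in> sets lborel"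
    using borel_Times[OF N(2), of UNIV] by simp
  ultimately show ?thesis
    using N(1) by (intro AE_I[of _ _ "N \<times> UNIV"]) auto
qed

text \<open>Joint Borel measurability is available for \<open>g\<close>, slice bounds for
  \<open>f\<close>. For almost every t the two slices agree almost everywhere, so Tonelli for
  \<open>g\<close> can use the bounds for \<open>f\<close>.\<close>

lemma nn_integral_time_slices:
  fixes f :: "'a::euclidean_space \<times> real \<Rightarrow> real" and g :: "'a \<times> real \<Rightarrow> real"
  assumes [measurable]: "g \<in> borel_measurable borel" and AE: "AE x in lborel. g x = f x"
    and ab: "a \<le> b" and out: "\<And>z t. t \<notin> {a..b} \<Longrightarrow> f (z, t) = 0"
    and B: "\<And>t. t \<in> {a..b} \<Longrightarrow> (\<integral>\<^sup>+z. ennreal (f (z, t)) \<partial>lebesgue) \<le> B"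
  shows "(\<integral>\<^sup>+x. ennreal (g x) \<partial>lborel) \<le> ennreal (b - a) * B"
proof -
  have "(\<integral>\<^sup>+x. ennreal (g x) \<partial>lborel) = (\<integral>\<^sup>+x. ennreal (g x) \<partial>(lborel \<Otimes>\<^sub>M lborel))"
    by (simp add: lborel_prod)
  also have "\<dots> = (\<integral>\<^sup>+t. (\<integral>\<^sup>+z. ennreal (g (z, t)) \<partial>lborel) \<partial>lborel)"
    by (rule lborel_pair.nn_integral_snd[symmetric]) (simp add: lborel_prod)
  also have "\<dots> \<le> (\<integral>\<^sup>+t. B * indicator {a..b} t \<partial>lborel)"
  proof (rule nn_integral_mono_AE)
    show "AE t in lborel. (\<integral>\<^sup>+z. ennreal (g (z, t)) \<partial>lborel) \<le> B * indicator {a..b} t"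
      using AE_lborel_sections[OF AE]
    proof eventually_elim
      case (elim t)
      have "(\<integral>\<^sup>+z. ennreal (g (z, t)) \<partial>lborel) = (\<integral>\<^sup>+z. ennreal (f (z, t)) \<partial>lborel)"
        by (rule nn_integral_cong_AE) (use elim in \<open>eventually_elim, simp\<close>)
      also have "\<dots> \<le> B * indicator {a..b} t"
        using B[of t] out[of t] by (cases "t \<in> {a..b}") (simp_all add: nn_integral_completion)
      finally show ?case .
    qed
  qed
  also have "\<dots> = ennreal (b - a) * B"
    using ab by (simp add: nn_integral_cmult_indicator mult.commute)
  finally show ?thesis .
qed

lemma locally_bounded_on_compact:
  assumes f: "locally_bounded_on S f" and C: "compact C" "C \<subseteq> S"
  obtains B where "0 < B" "\<And>x. x \<in> C \<Longrightarrow> \<bar>f x\<bar> \<le> B"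
proof -
  obtain U where U: "\<And>x. x \<in> S \<Longrightarrow> open (U x) \<and> x \<in> U x \<and> bounded (f ` (U x \<inter> S))"
    using f unfolding locally_bounded_on_def by metis
  have op: "open (U x)" if "x \<in> C" for x using U[OF subsetD[OF C(2) that]] by simp
  have "C \<subseteq> (\<Union>x\<in>C. U x)" using U C(2) by (meson UN_I subset_iff)
  from compactE_image[OF C(1) op this] obtain D where D: "D \<subseteq> C" "finite D" "C \<subseteq> (\<Union>x\<in>D. U x)"
    by blast
  have "bounded (\<Union>x\<in>D. f ` (U x \<inter> S))"
  proof (rule bounded_UN[OF D(2)])
    show "\<forall>x\<in>D. bounded (f ` (U x \<inter> S))"
      using U D(1) C(2) by (meson subset_iff)
  qed
  then have "bounded (f ` C)"
    by (rule bounded_subset) (use D(3) C(2) in blast)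
  then obtain B where "0 < B" "\<forall>y\<in>f ` C. norm y \<le> B" unfolding bounded_pos by blast
  then show ?thesis by (intro that[of B]) auto
qed

text \<open>Passes from integrals over a set in the completed measure to whole-space Borel
  integrals. \<open>f'\<close> is the integrand with the indicator absorbed, so \<open>A\<close>
  itself may lack measurability.\<close>

lemma set_lebesgue_integral_borel_version:
  fixes f :: "'a::euclidean_space \<Rightarrow> 'b::euclidean_space"
  assumes eq: "\<And>x. indicator A x *\<^sub>R f x = f' x" and f': "f' \<in> borel_measurable lebesgue"
    and g: "g \<in> borel_measurable borel" and AE: "AE x in lborel. f' x = g x"
  shows "set_lebesgue_integral lebesgue A f = integral\<^sup>L lborel g"
proof -
  have gl: "g \<in> borel_measurable lebesgue"
    using measurable_completion[of g lborel borel] g by simp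
  have "set_lebesgue_integral lebesgue A f = integral\<^sup>L lebesgue f'"
    by (simp add: set_lebesgue_integral_def eq)
  also have "\<dots> = integral\<^sup>L lebesgue g"
    by (rule integral_cong_AE[OF f' gl AE_completion[OF AE]])
  also have "\<dots> = integral\<^sup>L lborel g"
    using g by (intro integral_completion) simp
  finally show ?thesis .
qed

lemma borel_measurable_lebesgueI:
  fixes f :: "'a::euclidean_space \<Rightarrow> 'b::euclidean_space"
  assumes "f \<in> borel_measurable borel"
  shows "f \<in> borel_measurable lebesgue"
proof (rule measurable_completion)
  show "f \<in> borel_measurable lborel" using assms by simp
qed

lemma test_functionI:
  assumes "smooth \<psi>" and C: "compact C" and "\<And>x. x \<notin> C \<Longrightarrow> \<psi> x = 0" and "C \<subseteq> A"
  shows "\<psi> \<in> test_functions A"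
proof -
  have "closure {x. \<psi> x \<noteq> 0} \<subseteq> C"
    using assms by (intro closure_minimal compact_imp_closed) auto
  moreover from this have "compact (closure {x. \<psi> x \<noteq> 0})"
    using compact_Int_closed[OF C closed_closure, of "{x. \<psi> x \<noteq> 0}"] by (simp add: Int_absorb1)
  ultimately show ?thesis
    using assms unfolding test_functions_def by auto
qed

lemma test_function_C1c:
  assumes "\<phi> \<in> test_functions A"
  shows "C1c \<phi>"
proof -
  have s: "smooth \<phi>" and c: "compact (closure {x. \<phi> x \<noteq> 0})"
    using assms unfolding test_functions_def by blast+
  have z: "\<forall>x. x \<notin> closure {x. \<phi> x \<noteq> 0} \<longrightarrow> \<phi> x = 0"
    using closure_subset[of "{x. \<phi> x \<noteq> 0}"] by blast
  show ?thesis
    unfolding C1c_def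
  proof (intro conjI allI)
    show "\<phi> differentiable (at x)" for x
      using smooth_has_derivative[OF s] unfolding differentiable_def by blast
    show "continuous_on UNIV (\<lambda>x. fd \<phi> x e)" for e
      by (rule smooth_continuous_derivative[OF s])
    show "\<exists>K. compact K \<and> (\<forall>x. x \<notin> K \<longrightarrow> \<phi> x = 0)"
      using c z by blast
  qed
qed

section \<open>Truncated powers and the pointwise energy estimate\<close>

text \<open>This is (|s| - \<eta>)_+^p for positive \<eta>. As a sum of two one-sided powers it can
  be differentiated without meeting the corner of |s|.\<close>

definition cut :: "real \<Rightarrow> real \<Rightarrow> real \<Rightarrow> real" where
  "cut \<eta> p s = max 0 (s - \<eta>) powr p + max 0 (- s - \<eta>) powr p"

definition cut' :: "real \<Rightarrow> real \<Rightarrow> real \<Rightarrow> real" where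
  "cut' \<eta> p s = p * max 0 (s - \<eta>) powr (p - 1) - p * max 0 (- s - \<eta>) powr (p - 1)"

lemma cut_eq:
  assumes "0 < \<eta>"
  shows "cut \<eta> p s = max 0 (\<bar>s\<bar> - \<eta>) powr p"
  using assms by (cases "0 \<le> s") (auto simp: cut_def max_def)

lemma abs_cut':
  assumes "0 < \<eta>" "0 < p"
  shows "\<bar>cut' \<eta> p s\<bar> = p * max 0 (\<bar>s\<bar> - \<eta>) powr (p - 1)"
proof (cases "0 \<le> s")
  case True
  then have "max 0 (- s - \<eta>) = 0" "max 0 (\<bar>s\<bar> - \<eta>) = max 0 (s - \<eta>)" using assms by auto
  then show ?thesis using assms by (simp add: cut'_def abs_mult)
next
  case False
  then have "max 0 (s - \<eta>) = 0" "max 0 (\<bar>s\<bar> - \<eta>) = max 0 (- s - \<eta>)" using assms by auto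
  then show ?thesis using assms by (simp add: cut'_def abs_mult)
qed

lemma cut_deriv:
  assumes p: "1 < p"
  shows "(cut \<eta> p has_real_derivative cut' \<eta> p s) (at s)"
proof -
  have "((\<lambda>s. max 0 (s - \<eta>) powr p) has_real_derivative p * max 0 (s - \<eta>) powr (p - 1) * 1) (at s)"
    by (rule DERIV_chain2[OF pos_part_powr_deriv[OF p]]) (auto intro!: derivative_eq_intros)
  moreover have "((\<lambda>s. max 0 (- s - \<eta>) powr p) has_real_derivative p * max 0 (- s - \<eta>) powr (p - 1) * (- 1)) (at s)"
    by (rule DERIV_chain2[OF pos_part_powr_deriv[OF p]]) (auto intro!: derivative_eq_intros)
  ultimately show ?thesis
    unfolding cut_def[abs_def] cut'_def using DERIV_add by fastforce
qed

lemma cut'_continuous: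
  assumes "1 < p"
  shows "continuous_on UNIV (cut' \<eta> p)"
  unfolding cut'_def[abs_def] using assms
  by (intro continuous_intros continuous_on_powr') auto

text \<open>A Picone-type inequality: the flux paired with the gradient of u^(1-p) F^p X. In terms
  of a = F |G| / u the left side is at most v X (p |N| a^(p-1) - (p-1) a^p), and the tangent
  inequality bounds this by v X |N|^p. So the unknown gradient G drops out completely.\<close>

lemma energy_pointwise:
  fixes G N :: "'a::euclidean_space"
  assumes p: "1 < p" and u: "0 < u" and v: "0 \<le> v" and F: "0 \<le> F" and X: "0 \<le> X" and k': "\<bar>k'\<bar> = p * F powr (p - 1)"
  shows "((v * norm G powr (p - 2)) *\<^sub>R G) \<bullet> (u powr (1 - p) *\<^sub>R (k' * X) *\<^sub>R N + (F powr p * X * ((1 - p) * u powr (- p))) *\<^sub>R G)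
      \<le> v * X * norm N powr p"
proof (cases "G = 0")
  case True
  then show ?thesis using v X by simp
next
  case False
  define a where "a = F * norm G / u"
  have a: "0 \<le> a" using F u by (simp add: a_def)
  have g: "0 < norm G" using False by simp
  have "k' * (G \<bullet> N) \<le> \<bar>k'\<bar> * (norm G * norm N)"
  proof -
    have "k' * (G \<bullet> N) \<le> \<bar>k'\<bar> * \<bar>G \<bullet> N\<bar>"
      by (metis abs_ge_self abs_mult)
    also have "\<dots> \<le> \<bar>k'\<bar> * (norm G * norm N)"
      by (intro mult_left_mono Cauchy_Schwarz_ineq2) simp
    finally show ?thesis .
  qed
  then have 2: "k' * (G \<bullet> N) \<le> p * F powr (p - 1) * (norm G * norm N)" by (simp add: k')
  have ap: "norm G powr (p - 2) * u powr (1 - p) * F powr (p - 1) * norm G = a powr (p - 1)"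
    using g u F by (simp add: a_def powr_mult powr_divide powr_diff powr_minus_divide field_simps power2_eq_square)
  have ap': "norm G powr (p - 2) * u powr (- p) * F powr p * (norm G * norm G) = a powr p"
    using g u F by (simp add: a_def powr_mult powr_divide powr_diff powr_minus_divide field_simps power2_eq_square)
  have "((v * norm G powr (p - 2)) *\<^sub>R G) \<bullet> (u powr (1 - p) *\<^sub>R (k' * X) *\<^sub>R N + (F powr p * X * ((1 - p) * u powr (- p))) *\<^sub>R G) =
      v * X * (norm G powr (p - 2) * u powr (1 - p) * (k' * (G \<bullet> N)) - (p - 1) * (norm G powr (p - 2) * u powr (- p) * F powr p * (norm G * norm G)))"
    by (simp add: inner_add_right algebra_simps power2_norm_eq_inner[symmetric] power2_eq_square)
  also have "\<dots> \<le> v * X * (norm G powr (p - 2) * u powr (1 - p) * (p * F powr (p - 1) * (norm G * norm N)) - (p - 1) * a powr p)"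
    unfolding ap' by (intro mult_left_mono[of "norm G powr (p - 2) * u powr (1 - p) * (k' * (G \<bullet> N)) - (p - 1) * a powr p"]
        diff_right_mono mult_left_mono[OF 2]) (use v X in auto)
  also have "\<dots> = v * X * (p * norm N * a powr (p - 1) - (p - 1) * a powr p)"
    unfolding ap[symmetric] by (simp add: algebra_simps)
  also have "\<dots> \<le> v * X * norm N powr p"
    using Young_tangent[of p "norm N" a] p a v X by (intro mult_left_mono) auto
  finally show ?thesis .
qed

section \<open>The energy inequality\<close>

lemma borel_measurable_fst_snd:
  fixes f :: "'a::euclidean_space \<Rightarrow> 'b::euclidean_space" and g :: "'c::euclidean_space \<Rightarrow> 'b"
  shows "f \<in> borel_measurable borel \<Longrightarrow> (\<lambda>x::'a \<times> 'c. f (fst x)) \<in> borel_measurable borel"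
    and "g \<in> borel_measurable borel \<Longrightarrow> (\<lambda>x::'a \<times> 'c. g (snd x)) \<in> borel_measurable borel"
  by (rule measurable_compose[rotated], assumption, intro borel_measurable_continuous_onI continuous_intros)+

lemma smooth_imp_C1c:
  assumes s: "smooth f" and K: "compact K" and z: "\<And>x. x \<notin> K \<Longrightarrow> f x = 0"
  shows "C1c f"
  unfolding C1c_def
proof (intro conjI allI)
  show "f differentiable (at x)" for x
    using smooth_has_derivative[OF s] unfolding differentiable_def by blast
  show "continuous_on UNIV (\<lambda>x. fd f x e)" for e
    by (rule smooth_continuous_derivative[OF s])
  show "\<exists>K. compact K \<and> (\<forall>x. x \<notin> K \<longrightarrow> f x = 0)"
    using K z by blast
qed

lemma Ck_on_1_continuous_on:
  assumes "Ck_on 1 v S"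
  shows "continuous_on S v"
proof (rule continuous_at_imp_continuous_on, rule)
  fix z assume "z \<in> S"
  then have "v differentiable (at z)" using assms by auto
  then show "isCont v z" by (rule differentiable_imp_continuous_within)
qed

text \<open>Tests the equation with \<open>u\<^sup>1\<^sup>-\<^sup>p (|\<phi>| - \<eta>)\<^sub>+\<^sup>p \<beta>(t)\<close>. The truncation at
  height \<open>\<eta>\<close> keeps the support inside the open set \<open>{\<phi> \<noteq> 0}\<close>, so that mollification is possible although
  \<open>\<Omega>\<close> is not known to be open.\<close>

lemma energy_inequality:
  fixes \<gamma> p q lam \<eta> :: real and \<Omega> K :: "('m::finite, 'k::finite) point set" and v w u0 \<phi> wB :: "('m, 'k) point \<Rightarrow> real"
    and \<beta> :: "real \<Rightarrow> real"
  assumes \<gamma>: "0 \<le> \<gamma>" and p: "1 < p" "p < 2" and q: "p - 1 < q"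
    and sol: "general_positive_local_solution \<gamma> p q lam v w \<Omega> K u0 T u"
    and v: "Ck_on 1 v (\<Omega> - K)" "\<And>z. z \<in> \<Omega> - K \<Longrightarrow> 0 \<le> v z"
    and \<phi>: "\<phi> \<in> test_functions (\<Omega> - K)" and \<eta>: "0 < \<eta>"
    and \<beta>: "smooth \<beta>" "\<And>t. 0 \<le> \<beta> t" "\<And>t. t \<notin> {T/4..3*T/4} \<Longrightarrow> \<beta> t = 0" "integral\<^sup>L lborel \<beta> = 1"
  defines "C \<equiv> closure {z. \<phi> z \<noteq> 0}"
  assumes wB: "wB \<in> borel_measurable borel" "integrable lborel wB" "AE z in lborel. wB z = indicator C z * w z"
  obtains uB where "uB \<in> borel_measurable borel" "\<And>x. 0 \<le> uB x"
    "AE x in lborel. uB x = indicator ({z. \<eta> / 2 \<le> \<bar>\<phi> z\<bar>} \<times> {T/8..7*T/8}) x * u (fst x) (snd x)"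
    "integrable lborel (\<lambda>x. uB x powr (q - p + 1) * (cut \<eta> p (\<phi> (fst x)) * \<beta> (snd x)))"
    "integrable lborel (\<lambda>x. uB x powr (2 - p) * (cut \<eta> p (\<phi> (fst x)) * \<bar>fd \<beta> (snd x) 1\<bar>))"
    "integral\<^sup>L lborel (\<lambda>z. wB z * cut \<eta> p (\<phi> z)) \<le>
      integral\<^sup>L lborel (\<lambda>z. indicator C z * v z * norm (grushin_grad \<gamma> \<phi> z) powr p)
      + \<bar>lam\<bar> * integral\<^sup>L lborel (\<lambda>x. uB x powr (q - p + 1) * (cut \<eta> p (\<phi> (fst x)) * \<beta> (snd x)))
      + 1 / (2 - p) * integral\<^sup>L lborel (\<lambda>x. uB x powr (2 - p) * (cut \<eta> p (\<phi> (fst x)) * \<bar>fd \<beta> (snd x) 1\<bar>))"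
proof -
  have T: "0 < T" using sol by (simp add: general_positive_local_solution_def)
  have upos: "0 < u z t" if "z \<in> \<Omega> - K" "t \<in> {0<..<T}" for z t
    using sol that by (simp add: general_positive_local_solution_def)
  have lb: "locally_bounded_on ((\<Omega> - K) \<times> {0<..<T}) (\<lambda>(z, t). u z t)"
    "locally_bounded_on ((\<Omega> - K) \<times> {0<..<T}) (\<lambda>(z, t). 1 / u z t)"
    using sol by (simp_all add: general_positive_local_solution_def)
  obtain G where G: "Lp_loc_on p (\<Omega> \<times> {0<..<T}) G" "weak_grushin_grad \<gamma> \<Omega> T u G"
    "pde_in_distributions \<gamma> p q lam v w (\<Omega> - K) T u G"
    using sol by (auto simp: general_positive_local_solution_def)
  have sm\<phi>: "smooth \<phi>" and C: "compact C" "C \<subseteq> \<Omega> - K"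
    using \<phi> unfolding test_functions_def C_def by blast+
  have \<phi>0: "\<phi> z = 0" if "z \<notin> C" for z
    using that closure_subset[of "{z. \<phi> z \<noteq> 0}"] unfolding C_def by blast
  have C1\<phi>: "C1c \<phi>" by (rule test_function_C1c[OF \<phi>])
  have c\<phi>: "continuous_on UNIV \<phi>" by (rule C1cD(3)[OF C1\<phi>])
  note [measurable] = C1cD(4)[OF C1\<phi>]
  \<comment> \<open>\<open>C1\<close> contains the support of the truncated function and
    \<open>C2\<close> is its neighbourhood at half the height. Both lie in the support of
    \<phi>.\<close>
  define C2 where "C2 = {z. \<eta> / 2 \<le> \<bar>\<phi> z\<bar>}"
  define C1 where "C1 = {z. \<eta> \<le> \<bar>\<phi> z\<bar>}"
  have cl: "closed C2" "closed C1"
    unfolding C1_def C2_def by (intro closed_Collect_le continuous_intros c\<phi>)+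
  have sub: "C1 \<subseteq> C2" "C2 \<subseteq> C" using \<eta> \<phi>0 by (force simp: C1_def C2_def)+
  have cC: "compact C2" "compact C1"
    using compact_Int_closed[OF C(1) cl(1)] compact_Int_closed[OF C(1) cl(2)] sub by (simp_all add: Int_absorb1)
  define I1 where "I1 = {T/8..7*T/8}"
  define I0 where "I0 = {T/4..3*T/4}"
  define K1 where "K1 = C2 \<times> I1"
  define K0 where "K0 = C1 \<times> I0"
  have K: "compact K1" "compact K0"
    unfolding K1_def K0_def I1_def I0_def by (intro compact_Times cC compact_Icc)+
  have I1: "I1 \<subseteq> {0<..<T}" using T by (auto simp: I1_def)
  have K1D: "K1 \<subseteq> (\<Omega> - K) \<times> {0<..<T}" "K1 \<subseteq> \<Omega> \<times> {0<..<T}"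
    using sub C(2) I1 unfolding K1_def by blast+
  have [measurable]: "K1 \<in> sets borel" "C2 \<in> sets borel" "C \<in> sets borel"
    using K(1) cC(1) C(1) by (auto intro: borel_compact)
  have e2: "0 < \<eta> / 2" using \<eta> by simp
  obtain d1 where d1: "0 < d1" "\<And>x h. norm h < d1 \<Longrightarrow> norm (\<phi> (x + h) - \<phi> x) < \<eta> / 2"
    using compact_support_uniformly_continuous[OF c\<phi> C(1) \<phi>0 e2] by metis
  \<comment> \<open>A move by less than \<open>d1\<close> changes \<phi> by less than \<eta>/2 and
    so leads from \<open>C1\<close> into \<open>C2\<close>; T/8 is the gap between the time
    intervals.\<close>
  define d0 where "d0 = min d1 (T / 8)"
  have d0: "0 < d0" using d1 T by (simp add: d0_def)
  have thick: "y \<in> K1" if x: "x \<in> K0" and d: "dist x y < d0" for x y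
  proof -
    have "dist (fst x) (fst y) < d1" "dist (snd x) (snd y) < T / 8"
      using d dist_fst_le[of x y] dist_snd_le[of x y] by (auto simp: d0_def)
    then have "norm (fst y - fst x) < d1" "\<bar>snd x - snd y\<bar> < T / 8"
      by (simp_all add: dist_norm norm_minus_commute)
    moreover from this(1) have "norm (\<phi> (fst x + (fst y - fst x)) - \<phi> (fst x)) < \<eta> / 2"
      by (rule d1(2))
    moreover have "\<eta> \<le> \<bar>\<phi> (fst x)\<bar>" "snd x \<in> I0" using x by (auto simp: K0_def C1_def)
    ultimately have "\<eta> / 2 \<le> \<bar>\<phi> (fst y)\<bar>" "T / 8 \<le> snd y" "snd y \<le> 7 * T / 8"
      unfolding I0_def by (simp_all add: abs_if split: if_splits)
    then have "fst y \<in> C2" "snd y \<in> I1" by (auto simp: C2_def I1_def)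
    then show ?thesis unfolding K1_def by (cases y) auto
  qed
  obtain c1 where c1: "0 < c1" "\<And>x. x \<in> K1 \<Longrightarrow> \<bar>u (fst x) (snd x)\<bar> \<le> c1"
    using locally_bounded_on_compact[OF lb(1) K(1) K1D(1)] by (auto simp: case_prod_beta)
  obtain c2 where c2: "0 < c2" "\<And>x. x \<in> K1 \<Longrightarrow> \<bar>1 / u (fst x) (snd x)\<bar> \<le> c2"
    using locally_bounded_on_compact[OF lb(2) K(1) K1D(1)] by (auto simp: case_prod_beta)
  \<comment> \<open>The minimum keeps c0 \<le> c1 even when \<open>K1\<close> is empty.\<close>
  define c0 where "c0 = min c1 (1 / c2)"
  have c0: "0 < c0" "c0 \<le> c1" using c1(1) c2(1) by (auto simp: c0_def)
  have ub: "c0 \<le> u (fst x) (snd x) \<and> u (fst x) (snd x) \<le> c1" if x: "x \<in> K1" for x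
  proof -
    have pos: "0 < u (fst x) (snd x)" using K1D(1) x by (intro upos) (auto simp: mem_Times_iff)
    have "1 / c2 \<le> u (fst x) (snd x)" using c2(2)[OF x] c2(1) pos by (simp add: field_simps)
    then show ?thesis using c1(2)[OF x] pos by (simp add: c0_def)
  qed
  define u1 where "u1 x = indicator K1 x * u (fst x) (snd x)" for x
  have L1u: "L1_loc_on (\<Omega> \<times> {0<..<T}) (\<lambda>(z, t). u z t)"
    using G(2) by (simp add: weak_grushin_grad_def)
  have mu1: "u1 \<in> borel_measurable lebesgue"
  proof -
    have "set_integrable lebesgue K1 (\<lambda>(z, t). u z t)"
      using L1u K(1) K1D(2) by (simp add: L1_loc_on_def)
    then have "(\<lambda>x. indicator K1 x *\<^sub>R (case x of (z, t) \<Rightarrow> u z t)) \<in> borel_measurable lebesgue"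
      unfolding set_integrable_def by (rule borel_measurable_integrable)
    then show ?thesis by (simp add: u1_def[abs_def] case_prod_beta)
  qed
  obtain u2 where u2: "u2 \<in> borel_measurable borel" "AE x in lborel. u2 x = u1 x"
    using lebesgue_measurable_borel_version[OF mu1] by blast
  note [measurable] = u2(1)
  \<comment> \<open>Clamping the Borel version into [c0, c1] gives the bounds at every point of
    \<open>K1\<close>, as the locale demands, and changes it only on a null set.\<close>
  define uB where "uB x = (if x \<in> K1 then max c0 (min c1 (u2 x)) else 0)" for x
  have muB [measurable]: "uB \<in> borel_measurable borel" unfolding uB_def[abs_def] by measurable
  have uB: "AE x in lborel. uB x = u1 x"
    using u2(2)
  proof eventually_elim
    case (elim x)
    show ?case
      using ub[of x] elim by (cases "x \<in> K1") (simp_all add: uB_def u1_def)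
  qed
  have uBb: "c0 \<le> uB x" "uB x \<le> c1" if "x \<in> K1" for x
    using that c0 by (simp_all add: uB_def)
  have uB0: "uB x = 0" if "x \<notin> K1" for x using that by (simp add: uB_def)
  have uBn: "0 \<le> uB x" for x using uBb[of x] uB0[of x] c0 by (cases "x \<in> K1") auto
  define G1 where "G1 x = indicator K1 x *\<^sub>R G x" for x
  have G1: "G1 \<in> borel_measurable lebesgue" "set_integrable lebesgue K1 (\<lambda>x. norm (G x) powr p)"
    using G(1) K(1) K1D(2) by (auto simp: Lp_loc_on_def set_borel_measurable_def G1_def[abs_def])
  obtain G2 where G2: "G2 \<in> borel_measurable borel" "AE x in lborel. G2 x = G1 x"
    using lebesgue_measurable_borel_version[OF G1(1)] by blast
  note [measurable] = G2(1)
  define GB where "GB x = indicator K1 x *\<^sub>R G2 x" for x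
  have mGB [measurable]: "GB \<in> borel_measurable borel" unfolding GB_def[abs_def] by measurable
  have GB: "AE x in lborel. GB x = G1 x"
    using G2(2) by eventually_elim (simp add: GB_def G1_def indicator_def)
  have GB0: "GB x = 0" if "x \<notin> K1" for x using that by (simp add: GB_def)
  have finG: "modular p GB < \<infinity>"
  proof -
    have "modular p GB = (\<integral>\<^sup>+x. ennreal (norm (indicator K1 x *\<^sub>R (norm (G x) powr p))) \<partial>lborel)"
      unfolding modular_def
    proof (rule nn_integral_cong_AE)
      show "AE x in lborel. ennreal (norm (GB x) powr p) = ennreal (norm (indicator K1 x *\<^sub>R (norm (G x) powr p)))"
        using GB by eventually_elim (simp add: G1_def indicator_def)
    qed
    also have "\<dots> = (\<integral>\<^sup>+x. ennreal (norm (indicator K1 x *\<^sub>R (norm (G x) powr p))) \<partial>lebesgue)"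
      by (simp add: nn_integral_completion)
    also have "\<dots> < \<infinity>"
      using G1(2) unfolding set_integrable_def integrable_iff_bounded by blast
    finally show ?thesis .
  qed
  define vB where "vB z = indicator C z * v z" for z
  have cv: "continuous_on C v"
    by (rule continuous_on_subset[OF Ck_on_1_continuous_on[OF v(1)] C(2)])
  have mvB [measurable]: "vB \<in> borel_measurable borel"
    using borel_measurable_continuous_on_indicator[OF _ cv] by (simp add: vB_def[abs_def])
  have vB: "0 \<le> vB z" for z
    using v(2)[of z] C(2) by (cases "z \<in> C") (auto simp: vB_def)
  have "bounded (v ` C)" by (intro compact_imp_bounded compact_continuous_image cv C(1))
  then obtain Bv where Bv: "0 < Bv" "\<And>z. z \<in> C \<Longrightarrow> \<bar>v z\<bar> \<le> Bv"
    unfolding bounded_pos by auto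
  have vBb: "vB z \<le> Bv" for z
    using Bv(1) Bv(2)[of z] by (cases "z \<in> C") (auto simp: vB_def)
  note [measurable] = borel_measurable_fst_snd(1)[OF mvB, where 'c=real]
  define FB where "FB x = (vB (fst x) * norm (GB x) powr (p - 2)) *\<^sub>R GB x" for x
  have mFB [measurable]: "FB \<in> borel_measurable borel" unfolding FB_def[abs_def] by measurable
  have FB0: "FB x = 0" if "x \<notin> K1" for x using GB0[OF that] by (simp add: FB_def)
  have nFB: "norm (FB x) \<le> Bv * norm (GB x) powr (p - 1)" for x
  proof (cases "GB x = 0")
    case False
    have "norm (GB x) powr (p - 1) = norm (GB x) powr (p - 2) * norm (GB x)"
      using False powr_mult_base[of "norm (GB x)" "p - 2"] by (simp add: mult.commute)
    then show ?thesis
      using vB[of "fst x"] vBb[of "fst x"] by (simp add: FB_def abs_mult mult.assoc mult_right_mono)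
  qed (simp add: FB_def)
  have finF: "modular (p / (p - 1)) FB < \<infinity>"
  proof -
    have "modular (p / (p - 1)) FB \<le> ennreal (Bv powr (p / (p - 1))) * modular (p / (p - 1)) (\<lambda>x. norm (GB x) powr (p - 1))"
      using nFB p Bv(1) by (intro modular_le_cmult) auto
    also have "modular (p / (p - 1)) (\<lambda>x. norm (GB x) powr (p - 1)) = modular p GB"
      unfolding modular_def using p by (simp add: powr_powr)
    finally show ?thesis using finG by (auto simp: ennreal_mult_less_top intro: le_less_trans)
  qed
  define SB where "SB x = indicator K1 x * (wB (fst x) * uB x powr (p - 1) + lam * uB x powr q)" for x
  note [measurable] = wB(1) borel_measurable_fst_snd(1)[OF wB(1), where 'c=real]
  have mSB [measurable]: "SB \<in> borel_measurable borel" unfolding SB_def[abs_def] by measurable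
  have SB0: "SB x = 0" if "x \<notin> K1" for x using that by (simp add: SB_def)
  define flux where "flux = (\<lambda>(z, t). (v z * norm (G (z, t)) powr (p - 2)) *\<^sub>R G (z, t))"
  define source where "source = (\<lambda>(z, t). w z * u z t powr (p - 1) + lam * u z t powr q)"
  have P: "L1_loc_on ((\<Omega> - K) \<times> {0<..<T}) flux" "L1_loc_on ((\<Omega> - K) \<times> {0<..<T}) source"
    "\<And>\<psi>. \<psi> \<in> test_functions ((\<Omega> - K) \<times> {0<..<T}) \<Longrightarrow>
            - set_lebesgue_integral lebesgue ((\<Omega> - K) \<times> {0<..<T}) (\<lambda>(z, t). u z t * deriv (\<lambda>s. \<psi> (z, s)) t)
            = - set_lebesgue_integral lebesgue ((\<Omega> - K) \<times> {0<..<T})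
                  (\<lambda>(z, t). flux (z, t) \<bullet> grushin_grad \<gamma> (\<lambda>z'. \<psi> (z', t)) z)
              + set_lebesgue_integral lebesgue ((\<Omega> - K) \<times> {0<..<T}) (\<lambda>(z, t). source (z, t) * \<psi> (z, t))"
    using G(3) unfolding pde_in_distributions_def Let_def flux_def source_def by blast+
  have iflux: "integrable lebesgue (\<lambda>x. indicator K1 x *\<^sub>R flux x)"
    and isource: "integrable lebesgue (\<lambda>x. indicator K1 x *\<^sub>R source x)"
    using P(1,2) K(1) K1D(1) unfolding L1_loc_on_def set_integrable_def by blast+
  have FBeq: "AE x in lborel. indicator K1 x *\<^sub>R flux x = FB x"
    using GB
  proof eventually_elim
    case (elim x)
    show ?case
    proof (cases "x \<in> K1")
      case True
      then have "fst x \<in> C" using sub by (auto simp: K1_def)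
      then show ?thesis using True elim by (simp add: flux_def FB_def G1_def vB_def case_prod_beta)
    qed (simp add: FB0)
  qed
  have SBeq: "AE x in lborel. indicator K1 x *\<^sub>R source x = SB x"
    using uB AE_lborel_fst[OF wB(3), where 'b=real]
  proof eventually_elim
    case (elim x)
    show ?case
    proof (cases "x \<in> K1")
      case True
      then have "fst x \<in> C" using sub by (auto simp: K1_def)
      then show ?thesis using True elim by (simp add: source_def SB_def u1_def case_prod_beta)
    qed (simp add: SB0)
  qed
  have iSB: "integrable lborel SB"
  proof -
    have "integrable lebesgue SB"
      by (rule integrable_cong_AE_imp[OF isource borel_measurable_lebesgueI[OF mSB]])
        (use AE_completion[OF SBeq] in \<open>auto elim: eventually_mono\<close>)
    then show ?thesis by (subst (asm) integrable_completion) auto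
  qed
  have fdz: "fd \<psi> x e = 0" if "smooth \<psi>" "\<And>x. x \<notin> K1 \<Longrightarrow> \<psi> x = 0" "x \<notin> K1" for \<psi> x e
    using derivative_zero_outside[OF smooth_has_derivative[OF that(1)] compact_imp_closed[OF K(1)] that(2,3)] .
  \<comment> \<open>A test function supported in \<open>K1\<close> is admissible for the gradient
    identity on \<Omega> and for the equation off \<open>K\<close>. All integrals then reduce to
    \<open>K1\<close>, where the Borel versions agree with the original data almost
    everywhere.\<close>
  have sol': "local_weak_solution \<gamma> p c0 c1 d0 uB SB GB FB K0 K1"
  proof (unfold_locales)
    fix \<psi> :: "('m, 'k) point \<times> real \<Rightarrow> real" assume \<psi>: "smooth \<psi>" "\<And>\<zeta>. \<zeta> \<notin> K1 \<Longrightarrow> \<psi> \<zeta> = 0"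
    have fd0: "fd \<psi> x = (\<lambda>_. 0)" if "x \<notin> K1" for x using fdz[OF \<psi> that] by blast
    have D: "(\<psi> has_derivative fd \<psi> x) (at x)" for x by (rule smooth_has_derivative[OF \<psi>(1)])
    have [measurable]: "(\<lambda>x. fd \<psi> x (0, 1)) \<in> borel_measurable borel"
      "(\<lambda>x. ggrad \<gamma> x (fd \<psi> x)) \<in> borel_measurable borel" "\<psi> \<in> borel_measurable borel"
      using Ck_on_imp_continuous[of 0 \<psi>] \<psi>(1)
      by (intro borel_measurable_continuous_onI continuous_on_ggrad \<gamma> continuous_on_id smooth_continuous_derivative[OF \<psi>(1)]; simp)+
    note ml = borel_measurable_lebesgueI
    have tf: "\<psi> \<in> test_functions (\<Omega> \<times> {0<..<T})" "\<psi> \<in> test_functions ((\<Omega> - K) \<times> {0<..<T})"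
      by (rule test_functionI[OF \<psi>(1) K(1) \<psi>(2)], assumption, rule K1D)+
    have ind: "indicator A x *\<^sub>R y = y" if "K1 \<subseteq> A" "x \<notin> K1 \<Longrightarrow> y = 0" for A x and y :: "'c::real_vector"
      using that by (cases "x \<in> A") (auto simp: indicator_def)
    show "integral\<^sup>L lborel (\<lambda>\<zeta>. uB \<zeta> *\<^sub>R ggrad \<gamma> \<zeta> (fd \<psi> \<zeta>)) = - integral\<^sup>L lborel (\<lambda>\<zeta>. \<psi> \<zeta> *\<^sub>R GB \<zeta>)"
    proof -
      have "set_lebesgue_integral lebesgue (\<Omega> \<times> {0<..<T})
          (\<lambda>(z, t). u z t *\<^sub>R grushin_grad \<gamma> (\<lambda>z'. \<psi> (z', t)) z) = integral\<^sup>L lborel (\<lambda>\<zeta>. uB \<zeta> *\<^sub>R ggrad \<gamma> \<zeta> (fd \<psi> \<zeta>))"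
      proof (rule set_lebesgue_integral_borel_version[where f'="\<lambda>x. u1 x *\<^sub>R ggrad \<gamma> x (fd \<psi> x)"])
        show "indicator (\<Omega> \<times> {0<..<T}) x *\<^sub>R (case x of (z, t) \<Rightarrow> u z t *\<^sub>R grushin_grad \<gamma> (\<lambda>z'. \<psi> (z', t)) z) =
            u1 x *\<^sub>R ggrad \<gamma> x (fd \<psi> x)" for x
          using grushin_grad_slice[OF D, where z="fst x" and t="snd x" and \<gamma>=\<gamma>] fd0[of x] K1D(2)
          by (cases "x \<in> K1") (auto simp: u1_def case_prod_beta indicator_def)
        show "(\<lambda>x. u1 x *\<^sub>R ggrad \<gamma> x (fd \<psi> x)) \<in> borel_measurable lebesgue"
          by (rule borel_measurable_scaleR[OF mu1]) (rule ml, measurable)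
        show "AE x in lborel. u1 x *\<^sub>R ggrad \<gamma> x (fd \<psi> x) = uB x *\<^sub>R ggrad \<gamma> x (fd \<psi> x)"
          using uB by eventually_elim simp
      qed measurable
      moreover have "set_lebesgue_integral lebesgue (\<Omega> \<times> {0<..<T}) (\<lambda>(z, t). \<psi> (z, t) *\<^sub>R G (z, t)) =
          integral\<^sup>L lborel (\<lambda>\<zeta>. \<psi> \<zeta> *\<^sub>R GB \<zeta>)"
      proof (rule set_lebesgue_integral_borel_version[where f'="\<lambda>x. \<psi> x *\<^sub>R G1 x"])
        show "indicator (\<Omega> \<times> {0<..<T}) x *\<^sub>R (case x of (z, t) \<Rightarrow> \<psi> (z, t) *\<^sub>R G (z, t)) = \<psi> x *\<^sub>R G1 x" for x
          using \<psi>(2)[of x] K1D(2) by (cases "x \<in> K1") (auto simp: G1_def case_prod_beta indicator_def)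
        show "(\<lambda>x. \<psi> x *\<^sub>R G1 x) \<in> borel_measurable lebesgue"
          by (rule borel_measurable_scaleR[OF _ G1(1)]) (rule ml, measurable)
        show "AE x in lborel. \<psi> x *\<^sub>R G1 x = \<psi> x *\<^sub>R GB x"
          using GB by eventually_elim simp
      qed measurable
      moreover have "set_lebesgue_integral lebesgue (\<Omega> \<times> {0<..<T})
          (\<lambda>(z, t). u z t *\<^sub>R grushin_grad \<gamma> (\<lambda>z'. \<psi> (z', t)) z) =
          - set_lebesgue_integral lebesgue (\<Omega> \<times> {0<..<T}) (\<lambda>(z, t). \<psi> (z, t) *\<^sub>R G (z, t))"
        using G(2) tf(1) unfolding weak_grushin_grad_def by blast
      ultimately show ?thesis by simp
    qed
    show "- integral\<^sup>L lborel (\<lambda>\<zeta>. uB \<zeta> * fd \<psi> \<zeta> (0, 1)) =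
      - integral\<^sup>L lborel (\<lambda>\<zeta>. FB \<zeta> \<bullet> ggrad \<gamma> \<zeta> (fd \<psi> \<zeta>)) + integral\<^sup>L lborel (\<lambda>\<zeta>. SB \<zeta> * \<psi> \<zeta>)"
    proof -
      have "set_lebesgue_integral lebesgue ((\<Omega> - K) \<times> {0<..<T}) (\<lambda>(z, t). u z t * deriv (\<lambda>s. \<psi> (z, s)) t) =
          integral\<^sup>L lborel (\<lambda>\<zeta>. uB \<zeta> * fd \<psi> \<zeta> (0, 1))"
      proof (rule set_lebesgue_integral_borel_version[where f'="\<lambda>x. u1 x * fd \<psi> x (0, 1)"])
        show "indicator ((\<Omega> - K) \<times> {0<..<T}) x *\<^sub>R (case x of (z, t) \<Rightarrow> u z t * deriv (\<lambda>s. \<psi> (z, s)) t) =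
            u1 x * fd \<psi> x (0, 1)" for x
          using deriv_slice[OF D, where z="fst x" and t="snd x"] fd0[of x] K1D(1)
          by (cases "x \<in> K1") (auto simp: u1_def case_prod_beta indicator_def)
        show "(\<lambda>x. u1 x * fd \<psi> x (0, 1)) \<in> borel_measurable lebesgue"
          by (rule borel_measurable_times[OF mu1]) (rule ml, measurable)
        show "AE x in lborel. u1 x * fd \<psi> x (0, 1) = uB x * fd \<psi> x (0, 1)"
          using uB by eventually_elim simp
      qed measurable
      moreover have "set_lebesgue_integral lebesgue ((\<Omega> - K) \<times> {0<..<T})
            (\<lambda>(z, t). flux (z, t) \<bullet> grushin_grad \<gamma> (\<lambda>z'. \<psi> (z', t)) z) = integral\<^sup>L lborel (\<lambda>\<zeta>. FB \<zeta> \<bullet> ggrad \<gamma> \<zeta> (fd \<psi> \<zeta>))"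
      proof (rule set_lebesgue_integral_borel_version[where f'="\<lambda>x. (indicator K1 x *\<^sub>R flux x) \<bullet> ggrad \<gamma> x (fd \<psi> x)"])
        show "indicator ((\<Omega> - K) \<times> {0<..<T}) x *\<^sub>R (case x of (z, t) \<Rightarrow> flux (z, t) \<bullet> grushin_grad \<gamma> (\<lambda>z'. \<psi> (z', t)) z) =
            (indicator K1 x *\<^sub>R flux x) \<bullet> ggrad \<gamma> x (fd \<psi> x)" for x
          using grushin_grad_slice[OF D, where z="fst x" and t="snd x" and \<gamma>=\<gamma>] fd0[of x] K1D(1)
          by (cases "x \<in> K1") (auto simp: case_prod_beta indicator_def)
        show "(\<lambda>x. (indicator K1 x *\<^sub>R flux x) \<bullet> ggrad \<gamma> x (fd \<psi> x)) \<in> borel_measurable lebesgue"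
          by (rule borel_measurable_inner[OF borel_measurable_integrable[OF iflux]]) (rule ml, measurable)
        show "AE x in lborel. (indicator K1 x *\<^sub>R flux x) \<bullet> ggrad \<gamma> x (fd \<psi> x) = FB x \<bullet> ggrad \<gamma> x (fd \<psi> x)"
          using FBeq by eventually_elim simp
      qed measurable
      moreover have "set_lebesgue_integral lebesgue ((\<Omega> - K) \<times> {0<..<T}) (\<lambda>(z, t). source (z, t) * \<psi> (z, t)) =
          integral\<^sup>L lborel (\<lambda>\<zeta>. SB \<zeta> * \<psi> \<zeta>)"
      proof (rule set_lebesgue_integral_borel_version[where f'="\<lambda>x. (indicator K1 x *\<^sub>R source x) * \<psi> x"])
        show "indicator ((\<Omega> - K) \<times> {0<..<T}) x *\<^sub>R (case x of (z, t) \<Rightarrow> source (z, t) * \<psi> (z, t)) =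
            (indicator K1 x *\<^sub>R source x) * \<psi> x" for x
          using \<psi>(2)[of x] K1D(1) by (cases "x \<in> K1") (auto simp: case_prod_beta indicator_def)
        show "(\<lambda>x. (indicator K1 x *\<^sub>R source x) * \<psi> x) \<in> borel_measurable lebesgue"
          by (rule borel_measurable_times[OF borel_measurable_integrable[OF isource]]) (rule ml, measurable)
        show "AE x in lborel. (indicator K1 x *\<^sub>R source x) * \<psi> x = SB x * \<psi> x"
          using SBeq by eventually_elim simp
      qed measurable
      ultimately show ?thesis using P(3)[OF tf(2)] by simp
    qed
  qed (use \<gamma> p c0 d0 K thick muB mGB mFB mSB uB0 GB0 FB0 SB0 uBb finG finF iSB in blast)+
  interpret S: local_weak_solution \<gamma> p c0 c1 d0 uB SB GB FB K0 K1 by (rule sol')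
  have \<beta>0: "\<beta> t = 0" if "t \<notin> I0" for t using \<beta>(3) that by (simp add: I0_def)
  have cI0: "compact I0" by (simp add: I0_def)
  have C1\<beta>: "C1c \<beta>" by (rule smooth_imp_C1c[OF \<beta>(1) cI0 \<beta>0])
  have fd\<beta>0: "fd \<beta> t e = 0" if "t \<notin> I0" for t e
    using derivative_zero_outside[OF C1cD(1)[OF C1\<beta>] compact_imp_closed[OF cI0] \<beta>0 that] .
  define k where "k z = cut \<eta> p (\<phi> z)" for z
  have cut0: "cut \<eta> p 0 = 0" using \<eta> by (simp add: cut_eq)
  have C1k: "C1c k" and fdk: "fd k z e = cut' \<eta> p (\<phi> z) * fd \<phi> z e" for z e
    unfolding k_def[abs_def] using C1c_compose[OF C1\<phi> cut_deriv[OF p(1)] cut'_continuous[OF p(1)] cut0] by auto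
  have k0: "k z = 0" if "z \<notin> C1" for z
    using that \<eta> by (simp add: k_def cut_eq C1_def)
  have kn: "0 \<le> k z" for z using \<eta> by (simp add: k_def cut_eq)
  note [measurable] = C1cD(4)[OF C1k] C1cD(4)[OF C1\<beta>]
  have m\<beta>': "(\<lambda>t. fd \<beta> t 1) \<in> borel_measurable borel"
    by (intro borel_measurable_continuous_onI C1cD(2)[OF C1\<beta>])
  have [measurable]: "(\<lambda>x::('m, 'k) point \<times> real. k (fst x)) \<in> borel_measurable borel"
    "(\<lambda>x::('m, 'k) point \<times> real. \<beta> (snd x)) \<in> borel_measurable borel"
    "(\<lambda>x::('m, 'k) point \<times> real. fd \<beta> (snd x) 1) \<in> borel_measurable borel"
    by (intro borel_measurable_fst_snd C1cD(4) C1k C1\<beta> m\<beta>')+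
  define \<Phi> where "\<Phi> x = k (fst x) * \<beta> (snd x)" for x :: "('m, 'k) point \<times> real"
  define \<Phi>' where "\<Phi>' x e = k (fst x) * fd \<beta> (snd x) (snd e) + fd k (fst x) (fst e) * \<beta> (snd x)"
    for x e :: "('m, 'k) point \<times> real"
  have D: "(\<Phi> has_derivative \<Phi>' x) (at x)" for x
    unfolding \<Phi>_def[abs_def] \<Phi>'_def
    by (intro has_derivative_mult has_derivative_compose[OF bounded_linear_imp_has_derivative[OF bounded_linear_fst] C1cD(1)[OF C1k]]
      has_derivative_compose[OF bounded_linear_imp_has_derivative[OF bounded_linear_snd] C1cD(1)[OF C1\<beta>]])
  have c\<Phi>': "continuous_on UNIV (\<lambda>x. \<Phi>' x e)" for e
    unfolding \<Phi>'_def
    by (intro continuous_on_add continuous_on_mult continuous_on_compose2[OF C1cD(3)[OF C1k] continuous_on_fst[OF continuous_on_id]]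
       continuous_on_compose2[OF C1cD(3)[OF C1\<beta>] continuous_on_snd[OF continuous_on_id]]
       continuous_on_compose2[OF C1cD(2)[OF C1k] continuous_on_fst[OF continuous_on_id]]
       continuous_on_compose2[OF C1cD(2)[OF C1\<beta>] continuous_on_snd[OF continuous_on_id]]; simp)
  have \<Phi>0: "\<Phi> x = 0" if "x \<notin> K0" for x
    using that k0[of "fst x"] \<beta>0[of "snd x"] by (auto simp: \<Phi>_def K0_def mem_Times_iff)
  have \<Phi>1: "\<Phi> x = 0" if "x \<notin> K1" for x using \<Phi>0 S.K0_subset that by blast
  have c\<Phi>: "continuous_on UNIV \<Phi>"
    using D by (auto intro!: continuous_at_imp_continuous_on has_derivative_continuous)
  have [measurable]: "\<Phi> \<in> borel_measurable borel" by (rule borel_measurable_continuous_onI[OF c\<Phi>])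
  have \<Phi>n: "0 \<le> \<Phi> x" for x using kn \<beta>(2) by (simp add: \<Phi>_def)
  have g\<Phi>: "ggrad \<gamma> x (\<Phi>' x) = (cut' \<eta> p (\<phi> (fst x)) * \<beta> (snd x)) *\<^sub>R grushin_grad \<gamma> \<phi> (fst x)" for x
    using linear_0[OF has_derivative_linear[OF C1cD(1)[OF C1\<beta>]], of "snd x"]
    by (simp add: ggrad_def grushin_grad_def grushin_X_def grushin_Y_def \<Phi>'_def fdk vec_eq_iff mult_ac)
  have t\<Phi>: "\<Phi>' x (0, 1) = k (fst x) * fd \<beta> (snd x) 1" for x
    using linear_0[OF has_derivative_linear[OF C1cD(1)[OF C1k]], of "fst x"]
    by (simp add: \<Phi>'_def)
  \<comment> \<open>The multiplier, its derivative and its antiderivative. Because p < 2,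
    \<open>H\<close> is a positive power, which is the origin of the term with u^(2-p).\<close>
  define h where "h s = s powr (1 - p)" for s :: real
  define h' where "h' s = (1 - p) * s powr (- p)" for s :: real
  define H where "H s = s powr (2 - p) / (2 - p)" for s :: real
  have dh: "(h has_real_derivative h' s) (at s)" if "0 < s" for s
    using has_real_derivative_powr[OF that, of "1 - p"] by (simp add: h_def[abs_def] h'_def)
  have dH: "(H has_real_derivative h s) (at s)" if "0 < s" for s
    using DERIV_cdivide[OF has_real_derivative_powr[OF that, of "2 - p"], of "2 - p"] p(2) by (simp add: h_def H_def[abs_def])
  have ch': "continuous_on {0<..} h'" unfolding h'_def by (intro continuous_intros) auto
  have [measurable]: "h \<in> borel_measurable borel" "h' \<in> borel_measurable borel" "H \<in> borel_measurable borel"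
    unfolding h_def[abs_def] h'_def[abs_def] H_def[abs_def] by measurable
  define X where "X x = h (uB x) *\<^sub>R ggrad \<gamma> x (\<Phi>' x) + (\<Phi> x * h' (uB x)) *\<^sub>R GB x" for x
  have id: "- integral\<^sup>L lborel (\<lambda>x. \<Phi>' x (0, 1) * H (uB x)) =
      - integral\<^sup>L lborel (\<lambda>x. FB x \<bullet> X x) + integral\<^sup>L lborel (\<lambda>x. SB x * (\<Phi> x * h (uB x)))"
    unfolding X_def by (rule S.weak_chain_rule[OF D c\<Phi>' _ _ ch']) (use \<Phi>0 dh dH in auto)
  have uBp: "0 < uB x" if "x \<in> K1" for x using uBb(1)[OF that] c0 by linarith
  have i\<Phi>: "integrable lborel \<Phi>"
    by (rule continuous_compact_support_integrable[OF c\<Phi> K(2) \<Phi>0])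
  have powb: "uB x powr a \<le> c1 powr a" if "0 \<le> a" for a x
    using uBn[of x] uBb(2)[of x] uB0[of x] c1(1) that by (cases "x \<in> K1") (auto intro!: powr_mono2)
  have i_q: "integrable lborel (\<lambda>x. uB x powr (q - p + 1) * \<Phi> x)"
    using integrable_bounded_scaleR[OF i\<Phi>, of "\<lambda>x. uB x powr (q - p + 1)" "c1 powr (q - p + 1)"] powb q by simp
  have i_H: "integrable lborel (\<lambda>x. uB x powr (2 - p) * (k (fst x) * \<bar>fd \<beta> (snd x) 1\<bar>))"
  proof -
    have "integrable lborel (\<lambda>x. k (fst x) * \<bar>fd \<beta> (snd x) 1\<bar>)"
    proof (rule continuous_compact_support_integrable[OF _ K(2)])
      show "continuous_on UNIV (\<lambda>x::('m, 'k) point \<times> real. k (fst x) * \<bar>fd \<beta> (snd x) 1\<bar>)"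
        by (intro continuous_on_mult continuous_on_rabs continuous_on_compose2[OF C1cD(3)[OF C1k] continuous_on_fst[OF continuous_on_id]]
          continuous_on_compose2[OF C1cD(2)[OF C1\<beta>] continuous_on_snd[OF continuous_on_id]]; simp)
      show "k (fst x) * \<bar>fd \<beta> (snd x) 1\<bar> = 0" if "x \<notin> K0" for x
        using that k0[of "fst x"] fd\<beta>0[of "snd x"] by (auto simp: K0_def mem_Times_iff)
    qed
    from integrable_bounded_scaleR[OF this, of "\<lambda>x. uB x powr (2 - p)" "c1 powr (2 - p)"] powb p(2) show ?thesis by simp
  qed
  have ig: "integrable lborel (\<lambda>z. norm (grushin_grad \<gamma> \<phi> z) powr p)"
    by (rule grad_powr_integrable(2)[OF \<gamma> _ C1\<phi>]) (use p in auto)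
  have ivg: "integrable lborel (\<lambda>z. vB z * norm (grushin_grad \<gamma> \<phi> z) powr p)"
    using integrable_bounded_scaleR[OF ig, of vB Bv] vB vBb mvB by simp
  have i\<beta>: "integrable lborel \<beta>"
    by (rule continuous_compact_support_integrable[OF C1cD(3)[OF C1\<beta>] cI0 \<beta>0])
  obtain Bk where Bk: "\<bar>k z\<bar> \<le> Bk" for z
    using continuous_compact_support_bounded[OF C1cD(3)[OF C1k] cC(2) k0] by (metis real_norm_def)
  have iwk: "integrable lborel (\<lambda>z. wB z * k z)"
    using integrable_bounded_scaleR[OF wB(2), of k Bk] Bk C1cD(4)[OF C1k] by (simp add: mult.commute)
  note prodw = lborel_integral_product[OF iwk i\<beta>]
  note prodv = lborel_integral_product[OF ivg i\<beta>]
  have E1: "SB x * (\<Phi> x * h (uB x)) = wB (fst x) * k (fst x) * \<beta> (snd x) + lam * (uB x powr (q - p + 1) * \<Phi> x)" for x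
  proof (cases "x \<in> K1")
    case True
    have "uB x powr (p - 1) * uB x powr (1 - p) = 1" "uB x powr q * uB x powr (1 - p) = uB x powr (q - p + 1)"
      using uBp[OF True] by (simp_all add: add_diff_eq algebra_simps flip: powr_add)
    then have "SB x * (\<Phi> x * h (uB x)) = wB (fst x) * \<Phi> x * 1 + lam * \<Phi> x * uB x powr (q - p + 1)"
      using True unfolding SB_def h_def by (simp add: algebra_simps)
    then show ?thesis by (simp add: \<Phi>_def mult_ac)
  next
    case False
    then have "\<Phi> x = 0" by (rule \<Phi>1)
    moreover from this have "k (fst x) * \<beta> (snd x) = 0" by (simp add: \<Phi>_def)
    ultimately show ?thesis by (simp add: mult.assoc)
  qed
  have E2: "FB x \<bullet> X x \<le> vB (fst x) * norm (grushin_grad \<gamma> \<phi> (fst x)) powr p * \<beta> (snd x)" for x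
  proof (cases "x \<in> K1")
    case True
    define F where "F = max 0 (\<bar>\<phi> (fst x)\<bar> - \<eta>)"
    have "FB x \<bullet> X x \<le> vB (fst x) * \<beta> (snd x) * norm (grushin_grad \<gamma> \<phi> (fst x)) powr p"
      unfolding FB_def X_def g\<Phi> h_def h'_def \<Phi>_def k_def cut_eq[OF \<eta>]
      by (rule energy_pointwise[OF p(1) uBp[OF True] vB _ \<beta>(2)]) (use abs_cut'[OF \<eta>, of p] p in auto)
    then show ?thesis by (simp add: mult_ac)
  next
    case False
    then show ?thesis using FB0[OF False] vB \<beta>(2) by simp
  qed
  \<comment> \<open>\<open>E2\<close> is a one-sided bound, so integrability has to be shown
    separately: one summand pairs the integrable flux with a field bounded on \<open>K1\<close>, the
    other is dominated by a multiple of |GB|^p.\<close>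
  have i_F: "integrable lborel (\<lambda>x. FB x \<bullet> X x)"
  proof -
    have cg: "continuous_on UNIV (\<lambda>x. ggrad \<gamma> x (\<Phi>' x))"
      by (intro continuous_on_ggrad \<gamma> c\<Phi>' continuous_on_id)
    have [measurable]: "(\<lambda>x. ggrad \<gamma> x (\<Phi>' x)) \<in> borel_measurable borel" by (rule borel_measurable_continuous_onI[OF cg])
    have g0: "ggrad \<gamma> x (\<Phi>' x) = 0" if "x \<notin> K0" for x
    proof -
      have "\<Phi>' x = (\<lambda>_. 0)"
        using derivative_zero_outside[OF D compact_imp_closed[OF K(2)] \<Phi>0 that] by blast
      then show ?thesis by simp
    qed
    obtain Bg where Bg: "norm (ggrad \<gamma> x (\<Phi>' x)) \<le> Bg" for x
      using continuous_compact_support_bounded[OF cg K(2) g0] by metis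
    obtain B\<Phi> where B\<Phi>: "\<bar>\<Phi> x\<bar> \<le> B\<Phi>" for x
      using continuous_compact_support_bounded[OF c\<Phi> K(2) \<Phi>0] by (metis real_norm_def)
    have hb: "\<bar>h (uB x)\<bar> \<le> c0 powr (1 - p)" "\<bar>h' (uB x)\<bar> \<le> (p - 1) * c0 powr (- p)" if "x \<in> K1" for x
    proof -
      show "\<bar>h (uB x)\<bar> \<le> c0 powr (1 - p)"
        unfolding h_def using uBb(1)[OF that] c0 p by (auto intro!: powr_mono2')
      have "uB x powr (- p) \<le> c0 powr (- p)"
        using uBb(1)[OF that] c0 p by (intro powr_mono2') auto
      then have "(p - 1) * uB x powr (- p) \<le> (p - 1) * c0 powr (- p)"
        using p by (intro mult_left_mono) auto
      moreover have "\<bar>h' (uB x)\<bar> = (p - 1) * uB x powr (- p)"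
        using p by (simp add: h'_def abs_mult)
      ultimately show "\<bar>h' (uB x)\<bar> \<le> (p - 1) * c0 powr (- p)" by simp
    qed
    have "integrable lborel (\<lambda>x. FB x \<bullet> (h (uB x) *\<^sub>R ggrad \<gamma> x (\<Phi>' x)))"
    proof (rule bounded_integrable_inner(1)[OF S.int_F, where B="c0 powr (1 - p) * Bg"])
      fix x assume "FB x \<noteq> 0"
      then have x: "x \<in> K1" using FB0 by blast
      show "norm (h (uB x) *\<^sub>R ggrad \<gamma> x (\<Phi>' x)) \<le> c0 powr (1 - p) * Bg"
        using hb(1)[OF x] Bg[of x] by (simp add: mult_mono)
    qed measurable
    moreover have "integrable lborel (\<lambda>x. FB x \<bullet> ((\<Phi> x * h' (uB x)) *\<^sub>R GB x))"
    proof (rule Bochner_Integration.integrable_bound)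
      show "integrable lborel (\<lambda>x. B\<Phi> * ((p - 1) * c0 powr (- p)) * Bv * norm (GB x) powr p)"
        using modular_eq_integral(1)[OF mGB finG] by simp
      show "AE x in lborel. norm (FB x \<bullet> ((\<Phi> x * h' (uB x)) *\<^sub>R GB x)) \<le> norm (B\<Phi> * ((p - 1) * c0 powr (- p)) * Bv * norm (GB x) powr p)"
      proof (rule AE_I2)
        fix x
        show "norm (FB x \<bullet> ((\<Phi> x * h' (uB x)) *\<^sub>R GB x)) \<le> norm (B\<Phi> * ((p - 1) * c0 powr (- p)) * Bv * norm (GB x) powr p)"
        proof (cases "x \<in> K1")
          case True
          have "\<bar>FB x \<bullet> GB x\<bar> \<le> norm (FB x) * norm (GB x)" by (rule Cauchy_Schwarz_ineq2)
          also have "\<dots> \<le> Bv * norm (GB x) powr (p - 1) * norm (GB x)"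
            by (intro mult_right_mono nFB) simp
          also have "\<dots> = Bv * norm (GB x) powr p"
            using powr_mult_base[of "norm (GB x)" "p - 1"] by (simp add: mult_ac)
          finally have 1: "\<bar>FB x \<bullet> GB x\<bar> \<le> Bv * norm (GB x) powr p" .
          have 2: "\<bar>\<Phi> x * h' (uB x)\<bar> \<le> B\<Phi> * ((p - 1) * c0 powr (- p))"
            unfolding abs_mult using B\<Phi>[of x] hb(2)[OF True] by (intro mult_mono) auto
          have "norm (FB x \<bullet> ((\<Phi> x * h' (uB x)) *\<^sub>R GB x)) = \<bar>\<Phi> x * h' (uB x)\<bar> * \<bar>FB x \<bullet> GB x\<bar>"
            by (simp add: abs_mult)
          also have "\<dots> \<le> B\<Phi> * ((p - 1) * c0 powr (- p)) * (Bv * norm (GB x) powr p)"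
            using 1 2 by (intro mult_mono) auto
          also have "\<dots> \<le> norm (B\<Phi> * ((p - 1) * c0 powr (- p)) * Bv * norm (GB x) powr p)"
            by (simp add: mult.assoc)
          finally show ?thesis .
        qed (simp add: FB0)
      qed
    qed measurable
    ultimately show ?thesis unfolding X_def inner_add_right by (rule Bochner_Integration.integrable_add)
  qed
  have A1: "integral\<^sup>L lborel (\<lambda>x. SB x * (\<Phi> x * h (uB x))) =
      integral\<^sup>L lborel (\<lambda>z. wB z * k z) + lam * integral\<^sup>L lborel (\<lambda>x. uB x powr (q - p + 1) * \<Phi> x)"
    unfolding E1 using prodw i_q \<beta>(4) by simp
  have A2: "integral\<^sup>L lborel (\<lambda>x. FB x \<bullet> X x) \<le> integral\<^sup>L lborel (\<lambda>z. vB z * norm (grushin_grad \<gamma> \<phi> z) powr p)"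
    using integral_mono[OF i_F prodv(1) E2] prodv(2) \<beta>(4) by simp
  \<comment> \<open>Only \<beta> is differentiated in time. Its derivative has no sign, so its
    absolute value enters.\<close>
  have A3: "- integral\<^sup>L lborel (\<lambda>x. \<Phi>' x (0, 1) * H (uB x)) \<le>
      1 / (2 - p) * integral\<^sup>L lborel (\<lambda>x. uB x powr (2 - p) * (k (fst x) * \<bar>fd \<beta> (snd x) 1\<bar>))"
  proof -
    have "\<bar>integral\<^sup>L lborel (\<lambda>x. \<Phi>' x (0, 1) * H (uB x))\<bar> \<le>
        integral\<^sup>L lborel (\<lambda>x. 1 / (2 - p) * (uB x powr (2 - p) * (k (fst x) * \<bar>fd \<beta> (snd x) 1\<bar>)))"
    proof (rule integral_abs_bound_integral)
      show le: "\<bar>\<Phi>' x (0, 1) * H (uB x)\<bar> \<le> 1 / (2 - p) * (uB x powr (2 - p) * (k (fst x) * \<bar>fd \<beta> (snd x) 1\<bar>))" for x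
        using p(2) kn[of "fst x"] unfolding t\<Phi> H_def by (simp add: abs_mult mult_ac)
      show i: "integrable lborel (\<lambda>x. 1 / (2 - p) * (uB x powr (2 - p) * (k (fst x) * \<bar>fd \<beta> (snd x) 1\<bar>)))"
        using i_H by simp
      show "integrable lborel (\<lambda>x. \<Phi>' x (0, 1) * H (uB x))"
      proof (rule Bochner_Integration.integrable_bound[OF i])
        show "(\<lambda>x. \<Phi>' x (0, 1) * H (uB x)) \<in> borel_measurable lborel" unfolding t\<Phi> by measurable
        show "AE x in lborel. norm (\<Phi>' x (0, 1) * H (uB x)) \<le> norm (1 / (2 - p) * (uB x powr (2 - p) * (k (fst x) * \<bar>fd \<beta> (snd x) 1\<bar>)))"
          unfolding real_norm_def by (rule AE_I2, rule order_trans[OF le abs_ge_self])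
      qed
    qed
    then show ?thesis by simp
  qed
  have A4: "- (lam * integral\<^sup>L lborel (\<lambda>x. uB x powr (q - p + 1) * \<Phi> x)) \<le> \<bar>lam\<bar> * integral\<^sup>L lborel (\<lambda>x. uB x powr (q - p + 1) * \<Phi> x)"
  proof -
    have "0 \<le> integral\<^sup>L lborel (\<lambda>x. uB x powr (q - p + 1) * \<Phi> x)" using \<Phi>n by simp
    then show ?thesis using mult_right_mono[OF abs_ge_minus_self[of lam]] by simp
  qed
  show ?thesis
  proof (rule that[OF muB uBn])
    show "AE x in lborel. uB x = indicator ({z. \<eta> / 2 \<le> \<bar>\<phi> z\<bar>} \<times> {T/8..7*T/8}) x * u (fst x) (snd x)"
      using uB unfolding u1_def K1_def C2_def I1_def .
    show "integrable lborel (\<lambda>x. uB x powr (q - p + 1) * (cut \<eta> p (\<phi> (fst x)) * \<beta> (snd x)))"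
      using i_q by (simp add: \<Phi>_def k_def)
    show "integrable lborel (\<lambda>x. uB x powr (2 - p) * (cut \<eta> p (\<phi> (fst x)) * \<bar>fd \<beta> (snd x) 1\<bar>))"
      using i_H by (simp add: k_def)
    show "integral\<^sup>L lborel (\<lambda>z. wB z * cut \<eta> p (\<phi> z)) \<le>
      integral\<^sup>L lborel (\<lambda>z. indicator C z * v z * norm (grushin_grad \<gamma> \<phi> z) powr p)
      + \<bar>lam\<bar> * integral\<^sup>L lborel (\<lambda>x. uB x powr (q - p + 1) * (cut \<eta> p (\<phi> (fst x)) * \<beta> (snd x)))
      + 1 / (2 - p) * integral\<^sup>L lborel (\<lambda>x. uB x powr (2 - p) * (cut \<eta> p (\<phi> (fst x)) * \<bar>fd \<beta> (snd x) 1\<bar>))"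
      using id A1 A2 A3 A4 unfolding \<Phi>_def k_def vB_def by linarith
  qed
qed

section \<open>Nonexistence\<close>

text \<open>This yields both p < Q, required by the Sobolev inequality, and p > 1.\<close>

lemma two_le_hom_dim:
  fixes \<gamma> :: real
  assumes "0 \<le> \<gamma>"
  shows "2 \<le> real CARD('m::finite) + (1 + \<gamma>) * real CARD('k::finite)"
proof -
  have "1 \<le> real CARD('m)" "1 \<le> real CARD('k)"
    using zero_less_card_finite[where 'a='m] zero_less_card_finite[where 'a='k] by linarith+
  moreover from this(2) have "1 * 1 \<le> (1 + \<gamma>) * real CARD('k)"
    using assms by (intro mult_mono) auto
  ultimately show ?thesis by linarith
qed

lemma cut_le:
  assumes "0 < \<eta>" "0 \<le> p"
  shows "0 \<le> cut \<eta> p s" "cut \<eta> p s \<le> \<bar>s\<bar> powr p"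
  using assms by (auto simp: cut_eq intro!: powr_mono2)

lemma cut_tendsto:
  assumes "0 < p"
  shows "(\<lambda>n. cut (inverse (real (Suc n))) p s) \<longlonglongrightarrow> \<bar>s\<bar> powr p"
proof -
  have "(\<lambda>n. max 0 (\<bar>s\<bar> - inverse (real (Suc n)))) \<longlonglongrightarrow> max 0 (\<bar>s\<bar> - 0)"
    by (intro tendsto_intros LIMSEQ_inverse_real_of_nat)
  then have "(\<lambda>n. max 0 (\<bar>s\<bar> - inverse (real (Suc n))) powr p) \<longlonglongrightarrow> max 0 (\<bar>s\<bar> - 0) powr p"
    using assms by (intro tendsto_powr2 tendsto_const) auto
  then show ?thesis by (simp add: cut_eq)
qed

text \<open>For \<open>\<alpha> \<le> p / Q\<close> the power \<open>u\<^sup>\<alpha>\<close> is bounded by a constant plus \<open>(u 1\<^bsub>{u > N}\<^esub>)\<^bsup>p/Q\<^esup>\<close>, to which the weighted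
  Sobolev inequality applies.\<close>

lemma slice_estimate:
  fixes \<phi> :: "('m::finite, 'k::finite) point \<Rightarrow> real" and f :: "('m, 'k) point \<Rightarrow> real"
  assumes p: "0 < p" and Q: "0 < Q" "p / Q \<le> 1" and \<alpha>: "0 < \<alpha>" "\<alpha> \<le> p / Q" and N: "1 \<le> N"
    and f: "integrable lebesgue f" and tail: "integral\<^sup>L lebesgue (\<lambda>z. \<bar>f z\<bar> * indicator {x. N < x} \<bar>f z\<bar>) \<le> e"
    and \<phi>: "C1c \<phi>" and C0: "0 \<le> Cs"
    and Sob: "\<And>h. integrable lebesgue h \<Longrightarrow> (\<And>z. 0 \<le> h z) \<Longrightarrow>
      integrable lebesgue (\<lambda>z. h z powr (p / Q) * \<bar>\<phi> z\<bar> powr p) \<and>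
      integral\<^sup>L lebesgue (\<lambda>z. h z powr (p / Q) * \<bar>\<phi> z\<bar> powr p) \<le> Cs * integral\<^sup>L lebesgue h powr (p / Q) * E"
    and E: "0 \<le> E"
  shows "(\<integral>\<^sup>+z. ennreal (\<bar>f z\<bar> powr \<alpha> * \<bar>\<phi> z\<bar> powr p) \<partial>lebesgue) \<le>
      ennreal (N * integral\<^sup>L lborel (\<lambda>z. \<bar>\<phi> z\<bar> powr p) + Cs * e powr (p / Q) * E)"
proof -
  define h where "h z = \<bar>f z\<bar> * indicator {x. N < x} \<bar>f z\<bar>" for z
  have mf [measurable]: "f \<in> borel_measurable lebesgue" using f by simp
  have h0: "0 \<le> h z" for z by (simp add: h_def)
  have ih: "integrable lebesgue h"
    unfolding h_def by (rule Bochner_Integration.integrable_bound[OF integrable_abs[OF f]]) (auto simp: indicator_def)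
  note S = Sob[OF ih h0]
  obtain K where K: "compact K" "\<And>x. x \<notin> K \<Longrightarrow> \<phi> x = 0" using \<phi> by (auto simp: C1c_def)
  have i\<phi>: "integrable lborel (\<lambda>z. \<bar>\<phi> z\<bar> powr p)"
  proof (rule continuous_compact_support_integrable[OF _ K(1)])
    show "continuous_on UNIV (\<lambda>z. \<bar>\<phi> z\<bar> powr p)"
      using p by (intro continuous_on_powr' continuous_intros C1cD(3)[OF \<phi>]) auto
  qed (simp add: K(2))
  have i\<phi>': "integrable lebesgue (\<lambda>z. \<bar>\<phi> z\<bar> powr p)"
    "integral\<^sup>L lebesgue (\<lambda>z. \<bar>\<phi> z\<bar> powr p) = integral\<^sup>L lborel (\<lambda>z. \<bar>\<phi> z\<bar> powr p)"
    using i\<phi> by (auto simp: integrable_completion integral_completion)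
  \<comment> \<open>Above N \<ge> 1 the larger power p/Q dominates; below, the power is at most
    N^\<alpha> \<le> N because \<alpha> \<le> p/Q \<le> 1.\<close>
  have pw: "\<bar>f z\<bar> powr \<alpha> \<le> N + h z powr (p / Q)" for z
  proof (cases "N < \<bar>f z\<bar>")
    case True
    then have "\<bar>f z\<bar> powr \<alpha> \<le> h z powr (p / Q)" using N \<alpha> by (simp add: h_def powr_mono)
    then show ?thesis using N by simp
  next
    case False
    then have "\<bar>f z\<bar> powr \<alpha> \<le> N powr \<alpha>" using \<alpha> by (intro powr_mono2) auto
    also have "\<dots> \<le> N powr 1" using order_trans[OF \<alpha>(2) Q(2)] N by (intro powr_mono) auto
    finally show ?thesis using N by (simp add: add_increasing2)
  qed
  have i: "integrable lebesgue (\<lambda>z. N * \<bar>\<phi> z\<bar> powr p + h z powr (p / Q) * \<bar>\<phi> z\<bar> powr p)"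
    using i\<phi>'(1) S by simp
  have "(\<integral>\<^sup>+z. ennreal (\<bar>f z\<bar> powr \<alpha> * \<bar>\<phi> z\<bar> powr p) \<partial>lebesgue) \<le>
      (\<integral>\<^sup>+z. ennreal (N * \<bar>\<phi> z\<bar> powr p + h z powr (p / Q) * \<bar>\<phi> z\<bar> powr p) \<partial>lebesgue)"
    using mult_right_mono[OF pw powr_ge_zero] by (intro nn_integral_mono ennreal_leI) (simp add: distrib_right)
  also have "\<dots> = ennreal (integral\<^sup>L lebesgue (\<lambda>z. N * \<bar>\<phi> z\<bar> powr p + h z powr (p / Q) * \<bar>\<phi> z\<bar> powr p))"
    using N by (intro nn_integral_eq_integral[OF i]) auto
  also have "\<dots> \<le> ennreal (N * integral\<^sup>L lborel (\<lambda>z. \<bar>\<phi> z\<bar> powr p) + Cs * e powr (p / Q) * E)"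
  proof (rule ennreal_leI)
    have "integral\<^sup>L lebesgue (\<lambda>z. h z powr (p / Q) * \<bar>\<phi> z\<bar> powr p) \<le> Cs * integral\<^sup>L lebesgue h powr (p / Q) * E"
      using S by simp
    also have "\<dots> \<le> Cs * e powr (p / Q) * E"
      using tail h0 p Q C0 E unfolding h_def[abs_def, symmetric]
      by (intro mult_right_mono mult_left_mono powr_mono2) auto
    finally show "integral\<^sup>L lebesgue (\<lambda>z. N * \<bar>\<phi> z\<bar> powr p + h z powr (p / Q) * \<bar>\<phi> z\<bar> powr p) \<le>
        N * integral\<^sup>L lborel (\<lambda>z. \<bar>\<phi> z\<bar> powr p) + Cs * e powr (p / Q) * E"
      using i\<phi>' S by simp
  qed
  finally show ?thesis .
qed

text \<open>Lower boundedness of the quadratic-type form with an arbitrarily small extra gradient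
  coefficient \<delta>. The order of choices matters: \<delta> determines the admissible tail mass
  \<open>e\<close>, this determines the height \<open>N\<close> through the solution, and only then
  is \<phi> given; hence \<open>A\<close> is uniform in \<phi>.\<close>

lemma weighted_form_bound:
  fixes \<gamma> p q lam \<delta> Q :: real and \<Omega> K :: "('m::finite, 'k::finite) point set"
    and v w u0 :: "('m, 'k) point \<Rightarrow> real"
  assumes \<gamma>: "0 \<le> \<gamma>" and Q: "Q = real CARD('m) + (1 + \<gamma>) * real CARD('k)"
    and p: "1 < p" "p < 2" "2 - p \<le> p / Q" and q: "p - 1 < q" "q - p + 1 \<le> p / Q"
    and sol: "general_positive_local_solution \<gamma> p q lam v w \<Omega> K u0 T u"
    and v: "Ck_on 1 v (\<Omega> - K)" "\<And>z. z \<in> \<Omega> - K \<Longrightarrow> 0 \<le> v z"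
    and w: "L1_loc_on (\<Omega> - K) w" and \<delta>: "0 < \<delta>"
  obtains A where "0 \<le> A" "\<And>\<phi>. \<phi> \<in> test_functions (\<Omega> - K) \<Longrightarrow>
    set_lebesgue_integral lebesgue \<Omega> (\<lambda>z. w z * \<bar>\<phi> z\<bar> powr p) \<le>
    set_lebesgue_integral lebesgue \<Omega> (\<lambda>z. (\<delta> + v z) * norm (grushin_grad \<gamma> \<phi> z) powr p)
    + A * set_lebesgue_integral lebesgue \<Omega> (\<lambda>z. \<bar>\<phi> z\<bar> powr p)"
proof -
  have Q2: "2 \<le> Q" unfolding Q by (rule two_le_hom_dim[OF \<gamma>])
  have pQ: "p < Q" "p / Q \<le> 1" "0 < p / Q" "0 < Q" using p Q2 by auto
  have T: "0 < T" using sol by (simp add: general_positive_local_solution_def)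
  have upos: "0 < u z t" if "z \<in> \<Omega> - K" "t \<in> {0<..<T}" for z t
    using sol that by (simp add: general_positive_local_solution_def)
  obtain Cs where Cs: "0 \<le> Cs" "\<And>(\<phi> :: ('m, 'k) point \<Rightarrow> real) h. C1c \<phi> \<Longrightarrow> integrable lebesgue h \<Longrightarrow> (\<And>z. 0 \<le> h z) \<Longrightarrow>
    integrable lebesgue (\<lambda>z. h z powr (p / Q) * \<bar>\<phi> z\<bar> powr p) \<and>
    integral\<^sup>L lebesgue (\<lambda>z. h z powr (p / Q) * \<bar>\<phi> z\<bar> powr p) \<le>
      Cs * integral\<^sup>L lebesgue h powr (p / Q) * integral\<^sup>L lborel (\<lambda>z. norm (grushin_grad \<gamma> \<phi> z) powr p)"
    using grushin_weighted_Sobolev[OF \<gamma> less_imp_le[OF p(1)] Q pQ(1)] by blast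
  have T4: "0 < T / 4" using T by simp
  obtain b :: "real \<Rightarrow> real" where b: "smooth b" "\<And>x. 0 \<le> b x" "\<And>x. norm x \<ge> T / 4 \<Longrightarrow> b x = 0"
    "integral\<^sup>L lborel b = 1"
    using ex_mollifier[OF T4] by metis
  \<comment> \<open>A bump of radius T/4 centred at T/2. Its support stays T/8 away from the ends of
    the interval [T/8, 7T/8] on which \<open>u\<close> is used.\<close>
  define \<beta> where "\<beta> t = b (t - T / 2)" for t
  have \<beta>: "smooth \<beta>" "\<And>t. 0 \<le> \<beta> t" "\<And>t. t \<notin> {T/4..3*T/4} \<Longrightarrow> \<beta> t = 0" "integral\<^sup>L lborel \<beta> = 1"
  proof -
    show "smooth \<beta>"
      using Ck_on_compose_affine[OF bounded_linear_ident, of _ b "- T / 2"] b(1) by (simp add: \<beta>_def[abs_def])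
    show "\<beta> t = 0" if "t \<notin> {T/4..3*T/4}" for t
      unfolding \<beta>_def using that by (intro b(3)) (auto simp: abs_if)
    have "b \<in> borel_measurable borel"
      using Ck_on_imp_continuous[of 0 b] b(1) by (intro borel_measurable_continuous_onI) auto
    then show "integral\<^sup>L lborel \<beta> = 1"
      using integral_lborel_shift[of b "- T / 2"] b(4) by (simp add: \<beta>_def[abs_def])
  qed (use b in \<open>simp add: \<beta>_def\<close>)
  have C1\<beta>: "C1c \<beta>" by (rule smooth_imp_C1c[OF \<beta>(1) compact_Icc]) (rule \<beta>(3))
  obtain B where B: "0 < B" "\<And>t. \<beta> t \<le> B" "\<And>t. \<bar>fd \<beta> t 1\<bar> \<le> B"
  proof -
    have z: "fd \<beta> t 1 = 0" if "t \<notin> {T/4..3*T/4}" for t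
      using derivative_zero_outside[OF C1cD(1)[OF C1\<beta>] compact_imp_closed[OF compact_Icc] \<beta>(3) that] .
    obtain B1 where B1: "0 < B1" "\<And>t. norm (\<beta> t) \<le> B1"
      using continuous_compact_support_bounded[OF C1cD(3)[OF C1\<beta>] compact_Icc \<beta>(3)] by metis
    obtain B2 where B2: "0 < B2" "\<And>t. norm (fd \<beta> t 1) \<le> B2"
      using continuous_compact_support_bounded[OF C1cD(2)[OF C1\<beta>] compact_Icc z] by metis
    show thesis
    proof (rule that[of "B1 + B2"])
      show "\<beta> t \<le> B1 + B2" for t using B1(2)[of t] B2(1) by simp
      show "\<bar>fd \<beta> t 1\<bar> \<le> B1 + B2" for t using B2(2)[of t] B1(1) by simp
    qed (use B1(1) B2(1) in simp)
  qed
  define \<tau> where "\<tau> = 3 * T / 4"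
  have \<tau>: "0 < \<tau>" using T by (simp add: \<tau>_def)
  \<comment> \<open>Collects the coefficients of the two lower order terms, the common bound
    \<open>B\<close> of \<beta> and its derivative, and the length \<tau> of the time
    interval.\<close>
  define Kc where "Kc = (\<bar>lam\<bar> + 1 / (2 - p)) * (B * \<tau>)"
  have Kc: "0 \<le> Kc" using p(2) B(1) \<tau> by (simp add: Kc_def)
  \<comment> \<open>Solves Kc Cs e^(p/Q) \<le> \<delta>; the added 1 avoids division by 0.\<close>
  define e where "e = (\<delta> / (Kc * Cs + 1)) powr (Q / p)"
  have KC: "0 < Kc * Cs + 1" using Kc Cs(1) by (simp add: add_nonneg_pos)
  have e: "0 < e" "e powr (p / Q) = \<delta> / (Kc * Cs + 1)"
    using \<delta> KC pQ p by (simp_all add: e_def powr_powr)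
  have eK: "Kc * (Cs * e powr (p / Q)) \<le> \<delta>"
    unfolding e(2) using \<delta> KC by (simp add: field_simps)
  \<comment> \<open>Extension by zero: the L^1 continuity on \<Omega> becomes one on the whole
    space, where the Sobolev inequality is stated.\<close>
  define f where "f t z = indicator \<Omega> z * u z t" for t z
  have If: "integrable lebesgue (f t)" if "t \<in> {T/8..7*T/8}" for t
  proof -
    have "set_integrable lebesgue \<Omega> (\<lambda>z. u z t)"
      using sol that T by (auto simp: general_positive_local_solution_def)
    then show ?thesis by (simp add: set_integrable_def f_def[abs_def])
  qed
  have Cf: "((\<lambda>s. integral\<^sup>L lebesgue (\<lambda>z. \<bar>f s z - f t z\<bar>)) \<longlongrightarrow> 0) (at t within {T/8..7*T/8})" if "t \<in> {T/8..7*T/8}" for t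
  proof -
    have "((\<lambda>s. set_lebesgue_integral lebesgue \<Omega> (\<lambda>z. \<bar>u z s - u z t\<bar>)) \<longlongrightarrow> 0) (at t within {0..<T})"
      using sol that T by (auto simp: general_positive_local_solution_def)
    moreover have "set_lebesgue_integral lebesgue \<Omega> (\<lambda>z. \<bar>u z s - u z t\<bar>) = integral\<^sup>L lebesgue (\<lambda>z. \<bar>f s z - f t z\<bar>)" for s
      unfolding set_lebesgue_integral_def f_def
      by (intro Bochner_Integration.integral_cong refl) (simp add: indicator_def)
    ultimately show ?thesis
      using T by (auto intro: tendsto_within_subset)
  qed
  obtain N where N: "1 \<le> N" "\<And>t. t \<in> {T/8..7*T/8} \<Longrightarrow>
      integral\<^sup>L lebesgue (\<lambda>z. \<bar>f t z\<bar> * indicator {x. N < x} \<bar>f t z\<bar>) \<le> e"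
    using uniform_integrability[OF If Cf e(1)] by blast
  show ?thesis
  proof (rule that[of "Kc * N"])
    show "0 \<le> Kc * N" using Kc N(1) by simp
    fix \<phi> assume \<phi>: "\<phi> \<in> test_functions (\<Omega> - K)"
    define C where "C = closure {z. \<phi> z \<noteq> 0}"
    have C: "compact C" "C \<subseteq> \<Omega> - K" using \<phi> unfolding test_functions_def C_def by blast+
    have \<phi>0: "\<phi> z = 0" if "z \<notin> C" for z
      using that closure_subset[of "{z. \<phi> z \<noteq> 0}"] unfolding C_def by blast
    have C1\<phi>: "C1c \<phi>" by (rule test_function_C1c[OF \<phi>])
    note [measurable] = C1cD(4)[OF C1\<phi>]
    have [measurable]: "C \<in> sets borel" using C(1) by (rule borel_compact)
    define E where "E = integral\<^sup>L lborel (\<lambda>z. norm (grushin_grad \<gamma> \<phi> z) powr p)"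
    have E0: "0 \<le> E" by (simp add: E_def)
    define den where "den = integral\<^sup>L lborel (\<lambda>z. \<bar>\<phi> z\<bar> powr p)"
    have den0: "0 \<le> den" by (simp add: den_def)
    define vB where "vB z = indicator C z * v z" for z
    have mvB [measurable]: "vB \<in> borel_measurable borel"
      using borel_measurable_continuous_on_indicator[OF _ continuous_on_subset[OF Ck_on_1_continuous_on[OF v(1)] C(2)]]
      by (simp add: vB_def[abs_def])
    define V where "V = integral\<^sup>L lborel (\<lambda>z. vB z * norm (grushin_grad \<gamma> \<phi> z) powr p)"
    have iw: "integrable lebesgue (\<lambda>z. indicator C z * w z)"
      using w C by (simp add: L1_loc_on_def set_integrable_def)
    obtain wB where wB: "wB \<in> borel_measurable borel" "AE z in lborel. wB z = indicator C z * w z"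
      using lebesgue_measurable_borel_version[OF borel_measurable_integrable[OF iw]] by blast
    note [measurable] = wB(1)
    have iwB: "integrable lborel wB"
    proof -
      have "integrable lebesgue wB"
        by (rule integrable_cong_AE_imp[OF iw borel_measurable_lebesgueI[OF wB(1)]])
          (use AE_completion[OF wB(2)] in \<open>auto elim: eventually_mono\<close>)
      then show ?thesis by (subst (asm) integrable_completion) auto
    qed
    \<comment> \<open>The right side does not depend on \<eta>, so the truncation can be removed in
      the limit.\<close>
    have step: "integral\<^sup>L lborel (\<lambda>z. wB z * cut \<eta> p (\<phi> z)) \<le> V + Kc * N * den + \<delta> * E" if \<eta>: "0 < \<eta>" for \<eta>
    proof -
      obtain uB where uB: "uB \<in> borel_measurable borel" "\<And>x. 0 \<le> uB x"
        "AE x in lborel. uB x = indicator ({z. \<eta> / 2 \<le> \<bar>\<phi> z\<bar>} \<times> {T/8..7*T/8}) x * u (fst x) (snd x)"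
        "integrable lborel (\<lambda>x. uB x powr (q - p + 1) * (cut \<eta> p (\<phi> (fst x)) * \<beta> (snd x)))"
        "integrable lborel (\<lambda>x. uB x powr (2 - p) * (cut \<eta> p (\<phi> (fst x)) * \<bar>fd \<beta> (snd x) 1\<bar>))"
        "integral\<^sup>L lborel (\<lambda>z. wB z * cut \<eta> p (\<phi> z)) \<le>
          integral\<^sup>L lborel (\<lambda>z. indicator C z * v z * norm (grushin_grad \<gamma> \<phi> z) powr p)
          + \<bar>lam\<bar> * integral\<^sup>L lborel (\<lambda>x. uB x powr (q - p + 1) * (cut \<eta> p (\<phi> (fst x)) * \<beta> (snd x)))
          + 1 / (2 - p) * integral\<^sup>L lborel (\<lambda>x. uB x powr (2 - p) * (cut \<eta> p (\<phi> (fst x)) * \<bar>fd \<beta> (snd x) 1\<bar>))"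
        using energy_inequality[OF \<gamma> p(1,2) q(1) sol v \<phi> \<eta> \<beta> wB(1) iwB wB(2)[unfolded C_def], folded C_def] by blast
      note [measurable] = uB(1) borel_measurable_fst_snd(1)[OF C1cD(4)[OF C1\<phi>], where 'c=real]
      define J where "J = N * den + Cs * e powr (p / Q) * E"
      have J0: "0 \<le> J" using N(1) den0 Cs(1) E0 by (simp add: J_def)
      have slice: "(\<integral>\<^sup>+x. ennreal (uB x powr \<alpha> * \<bar>\<phi> (fst x)\<bar> powr p) \<partial>lborel) \<le> ennreal (\<tau> * J)"
        if \<alpha>: "0 < \<alpha>" "\<alpha> \<le> p / Q" for \<alpha>
      proof -
        define C2 where "C2 = {z. \<eta> / 2 \<le> \<bar>\<phi> z\<bar>}"
        have C2: "C2 \<subseteq> C" using \<eta> \<phi>0 by (force simp: C2_def)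
        define g where "g x = (indicator (C2 \<times> {T/8..7*T/8}) x * u (fst x) (snd x)) powr \<alpha> * \<bar>\<phi> (fst x)\<bar> powr p" for x
        have "(\<integral>\<^sup>+x. ennreal (uB x powr \<alpha> * \<bar>\<phi> (fst x)\<bar> powr p) \<partial>lborel) \<le> ennreal (7 * T / 8 - T / 8) * ennreal J"
        proof (rule nn_integral_time_slices[where f=g])
          show "(\<lambda>x. uB x powr \<alpha> * \<bar>\<phi> (fst x)\<bar> powr p) \<in> borel_measurable borel" by measurable
          show "AE x in lborel. uB x powr \<alpha> * \<bar>\<phi> (fst x)\<bar> powr p = g x"
            using uB(3) by eventually_elim (simp add: g_def C2_def)
          show "T / 8 \<le> 7 * T / 8" using T by simp
          show "g (z, t) = 0" if "t \<notin> {T/8..7*T/8}" for z t using that \<alpha> by (simp add: g_def)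
          fix t assume t: "t \<in> {T/8..7*T/8}"
          have "g (z, t) \<le> \<bar>f t z\<bar> powr \<alpha> * \<bar>\<phi> z\<bar> powr p" for z
          proof (cases "z \<in> C2")
            case True
            then have z: "z \<in> \<Omega>" "z \<in> \<Omega> - K" using C2 C(2) by auto
            have "t \<in> {0<..<T}" using t T by auto
            from upos[OF z(2) this] show ?thesis using True t z(1) by (simp add: g_def f_def)
          next
            case False
            then show ?thesis using \<alpha> by (simp add: g_def)
          qed
          then have "(\<integral>\<^sup>+z. ennreal (g (z, t)) \<partial>lebesgue) \<le> (\<integral>\<^sup>+z. ennreal (\<bar>f t z\<bar> powr \<alpha> * \<bar>\<phi> z\<bar> powr p) \<partial>lebesgue)"
            by (intro nn_integral_mono ennreal_leI)
          also have "\<dots> \<le> ennreal J"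
            unfolding J_def den_def
            by (rule slice_estimate[OF _ pQ(4) pQ(2) \<alpha> N(1) If[OF t] N(2)[OF t] C1\<phi> Cs(1) Cs(2)[OF C1\<phi>, folded E_def] E0])
              (use p in auto)
          finally show "(\<integral>\<^sup>+z. ennreal (g (z, t)) \<partial>lebesgue) \<le> ennreal J" .
        qed
        also have "\<dots> = ennreal (\<tau> * J)"
          using T J0 by (simp add: \<tau>_def flip: ennreal_mult)
        finally show ?thesis .
      qed
      have est: "integral\<^sup>L lborel (\<lambda>x. uB x powr \<alpha> * (cut \<eta> p (\<phi> (fst x)) * c (snd x))) \<le> B * (\<tau> * J)"
        if i: "integrable lborel (\<lambda>x. uB x powr \<alpha> * (cut \<eta> p (\<phi> (fst x)) * c (snd x)))"
          and \<alpha>: "0 < \<alpha>" "\<alpha> \<le> p / Q" and c: "\<And>t. 0 \<le> c t" "\<And>t. c t \<le> B" for \<alpha> c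
      proof -
        have cutb: "0 \<le> cut \<eta> p s" "cut \<eta> p s \<le> \<bar>s\<bar> powr p" for s using cut_le[OF \<eta>, of p s] p by auto
        have "ennreal (integral\<^sup>L lborel (\<lambda>x. uB x powr \<alpha> * (cut \<eta> p (\<phi> (fst x)) * c (snd x)))) =
            (\<integral>\<^sup>+x. ennreal (uB x powr \<alpha> * (cut \<eta> p (\<phi> (fst x)) * c (snd x))) \<partial>lborel)"
          using c cutb by (intro nn_integral_eq_integral[OF i, symmetric]) auto
        also have "\<dots> \<le> (\<integral>\<^sup>+x. ennreal B * ennreal (uB x powr \<alpha> * \<bar>\<phi> (fst x)\<bar> powr p) \<partial>lborel)"
        proof (rule nn_integral_mono)
          fix x :: "('m, 'k) point \<times> real"
          have "cut \<eta> p (\<phi> (fst x)) * c (snd x) \<le> \<bar>\<phi> (fst x)\<bar> powr p * B"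
            using c cutb by (intro mult_mono) auto
          then have "uB x powr \<alpha> * (cut \<eta> p (\<phi> (fst x)) * c (snd x)) \<le> uB x powr \<alpha> * (\<bar>\<phi> (fst x)\<bar> powr p * B)"
            by (intro mult_left_mono) auto
          then show "ennreal (uB x powr \<alpha> * (cut \<eta> p (\<phi> (fst x)) * c (snd x))) \<le> ennreal B * ennreal (uB x powr \<alpha> * \<bar>\<phi> (fst x)\<bar> powr p)"
            using B(1) by (simp add: mult_ac ennreal_leI flip: ennreal_mult)
        qed
        also have "\<dots> = ennreal B * (\<integral>\<^sup>+x. ennreal (uB x powr \<alpha> * \<bar>\<phi> (fst x)\<bar> powr p) \<partial>lborel)"
          by (rule nn_integral_cmult) measurable
        also have "\<dots> \<le> ennreal B * ennreal (\<tau> * J)"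
          by (intro mult_left_mono slice \<alpha>) simp
        also have "\<dots> = ennreal (B * (\<tau> * J))" using B(1) \<tau> J0 by (simp flip: ennreal_mult)
        finally show ?thesis using B(1) \<tau> J0 by (simp add: ennreal_le_iff)
      qed
      have e1: "\<bar>lam\<bar> * integral\<^sup>L lborel (\<lambda>x. uB x powr (q - p + 1) * (cut \<eta> p (\<phi> (fst x)) * \<beta> (snd x))) \<le> \<bar>lam\<bar> * (B * (\<tau> * J))"
        using q by (intro mult_left_mono est uB(4) \<beta>(2) B(2)) auto
      have e2: "1 / (2 - p) * integral\<^sup>L lborel (\<lambda>x. uB x powr (2 - p) * (cut \<eta> p (\<phi> (fst x)) * \<bar>fd \<beta> (snd x) 1\<bar>)) \<le> 1 / (2 - p) * (B * (\<tau> * J))"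
        using p B(3) by (intro mult_left_mono est[of "2 - p" "\<lambda>t. \<bar>fd \<beta> t 1\<bar>"] uB(5)) auto
      have "integral\<^sup>L lborel (\<lambda>z. wB z * cut \<eta> p (\<phi> z)) \<le> V + \<bar>lam\<bar> * (B * (\<tau> * J)) + 1 / (2 - p) * (B * (\<tau> * J))"
        using uB(6) e1 e2 unfolding V_def vB_def by linarith
      also have "\<dots> = V + Kc * J" by (simp add: Kc_def algebra_simps)
      also have "\<dots> = V + Kc * N * den + Kc * (Cs * e powr (p / Q)) * E" by (simp add: J_def algebra_simps)
      also have "\<dots> \<le> V + Kc * N * den + \<delta> * E" using mult_right_mono[OF eK E0] by simp
      finally show ?thesis .
    qed
    obtain B\<phi> where B\<phi>: "0 < B\<phi>" "\<And>z. norm (\<phi> z) \<le> B\<phi>"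
      using continuous_compact_support_bounded[OF C1cD(3)[OF C1\<phi>] C(1) \<phi>0] by metis
    \<comment> \<open>Dominated convergence along \<eta> = 1/(n+1): \<phi> is bounded and
      \<open>wB\<close> is integrable, being \<open>w\<close> restricted to the support of
      \<phi>.\<close>
    have lim: "(\<lambda>n. integral\<^sup>L lborel (\<lambda>z. wB z * cut (inverse (real (Suc n))) p (\<phi> z))) \<longlonglongrightarrow> integral\<^sup>L lborel (\<lambda>z. wB z * \<bar>\<phi> z\<bar> powr p)"
    proof (rule integral_dominated_convergence[where w="\<lambda>z. \<bar>wB z\<bar> * B\<phi> powr p"])
      show "AE z in lborel. (\<lambda>n. wB z * cut (inverse (real (Suc n))) p (\<phi> z)) \<longlonglongrightarrow> wB z * \<bar>\<phi> z\<bar> powr p"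
        using p by (intro AE_I2 tendsto_intros cut_tendsto) auto
      show "AE z in lborel. norm (wB z * cut (inverse (real (Suc n))) p (\<phi> z)) \<le> \<bar>wB z\<bar> * B\<phi> powr p" for n
      proof (rule AE_I2)
        fix z
        have "cut (inverse (real (Suc n))) p (\<phi> z) \<le> \<bar>\<phi> z\<bar> powr p" "0 \<le> cut (inverse (real (Suc n))) p (\<phi> z)"
          using p by (intro cut_le; simp)+
        moreover have "\<bar>\<phi> z\<bar> powr p \<le> B\<phi> powr p" using B\<phi>(2)[of z] p by (intro powr_mono2) auto
        ultimately show "norm (wB z * cut (inverse (real (Suc n))) p (\<phi> z)) \<le> \<bar>wB z\<bar> * B\<phi> powr p"
          by (auto simp: abs_mult intro!: mult_left_mono)
      qed
      show "(\<lambda>z. wB z * cut (inverse (real (Suc n))) p (\<phi> z)) \<in> borel_measurable lborel" for n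
        unfolding cut_def by measurable
    qed (use iwB in auto)
    have W: "integral\<^sup>L lborel (\<lambda>z. wB z * \<bar>\<phi> z\<bar> powr p) \<le> V + Kc * N * den + \<delta> * E"
      by (rule LIMSEQ_le_const2[OF lim]) (use step in auto)
    have gz: "grushin_grad \<gamma> \<phi> z = 0" if "z \<notin> C" for z
    proof -
      have "fd \<phi> z e = 0" for e
        using derivative_zero_outside[OF C1cD(1)[OF C1\<phi>] compact_imp_closed[OF C(1)] \<phi>0 that] .
      then show ?thesis by (simp add: grushin_grad_def grushin_X_def grushin_Y_def prod_eq_iff vec_eq_iff)
    qed
    have [measurable]: "grushin_grad \<gamma> \<phi> \<in> borel_measurable borel"
      by (intro borel_measurable_continuous_onI continuous_grushin_grad \<gamma> C1cD(2)[OF C1\<phi>])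
    have ig: "integrable lborel (\<lambda>z. norm (grushin_grad \<gamma> \<phi> z) powr p)"
      by (rule grad_powr_integrable(2)[OF \<gamma> _ C1\<phi>]) (use p in auto)
    have ivg: "integrable lborel (\<lambda>z. vB z * norm (grushin_grad \<gamma> \<phi> z) powr p)"
    proof -
      have "bounded (v ` C)"
        by (intro compact_imp_bounded compact_continuous_image continuous_on_subset[OF Ck_on_1_continuous_on[OF v(1)] C(2)] C(1))
      then obtain Bv where Bv: "0 < Bv" "\<And>z. z \<in> C \<Longrightarrow> \<bar>v z\<bar> \<le> Bv"
        unfolding bounded_pos by auto
      have "\<bar>vB z\<bar> \<le> Bv" for z using Bv(1) Bv(2)[of z] by (cases "z \<in> C") (auto simp: vB_def)
      then show ?thesis
        using integrable_bounded_scaleR[OF ig, of vB Bv] by simp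
    qed
    have S1: "set_lebesgue_integral lebesgue \<Omega> (\<lambda>z. (\<delta> + v z) * norm (grushin_grad \<gamma> \<phi> z) powr p) = \<delta> * E + V"
    proof -
      have "set_lebesgue_integral lebesgue \<Omega> (\<lambda>z. (\<delta> + v z) * norm (grushin_grad \<gamma> \<phi> z) powr p) =
          integral\<^sup>L lborel (\<lambda>z. (\<delta> + vB z) * norm (grushin_grad \<gamma> \<phi> z) powr p)"
      proof (rule set_lebesgue_integral_borel_version[where f'="\<lambda>z. (\<delta> + vB z) * norm (grushin_grad \<gamma> \<phi> z) powr p"])
        show "indicator \<Omega> z *\<^sub>R ((\<delta> + v z) * norm (grushin_grad \<gamma> \<phi> z) powr p) = (\<delta> + vB z) * norm (grushin_grad \<gamma> \<phi> z) powr p" for z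
          using gz[of z] C(2) by (cases "z \<in> C") (auto simp: vB_def)
        show "(\<lambda>z. (\<delta> + vB z) * norm (grushin_grad \<gamma> \<phi> z) powr p) \<in> borel_measurable lebesgue"
          by (rule borel_measurable_lebesgueI) measurable
      qed auto
      also have "\<dots> = \<delta> * E + V" unfolding E_def V_def using ig ivg by (simp add: distrib_right)
      finally show ?thesis .
    qed
    have S2: "set_lebesgue_integral lebesgue \<Omega> (\<lambda>z. w z * \<bar>\<phi> z\<bar> powr p) = integral\<^sup>L lborel (\<lambda>z. wB z * \<bar>\<phi> z\<bar> powr p)"
    proof (rule set_lebesgue_integral_borel_version[where f'="\<lambda>z. (indicator C z * w z) * \<bar>\<phi> z\<bar> powr p"])
      show "indicator \<Omega> z *\<^sub>R (w z * \<bar>\<phi> z\<bar> powr p) = (indicator C z * w z) * \<bar>\<phi> z\<bar> powr p" for z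
        using \<phi>0[of z] C(2) by (cases "z \<in> C") auto
      show "(\<lambda>z. (indicator C z * w z) * \<bar>\<phi> z\<bar> powr p) \<in> borel_measurable lebesgue"
        by (rule borel_measurable_times[OF borel_measurable_integrable[OF iw]]) (rule borel_measurable_lebesgueI, measurable)
      show "AE z in lborel. (indicator C z * w z) * \<bar>\<phi> z\<bar> powr p = wB z * \<bar>\<phi> z\<bar> powr p"
        using wB(2) by eventually_elim simp
    qed measurable
    have S3: "set_lebesgue_integral lebesgue \<Omega> (\<lambda>z. \<bar>\<phi> z\<bar> powr p) = den"
      unfolding den_def
    proof (rule set_lebesgue_integral_borel_version[where f'="\<lambda>z. \<bar>\<phi> z\<bar> powr p"])
      show "indicator \<Omega> z *\<^sub>R \<bar>\<phi> z\<bar> powr p = \<bar>\<phi> z\<bar> powr p" for z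
        using \<phi>0[of z] C(2) by (cases "z \<in> C") auto
      show "(\<lambda>z. \<bar>\<phi> z\<bar> powr p) \<in> borel_measurable lebesgue"
        by (rule borel_measurable_lebesgueI) measurable
    qed auto
    show "set_lebesgue_integral lebesgue \<Omega> (\<lambda>z. w z * \<bar>\<phi> z\<bar> powr p) \<le>
      set_lebesgue_integral lebesgue \<Omega> (\<lambda>z. (\<delta> + v z) * norm (grushin_grad \<gamma> \<phi> z) powr p)
      + Kc * N * set_lebesgue_integral lebesgue \<Omega> (\<lambda>z. \<bar>\<phi> z\<bar> powr p)"
      unfolding S1 S2 S3 using W by linarith
  qed
qed

theorem theorem3p22:
  fixes \<gamma> p q lam \<epsilon> Q :: real
    and \<Omega> K :: "('m::finite, 'k::finite) point set"
    and v w u0 :: "('m, 'k) point \<Rightarrow> real"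
  assumes "\<gamma> \<ge> 0"
    and "Q = hom_dim TYPE('m) TYPE('k) \<gamma>"
    and "2 * Q / (Q + 1) \<le> p" and "p < 2"
    and "p - 1 < q" and "q \<le> p - 1 + p / Q"
    and "\<exists>z0 r. r > 0 \<and> \<Omega> = cc_ball \<gamma> z0 r"
    and "closed_null_subset \<Omega> K"
    and "Ck_on 1 v (\<Omega> - K)" and "\<forall>z\<in>\<Omega> - K. v z \<ge> 0"
    and "L1_loc_on (\<Omega> - K) w" and "\<forall>z\<in>\<Omega> - K. w z \<ge> 0"
    and "\<forall>z\<in>\<Omega>. u0 z \<ge> 0"
    and "0 < \<epsilon>" and "\<epsilon> < 1"
    and "(INF \<phi>\<in>test_functions (\<Omega> - K) - {\<lambda>_. 0}.
           ereal ((set_lebesgue_integral lebesgue \<Omega>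
                     (\<lambda>z. (\<epsilon> + (1 - \<epsilon>) * v z) * norm (grushin_grad \<gamma> \<phi> z) powr p)
                   - set_lebesgue_integral lebesgue \<Omega> (\<lambda>z. (1 - \<epsilon>) * w z * \<bar>\<phi> z\<bar> powr p))
                  / set_lebesgue_integral lebesgue \<Omega> (\<lambda>z. \<bar>\<phi> z\<bar> powr p))) = -\<infinity>"
  shows "\<not> (\<exists>T u. general_positive_local_solution \<gamma> p q lam v w \<Omega> K u0 T u)"
proof
  assume "\<exists>T u. general_positive_local_solution \<gamma> p q lam v w \<Omega> K u0 T u"
  then obtain T u where sol: "general_positive_local_solution \<gamma> p q lam v w \<Omega> K u0 T u" by blast
  have Q: "Q = real CARD('m) + (1 + \<gamma>) * real CARD('k)"
    using assms(2) by (simp add: hom_dim_def)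
  have Q2: "2 \<le> Q" unfolding Q by (rule two_le_hom_dim[OF assms(1)])
  have pQ: "2 * Q \<le> p * (Q + 1)" using assms(3) Q2 by (simp add: divide_le_eq)
  \<comment> \<open>After division by Q, the lower bound on p is the statement that the power from
    the time derivative is at most critical.\<close>
  then have p2: "2 - p \<le> p / Q" using Q2 by (simp add: le_divide_eq algebra_simps)
  have p1: "1 < p"
  proof (rule ccontr)
    assume "\<not> 1 < p"
    then have "p * (Q + 1) \<le> 1 * (Q + 1)" using Q2 by (intro mult_right_mono) auto
    from order_trans[OF pQ this] show False using Q2 by simp
  qed
  \<comment> \<open>Division of the numerator by 1 - \<epsilon> leaves the coefficient \<delta> + v
    in front of the gradient.\<close>
  define \<delta> where "\<delta> = \<epsilon> / (1 - \<epsilon>)"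
  have \<delta>: "0 < \<delta>" "(1 - \<epsilon>) * \<delta> = \<epsilon>" using assms(14,15) by (auto simp: \<delta>_def)
  obtain A where A: "0 \<le> A" "\<And>\<phi>. \<phi> \<in> test_functions (\<Omega> - K) \<Longrightarrow>
    set_lebesgue_integral lebesgue \<Omega> (\<lambda>z. w z * \<bar>\<phi> z\<bar> powr p) \<le>
    set_lebesgue_integral lebesgue \<Omega> (\<lambda>z. (\<delta> + v z) * norm (grushin_grad \<gamma> \<phi> z) powr p)
    + A * set_lebesgue_integral lebesgue \<Omega> (\<lambda>z. \<bar>\<phi> z\<bar> powr p)"
    using weighted_form_bound[OF assms(1) Q p1 assms(4) p2 assms(5) _ sol assms(9) _ assms(11) \<delta>(1)] assms(6,10)
    by (auto simp: algebra_simps)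
  have "ereal (- ((1 - \<epsilon>) * A)) \<le> (INF \<phi>\<in>test_functions (\<Omega> - K) - {\<lambda>_. 0}.
           ereal ((set_lebesgue_integral lebesgue \<Omega>
                     (\<lambda>z. (\<epsilon> + (1 - \<epsilon>) * v z) * norm (grushin_grad \<gamma> \<phi> z) powr p)
                   - set_lebesgue_integral lebesgue \<Omega> (\<lambda>z. (1 - \<epsilon>) * w z * \<bar>\<phi> z\<bar> powr p))
                  / set_lebesgue_integral lebesgue \<Omega> (\<lambda>z. \<bar>\<phi> z\<bar> powr p)))"
  proof (rule INF_greatest)
    fix \<phi> assume "\<phi> \<in> test_functions (\<Omega> - K) - {\<lambda>_. 0}"
    then have \<phi>: "\<phi> \<in> test_functions (\<Omega> - K)" by simp
    let ?D = "set_lebesgue_integral lebesgue \<Omega> (\<lambda>z. \<bar>\<phi> z\<bar> powr p)"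
    have D0: "0 \<le> ?D" unfolding set_lebesgue_integral_def by (intro Bochner_Integration.integral_nonneg) simp
    have "(\<epsilon> + (1 - \<epsilon>) * v z) * norm (grushin_grad \<gamma> \<phi> z) powr p = (1 - \<epsilon>) * ((\<delta> + v z) * norm (grushin_grad \<gamma> \<phi> z) powr p)" for z
    proof -
      have "(1 - \<epsilon>) * (\<delta> + v z) = \<epsilon> + (1 - \<epsilon>) * v z" by (simp only: distrib_left \<delta>(2))
      then show ?thesis by (simp only: mult.assoc[symmetric])
    qed
    then have 1: "set_lebesgue_integral lebesgue \<Omega> (\<lambda>z. (\<epsilon> + (1 - \<epsilon>) * v z) * norm (grushin_grad \<gamma> \<phi> z) powr p) =
        (1 - \<epsilon>) * set_lebesgue_integral lebesgue \<Omega> (\<lambda>z. (\<delta> + v z) * norm (grushin_grad \<gamma> \<phi> z) powr p)"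
      by (simp only: set_integral_mult_right)
    have 2: "set_lebesgue_integral lebesgue \<Omega> (\<lambda>z. (1 - \<epsilon>) * w z * \<bar>\<phi> z\<bar> powr p) =
        (1 - \<epsilon>) * set_lebesgue_integral lebesgue \<Omega> (\<lambda>z. w z * \<bar>\<phi> z\<bar> powr p)"
      by (simp only: mult.assoc set_integral_mult_right)
    have "(1 - \<epsilon>) * set_lebesgue_integral lebesgue \<Omega> (\<lambda>z. w z * \<bar>\<phi> z\<bar> powr p) \<le>
        (1 - \<epsilon>) * (set_lebesgue_integral lebesgue \<Omega> (\<lambda>z. (\<delta> + v z) * norm (grushin_grad \<gamma> \<phi> z) powr p) + A * ?D)"
      using A(2)[OF \<phi>] assms(15) by (intro mult_left_mono) auto
    then have "- ((1 - \<epsilon>) * A) * ?D \<le> (1 - \<epsilon>) * set_lebesgue_integral lebesgue \<Omega> (\<lambda>z. (\<delta> + v z) * norm (grushin_grad \<gamma> \<phi> z) powr p)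
        - (1 - \<epsilon>) * set_lebesgue_integral lebesgue \<Omega> (\<lambda>z. w z * \<bar>\<phi> z\<bar> powr p)"
      by (simp add: algebra_simps)
    then show "ereal (- ((1 - \<epsilon>) * A)) \<le> ereal ((set_lebesgue_integral lebesgue \<Omega>
                     (\<lambda>z. (\<epsilon> + (1 - \<epsilon>) * v z) * norm (grushin_grad \<gamma> \<phi> z) powr p)
                   - set_lebesgue_integral lebesgue \<Omega> (\<lambda>z. (1 - \<epsilon>) * w z * \<bar>\<phi> z\<bar> powr p)) / ?D)"
      \<comment> \<open>If the denominator is 0, the quotient is 0 by convention, and the lower
        bound still holds because it is at most 0.\<close>
      unfolding 1 2 using D0 A(1) assms(15)
      by (cases "?D = 0") (simp_all add: le_divide_eq)
  qed
  then show False unfolding assms(16) by simp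
qed

end
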